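(* Let $G$ be a second-countable locally compact Hausdorff étale groupoid, let $\mathrm{Iso}(G)^\circ$ be the interior of its isotropy, and let $\iota : C^*(\mathrm{Iso}(G)^\circ)\to C^*(G)$ and $\iota_r : C^*_r(\mathrm{Iso}(G)^\circ)\to C^*_r(G)$ be the homomorphisms induced by extension of functions by zero. Let $M := \iota(C^*(\mathrm{Iso}(G)^\circ)) \subseteq C^*(G)$ and $M_r := \iota_r(C^*_r(\mathrm{Iso}(G)^\circ)) \subseteq C^*_r(G)$. (a) There exists a conditional expectation from $C^*_r(G)$ to $M_r$ if and only if $\mathrm{Iso}(G)^\circ$ is closed in $G$. (b) If $\mathrm{Iso}(G)^\circ$ is closed, then there is a faithful conditional expectation $\Psi_r : C^*_r(G) \to M_r$ such that $\Psi_r(f) = \iota_r(f|_{\mathrm{Iso}(G)^\circ})$ for all $f \in C_c(G)$. (c) If $\mathrm{Iso}(G)^\circ$ is closed and amenable, then there is also a conditional expectation (not necessarily faithful) $\Psi : C^*(G) \to M$ satisfying $\Psi(f) = \iota(f|_{\mathrm{Iso}(G)^\circ})$ for all $f \in C_c(G)$.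
   Context: A groupoid $G$ is étale if $r,s:G\to G^{(0)}$ are local homeomorphisms. Write $G_u=s^{-1}(u)$, $G^u=r^{-1}(u)$ for $u\in G^{(0)}$. $\mathrm{Iso}(G)=\{\gamma\in G: r(\gamma)=s(\gamma)\}$ and $\mathrm{Iso}(G)^\circ$ is its interior in $G$; it is an open étale subgroupoid containing $G^{(0)}$. $C^*(G)$ is the completion of the convolution $*$-algebra $C_c(G)$ in the norm $\sup\|\pi(\cdot)\|$ over all $*$-representations bounded for the $I$-norm $\|f\|_I=\sup_{u}\max\{\sum_{\gamma\in G_u}|f(\gamma)|,\sum_{\gamma\in G^u}|f(\gamma)|\}$. $C^*_r(G)$ is the image of $C^*(G)$ under $\bigoplus_{u\in G^{(0)}}L^u$, where $L^u(f)\delta_\gamma=\sum_{s(\alpha)=r(\gamma)}f(\alpha)\delta_{\alpha\gamma}$ on $\ell^2(G_u)$. Extension by zero $C_c(\mathrm{Iso}(G)^\circ)\to C_c(G)$ extends to the homomorphism $\iota$ of full $C^*$-algebras and the injective homomorphism $\iota_r$ of reduced $C^*$-algebras. Amenability means (topological) amenability of the étale groupoid $\mathrm{Iso}(G)^\circ$. *)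

theory Defs
  imports "HOL-Analysis.Analysis"
begin

section \<open>Etale groupoids\<close>

text \<open>
  A groupoid is identified with its set of arrows, which is the underlying set of its topology; units
  are arrows. The product \<open>gmult G \<alpha> \<beta>\<close> is meaningful only when \<open>gsrc G \<alpha> = grng G \<beta>\<close>.
\<close>

record 'g groupoid =
  gtop :: "'g topology"
  gsrc :: "'g \<Rightarrow> 'g"
  grng :: "'g \<Rightarrow> 'g"
  gmult :: "'g \<Rightarrow> 'g \<Rightarrow> 'g"
  ginv :: "'g \<Rightarrow> 'g"

definition arrows :: "'g groupoid \<Rightarrow> 'g set" where
  "arrows G = topspace (gtop G)"

definition units :: "'g groupoid \<Rightarrow> 'g set" where
  "units G = gsrc G ` arrows G"

definition src_fibre :: "'g groupoid \<Rightarrow> 'g \<Rightarrow> 'g set" where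
  "src_fibre G u = {\<gamma> \<in> arrows G. gsrc G \<gamma> = u}"

definition rng_fibre :: "'g groupoid \<Rightarrow> 'g \<Rightarrow> 'g set" where
  "rng_fibre G u = {\<gamma> \<in> arrows G. grng G \<gamma> = u}"

definition composable :: "'g groupoid \<Rightarrow> ('g \<times> 'g) set" where
  "composable G = {(\<alpha>, \<beta>). \<alpha> \<in> arrows G \<and> \<beta> \<in> arrows G \<and> gsrc G \<alpha> = grng G \<beta>}"

definition algebraic_groupoid :: "'g groupoid \<Rightarrow> bool" where
  "algebraic_groupoid G \<longleftrightarrow>
     (\<forall>\<alpha> \<in> arrows G.
        gsrc G \<alpha> \<in> arrows G \<and> grng G \<alpha> \<in> arrows G \<and>
        gsrc G (gsrc G \<alpha>) = gsrc G \<alpha> \<and> grng G (gsrc G \<alpha>) = gsrc G \<alpha> \<and>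
        gsrc G (grng G \<alpha>) = grng G \<alpha> \<and> grng G (grng G \<alpha>) = grng G \<alpha> \<and>
        gmult G (grng G \<alpha>) \<alpha> = \<alpha> \<and> gmult G \<alpha> (gsrc G \<alpha>) = \<alpha> \<and>
        ginv G \<alpha> \<in> arrows G \<and>
        gsrc G (ginv G \<alpha>) = grng G \<alpha> \<and> grng G (ginv G \<alpha>) = gsrc G \<alpha> \<and>
        gmult G (ginv G \<alpha>) \<alpha> = gsrc G \<alpha> \<and> gmult G \<alpha> (ginv G \<alpha>) = grng G \<alpha>) \<and>
     (\<forall>(\<alpha>, \<beta>) \<in> composable G.
        gmult G \<alpha> \<beta> \<in> arrows G \<and>
        gsrc G (gmult G \<alpha> \<beta>) = gsrc G \<beta> \<and> grng G (gmult G \<alpha> \<beta>) = grng G \<alpha>) \<and>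
     (\<forall>\<alpha> \<beta> \<gamma>. (\<alpha>, \<beta>) \<in> composable G \<and> (\<beta>, \<gamma>) \<in> composable G \<longrightarrow>
        gmult G (gmult G \<alpha> \<beta>) \<gamma> = gmult G \<alpha> (gmult G \<beta> \<gamma>))"

definition topological_groupoid :: "'g groupoid \<Rightarrow> bool" where
  "topological_groupoid G \<longleftrightarrow>
     algebraic_groupoid G \<and>
     continuous_map (gtop G) (gtop G) (gsrc G) \<and>
     continuous_map (gtop G) (gtop G) (grng G) \<and>
     continuous_map (gtop G) (gtop G) (ginv G) \<and>
     continuous_map (subtopology (prod_topology (gtop G) (gtop G)) (composable G)) (gtop G)
       (\<lambda>(\<alpha>, \<beta>). gmult G \<alpha> \<beta>)"

definition local_homeomorphism :: "'a topology \<Rightarrow> 'b topology \<Rightarrow> ('a \<Rightarrow> 'b) \<Rightarrow> bool" where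
  "local_homeomorphism X Y p \<longleftrightarrow>
     (\<forall>x \<in> topspace X. \<exists>U. openin X U \<and> x \<in> U \<and> openin Y (p ` U) \<and>
        homeomorphic_map (subtopology X U) (subtopology Y (p ` U)) p)"

definition etale_groupoid :: "'g groupoid \<Rightarrow> bool" where
  "etale_groupoid G \<longleftrightarrow>
     topological_groupoid G \<and>
     local_homeomorphism (gtop G) (subtopology (gtop G) (units G)) (grng G) \<and>
     local_homeomorphism (gtop G) (subtopology (gtop G) (units G)) (gsrc G)"

definition isotropy :: "'g groupoid \<Rightarrow> 'g set" where
  "isotropy G = {\<gamma> \<in> arrows G. grng G \<gamma> = gsrc G \<gamma>}"

definition isotropy_interior :: "'g groupoid \<Rightarrow> 'g set" where
  "isotropy_interior G = gtop G interior_of isotropy G"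

definition iso_groupoid :: "'g groupoid \<Rightarrow> 'g groupoid" where
  "iso_groupoid G = G\<lparr>gtop := subtopology (gtop G) (isotropy_interior G)\<rparr>"


section \<open>Normed *-algebras with explicit carriers, and their completions\<close>

record 'a star_algebra =
  carr :: "'a set"
  azero :: "'a"
  aadd :: "'a \<Rightarrow> 'a \<Rightarrow> 'a"
  ascale :: "complex \<Rightarrow> 'a \<Rightarrow> 'a"
  amult :: "'a \<Rightarrow> 'a \<Rightarrow> 'a"
  astar :: "'a \<Rightarrow> 'a"
  anorm :: "'a \<Rightarrow> real"

definition adist :: "'a star_algebra \<Rightarrow> 'a \<Rightarrow> 'a \<Rightarrow> real" where
  "adist A a b = anorm A (aadd A a (ascale A (-1) b))"

definition converges_to :: "'a star_algebra \<Rightarrow> (nat \<Rightarrow> 'a) \<Rightarrow> 'a \<Rightarrow> bool" where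
  "converges_to A x a \<longleftrightarrow> (\<lambda>n. adist A (x n) a) \<longlonglongrightarrow> 0"

definition star_hom :: "'a star_algebra \<Rightarrow> 'b star_algebra \<Rightarrow> ('a \<Rightarrow> 'b) \<Rightarrow> bool" where
  "star_hom A B \<phi> \<longleftrightarrow>
     (\<forall>a \<in> carr A. \<phi> a \<in> carr B) \<and>
     (\<forall>a \<in> carr A. \<forall>b \<in> carr A. \<phi> (aadd A a b) = aadd B (\<phi> a) (\<phi> b)) \<and>
     (\<forall>c. \<forall>a \<in> carr A. \<phi> (ascale A c a) = ascale B c (\<phi> a)) \<and>
     (\<forall>a \<in> carr A. \<forall>b \<in> carr A. \<phi> (amult A a b) = amult B (\<phi> a) (\<phi> b)) \<and>
     (\<forall>a \<in> carr A. \<phi> (astar A a) = astar B (\<phi> a))"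

definition norm_bounded :: "'a star_algebra \<Rightarrow> 'b star_algebra \<Rightarrow> ('a \<Rightarrow> 'b) \<Rightarrow> bool" where
  "norm_bounded A B \<phi> \<longleftrightarrow> (\<exists>C. \<forall>a \<in> carr A. anorm B (\<phi> a) \<le> C * anorm A a)"

definition cauchy_seqs :: "'a star_algebra \<Rightarrow> (nat \<Rightarrow> 'a) set" where
  "cauchy_seqs A = {x. (\<forall>n. x n \<in> carr A) \<and>
     (\<forall>e > 0. \<exists>N. \<forall>m \<ge> N. \<forall>n \<ge> N. adist A (x m) (x n) < e)}"

definition cauchy_class :: "'a star_algebra \<Rightarrow> (nat \<Rightarrow> 'a) \<Rightarrow> (nat \<Rightarrow> 'a) set" where
  "cauchy_class A x = {y \<in> cauchy_seqs A. (\<lambda>n. adist A (x n) (y n)) \<longlonglongrightarrow> 0}"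

text \<open>
  The completion consists of the classes of Cauchy sequences modulo null sequences. The unions below
  are unions of a single class: the class of the result does not depend on the representatives.
\<close>

definition completion :: "'a star_algebra \<Rightarrow> (nat \<Rightarrow> 'a) set star_algebra" where
  "completion A =
     \<lparr>carr = cauchy_class A ` cauchy_seqs A,
      azero = cauchy_class A (\<lambda>_. azero A),
      aadd = (\<lambda>X Y. \<Union>x\<in>X. \<Union>y\<in>Y. cauchy_class A (\<lambda>n. aadd A (x n) (y n))),
      ascale = (\<lambda>c X. \<Union>x\<in>X. cauchy_class A (\<lambda>n. ascale A c (x n))),
      amult = (\<lambda>X Y. \<Union>x\<in>X. \<Union>y\<in>Y. cauchy_class A (\<lambda>n. amult A (x n) (y n))),
      astar = (\<lambda>X. \<Union>x\<in>X. cauchy_class A (\<lambda>n. astar A (x n))),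
      anorm = (\<lambda>X. THE r. \<forall>x\<in>X. (\<lambda>n. anorm A (x n)) \<longlonglongrightarrow> r)\<rparr>"

definition to_completion :: "'a star_algebra \<Rightarrow> 'a \<Rightarrow> (nat \<Rightarrow> 'a) set" where
  "to_completion A a = cauchy_class A (\<lambda>_. a)"

text \<open>
  Extension by continuity: if \<open>p ` D\<close> is dense in \<open>A\<close>, this is the continuous map from \<open>A\<close> to \<open>B\<close>
  that sends \<open>p d\<close> to \<open>q d\<close> for all \<open>d\<close> in \<open>D\<close>.
\<close>

definition continuous_extension ::
    "'d set \<Rightarrow> 'a star_algebra \<Rightarrow> ('d \<Rightarrow> 'a) \<Rightarrow> 'b star_algebra \<Rightarrow> ('d \<Rightarrow> 'b) \<Rightarrow> 'a \<Rightarrow> 'b" where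
  "continuous_extension D A p B q a =
     (THE b. b \<in> carr B \<and>
        (\<exists>d. (\<forall>n. d n \<in> D) \<and>
             converges_to A (\<lambda>n. p (d n)) a \<and> converges_to B (\<lambda>n. q (d n)) b))"

definition conditional_expectation ::
    "'a star_algebra \<Rightarrow> 'a set \<Rightarrow> ('a \<Rightarrow> 'a) \<Rightarrow> bool" where
  "conditional_expectation A B \<Phi> \<longleftrightarrow>
     (\<forall>a \<in> carr A. \<Phi> a \<in> B) \<and>
     (\<forall>b \<in> B. \<Phi> b = b) \<and>
     (\<forall>a \<in> carr A. \<forall>a' \<in> carr A. \<Phi> (aadd A a a') = aadd A (\<Phi> a) (\<Phi> a')) \<and>
     (\<forall>c. \<forall>a \<in> carr A. \<Phi> (ascale A c a) = ascale A c (\<Phi> a)) \<and>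
     (\<forall>a \<in> carr A. anorm A (\<Phi> a) \<le> anorm A a) \<and>
     (\<forall>a \<in> carr A. \<exists>c \<in> carr A. \<Phi> (amult A (astar A a) a) = amult A (astar A c) c) \<and>
     (\<forall>a \<in> carr A. \<forall>b \<in> B. \<Phi> (amult A b a) = amult A b (\<Phi> a) \<and>
                             \<Phi> (amult A a b) = amult A (\<Phi> a) b)"

definition faithful_map :: "'a star_algebra \<Rightarrow> ('a \<Rightarrow> 'a) \<Rightarrow> bool" where
  "faithful_map A \<Phi> \<longleftrightarrow>
     (\<forall>a \<in> carr A. \<Phi> (amult A (astar A a) a) = azero A \<longrightarrow> a = azero A)"


section \<open>Bounded operators on \<open>\<ell>\<^sup>2(S)\<close>\<close>

text \<open>
  Vectors of \<open>\<ell>\<^sup>2(S)\<close> are functions on the whole type that vanish off \<open>S\<close>. Operators are total functions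
  that vanish off \<open>\<ell>\<^sup>2(S)\<close>, so that equality of operators is equality of functions.
\<close>

definition ell2 :: "'i set \<Rightarrow> ('i \<Rightarrow> complex) set" where
  "ell2 S = {\<xi>. (\<forall>i. i \<notin> S \<longrightarrow> \<xi> i = 0) \<and> (\<lambda>i. (cmod (\<xi> i))\<^sup>2) summable_on S}"

definition ell2_inner :: "'i set \<Rightarrow> ('i \<Rightarrow> complex) \<Rightarrow> ('i \<Rightarrow> complex) \<Rightarrow> complex" where
  "ell2_inner S \<xi> \<eta> = (\<Sum>\<^sub>\<infinity>i\<in>S. \<xi> i * cnj (\<eta> i))"

definition ell2_norm :: "'i set \<Rightarrow> ('i \<Rightarrow> complex) \<Rightarrow> real" where
  "ell2_norm S \<xi> = sqrt (\<Sum>\<^sub>\<infinity>i\<in>S. (cmod (\<xi> i))\<^sup>2)"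

type_synonym 'i operator = "('i \<Rightarrow> complex) \<Rightarrow> ('i \<Rightarrow> complex)"

definition bounded_ops :: "'i set \<Rightarrow> 'i operator set" where
  "bounded_ops S = {T.
     (\<forall>\<xi> \<in> ell2 S. T \<xi> \<in> ell2 S) \<and>
     (\<forall>\<xi> \<in> ell2 S. \<forall>\<eta> \<in> ell2 S. T (\<lambda>i. \<xi> i + \<eta> i) = (\<lambda>i. T \<xi> i + T \<eta> i)) \<and>
     (\<forall>c. \<forall>\<xi> \<in> ell2 S. T (\<lambda>i. c * \<xi> i) = (\<lambda>i. c * T \<xi> i)) \<and>
     (\<exists>C. \<forall>\<xi> \<in> ell2 S. ell2_norm S (T \<xi>) \<le> C * ell2_norm S \<xi>) \<and>
     (\<forall>\<xi>. \<xi> \<notin> ell2 S \<longrightarrow> T \<xi> = (\<lambda>_. 0))}"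

definition op_adjoint :: "'i set \<Rightarrow> 'i operator \<Rightarrow> 'i operator" where
  "op_adjoint S T = (THE T'. T' \<in> bounded_ops S \<and>
     (\<forall>\<xi> \<in> ell2 S. \<forall>\<eta> \<in> ell2 S. ell2_inner S (T \<xi>) \<eta> = ell2_inner S \<xi> (T' \<eta>)))"

definition op_norm :: "'i set \<Rightarrow> 'i operator \<Rightarrow> real" where
  "op_norm S T = (SUP \<xi>\<in>{\<xi> \<in> ell2 S. ell2_norm S \<xi> \<le> 1}. ell2_norm S (T \<xi>))"

definition operator_algebra :: "'i set \<Rightarrow> 'i operator star_algebra" where
  "operator_algebra S =
     \<lparr>carr = bounded_ops S,
      azero = (\<lambda>_ _. 0),
      aadd = (\<lambda>T U \<xi> i. T \<xi> i + U \<xi> i),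
      ascale = (\<lambda>c T \<xi> i. c * T \<xi> i),
      amult = (\<lambda>T U. T \<circ> U),
      astar = op_adjoint S,
      anorm = op_norm S\<rparr>"


section \<open>Groupoid C*-algebras\<close>

text \<open>
  Functions on \<open>G\<close> are represented by functions on the whole type that vanish off \<open>arrows G\<close>. Hence if
  \<open>H\<close> is an open subgroupoid of \<open>G\<close>, extension by zero from \<open>C\<^sub>c(H)\<close> to \<open>C\<^sub>c(G)\<close> is the identity on
  representatives, and the representative of the restriction of \<open>f\<close> to \<open>H\<close> is \<open>restrict_fun (arrows H) f\<close>.
\<close>

definition Cc :: "'g groupoid \<Rightarrow> ('g \<Rightarrow> complex) set" where
  "Cc G = {f. (\<forall>\<gamma>. \<gamma> \<notin> arrows G \<longrightarrow> f \<gamma> = 0) \<and>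
     continuous_map (gtop G) euclidean f \<and>
     compactin (gtop G) (gtop G closure_of {\<gamma> \<in> arrows G. f \<gamma> \<noteq> 0})}"

definition restrict_fun :: "'g set \<Rightarrow> ('g \<Rightarrow> complex) \<Rightarrow> 'g \<Rightarrow> complex" where
  "restrict_fun S f = (\<lambda>\<gamma>. if \<gamma> \<in> S then f \<gamma> else 0)"

definition convolution ::
    "'g groupoid \<Rightarrow> ('g \<Rightarrow> complex) \<Rightarrow> ('g \<Rightarrow> complex) \<Rightarrow> 'g \<Rightarrow> complex" where
  "convolution G f g \<gamma> =
     (\<Sum>\<^sub>\<infinity>(\<alpha>, \<beta>)\<in>{(\<alpha>, \<beta>) \<in> composable G. gmult G \<alpha> \<beta> = \<gamma>}. f \<alpha> * g \<beta>)"

definition involution :: "'g groupoid \<Rightarrow> ('g \<Rightarrow> complex) \<Rightarrow> 'g \<Rightarrow> complex" where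
  "involution G f \<gamma> = (if \<gamma> \<in> arrows G then cnj (f (ginv G \<gamma>)) else 0)"

definition I_norm :: "'g groupoid \<Rightarrow> ('g \<Rightarrow> complex) \<Rightarrow> real" where
  "I_norm G f = (SUP u\<in>units G. max (\<Sum>\<^sub>\<infinity>\<gamma>\<in>src_fibre G u. cmod (f \<gamma>))
                                    (\<Sum>\<^sub>\<infinity>\<gamma>\<in>rng_fibre G u. cmod (f \<gamma>)))"

definition Cc_algebra :: "'g groupoid \<Rightarrow> ('g \<Rightarrow> complex) star_algebra" where
  "Cc_algebra G =
     \<lparr>carr = Cc G,
      azero = (\<lambda>_. 0),
      aadd = (\<lambda>f g \<gamma>. f \<gamma> + g \<gamma>),
      ascale = (\<lambda>c f \<gamma>. c * f \<gamma>),
      amult = convolution G,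
      astar = involution G,
      anorm = I_norm G\<rparr>"

text \<open>
  Representations are taken on the single Hilbert space \<open>\<ell>\<^sup>2(I)\<close> with \<open>I\<close> the type of all complex
  functions on the arrow type. This yields the supremum over representations on arbitrary Hilbert
  spaces: for any representation \<open>\<pi>\<close> and vector \<open>\<xi>\<close>, the closed span of \<open>\<xi>\<close> and
  \<open>{\<pi>(f)\<xi> | f \<in> C\<^sub>c(G)}\<close> is invariant and of dimension at most the cardinality of \<open>I\<close>. It therefore embeds
  isometrically into \<open>\<ell>\<^sup>2(I)\<close>, and \<open>\<pi>\<close> is extended by zero on the complement, representations not being
  required to be nondegenerate.
\<close>

definition I_bounded_reps ::
    "'g groupoid \<Rightarrow> (('g \<Rightarrow> complex) \<Rightarrow> ('g \<Rightarrow> complex) operator) set" where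
  "I_bounded_reps G = {\<pi>. star_hom (Cc_algebra G) (operator_algebra UNIV) \<pi> \<and>
                          norm_bounded (Cc_algebra G) (operator_algebra UNIV) \<pi>}"

definition full_norm :: "'g groupoid \<Rightarrow> ('g \<Rightarrow> complex) \<Rightarrow> real" where
  "full_norm G f = (SUP \<pi>\<in>I_bounded_reps G. op_norm UNIV (\<pi> f))"

type_synonym 'g full_element = "(nat \<Rightarrow> 'g \<Rightarrow> complex) set"

definition full_algebra :: "'g groupoid \<Rightarrow> 'g full_element star_algebra" where
  "full_algebra G = completion ((Cc_algebra G)\<lparr>anorm := full_norm G\<rparr>)"

definition full_embed :: "'g groupoid \<Rightarrow> ('g \<Rightarrow> complex) \<Rightarrow> 'g full_element" where
  "full_embed G = to_completion ((Cc_algebra G)\<lparr>anorm := full_norm G\<rparr>)"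

definition basis_vector :: "'g \<Rightarrow> 'g \<Rightarrow> complex" where
  "basis_vector \<gamma> = (\<lambda>\<eta>. if \<eta> = \<gamma> then 1 else 0)"

text \<open>
  \<open>regular_rep G u\<close> is \<open>L\<^sup>u\<close>, given on a general vector of \<open>\<ell>\<^sup>2(G\<^sub>u)\<close> by linearity and continuity from its
  values on basis vectors. For \<open>f\<close> in \<open>C\<^sub>c(G)\<close> only finitely many terms contribute at each \<open>\<eta>\<close>.
\<close>

definition regular_rep ::
    "'g groupoid \<Rightarrow> 'g \<Rightarrow> ('g \<Rightarrow> complex) \<Rightarrow> 'g operator" where
  "regular_rep G u f \<xi> =
     (\<lambda>\<eta>. \<Sum>\<^sub>\<infinity>\<gamma>\<in>src_fibre G u.
             \<xi> \<gamma> * (\<Sum>\<^sub>\<infinity>\<alpha>\<in>src_fibre G (grng G \<gamma>). f \<alpha> * basis_vector (gmult G \<alpha> \<gamma>) \<eta>))"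

text \<open>
  As \<open>G\<close> is the disjoint union of the fibres \<open>G\<^sub>u\<close>, the direct sum of the spaces \<open>\<ell>\<^sup>2(G\<^sub>u)\<close> is \<open>\<ell>\<^sup>2(G)\<close>; the
  block of the vector \<open>\<xi>\<close> that contains the coordinate \<open>\<eta>\<close> is the one with index \<open>gsrc G \<eta>\<close>.
\<close>

definition sum_regular_rep :: "'g groupoid \<Rightarrow> ('g \<Rightarrow> complex) \<Rightarrow> 'g operator" where
  "sum_regular_rep G f \<xi> =
     (\<lambda>\<eta>. if \<xi> \<in> ell2 (arrows G) \<and> \<eta> \<in> arrows G then regular_rep G (gsrc G \<eta>) f \<xi> \<eta> else 0)"

definition reduced_quotient :: "'g groupoid \<Rightarrow> 'g full_element \<Rightarrow> 'g operator" where
  "reduced_quotient G =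
     continuous_extension (Cc G) (full_algebra G) (full_embed G)
       (operator_algebra (arrows G)) (sum_regular_rep G)"

definition reduced_algebra :: "'g groupoid \<Rightarrow> 'g operator star_algebra" where
  "reduced_algebra G =
     (operator_algebra (arrows G))\<lparr>carr := reduced_quotient G ` carr (full_algebra G)\<rparr>"

definition iso_inclusion :: "'g groupoid \<Rightarrow> 'g full_element \<Rightarrow> 'g full_element" where
  "iso_inclusion G =
     continuous_extension (Cc (iso_groupoid G))
       (full_algebra (iso_groupoid G)) (full_embed (iso_groupoid G))
       (full_algebra G) (full_embed G)"

definition iso_inclusion_red :: "'g groupoid \<Rightarrow> 'g operator \<Rightarrow> 'g operator" where
  "iso_inclusion_red G =
     continuous_extension (Cc (iso_groupoid G))
       (reduced_algebra (iso_groupoid G)) (sum_regular_rep (iso_groupoid G))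
       (reduced_algebra G) (sum_regular_rep G)"

definition iso_subalgebra :: "'g groupoid \<Rightarrow> 'g full_element set" where
  "iso_subalgebra G = iso_inclusion G ` carr (full_algebra (iso_groupoid G))"

definition iso_subalgebra_red :: "'g groupoid \<Rightarrow> 'g operator set" where
  "iso_subalgebra_red G = iso_inclusion_red G ` carr (reduced_algebra (iso_groupoid G))"


section \<open>Topological amenability\<close>

text \<open>
  This is the definition of Brown and Ozawa for etale groupoids (C*-Algebras and Finite-Dimensional
  Approximations, Definition 5.6.13). The net of functions \<open>\<mu>\<close> is given by a proper filter on functions.
\<close>

definition amenable_groupoid :: "'g groupoid \<Rightarrow> bool" where
  "amenable_groupoid G \<longleftrightarrow>
     (\<exists>F :: ('g \<Rightarrow> real) filter. F \<noteq> bot \<and>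
        (\<forall>\<^sub>F \<mu> in F. (\<forall>\<gamma>. 0 \<le> \<mu> \<gamma>) \<and> (\<lambda>\<gamma>. complex_of_real (\<mu> \<gamma>)) \<in> Cc G) \<and>
        (\<forall>K. compactin (gtop G) K \<longrightarrow>
           uniform_limit K
             (\<lambda>\<mu> \<gamma>. \<Sum>\<^sub>\<infinity>\<beta>\<in>src_fibre G (grng G \<gamma>). \<mu> \<beta>) (\<lambda>_. 1) F \<and>
           uniform_limit K
             (\<lambda>\<mu> \<gamma>. \<Sum>\<^sub>\<infinity>\<beta>\<in>src_fibre G (grng G \<gamma>). \<bar>\<mu> \<beta> - \<mu> (gmult G \<beta> \<gamma>)\<bar>) (\<lambda>_. 0) F))"

end

theory Submission
  imports Defs "HOL-Computational_Algebra.Fundamental_Theorem_Algebra"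
begin

text \<open>
  Let \<open>I\<close> be the interior of the isotropy. Operators in the reduced algebra are matrices over \<open>G\<close>, and
  \<open>M\<^sub>r\<close> consists of matrices that are block diagonal with respect to the cosets of \<open>I\<close>.

  If \<open>E\<close> is an expectation onto \<open>M\<^sub>r\<close> and \<open>f\<close> is supported in a bisection, then bimodularity over functions
  on the unit space shows that \<open>E f\<close> agrees with \<open>f\<close> on \<open>I\<close>. If \<open>f\<close> is 1 at a point of the closure of \<open>I\<close>
  outside \<open>I\<close>, this contradicts that \<open>E f\<close> is a uniform limit of elements of \<open>C\<^sub>c(I)\<close>, which vanish at that point.

  If \<open>I\<close> is closed, compression to the diagonal blocks restricts \<open>f\<close> to \<open>I\<close>. It is contractive and faithful, and
  \<open>\<Psi>(a\<^sup>*a)\<close> is positive with a square root in \<open>M\<^sub>r\<close>.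

  If \<open>I\<close> is amenable, its full and reduced norms agree, so restriction is also contractive for the full norms. For the
  equality of norms, amenability yields functions \<open>h \<gamma> = \<Sum>y. \<xi> (\<gamma> y) \<xi> y\<close> close to 1 on compact sets. If \<open>\<xi>\<close> is a sum of
  squares of functions \<open>a\<^sub>i\<close> supported in bisections, then \<open>h f = \<Sum>i j. a\<^sub>j * e\<^sub>i\<^sub>j * a\<^sub>i\<^sup>*\<close>, where \<open>e\<^sub>i\<^sub>j\<close> is a function on the units whose
  values are matrix coefficients of the regular representation.
\<close>

section \<open>Square summable families and bounded operators on them\<close>

section \<open>Square summable functions\<close>

text \<open>The algebras are given by explicit carriers, so polynomials take the place of spectral
  theory. Two obstacles require them. A conditional expectation has to send \<open>a* a\<close> to
  an element of the form \<open>c* c\<close>, so a square root must be found inside the isotropy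
  algebra, which may have no unit; it is a limit of polynomials without constant term. And the
  reduced algebra is defined as the image of the full completion, so limits in the reduced norm must
  first be seen to lie in it: a function of small reduced norm is changed, by little in that norm,
  into one whose full norm is small as well.

  The comparison of norms for amenable isotropy uses no disintegration of representations. Since the
  isotropy is a bundle of groups, the functions in the middle of the decomposition of
  \<open>h f\<close> live on the unit space; a partition of unity turns them into finitely many
  scalars, and the coefficients of an arbitrary representation then appear as coefficients of the
  regular representation tensored with an identity, in the spirit of Fell's absorption
  principle.\<close>

lemma ell2_vanish: "\<xi> \<in> ell2 S \<Longrightarrow> i \<notin> S \<Longrightarrow> \<xi> i = 0"
  by (simp add: ell2_def)

lemma ell2_summable: "\<xi> \<in> ell2 S \<Longrightarrow> (\<lambda>i. (cmod (\<xi> i))\<^sup>2) summable_on S"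
  by (simp add: ell2_def)

lemma ell2_norm_nonneg [simp]: "0 \<le> ell2_norm S \<xi>"
  by (simp add: ell2_norm_def infsum_nonneg)

lemma ell2_norm_square: "(ell2_norm S \<xi>)\<^sup>2 = (\<Sum>\<^sub>\<infinity>i\<in>S. (cmod (\<xi> i))\<^sup>2)"
  by (simp add: ell2_norm_def infsum_nonneg)

lemma L2_set_le_ell2_norm:
  assumes "\<xi> \<in> ell2 S" "finite F" "F \<subseteq> S"
  shows "L2_set (\<lambda>i. cmod (\<xi> i)) F \<le> ell2_norm S \<xi>"
  unfolding L2_set_def ell2_norm_def
  by (rule real_sqrt_le_mono) (rule finite_sum_le_infsum[OF ell2_summable[OF assms(1)] assms(2,3)], simp)

text \<open>A nonnegative series is controlled by its finite partial sums. Most membership and norm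
  estimates below are reduced in this way to \<open>L2_set\<close> over finite sets, where Minkowski
  and Cauchy-Schwarz are at hand.\<close>

lemma ell2_boundedI:
  assumes "\<And>i. i \<notin> S \<Longrightarrow> \<xi> i = 0"
    and "\<And>F. finite F \<Longrightarrow> F \<subseteq> S \<Longrightarrow> L2_set (\<lambda>i. cmod (\<xi> i)) F \<le> C"
  shows "\<xi> \<in> ell2 S" "ell2_norm S \<xi> \<le> C"
proof -
  have C: "0 \<le> C" using assms(2)[of "{}"] by simp
  have fin: "(\<Sum>i\<in>F. (cmod (\<xi> i))\<^sup>2) \<le> C\<^sup>2" if "finite F" "F \<subseteq> S" for F
    using assms(2)[OF that] C unfolding L2_set_def by (simp add: real_sqrt_le_iff sqrt_le_D)
  have s: "(\<lambda>i. (cmod (\<xi> i))\<^sup>2) summable_on S"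
    by (rule nonneg_bdd_above_summable_on) (auto intro!: bdd_aboveI2 fin)
  show "\<xi> \<in> ell2 S" using assms(1) s by (simp add: ell2_def)
  have "(\<Sum>\<^sub>\<infinity>i\<in>S. (cmod (\<xi> i))\<^sup>2) \<le> C\<^sup>2"
    by (rule infsum_le_finite_sums[OF s]) (auto intro: fin)
  then show "ell2_norm S \<xi> \<le> C" using C
    by (simp add: ell2_norm_def real_le_lsqrt)
qed

lemma ell2_zero [simp]: "(\<lambda>_. 0) \<in> ell2 S"
  by (simp add: ell2_def)

lemma ell2_norm_zero [simp]: "ell2_norm S (\<lambda>_. 0) = 0"
  by (simp add: ell2_norm_def)

lemma ell2_add_aux:
  assumes "\<xi> \<in> ell2 S" "\<eta> \<in> ell2 S"
  shows "(\<lambda>i. \<xi> i + \<eta> i) \<in> ell2 S \<and> ell2_norm S (\<lambda>i. \<xi> i + \<eta> i) \<le> ell2_norm S \<xi> + ell2_norm S \<eta>"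
proof -
  have "L2_set (\<lambda>i. cmod (\<xi> i + \<eta> i)) F \<le> ell2_norm S \<xi> + ell2_norm S \<eta>"
    if F: "finite F" "F \<subseteq> S" for F
  proof -
    have "L2_set (\<lambda>i. cmod (\<xi> i + \<eta> i)) F \<le> L2_set (\<lambda>i. cmod (\<xi> i) + cmod (\<eta> i)) F"
      by (rule L2_set_mono) (auto intro: norm_triangle_ineq)
    also have "\<dots> \<le> L2_set (\<lambda>i. cmod (\<xi> i)) F + L2_set (\<lambda>i. cmod (\<eta> i)) F"
      by (rule L2_set_triangle_ineq)
    also have "\<dots> \<le> ell2_norm S \<xi> + ell2_norm S \<eta>"
      using L2_set_le_ell2_norm[OF assms(1) F] L2_set_le_ell2_norm[OF assms(2) F] by simp
    finally show ?thesis .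
  qed
  moreover have "\<xi> i + \<eta> i = 0" if "i \<notin> S" for i
    using assms that by (simp add: ell2_vanish)
  ultimately show ?thesis by (intro conjI ell2_boundedI) auto
qed

lemma ell2_add: "\<xi> \<in> ell2 S \<Longrightarrow> \<eta> \<in> ell2 S \<Longrightarrow> (\<lambda>i. \<xi> i + \<eta> i) \<in> ell2 S"
  and ell2_norm_triangle: "\<xi> \<in> ell2 S \<Longrightarrow> \<eta> \<in> ell2 S \<Longrightarrow>
    ell2_norm S (\<lambda>i. \<xi> i + \<eta> i) \<le> ell2_norm S \<xi> + ell2_norm S \<eta>"
  using ell2_add_aux by blast+

lemma ell2_scale: "\<xi> \<in> ell2 S \<Longrightarrow> (\<lambda>i. c * \<xi> i) \<in> ell2 S"
  by (auto simp: ell2_def norm_mult power_mult_distrib intro!: summable_on_cmult_right)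

lemma ell2_norm_scale: "ell2_norm S (\<lambda>i. c * \<xi> i) = cmod c * ell2_norm S \<xi>"
  by (simp add: ell2_norm_def norm_mult power_mult_distrib infsum_cmult_right' real_sqrt_mult)

lemma ell2_diff: "\<xi> \<in> ell2 S \<Longrightarrow> \<eta> \<in> ell2 S \<Longrightarrow> (\<lambda>i. \<xi> i - \<eta> i) \<in> ell2 S"
  using ell2_add[of \<xi> S "\<lambda>i. (-1) * \<eta> i"] ell2_scale[of \<eta> S "-1"] by simp

lemma ell2_norm_diff_triangle: "\<xi> \<in> ell2 S \<Longrightarrow> \<eta> \<in> ell2 S \<Longrightarrow>
    ell2_norm S (\<lambda>i. \<xi> i - \<eta> i) \<le> ell2_norm S \<xi> + ell2_norm S \<eta>"
  using ell2_norm_triangle[of \<xi> S "\<lambda>i. (-1) * \<eta> i"] ell2_scale[of \<eta> S "-1"] ell2_norm_scale[of S "-1" \<eta>]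
  by simp

lemma ell2_sum: "(\<And>k. k \<in> K \<Longrightarrow> \<xi> k \<in> ell2 S) \<Longrightarrow> (\<lambda>i. \<Sum>k\<in>K. \<xi> k i) \<in> ell2 S"
  by (induction K rule: infinite_finite_induct) (auto intro: ell2_add)

lemma ell2_cmod_le_norm:
  assumes "\<xi> \<in> ell2 S" shows "cmod (\<xi> i) \<le> ell2_norm S \<xi>"
proof (cases "i \<in> S")
  case True then show ?thesis using L2_set_le_ell2_norm[OF assms, of "{i}"] by simp
qed (simp add: ell2_vanish[OF assms])

lemma ell2_norm_eq_0: "\<xi> \<in> ell2 S \<Longrightarrow> ell2_norm S \<xi> = 0 \<Longrightarrow> \<xi> = (\<lambda>_. 0)"
  using ell2_cmod_le_norm by fastforce

lemma restrict_fun_ell2: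
  assumes "\<xi> \<in> ell2 S" shows "restrict_fun X \<xi> \<in> ell2 S" "ell2_norm S (restrict_fun X \<xi>) \<le> ell2_norm S \<xi>"
proof -
  have *: "L2_set (\<lambda>i. cmod (restrict_fun X \<xi> i)) F \<le> ell2_norm S \<xi>" if "finite F" "F \<subseteq> S" for F
    by (rule order_trans[OF L2_set_mono L2_set_le_ell2_norm[OF assms that]]) (auto simp: restrict_fun_def)
  show "restrict_fun X \<xi> \<in> ell2 S" "ell2_norm S (restrict_fun X \<xi>) \<le> ell2_norm S \<xi>"
    by (rule ell2_boundedI, use * ell2_vanish[OF assms] in \<open>auto simp: restrict_fun_def\<close>)+
qed

lemma ell2_inner_abs_summable:
  assumes "\<xi> \<in> ell2 S" "\<eta> \<in> ell2 S"
  shows "(\<lambda>i. cmod (\<xi> i * cnj (\<eta> i))) summable_on S"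
  by (rule abs_summable_product)
     (use ell2_summable[OF assms(1)] ell2_summable[OF assms(2)] in
       \<open>simp_all add: norm_mult power2_eq_square\<close>)

lemma ell2_inner_summable:
  assumes "\<xi> \<in> ell2 S" "\<eta> \<in> ell2 S"
  shows "(\<lambda>i. \<xi> i * cnj (\<eta> i)) summable_on S"
  using abs_summable_summable[OF ell2_inner_abs_summable[OF assms]] .

lemma ell2_Cauchy_Schwarz_sum:
  assumes "\<xi> \<in> ell2 S" "\<eta> \<in> ell2 S"
  shows "(\<Sum>\<^sub>\<infinity>i\<in>S. cmod (\<xi> i * cnj (\<eta> i))) \<le> ell2_norm S \<xi> * ell2_norm S \<eta>"
proof (rule infsum_le_finite_sums[OF ell2_inner_abs_summable[OF assms]])
  fix F assume F: "finite F" "F \<subseteq> S"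
  have "(\<Sum>i\<in>F. cmod (\<xi> i * cnj (\<eta> i))) = (\<Sum>i\<in>F. \<bar>cmod (\<xi> i)\<bar> * \<bar>cmod (\<eta> i)\<bar>)"
    by (simp add: norm_mult)
  also have "\<dots> \<le> L2_set (\<lambda>i. cmod (\<xi> i)) F * L2_set (\<lambda>i. cmod (\<eta> i)) F"
    by (rule L2_set_mult_ineq)
  also have "\<dots> \<le> ell2_norm S \<xi> * ell2_norm S \<eta>"
    by (intro mult_mono L2_set_le_ell2_norm assms F) auto
  finally show "(\<Sum>i\<in>F. cmod (\<xi> i * cnj (\<eta> i))) \<le> ell2_norm S \<xi> * ell2_norm S \<eta>" .
qed

lemma ell2_Cauchy_Schwarz:
  assumes "\<xi> \<in> ell2 S" "\<eta> \<in> ell2 S"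
  shows "cmod (ell2_inner S \<xi> \<eta>) \<le> ell2_norm S \<xi> * ell2_norm S \<eta>"
  unfolding ell2_inner_def
  using norm_infsum_bound[OF ell2_inner_abs_summable[OF assms]] ell2_Cauchy_Schwarz_sum[OF assms] by linarith

lemma ell2_inner_add_left: "\<xi> \<in> ell2 S \<Longrightarrow> \<xi>' \<in> ell2 S \<Longrightarrow> \<eta> \<in> ell2 S \<Longrightarrow>
    ell2_inner S (\<lambda>i. \<xi> i + \<xi>' i) \<eta> = ell2_inner S \<xi> \<eta> + ell2_inner S \<xi>' \<eta>"
  unfolding ell2_inner_def by (simp add: distrib_right infsum_add ell2_inner_summable)

lemma ell2_inner_scale_left: "ell2_inner S (\<lambda>i. c * \<xi> i) \<eta> = c * ell2_inner S \<xi> \<eta>"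
  unfolding ell2_inner_def by (simp add: infsum_cmult_right' mult.assoc)

lemma ell2_inner_commute: "ell2_inner S \<eta> \<xi> = cnj (ell2_inner S \<xi> \<eta>)"
  unfolding ell2_inner_def by (simp flip: infsum_cnj add: mult.commute)

lemma ell2_inner_add_right: "\<xi> \<in> ell2 S \<Longrightarrow> \<xi>' \<in> ell2 S \<Longrightarrow> \<eta> \<in> ell2 S \<Longrightarrow>
    ell2_inner S \<eta> (\<lambda>i. \<xi> i + \<xi>' i) = ell2_inner S \<eta> \<xi> + ell2_inner S \<eta> \<xi>'"
  using ell2_inner_add_left[of \<xi> S \<xi>' \<eta>] by (simp add: ell2_inner_commute[of S \<eta>])

lemma ell2_inner_scale_right: "ell2_inner S \<eta> (\<lambda>i. c * \<xi> i) = cnj c * ell2_inner S \<eta> \<xi>"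
  by (simp add: ell2_inner_commute[of S \<eta>] ell2_inner_scale_left)

lemma ell2_inner_diff_left: "\<xi> \<in> ell2 S \<Longrightarrow> \<xi>' \<in> ell2 S \<Longrightarrow> \<eta> \<in> ell2 S \<Longrightarrow>
    ell2_inner S (\<lambda>i. \<xi> i - \<xi>' i) \<eta> = ell2_inner S \<xi> \<eta> - ell2_inner S \<xi>' \<eta>"
  using ell2_inner_add_left[of \<xi> S "\<lambda>i. (-1) * \<xi>' i" \<eta>] ell2_scale[of \<xi>' S "-1"]
    ell2_inner_scale_left[of S "-1" \<xi>' \<eta>] by simp

lemma ell2_inner_zero_left [simp]: "ell2_inner S (\<lambda>_. 0) \<eta> = 0"
  by (simp add: ell2_inner_def)

lemma ell2_inner_zero_right [simp]: "ell2_inner S \<eta> (\<lambda>_. 0) = 0"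
  by (simp add: ell2_inner_def)

lemma ell2_inner_sum_left: "(\<And>k. k \<in> K \<Longrightarrow> \<xi> k \<in> ell2 S) \<Longrightarrow> \<eta> \<in> ell2 S \<Longrightarrow>
   ell2_inner S (\<lambda>i. \<Sum>k\<in>K. \<xi> k i) \<eta> = (\<Sum>k\<in>K. ell2_inner S (\<xi> k) \<eta>)"
  by (induction K rule: infinite_finite_induct) (simp_all add: ell2_inner_add_left ell2_sum)

lemma ell2_inner_sum_right: "(\<And>k. k \<in> K \<Longrightarrow> \<xi> k \<in> ell2 S) \<Longrightarrow> \<eta> \<in> ell2 S \<Longrightarrow>
   ell2_inner S \<eta> (\<lambda>i. \<Sum>k\<in>K. \<xi> k i) = (\<Sum>k\<in>K. ell2_inner S \<eta> (\<xi> k))"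
  by (induction K rule: infinite_finite_induct) (simp_all add: ell2_inner_add_right ell2_sum)

lemma ell2_inner_self:
  assumes "\<xi> \<in> ell2 S" shows "ell2_inner S \<xi> \<xi> = of_real ((ell2_norm S \<xi>)\<^sup>2)"
proof -
  have "ell2_inner S \<xi> \<xi> = (\<Sum>\<^sub>\<infinity>i\<in>S. complex_of_real ((cmod (\<xi> i))\<^sup>2))"
    unfolding ell2_inner_def by (rule infsum_cong) (simp only: complex_norm_square)
  also have "\<dots> = of_real (\<Sum>\<^sub>\<infinity>i\<in>S. (cmod (\<xi> i))\<^sup>2)"
    by (rule infsumI[OF has_sum_of_real[OF has_sum_infsum[OF ell2_summable[OF assms]]]])
  finally show ?thesis by (simp add: ell2_norm_square)
qed

lemma basis_vector_ell2: "i \<in> S \<Longrightarrow> basis_vector i \<in> ell2 S"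
  and ell2_norm_basis_vector: "i \<in> S \<Longrightarrow> ell2_norm S (basis_vector i) = 1"
proof -
  assume i: "i \<in> S"
  have "((\<lambda>j. (cmod (basis_vector i j))\<^sup>2) has_sum 1) S \<longleftrightarrow> ((\<lambda>j. (cmod (basis_vector i j))\<^sup>2) has_sum 1) {i}"
    by (rule has_sum_cong_neutral) (use i in \<open>auto simp: basis_vector_def\<close>)
  then have h: "((\<lambda>j. (cmod (basis_vector i j))\<^sup>2) has_sum 1) S"
    by (simp add: basis_vector_def has_sum_finiteI)
  show "basis_vector i \<in> ell2 S" using h i
    by (auto simp: ell2_def summable_on_def basis_vector_def)
  show "ell2_norm S (basis_vector i) = 1" using infsumI[OF h] by (simp add: ell2_norm_def)
qed

lemma ell2_inner_basis_right: "i \<in> S \<Longrightarrow> ell2_inner S \<xi> (basis_vector i) = \<xi> i"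
proof -
  assume i: "i \<in> S"
  have "infsum (\<lambda>j. \<xi> j * cnj (basis_vector i j)) S = infsum (\<lambda>j. \<xi> j * cnj (basis_vector i j)) {i}"
    by (rule infsum_cong_neutral) (use i in \<open>auto simp: basis_vector_def\<close>)
  then show ?thesis by (simp add: ell2_inner_def basis_vector_def)
qed

lemma ell2_inner_basis_left: "i \<in> S \<Longrightarrow> ell2_inner S (basis_vector i) \<xi> = cnj (\<xi> i)"
  using ell2_inner_basis_right ell2_inner_commute by metis

lemma ell2_finite_approx:
  assumes "\<xi> \<in> ell2 S" "0 < e"
  shows "\<exists>F. finite F \<and> F \<subseteq> S \<and> ell2_norm S (\<lambda>i. \<xi> i - restrict_fun F \<xi> i) < e"
proof -
  let ?s = "\<lambda>F. \<Sum>i\<in>F. (cmod (\<xi> i))\<^sup>2"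
  obtain F where F: "finite F" "F \<subseteq> S" "dist (?s F) (infsum (\<lambda>i. (cmod (\<xi> i))\<^sup>2) S) \<le> (e/2)\<^sup>2"
    using infsum_finite_approximation[OF ell2_summable[OF assms(1)], of "(e/2)\<^sup>2"] assms(2) by auto
  have "L2_set (\<lambda>i. cmod (\<xi> i - restrict_fun F \<xi> i)) F' \<le> e/2" if F': "finite F'" "F' \<subseteq> S" for F'
  proof -
    have "(\<Sum>i\<in>F'. (cmod (\<xi> i - restrict_fun F \<xi> i))\<^sup>2) = (\<Sum>i\<in>F'-F. (cmod (\<xi> i))\<^sup>2)"
      by (rule sum.mono_neutral_cong_right) (use F' in \<open>auto simp: restrict_fun_def\<close>)
    also have "\<dots> = ?s (F' \<union> F) - ?s F"
      using sum_diff[of "F' \<union> F" F "\<lambda>i. (cmod (\<xi> i))\<^sup>2"] F F' by (simp add: Un_Diff)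
    also have "?s (F' \<union> F) \<le> infsum (\<lambda>i. (cmod (\<xi> i))\<^sup>2) S"
      by (rule finite_sum_le_infsum[OF ell2_summable[OF assms(1)]]) (use F F' in auto)
    finally have "(\<Sum>i\<in>F'. (cmod (\<xi> i - restrict_fun F \<xi> i))\<^sup>2) \<le> (e/2)\<^sup>2"
      using F(3) by (simp add: dist_real_def)
    then show ?thesis unfolding L2_set_def using assms(2) by (intro real_le_lsqrt) (auto intro: sum_nonneg)
  qed
  then have "ell2_norm S (\<lambda>i. \<xi> i - restrict_fun F \<xi> i) \<le> e/2"
    by (intro ell2_boundedI) (use ell2_vanish[OF assms(1)] in \<open>auto simp: restrict_fun_def\<close>)
  with F assms(2) show ?thesis by (intro exI[of _ F]) auto
qed

lemma restrict_fun_finite_eq_sum: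
  "finite F \<Longrightarrow> restrict_fun F \<xi> = (\<lambda>i. \<Sum>j\<in>F. \<xi> j * basis_vector j i)"
  by (auto simp: restrict_fun_def basis_vector_def fun_eq_iff if_distrib cong: if_cong)

text \<open>Finitely supported vectors are dense, and the functional is continuous. It serves to
  test identities of bounded operators on basis vectors.\<close>

lemma ell2_functional_zero:
  assumes add: "\<And>\<xi> \<eta>. \<xi> \<in> ell2 S \<Longrightarrow> \<eta> \<in> ell2 S \<Longrightarrow> \<phi> (\<lambda>i. \<xi> i + \<eta> i) = \<phi> \<xi> + (\<phi> \<eta> :: complex)"
    and scale: "\<And>c \<xi>. \<xi> \<in> ell2 S \<Longrightarrow> \<phi> (\<lambda>i. c * \<xi> i) = c * \<phi> \<xi>"
    and bdd: "\<And>\<xi>. \<xi> \<in> ell2 S \<Longrightarrow> cmod (\<phi> \<xi>) \<le> C * ell2_norm S \<xi>"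
    and basis: "\<And>i. i \<in> S \<Longrightarrow> \<phi> (basis_vector i) = 0"
    and \<xi>: "\<xi> \<in> ell2 S"
  shows "\<phi> \<xi> = 0"
proof (rule ccontr)
  assume n: "\<phi> \<xi> \<noteq> 0"
  \<comment> \<open>Chosen so that \<open>\<bar>C\<bar> * e\<close> stays strictly below
    \<open>cmod (\<phi> \<xi>)\<close>, also when \<open>C\<close> is zero.\<close>
  define e where "e = cmod (\<phi> \<xi>) / (\<bar>C\<bar> + 1)"
  have e: "0 < e" using n by (simp add: e_def)
  obtain F where F: "finite F" "F \<subseteq> S" "ell2_norm S (\<lambda>i. \<xi> i - restrict_fun F \<xi> i) < e"
    using ell2_finite_approx[OF \<xi> e] by blast
  have z: "\<phi> (\<lambda>_. 0) = 0" using scale[OF ell2_zero, of 0] by simp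
  have "\<phi> (\<lambda>i. \<Sum>j\<in>F'. \<xi> j * basis_vector j i) = 0" if "finite F'" "F' \<subseteq> S" for F'
    using that
  proof (induction rule: finite_induct)
    case (insert x F')
    have "\<phi> (\<lambda>i. \<xi> x * basis_vector x i + (\<Sum>j\<in>F'. \<xi> j * basis_vector j i)) =
      \<phi> (\<lambda>i. \<xi> x * basis_vector x i) + \<phi> (\<lambda>i. \<Sum>j\<in>F'. \<xi> j * basis_vector j i)"
      by (rule add) (use insert in \<open>auto intro!: ell2_sum ell2_scale basis_vector_ell2\<close>)
    then show ?case using insert scale[OF basis_vector_ell2, of x] basis by simp
  qed (simp add: z)
  then have r: "\<phi> (restrict_fun F \<xi>) = 0" using F by (simp add: restrict_fun_finite_eq_sum)
  have "\<phi> \<xi> = \<phi> (\<lambda>i. (\<xi> i - restrict_fun F \<xi> i) + restrict_fun F \<xi> i)" by simp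
  also have "\<dots> = \<phi> (\<lambda>i. \<xi> i - restrict_fun F \<xi> i)"
    using add[OF ell2_diff[OF \<xi> restrict_fun_ell2(1)[OF \<xi>]] restrict_fun_ell2(1)[OF \<xi>], of F F] r by simp
  finally have "cmod (\<phi> \<xi>) \<le> C * ell2_norm S (\<lambda>i. \<xi> i - restrict_fun F \<xi> i)"
    using bdd[OF ell2_diff[OF \<xi> restrict_fun_ell2(1)[OF \<xi>]], of F] by simp
  also have "\<dots> \<le> \<bar>C\<bar> * e" using F(3) by (intro mult_mono) auto
  also have "\<dots> < (\<bar>C\<bar> + 1) * e" using e by (simp add: algebra_simps)
  finally show False by (simp add: e_def)
qed

section \<open>Bounded operators\<close>

abbreviation op_minus (infixl "\<ominus>" 65) where "T \<ominus> U \<equiv> \<lambda>\<xi> i. T \<xi> i - U \<xi> i"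
abbreviation op_plus (infixl "\<oplus>" 65) where "T \<oplus> U \<equiv> \<lambda>\<xi> i. T \<xi> i + U \<xi> i"

lemma bounded_opsI:
  assumes "\<And>\<xi>. \<xi> \<in> ell2 S \<Longrightarrow> T \<xi> \<in> ell2 S"
    and "\<And>\<xi> \<eta>. \<xi> \<in> ell2 S \<Longrightarrow> \<eta> \<in> ell2 S \<Longrightarrow> T (\<lambda>i. \<xi> i + \<eta> i) = (\<lambda>i. T \<xi> i + T \<eta> i)"
    and "\<And>c \<xi>. \<xi> \<in> ell2 S \<Longrightarrow> T (\<lambda>i. c * \<xi> i) = (\<lambda>i. c * T \<xi> i)"
    and "\<And>\<xi>. \<xi> \<in> ell2 S \<Longrightarrow> ell2_norm S (T \<xi>) \<le> C * ell2_norm S \<xi>"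
    and "\<And>\<xi>. \<xi> \<notin> ell2 S \<Longrightarrow> T \<xi> = (\<lambda>_. 0)"
  shows "T \<in> bounded_ops S"
  unfolding bounded_ops_def using assms by blast

context
  fixes S :: "'i set" and T :: "'i operator"
  assumes T: "T \<in> bounded_ops S"
begin

lemma bop_ell2: "\<xi> \<in> ell2 S \<Longrightarrow> T \<xi> \<in> ell2 S"
  and bop_add: "\<xi> \<in> ell2 S \<Longrightarrow> \<eta> \<in> ell2 S \<Longrightarrow> T (\<lambda>i. \<xi> i + \<eta> i) = (\<lambda>i. T \<xi> i + T \<eta> i)"
  and bop_scale: "\<xi> \<in> ell2 S \<Longrightarrow> T (\<lambda>i. c * \<xi> i) = (\<lambda>i. c * T \<xi> i)"
  and bop_off: "\<xi> \<notin> ell2 S \<Longrightarrow> T \<xi> = (\<lambda>_. 0)"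
  using T unfolding bounded_ops_def by blast+

lemma bop_ell2': "T \<xi> \<in> ell2 S"
  using bop_ell2 bop_off by (cases "\<xi> \<in> ell2 S") auto

lemma bop_zero: "T (\<lambda>_. 0) = (\<lambda>_. 0)"
  using bop_scale[of "\<lambda>_. 0" 0] by simp

lemma bop_diff: "\<xi> \<in> ell2 S \<Longrightarrow> \<eta> \<in> ell2 S \<Longrightarrow> T (\<lambda>i. \<xi> i - \<eta> i) = (\<lambda>i. T \<xi> i - T \<eta> i)"
  using bop_add[of \<xi> "\<lambda>i. (-1) * \<eta> i"] bop_scale[of \<eta> "-1"] ell2_scale[of \<eta> S "-1"] by simp

lemma bop_sum: "(\<And>k. k \<in> K \<Longrightarrow> \<xi> k \<in> ell2 S) \<Longrightarrow> T (\<lambda>i. \<Sum>k\<in>K. \<xi> k i) = (\<lambda>i. \<Sum>k\<in>K. T (\<xi> k) i)"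
  by (induction K rule: infinite_finite_induct) (simp_all add: bop_zero bop_add ell2_sum)

lemma op_norm_bdd_above: "bdd_above ((\<lambda>\<xi>. ell2_norm S (T \<xi>)) ` {\<xi> \<in> ell2 S. ell2_norm S \<xi> \<le> 1})"
proof -
  obtain C where C: "\<forall>\<xi> \<in> ell2 S. ell2_norm S (T \<xi>) \<le> C * ell2_norm S \<xi>"
    using T unfolding bounded_ops_def by blast
  have "ell2_norm S (T \<xi>) \<le> \<bar>C\<bar>" if "\<xi> \<in> ell2 S" "ell2_norm S \<xi> \<le> 1" for \<xi>
  proof -
    have "C * ell2_norm S \<xi> \<le> \<bar>C\<bar> * 1" using that by (intro mult_mono) auto
    with C that show ?thesis by fastforce
  qed
  then show ?thesis by (intro bdd_aboveI2) auto
qed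

lemma op_norm_nonneg: "0 \<le> op_norm S T"
  unfolding op_norm_def
  by (rule cSUP_upper2[OF op_norm_bdd_above, of "\<lambda>_. 0"]) auto

lemma op_norm_bound: "\<xi> \<in> ell2 S \<Longrightarrow> ell2_norm S (T \<xi>) \<le> op_norm S T * ell2_norm S \<xi>"
proof (cases "ell2_norm S \<xi> = 0")
  case True
  moreover assume "\<xi> \<in> ell2 S"
  ultimately have "\<xi> = (\<lambda>_. 0)" using ell2_norm_eq_0 by blast
  then show ?thesis by (simp add: bop_zero)
next
  case False
  assume x: "\<xi> \<in> ell2 S"
  let ?c = "complex_of_real (inverse (ell2_norm S \<xi>))"
  have "ell2_norm S (T (\<lambda>i. ?c * \<xi> i)) \<le> op_norm S T"
    unfolding op_norm_def
    by (rule cSUP_upper[OF _ op_norm_bdd_above])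
      (use x False in \<open>auto simp: ell2_scale ell2_norm_scale simp del: of_real_inverse\<close>)
  then have "inverse (ell2_norm S \<xi>) * ell2_norm S (T \<xi>) \<le> op_norm S T"
    using x by (simp add: bop_scale ell2_norm_scale del: of_real_inverse)
  moreover have "0 < ell2_norm S \<xi>" using False ell2_norm_nonneg[of S \<xi>] by linarith
  ultimately show ?thesis by (simp add: field_simps)
qed

end

lemma op_norm_leI:
  assumes "0 \<le> C" "\<And>\<xi>. \<xi> \<in> ell2 S \<Longrightarrow> ell2_norm S (T \<xi>) \<le> C * ell2_norm S \<xi>"
  shows "op_norm S T \<le> C"
  unfolding op_norm_def
proof (rule cSUP_least)
  show "{\<xi> \<in> ell2 S. ell2_norm S \<xi> \<le> 1} \<noteq> {}" using ell2_norm_zero[of S] ell2_zero[of S] by (metis (mono_tags, lifting) empty_iff mem_Collect_eq zero_le_one)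
  fix \<xi> assume "\<xi> \<in> {\<xi> \<in> ell2 S. ell2_norm S \<xi> \<le> 1}"
  then have "ell2_norm S (T \<xi>) \<le> C * ell2_norm S \<xi>" "C * ell2_norm S \<xi> \<le> C"
    using assms(1) assms(2)[of \<xi>] mult_left_le[of "ell2_norm S \<xi>" C] by auto
  then show "ell2_norm S (T \<xi>) \<le> C" by simp
qed

lemma bounded_ops_zero: "(\<lambda>_ _. 0) \<in> bounded_ops S"
  by (rule bounded_opsI[where C=0]) auto

lemma op_norm_zero [simp]: "op_norm S (\<lambda>_ _. 0) = 0"
  using op_norm_nonneg[OF bounded_ops_zero, of S] op_norm_leI[of 0 S "\<lambda>_ _. 0"] by simp

lemma bounded_ops_add_aux:
  assumes "T \<in> bounded_ops S" "U \<in> bounded_ops S"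
  shows "T \<oplus> U \<in> bounded_ops S \<and>
    op_norm S (T \<oplus> U) \<le> op_norm S T + op_norm S U"
proof -
  have *: "ell2_norm S (\<lambda>i. T \<xi> i + U \<xi> i) \<le> (op_norm S T + op_norm S U) * ell2_norm S \<xi>"
    if "\<xi> \<in> ell2 S" for \<xi>
    using ell2_norm_triangle[OF bop_ell2'[OF assms(1)] bop_ell2'[OF assms(2)], of \<xi> \<xi>]
      op_norm_bound[OF assms(1) that] op_norm_bound[OF assms(2) that] by (simp add: distrib_right)
  show ?thesis
  proof
    show "T \<oplus> U \<in> bounded_ops S"
      by (rule bounded_opsI[OF _ _ _ *])
        (simp_all add: ell2_add bop_ell2[OF assms(1)] bop_ell2[OF assms(2)] bop_add[OF assms(1)] bop_add[OF assms(2)]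
         bop_scale[OF assms(1)] bop_scale[OF assms(2)] bop_off[OF assms(1)] bop_off[OF assms(2)] algebra_simps)
    show "op_norm S (T \<oplus> U) \<le> op_norm S T + op_norm S U"
      by (rule op_norm_leI[OF _ *]) (simp_all add: op_norm_nonneg assms)
  qed
qed

lemmas bounded_ops_add = bounded_ops_add_aux[THEN conjunct1]
  and op_norm_triangle = bounded_ops_add_aux[THEN conjunct2]

lemma bounded_ops_scale_aux:
  assumes "T \<in> bounded_ops S"
  shows "(\<lambda>\<xi> i. c * T \<xi> i) \<in> bounded_ops S \<and> op_norm S (\<lambda>\<xi> i. c * T \<xi> i) \<le> cmod c * op_norm S T"
proof -
  have *: "ell2_norm S (\<lambda>i. c * T \<xi> i) \<le> (cmod c * op_norm S T) * ell2_norm S \<xi>" if "\<xi> \<in> ell2 S" for \<xi>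
    using op_norm_bound[OF assms that] by (simp add: ell2_norm_scale mult.assoc mult_left_mono)
  show ?thesis
  proof
    show "(\<lambda>\<xi> i. c * T \<xi> i) \<in> bounded_ops S"
      by (rule bounded_opsI[OF _ _ _ *])
        (simp_all add: ell2_scale bop_ell2[OF assms] bop_add[OF assms] bop_scale[OF assms] bop_off[OF assms] algebra_simps)
    show "op_norm S (\<lambda>\<xi> i. c * T \<xi> i) \<le> cmod c * op_norm S T"
      by (rule op_norm_leI[OF _ *]) (simp_all add: op_norm_nonneg assms)
  qed
qed

lemmas bounded_ops_scale = bounded_ops_scale_aux[THEN conjunct1]

lemma op_norm_scale:
  assumes "T \<in> bounded_ops S"
  shows "op_norm S (\<lambda>\<xi> i. c * T \<xi> i) = cmod c * op_norm S T"
proof (cases "c = 0")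
  case False
  have "op_norm S (\<lambda>\<xi> i. inverse c * (c * T \<xi> i)) \<le> cmod (inverse c) * op_norm S (\<lambda>\<xi> i. c * T \<xi> i)"
    using bounded_ops_scale_aux[OF bounded_ops_scale[OF assms, of c], of "inverse c"] by blast
  moreover have "(\<lambda>\<xi> i. inverse c * (c * T \<xi> i)) = T" using False by (auto simp: fun_eq_iff)
  ultimately have "cmod c * op_norm S T \<le> op_norm S (\<lambda>\<xi> i. c * T \<xi> i)"
    using False by (simp add: norm_inverse norm_divide field_simps)
  with bounded_ops_scale_aux[OF assms, of c] show ?thesis by linarith
qed simp

lemma bounded_ops_diff:
  assumes "T \<in> bounded_ops S" "U \<in> bounded_ops S"
  shows "T \<ominus> U \<in> bounded_ops S"
  using bounded_ops_add[OF assms(1) bounded_ops_scale[OF assms(2), of "-1"]] by simp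

lemma op_norm_minus_commute:
  assumes "T \<in> bounded_ops S" "U \<in> bounded_ops S"
  shows "op_norm S (T \<ominus> U) = op_norm S (U \<ominus> T)"
  using op_norm_scale[OF bounded_ops_diff[OF assms], of "-1"] by simp

lemma op_norm_diff_triangle:
  assumes "T \<in> bounded_ops S" "U \<in> bounded_ops S" "V \<in> bounded_ops S"
  shows "op_norm S (T \<ominus> V) \<le> op_norm S (T \<ominus> U) + op_norm S (U \<ominus> V)"
  using op_norm_triangle[OF bounded_ops_diff[OF assms(1,2)] bounded_ops_diff[OF assms(2,3)]] by simp

lemma bounded_ops_compose_aux:
  assumes "T \<in> bounded_ops S" "U \<in> bounded_ops S"
  shows "T \<circ> U \<in> bounded_ops S \<and> op_norm S (T \<circ> U) \<le> op_norm S T * op_norm S U"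
proof -
  have *: "ell2_norm S ((T \<circ> U) \<xi>) \<le> (op_norm S T * op_norm S U) * ell2_norm S \<xi>" if "\<xi> \<in> ell2 S" for \<xi>
    using op_norm_bound[OF assms(1) bop_ell2[OF assms(2) that]]
      mult_left_mono[OF op_norm_bound[OF assms(2) that] op_norm_nonneg[OF assms(1)]]
    by (simp add: mult.assoc)
  show ?thesis
  proof
    show "T \<circ> U \<in> bounded_ops S"
      by (rule bounded_opsI[OF _ _ _ *])
        (simp_all add: bop_ell2[OF assms(1)] bop_ell2[OF assms(2)] bop_add[OF assms(1)] bop_add[OF assms(2)]
         bop_scale[OF assms(1)] bop_scale[OF assms(2)] bop_off[OF assms(2)] bop_zero[OF assms(1)])
    show "op_norm S (T \<circ> U) \<le> op_norm S T * op_norm S U"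
      by (rule op_norm_leI[OF _ *]) (simp_all add: op_norm_nonneg assms)
  qed
qed

lemmas bounded_ops_compose = bounded_ops_compose_aux[THEN conjunct1]
  and op_norm_compose = bounded_ops_compose_aux[THEN conjunct2]

lemma op_norm_entry_le:
  assumes "T \<in> bounded_ops S" "j \<in> S"
  shows "cmod (T (basis_vector j) i) \<le> op_norm S T"
  using order_trans[OF ell2_cmod_le_norm[OF bop_ell2'[OF assms(1)]] op_norm_bound[OF assms(1) basis_vector_ell2[OF assms(2)]]]
  by (simp add: ell2_norm_basis_vector[OF assms(2)])

text \<open>Each coordinate of the difference is a bounded functional that vanishes on basis
  vectors; off \<open>ell2 S\<close> both operators are zero by convention. Identities between
  operators thus become identities between matrix entries.\<close>

lemma bounded_ops_eqI:
  assumes "T \<in> bounded_ops S" "U \<in> bounded_ops S"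
    and "\<And>i j. i \<in> S \<Longrightarrow> j \<in> S \<Longrightarrow> T (basis_vector j) i = U (basis_vector j) i"
  shows "T = U"
proof
  fix \<xi>
  note D = bounded_ops_diff[OF assms(1,2)]
  show "T \<xi> = U \<xi>"
  proof (cases "\<xi> \<in> ell2 S")
    case True
    have "T \<xi> i - U \<xi> i = 0" if "i \<in> S" for i
      by (rule ell2_functional_zero[where \<phi> = "\<lambda>\<xi>. T \<xi> i - U \<xi> i" and S = S and
          C = "op_norm S (T \<ominus> U)"])
        (use True assms(3) that op_norm_bound[OF D] in
        \<open>auto simp: bop_add[OF assms(1)] bop_add[OF assms(2)] bop_scale[OF assms(1)] bop_scale[OF assms(2)] algebra_simps
          intro!: order_trans[OF ell2_cmod_le_norm[OF bop_ell2'[OF D]]]\<close>)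
    then show ?thesis using ell2_vanish[OF bop_ell2'[OF assms(1)]] ell2_vanish[OF bop_ell2'[OF assms(2)]]
      by (metis eq_iff_diff_eq_0 ext)
  qed (simp add: bop_off[OF assms(1)] bop_off[OF assms(2)])
qed

section \<open>Adjoints\<close>

text \<open>Instead of invoking Riesz, the adjoint is written down through its matrix and bounded by
  duality: pairing a finite section of \<open>T' \<eta>\<close> with itself gives
  \<open>ell2_inner S \<eta> (T \<zeta>)\<close> for a finitely supported \<open>\<zeta>\<close> of
  no larger norm, and one factor cancels.\<close>

lemma op_adjoint_exists:
  assumes T: "T \<in> bounded_ops S"
  shows "\<exists>T' \<in> bounded_ops S. \<forall>\<xi> \<in> ell2 S. \<forall>\<eta> \<in> ell2 S. ell2_inner S (T \<xi>) \<eta> = ell2_inner S \<xi> (T' \<eta>)"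
proof -
  define T' where "T' \<eta> i = (if \<eta> \<in> ell2 S \<and> i \<in> S then ell2_inner S \<eta> (T (basis_vector i)) else 0)" for \<eta> i
  have b: "T' \<eta> \<in> ell2 S \<and> ell2_norm S (T' \<eta>) \<le> op_norm S T * ell2_norm S \<eta>" if \<eta>: "\<eta> \<in> ell2 S" for \<eta>
  proof -
    have "L2_set (\<lambda>i. cmod (T' \<eta> i)) F \<le> op_norm S T * ell2_norm S \<eta>" if F: "finite F" "F \<subseteq> S" for F
    proof -
      define \<zeta> where "\<zeta> = (\<lambda>i. \<Sum>j\<in>F. T' \<eta> j * basis_vector j i)"
      have \<zeta>r: "\<zeta> = restrict_fun F (T' \<eta>)" using F by (simp add: \<zeta>_def restrict_fun_finite_eq_sum)
      have \<zeta>2: "\<zeta> \<in> ell2 S" unfolding \<zeta>_def using F by (auto intro!: ell2_sum ell2_scale basis_vector_ell2)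
      let ?L = "L2_set (\<lambda>i. cmod (T' \<eta> i)) F"
      have "ell2_norm S \<zeta> \<le> ?L"
      proof (rule ell2_boundedI)
        show "\<zeta> i = 0" if "i \<notin> S" for i using \<zeta>2 that by (rule ell2_vanish)
        fix F' assume F': "finite F'" "F' \<subseteq> S"
        have "(\<Sum>i\<in>F'. (cmod (\<zeta> i))\<^sup>2) \<le> (\<Sum>i\<in>F' \<union> F. (cmod (\<zeta> i))\<^sup>2)"
          by (rule sum_mono2) (use F F' in auto)
        also have "\<dots> = (\<Sum>i\<in>F. (cmod (T' \<eta> i))\<^sup>2)"
          by (rule sum.mono_neutral_cong_right) (use F F' in \<open>auto simp: \<zeta>r restrict_fun_def\<close>)
        finally show "L2_set (\<lambda>i. cmod (\<zeta> i)) F' \<le> ?L" by (simp add: L2_set_def)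
      qed
      have "?L\<^sup>2 = cmod (of_real (\<Sum>i\<in>F. (cmod (T' \<eta> i))\<^sup>2))"
        by (simp only: norm_of_real) (simp add: L2_set_def sum_nonneg)
      also have "complex_of_real (\<Sum>i\<in>F. (cmod (T' \<eta> i))\<^sup>2) = (\<Sum>i\<in>F. complex_of_real ((cmod (T' \<eta> i))\<^sup>2))"
        by (rule of_real_sum)
      also have "(\<Sum>i\<in>F. complex_of_real ((cmod (T' \<eta> i))\<^sup>2)) = (\<Sum>i\<in>F. cnj (T' \<eta> i) * ell2_inner S \<eta> (T (basis_vector i)))"
        by (rule sum.cong[OF refl], subst complex_norm_square) (use F \<eta> in \<open>auto simp: T'_def\<close>)
      also have "\<dots> = ell2_inner S \<eta> (\<lambda>i. \<Sum>j\<in>F. T' \<eta> j * T (basis_vector j) i)"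
        by (subst ell2_inner_sum_right) (auto simp: ell2_inner_scale_right \<eta> intro!: ell2_scale bop_ell2'[OF T])
      also have "(\<lambda>i. \<Sum>j\<in>F. T' \<eta> j * T (basis_vector j) i) = T \<zeta>"
        unfolding \<zeta>_def by (subst bop_sum[OF T])
          (use F in \<open>auto simp: bop_scale[OF T] basis_vector_ell2 subsetD intro!: ell2_scale basis_vector_ell2\<close>)
      also have "cmod (ell2_inner S \<eta> (T \<zeta>)) \<le> ell2_norm S \<eta> * ell2_norm S (T \<zeta>)"
        by (rule ell2_Cauchy_Schwarz) (simp_all add: \<eta> bop_ell2'[OF T])
      also have "\<dots> \<le> ell2_norm S \<eta> * (op_norm S T * ?L)"
        using op_norm_bound[OF T \<zeta>2] \<open>ell2_norm S \<zeta> \<le> ?L\<close>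
        by (intro mult_left_mono) (auto intro: order_trans mult_left_mono op_norm_nonneg[OF T])
      finally have "?L * ?L \<le> (op_norm S T * ell2_norm S \<eta>) * ?L" by (simp add: power2_eq_square mult_ac)
      moreover have "0 \<le> ?L" by simp
      ultimately show ?thesis
        using op_norm_nonneg[OF T] by (cases "?L = 0") (auto simp: mult_le_cancel_right)
    qed
    then show ?thesis by (intro conjI ell2_boundedI) (auto simp: T'_def)
  qed
  have add: "T' (\<lambda>i. \<xi> i + \<eta> i) = (\<lambda>i. T' \<xi> i + T' \<eta> i)" if "\<xi> \<in> ell2 S" "\<eta> \<in> ell2 S" for \<xi> \<eta>
    using that by (auto simp: T'_def ell2_add ell2_inner_add_left bop_ell2'[OF T])
  have B: "T' \<in> bounded_ops S"
    by (rule bounded_opsI[where C = "op_norm S T"])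
      (use b add in \<open>auto simp: T'_def ell2_scale ell2_inner_scale_left\<close>)
  have "ell2_inner S (T \<xi>) \<eta> = ell2_inner S \<xi> (T' \<eta>)" if "\<xi> \<in> ell2 S" "\<eta> \<in> ell2 S" for \<xi> \<eta>
  proof -
    \<comment> \<open>Both terms are linear and bounded in \<open>\<xi>\<close>, so basis vectors
      suffice.\<close>
    have "ell2_inner S (T \<xi>) \<eta> - ell2_inner S \<xi> (T' \<eta>) = 0"
    proof (rule ell2_functional_zero[where S = S and C = "op_norm S T * ell2_norm S \<eta> + ell2_norm S (T' \<eta>)"
          and \<phi> = "\<lambda>\<xi>. ell2_inner S (T \<xi>) \<eta> - ell2_inner S \<xi> (T' \<eta>)"])
      fix \<xi> assume \<xi>: "\<xi> \<in> ell2 S"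
      have "cmod (ell2_inner S (T \<xi>) \<eta> - ell2_inner S \<xi> (T' \<eta>)) \<le>
         ell2_norm S (T \<xi>) * ell2_norm S \<eta> + ell2_norm S \<xi> * ell2_norm S (T' \<eta>)"
        by (rule order_trans[OF norm_triangle_ineq4])
          (intro add_mono ell2_Cauchy_Schwarz bop_ell2[OF T] bop_ell2[OF B] \<xi> that)
      also have "ell2_norm S (T \<xi>) * ell2_norm S \<eta> \<le> (op_norm S T * ell2_norm S \<xi>) * ell2_norm S \<eta>"
        by (intro mult_right_mono op_norm_bound[OF T] \<xi>) auto
      finally show "cmod (ell2_inner S (T \<xi>) \<eta> - ell2_inner S \<xi> (T' \<eta>)) \<le>
         (op_norm S T * ell2_norm S \<eta> + ell2_norm S (T' \<eta>)) * ell2_norm S \<xi>"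
        by (simp add: algebra_simps)
    next
      fix i assume "i \<in> S"
      then show "ell2_inner S (T (basis_vector i)) \<eta> - ell2_inner S (basis_vector i) (T' \<eta>) = 0"
        using that by (simp add: ell2_inner_basis_left T'_def flip: ell2_inner_commute)
    qed (use that in \<open>auto simp: bop_add[OF T] bop_scale[OF T] ell2_inner_add_left ell2_inner_scale_left
          bop_ell2'[OF T] bop_ell2'[OF B] algebra_simps\<close>)
    then show ?thesis by simp
  qed
  with B show ?thesis by blast
qed

lemma op_adjoint_eqI:
  assumes "T' \<in> bounded_ops S"
    and "\<And>\<xi> \<eta>. \<xi> \<in> ell2 S \<Longrightarrow> \<eta> \<in> ell2 S \<Longrightarrow> ell2_inner S (T \<xi>) \<eta> = ell2_inner S \<xi> (T' \<eta>)"
  shows "op_adjoint S T = T'"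
  unfolding op_adjoint_def
proof (rule the_equality)
  fix U assume U: "U \<in> bounded_ops S \<and> (\<forall>\<xi> \<in> ell2 S. \<forall>\<eta> \<in> ell2 S. ell2_inner S (T \<xi>) \<eta> = ell2_inner S \<xi> (U \<eta>))"
  show "U = T'"
  proof (rule bounded_ops_eqI)
    fix i j assume ij: "i \<in> S" "j \<in> S"
    then have "ell2_inner S (basis_vector i) (U (basis_vector j)) = ell2_inner S (basis_vector i) (T' (basis_vector j))"
      using U assms(2) by (metis basis_vector_ell2)
    then show "U (basis_vector j) i = T' (basis_vector j) i" using ij by (simp add: ell2_inner_basis_left)
  qed (use U assms in auto)
qed (use assms in auto)

lemma
  assumes "T \<in> bounded_ops S"
  shows op_adjoint_bounded: "op_adjoint S T \<in> bounded_ops S"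
    and op_adjoint_inner: "\<xi> \<in> ell2 S \<Longrightarrow> \<eta> \<in> ell2 S \<Longrightarrow> ell2_inner S (T \<xi>) \<eta> = ell2_inner S \<xi> (op_adjoint S T \<eta>)"
proof -
  obtain T' where T': "T' \<in> bounded_ops S" "\<forall>\<xi> \<in> ell2 S. \<forall>\<eta> \<in> ell2 S. ell2_inner S (T \<xi>) \<eta> = ell2_inner S \<xi> (T' \<eta>)"
    using op_adjoint_exists[OF assms] by blast
  then have "op_adjoint S T = T'" by (intro op_adjoint_eqI) auto
  with T' show "op_adjoint S T \<in> bounded_ops S"
    "\<xi> \<in> ell2 S \<Longrightarrow> \<eta> \<in> ell2 S \<Longrightarrow> ell2_inner S (T \<xi>) \<eta> = ell2_inner S \<xi> (op_adjoint S T \<eta>)" by auto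
qed

lemma op_adjoint_inner':
  assumes "T \<in> bounded_ops S" "\<xi> \<in> ell2 S" "\<eta> \<in> ell2 S"
  shows "ell2_inner S (op_adjoint S T \<xi>) \<eta> = ell2_inner S \<xi> (T \<eta>)"
  using op_adjoint_inner[OF assms(1,3,2)] ell2_inner_commute by metis

lemma op_adjoint_involutive: "T \<in> bounded_ops S \<Longrightarrow> op_adjoint S (op_adjoint S T) = T"
  by (rule op_adjoint_eqI) (auto simp: op_adjoint_inner')

lemma op_adjoint_entry:
  assumes "T \<in> bounded_ops S" "i \<in> S" "j \<in> S"
  shows "op_adjoint S T (basis_vector j) i = cnj (T (basis_vector i) j)"
  using op_adjoint_inner[OF assms(1) basis_vector_ell2[OF assms(2)] basis_vector_ell2[OF assms(3)]]
  by (simp add: assms ell2_inner_basis_left ell2_inner_basis_right)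

lemma ell2_norm_sq_op:
  assumes "T \<in> bounded_ops S" "\<xi> \<in> ell2 S"
  shows "ell2_inner S (op_adjoint S T (T \<xi>)) \<xi> = of_real ((ell2_norm S (T \<xi>))\<^sup>2)"
  using assms by (simp add: op_adjoint_inner' bop_ell2 ell2_inner_self)

lemma op_norm_adjoint_le:
  assumes "T \<in> bounded_ops S" shows "op_norm S T \<le> op_norm S (op_adjoint S T)"
proof (rule op_norm_leI)
  note A = op_adjoint_bounded[OF assms]
  show "0 \<le> op_norm S (op_adjoint S T)" by (rule op_norm_nonneg[OF A])
  fix \<xi> assume \<xi>: "\<xi> \<in> ell2 S"
  have "(ell2_norm S (T \<xi>))\<^sup>2 = cmod (ell2_inner S (op_adjoint S T (T \<xi>)) \<xi>)"
    using ell2_norm_sq_op[OF assms \<xi>] by (simp only: o_def norm_of_real) simp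
  also have "\<dots> \<le> ell2_norm S (op_adjoint S T (T \<xi>)) * ell2_norm S \<xi>"
    by (rule ell2_Cauchy_Schwarz) (simp_all add: \<xi> bop_ell2'[OF A])
  also have "\<dots> \<le> (op_norm S (op_adjoint S T) * ell2_norm S (T \<xi>)) * ell2_norm S \<xi>"
    by (intro mult_right_mono op_norm_bound[OF A] bop_ell2[OF assms] \<xi>) auto
  finally have "ell2_norm S (T \<xi>) * ell2_norm S (T \<xi>) \<le> (op_norm S (op_adjoint S T) * ell2_norm S \<xi>) * ell2_norm S (T \<xi>)"
    by (simp add: power2_eq_square mult_ac)
  then show "ell2_norm S (T \<xi>) \<le> op_norm S (op_adjoint S T) * ell2_norm S \<xi>"
    using op_norm_nonneg[OF A] ell2_norm_nonneg[of S "T \<xi>"]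
    by (cases "ell2_norm S (T \<xi>) = 0") (auto simp: mult_le_cancel_right)
qed

lemma op_norm_adjoint: "T \<in> bounded_ops S \<Longrightarrow> op_norm S (op_adjoint S T) = op_norm S T"
  using op_norm_adjoint_le[of T S] op_norm_adjoint_le[OF op_adjoint_bounded, of T S] op_adjoint_involutive[of T S] by simp

text \<open>The C*-identity. The squared norm of \<open>T \<xi>\<close> is a diagonal coefficient of
  the product, hence bounded by the norm of that product.\<close>

lemma op_norm_Cstar:
  assumes "T \<in> bounded_ops S" shows "op_norm S (op_adjoint S T \<circ> T) = (op_norm S T)\<^sup>2"
proof (rule antisym)
  note A = op_adjoint_bounded[OF assms]
  show "op_norm S (op_adjoint S T \<circ> T) \<le> (op_norm S T)\<^sup>2"
    using op_norm_compose[OF A assms] op_norm_adjoint[OF assms] by (simp add: power2_eq_square)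
  have "op_norm S T \<le> sqrt (op_norm S (op_adjoint S T \<circ> T))"
  proof (rule op_norm_leI)
    note C = bounded_ops_compose[OF A assms]
    show "0 \<le> sqrt (op_norm S (op_adjoint S T \<circ> T))" using op_norm_nonneg[OF C] by simp
    fix \<xi> assume \<xi>: "\<xi> \<in> ell2 S"
    have "(ell2_norm S (T \<xi>))\<^sup>2 = cmod (ell2_inner S ((op_adjoint S T \<circ> T) \<xi>) \<xi>)"
      using ell2_norm_sq_op[OF assms \<xi>] by (simp only: o_def norm_of_real) simp
    also have "\<dots> \<le> ell2_norm S ((op_adjoint S T \<circ> T) \<xi>) * ell2_norm S \<xi>"
      by (rule ell2_Cauchy_Schwarz[OF bop_ell2'[OF C] \<xi>])
    also have "\<dots> \<le> (op_norm S (op_adjoint S T \<circ> T) * ell2_norm S \<xi>) * ell2_norm S \<xi>"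
      by (intro mult_right_mono op_norm_bound[OF C \<xi>]) auto
    also have "\<dots> = (sqrt (op_norm S (op_adjoint S T \<circ> T)) * ell2_norm S \<xi>)\<^sup>2"
      using op_norm_nonneg[OF C] by (simp add: power_mult_distrib) (simp add: power2_eq_square)
    finally show "ell2_norm S (T \<xi>) \<le> sqrt (op_norm S (op_adjoint S T \<circ> T)) * ell2_norm S \<xi>"
      by (rule power2_le_imp_le) (simp add: op_norm_nonneg[OF C])
  qed
  then show "(op_norm S T)\<^sup>2 \<le> op_norm S (op_adjoint S T \<circ> T)"
    using op_norm_nonneg[OF assms] op_norm_nonneg[OF bounded_ops_compose[OF A assms]]
    by (metis power2_eq_square real_sqrt_pow2 power_mono)
qed

section \<open>Completeness\<close>

text \<open>Coordinates converge because they are Cauchy sequences of complex numbers. The uniform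
  estimate survives the limit since it is tested on finite sets of coordinates, where the limit in
  \<open>m\<close> may be taken termwise.\<close>

lemma bounded_ops_complete:
  assumes T: "\<And>n. T n \<in> bounded_ops S"
    and cau: "\<And>e. 0 < e \<Longrightarrow> \<exists>N. \<forall>m \<ge> N. \<forall>n \<ge> N. op_norm S (T m \<ominus> T n) < e"
  shows "\<exists>U \<in> bounded_ops S. (\<lambda>n. op_norm S (T n \<ominus> U)) \<longlonglongrightarrow> 0"
proof -
  note D = bounded_ops_diff[OF T T]
  have pt: "\<exists>l. (\<lambda>n. T n \<xi> i) \<longlonglongrightarrow> l" if \<xi>: "\<xi> \<in> ell2 S" for \<xi> i
  proof -
    have "Cauchy (\<lambda>n. T n \<xi> i)"
    proof (rule metric_CauchyI)
      fix e :: real assume e: "0 < e"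
      \<comment> \<open>Adding 1 avoids a division by a vanishing norm.\<close>
      let ?e = "e / (ell2_norm S \<xi> + 1)"
      have e0: "0 < ?e" using e by (simp add: add_nonneg_pos)
      then obtain N where N: "\<forall>m \<ge> N. \<forall>n \<ge> N. op_norm S (T m \<ominus> T n) < ?e" using cau by blast
      have "dist (T m \<xi> i) (T n \<xi> i) < e" if "m \<ge> N" "n \<ge> N" for m n
      proof -
        have "dist (T m \<xi> i) (T n \<xi> i) \<le> op_norm S (T m \<ominus> T n) * ell2_norm S \<xi>"
          using order_trans[OF ell2_cmod_le_norm[OF bop_ell2'[OF D]] op_norm_bound[OF D \<xi>]] by (simp add: dist_norm)
        also have "\<dots> \<le> ?e * ell2_norm S \<xi>" using N that by (intro mult_right_mono) (auto intro: less_imp_le)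
        also have "\<dots> < e" 
        proof -
          have "ell2_norm S \<xi> + 1 \<noteq> 0" using ell2_norm_nonneg[of S \<xi>] by linarith
          then have "?e * ell2_norm S \<xi> + ?e = e" by (metis distrib_left mult.right_neutral nonzero_eq_divide_eq)
          with e0 show ?thesis by linarith
        qed
        finally show ?thesis .
      qed
      then show "\<exists>M. \<forall>m\<ge>M. \<forall>n\<ge>M. dist (T m \<xi> i) (T n \<xi> i) < e" by blast
    qed
    then show ?thesis using convergent_eq_Cauchy by blast
  qed
  define U where "U \<xi> i = (if \<xi> \<in> ell2 S then lim (\<lambda>n. T n \<xi> i) else 0)" for \<xi> i
  have U: "(\<lambda>n. T n \<xi> i) \<longlonglongrightarrow> U \<xi> i" if "\<xi> \<in> ell2 S" for \<xi> i
    using pt[OF that] that by (simp add: U_def convergent_def flip: convergent_LIMSEQ_iff)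
  have est: "(\<lambda>i. T n \<xi> i - U \<xi> i) \<in> ell2 S \<and> ell2_norm S (\<lambda>i. T n \<xi> i - U \<xi> i) \<le> e * ell2_norm S \<xi>"
    if N: "\<forall>m \<ge> N. \<forall>n \<ge> N. op_norm S (T m \<ominus> T n) < e" and n: "n \<ge> N" and \<xi>: "\<xi> \<in> ell2 S" for N e n \<xi>
  proof -
    have *: "L2_set (\<lambda>i. cmod (T n \<xi> i - U \<xi> i)) F \<le> e * ell2_norm S \<xi>" if F: "finite F" "F \<subseteq> S" for F
    proof (rule LIMSEQ_le_const2)
      show "(\<lambda>m. L2_set (\<lambda>i. cmod (T n \<xi> i - T m \<xi> i)) F) \<longlonglongrightarrow> L2_set (\<lambda>i. cmod (T n \<xi> i - U \<xi> i)) F"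
        unfolding L2_set_def by (intro tendsto_intros U \<xi>)
      have "L2_set (\<lambda>i. cmod (T n \<xi> i - T m \<xi> i)) F \<le> e * ell2_norm S \<xi>" if "m \<ge> N" for m
      proof -
        have "L2_set (\<lambda>i. cmod (T n \<xi> i - T m \<xi> i)) F \<le> ell2_norm S (\<lambda>i. T n \<xi> i - T m \<xi> i)"
          by (rule L2_set_le_ell2_norm[OF bop_ell2'[OF D] F])
        also have "\<dots> \<le> op_norm S (T n \<ominus> T m) * ell2_norm S \<xi>" by (rule op_norm_bound[OF D \<xi>])
        also have "\<dots> \<le> e * ell2_norm S \<xi>" using N n that by (intro mult_right_mono) (auto intro: less_imp_le)
        finally show ?thesis .
      qed
      then show "\<exists>N. \<forall>m\<ge>N. L2_set (\<lambda>i. cmod (T n \<xi> i - T m \<xi> i)) F \<le> e * ell2_norm S \<xi>" by blast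
    qed
    have "U \<xi> i = 0" if "i \<notin> S" for i
      using U[OF \<xi>, of i] ell2_vanish[OF bop_ell2'[OF T] that] by (simp add: LIMSEQ_const_iff)
    then show ?thesis using * ell2_vanish[OF bop_ell2'[OF T]] by (intro conjI ell2_boundedI) auto
  qed
  obtain N where N: "\<forall>m \<ge> N. \<forall>n \<ge> N. op_norm S (T m \<ominus> T n) < 1" using cau[of 1] by auto
  have UB: "U \<xi> \<in> ell2 S \<and> ell2_norm S (U \<xi>) \<le> (op_norm S (T N) + 1) * ell2_norm S \<xi>" if \<xi>: "\<xi> \<in> ell2 S" for \<xi>
  proof -
    have e: "(\<lambda>i. T N \<xi> i - U \<xi> i) \<in> ell2 S" "ell2_norm S (\<lambda>i. T N \<xi> i - U \<xi> i) \<le> 1 * ell2_norm S \<xi>"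
      using est[OF N _ \<xi>, of N] by auto
    have "U \<xi> = (\<lambda>i. T N \<xi> i - (T N \<xi> i - U \<xi> i))" by simp
    then show ?thesis
      using ell2_diff[OF bop_ell2'[OF T] e(1), of N \<xi>] ell2_norm_diff_triangle[OF bop_ell2'[OF T] e(1), of N \<xi>] e(2)
        op_norm_bound[OF T \<xi>, of N] by (simp add: algebra_simps)
  qed
  have Uadd: "U (\<lambda>i. \<xi> i + \<eta> i) = (\<lambda>i. U \<xi> i + U \<eta> i)" if "\<xi> \<in> ell2 S" "\<eta> \<in> ell2 S" for \<xi> \<eta>
  proof
    fix i
    have "(\<lambda>n. T n \<xi> i + T n \<eta> i) \<longlonglongrightarrow> U \<xi> i + U \<eta> i" by (intro tendsto_intros U that)
    moreover have "(\<lambda>n. T n \<xi> i + T n \<eta> i) \<longlonglongrightarrow> U (\<lambda>i. \<xi> i + \<eta> i) i"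
      using U[OF ell2_add[OF that], of i] by (simp add: bop_add[OF T] that)
    ultimately show "U (\<lambda>i. \<xi> i + \<eta> i) i = U \<xi> i + U \<eta> i" using LIMSEQ_unique by blast
  qed
  have Uscale: "U (\<lambda>i. c * \<xi> i) = (\<lambda>i. c * U \<xi> i)" if "\<xi> \<in> ell2 S" for c \<xi>
  proof
    fix i
    have "(\<lambda>n. c * T n \<xi> i) \<longlonglongrightarrow> c * U \<xi> i" by (intro tendsto_intros U that)
    moreover have "(\<lambda>n. c * T n \<xi> i) \<longlonglongrightarrow> U (\<lambda>i. c * \<xi> i) i"
      using U[OF ell2_scale[OF that], of c i] by (simp add: bop_scale[OF T] that)
    ultimately show "U (\<lambda>i. c * \<xi> i) i = c * U \<xi> i" using LIMSEQ_unique by blast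
  qed
  have UU: "U \<in> bounded_ops S"
    by (rule bounded_opsI[where C = "op_norm S (T N) + 1"]) (use UB Uadd Uscale in \<open>auto simp: U_def\<close>)
  have "(\<lambda>n. op_norm S (T n \<ominus> U)) \<longlonglongrightarrow> 0"
  proof (rule LIMSEQ_I)
    fix e :: real assume e: "0 < e"
    obtain N where N: "\<forall>m \<ge> N. \<forall>n \<ge> N. op_norm S (T m \<ominus> T n) < e/2" using cau[of "e/2"] e by auto
    have "norm (op_norm S (T n \<ominus> U) - 0) < e" if "n \<ge> N" for n
    proof -
      have "op_norm S (T n \<ominus> U) \<le> e/2"
        by (rule op_norm_leI) (use e est[OF N that] in auto)
      then show ?thesis using op_norm_nonneg[OF bounded_ops_diff[OF T UU], of n] e by simp
    qed
    then show "\<exists>no. \<forall>n\<ge>no. norm (op_norm S (T n \<ominus> U) - 0) < e" by blast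
  qed
  with UU show ?thesis by blast
qed

section \<open>Convergence in operator norm\<close>

definition op_conv :: "'i set \<Rightarrow> (nat \<Rightarrow> 'i operator) \<Rightarrow> 'i operator \<Rightarrow> bool" where
  "op_conv S T U \<longleftrightarrow> (\<lambda>n. op_norm S (T n \<ominus> U)) \<longlonglongrightarrow> 0"

lemma op_norm_diff_le:
  assumes "T \<in> bounded_ops S" "U \<in> bounded_ops S"
  shows "\<bar>op_norm S T - op_norm S U\<bar> \<le> op_norm S (T \<ominus> U)"
  using op_norm_triangle[OF bounded_ops_diff[OF assms] assms(2)]
    op_norm_triangle[OF bounded_ops_diff[OF assms(2,1)] assms(1)] op_norm_minus_commute[OF assms] by simp

lemma op_norm_eq_0:
  assumes "T \<in> bounded_ops S" "op_norm S T = 0"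
  shows "T = (\<lambda>_ _. 0)"
proof (rule bounded_ops_eqI[OF assms(1) bounded_ops_zero])
  fix i j assume "j \<in> S"
  then show "T (basis_vector j) i = 0" using op_norm_entry_le[OF assms(1), of j i] assms(2) by simp
qed

lemma op_conv_norm:
  assumes "\<And>n. T n \<in> bounded_ops S" "U \<in> bounded_ops S" "op_conv S T U"
  shows "(\<lambda>n. op_norm S (T n)) \<longlonglongrightarrow> op_norm S U"
proof -
  have "(\<lambda>n. op_norm S (T n) - op_norm S U) \<longlonglongrightarrow> 0"
    by (rule Lim_null_comparison[OF always_eventually assms(3)[unfolded op_conv_def]])
      (simp add: op_norm_diff_le assms)
  then show ?thesis by (simp add: LIM_zero_iff)
qed

lemma op_conv_const: "op_conv S (\<lambda>_. U) U"
  by (simp add: op_conv_def)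

lemma op_conv_unique:
  assumes T: "\<And>n. T n \<in> bounded_ops S" and U: "U \<in> bounded_ops S" "op_conv S T U" and V: "V \<in> bounded_ops S" "op_conv S T V"
  shows "U = V"
proof -
  have "(\<lambda>n. op_norm S (T n \<ominus> U) + op_norm S (T n \<ominus> V)) \<longlonglongrightarrow> 0"
    using tendsto_add[OF U(2)[unfolded op_conv_def] V(2)[unfolded op_conv_def]] by simp
  moreover have "op_norm S (U \<ominus> V) \<le> op_norm S (T n \<ominus> U) + op_norm S (T n \<ominus> V)" for n
    using op_norm_diff_triangle[OF U(1) T V(1), of n] op_norm_minus_commute[OF U(1) T, of n] by simp
  ultimately have "op_norm S (U \<ominus> V) \<le> 0"
    by (meson LIMSEQ_le_const)
  then have "op_norm S (U \<ominus> V) = 0" using op_norm_nonneg[OF bounded_ops_diff[OF U(1) V(1)]] by linarith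
  from op_norm_eq_0[OF bounded_ops_diff[OF U(1) V(1)] this] show ?thesis
    by (simp add: fun_eq_iff)
qed

lemma op_conv_add:
  assumes T: "\<And>n. T n \<in> bounded_ops S" "U \<in> bounded_ops S" "op_conv S T U"
    and T': "\<And>n. T' n \<in> bounded_ops S" "U' \<in> bounded_ops S" "op_conv S T' U'"
  shows "op_conv S (\<lambda>n \<xi> i. T n \<xi> i + T' n \<xi> i) (U \<oplus> U')"
  unfolding op_conv_def
proof (rule Lim_null_comparison[OF always_eventually tendsto_add_zero[OF T(3)[unfolded op_conv_def] T'(3)[unfolded op_conv_def]]], rule allI)
  fix n
  have "(\<lambda>\<xi> i. T n \<xi> i + T' n \<xi> i - (U \<xi> i + U' \<xi> i)) = (\<lambda>\<xi> i. (T n \<xi> i - U \<xi> i) + (T' n \<xi> i - U' \<xi> i))"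
    by (auto simp: algebra_simps)
  then show "norm (op_norm S (\<lambda>\<xi> i. T n \<xi> i + T' n \<xi> i - (U \<xi> i + U' \<xi> i)))
     \<le> op_norm S (T n \<ominus> U) + op_norm S (T' n \<ominus> U')"
    using op_norm_triangle[OF bounded_ops_diff[OF T(1,2)] bounded_ops_diff[OF T'(1,2)], of n n]
      op_norm_nonneg[OF bounded_ops_add[OF bounded_ops_diff[OF T(1,2)] bounded_ops_diff[OF T'(1,2)]], of n n] by simp
qed

lemma op_conv_scale:
  assumes T: "\<And>n. T n \<in> bounded_ops S" "U \<in> bounded_ops S" "op_conv S T U"
  shows "op_conv S (\<lambda>n \<xi> i. c * T n \<xi> i) (\<lambda>\<xi> i. c * U \<xi> i)"
proof -
  have "(\<lambda>\<xi> i. c * T n \<xi> i - c * U \<xi> i) = (\<lambda>\<xi> i. c * (T n \<xi> i - U \<xi> i))" for n by (auto simp: algebra_simps)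
  then show ?thesis
    using tendsto_mult_right_zero[OF T(3)[unfolded op_conv_def], of "cmod c"]
    by (simp add: op_conv_def op_norm_scale[OF bounded_ops_diff[OF T(1,2)]])
qed

lemma op_norm_compose_diff:
  assumes T: "T \<in> bounded_ops S" and U: "U \<in> bounded_ops S"
    and T': "T' \<in> bounded_ops S" and U': "U' \<in> bounded_ops S"
  shows "op_norm S ((T \<circ> T') \<ominus> (U \<circ> U')) \<le>
    op_norm S T * op_norm S (T' \<ominus> U') + op_norm S (T \<ominus> U) * op_norm S U'"
proof -
  let ?D = "\<lambda>\<xi> i. T \<xi> i - U \<xi> i" and ?D' = "\<lambda>\<xi> i. T' \<xi> i - U' \<xi> i"
  note D = bounded_ops_diff[OF T U] bounded_ops_diff[OF T' U']
  have "((T \<circ> T') \<ominus> (U \<circ> U')) = ((T \<circ> ?D') \<oplus> (?D \<circ> U'))"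
    by (auto simp: fun_eq_iff bop_diff[OF T bop_ell2'[OF T'] bop_ell2'[OF U']])
  then have "op_norm S ((T \<circ> T') \<ominus> (U \<circ> U')) \<le> op_norm S (T \<circ> ?D') + op_norm S (?D \<circ> U')"
    using op_norm_triangle[OF bounded_ops_compose[OF T D(2)] bounded_ops_compose[OF D(1) U']] by (simp only:)
  also have "\<dots> \<le> op_norm S T * op_norm S ?D' + op_norm S ?D * op_norm S U'"
    by (rule add_mono[OF op_norm_compose[OF T D(2)] op_norm_compose[OF D(1) U']])
  finally show ?thesis .
qed

lemma op_conv_compose:
  assumes T: "\<And>n. T n \<in> bounded_ops S" "U \<in> bounded_ops S" "op_conv S T U"
    and T': "\<And>n. T' n \<in> bounded_ops S" "U' \<in> bounded_ops S" "op_conv S T' U'"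
  shows "op_conv S (\<lambda>n. T n \<circ> T' n) (U \<circ> U')"
  unfolding op_conv_def
proof (rule Lim_null_comparison[OF always_eventually], rule allI)
  fix n
  show "norm (op_norm S ((T n \<circ> T' n) \<ominus> (U \<circ> U'))) \<le>
    op_norm S (T n) * op_norm S (T' n \<ominus> U') + op_norm S (T n \<ominus> U) * op_norm S U'"
    using op_norm_compose_diff[OF T(1) T(2) T'(1) T'(2), of n n]
      op_norm_nonneg[OF bounded_ops_diff[OF bounded_ops_compose[OF T(1) T'(1)] bounded_ops_compose[OF T(2) T'(2)]], of n n]
    by simp
next
  show "(\<lambda>n. op_norm S (T n) * op_norm S (T' n \<ominus> U') + op_norm S (T n \<ominus> U) * op_norm S U') \<longlonglongrightarrow> 0"
    using tendsto_add[OF tendsto_mult[OF op_conv_norm[OF T] T'(3)[unfolded op_conv_def]]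
       tendsto_mult[OF T(3)[unfolded op_conv_def] tendsto_const]] by simp
qed

lemma op_adjoint_diff:
  assumes "T \<in> bounded_ops S" "U \<in> bounded_ops S"
  shows "op_adjoint S (T \<ominus> U) = (op_adjoint S T \<ominus> op_adjoint S U)"
proof -
  note A = op_adjoint_bounded[OF assms(1)] op_adjoint_bounded[OF assms(2)]
  show ?thesis
    by (rule bounded_ops_eqI[OF op_adjoint_bounded[OF bounded_ops_diff[OF assms]] bounded_ops_diff[OF A]])
      (simp add: op_adjoint_entry assms bounded_ops_diff)
qed

lemma op_conv_adjoint:
  assumes T: "\<And>n. T n \<in> bounded_ops S" "U \<in> bounded_ops S" "op_conv S T U"
  shows "op_conv S (\<lambda>n. op_adjoint S (T n)) (op_adjoint S U)"
  using T(3) unfolding op_conv_def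
  by (simp flip: op_adjoint_diff[OF T(1,2)] add: op_norm_adjoint[OF bounded_ops_diff[OF T(1,2)]])

lemma op_conv_Cauchy:
  assumes T: "\<And>n. T n \<in> bounded_ops S" "U \<in> bounded_ops S" "op_conv S T U" and e: "0 < (e::real)"
  shows "\<exists>N. \<forall>m \<ge> N. \<forall>n \<ge> N. op_norm S (T m \<ominus> T n) < e"
proof -
  have e2: "0 < e/2" using e by simp
  obtain N where N: "\<forall>n\<ge>N. norm (op_norm S (T n \<ominus> U) - 0) < e/2"
    using LIMSEQ_D[OF T(3)[unfolded op_conv_def] e2] by blast
  have N': "op_norm S (T n \<ominus> U) < e/2" if "n \<ge> N" for n
    using N that by (simp only: real_norm_def diff_zero abs_less_iff)
  have "op_norm S (T m \<ominus> T n) < e" if "m \<ge> N" "n \<ge> N" for m n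
  proof -
    have "op_norm S (T m \<ominus> T n) \<le>
        op_norm S (T m \<ominus> U) + op_norm S (T n \<ominus> U)"
      using op_norm_diff_triangle[OF T(1,2,1), of m n] unfolding op_norm_minus_commute[OF T(2,1), of n] .
    also have "\<dots> < e/2 + e/2" by (rule add_strict_mono[OF N'[OF that(1)] N'[OF that(2)]])
    finally show ?thesis by simp
  qed
  then show ?thesis by blast
qed

section \<open>Functional calculus by positivity of polynomials\<close>

section \<open>Polynomials that are nonnegative on an interval\<close>

text \<open>A complex root \<open>z\<close> is either real or occurs together with its conjugate,
  and the quadratic is the product of the two conjugate linear factors. The remainder modulo the
  quadratic is real of degree at most one, so vanishing at a nonreal \<open>z\<close> forces it to
  be zero.\<close>

lemma real_poly_factor:
  fixes p :: "real poly"
  assumes "0 < degree p"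
  shows "(\<exists>x q. p = [:-x, 1:] * q) \<or> (\<exists>a b q. p = [:a\<^sup>2 + b\<^sup>2, -2 * a, 1:] * q)"
proof -
  let ?c = "map_poly complex_of_real"
  have c_add: "?c (q + r) = ?c q + ?c r" for q r by (rule poly_eqI) (simp add: coeff_map_poly)
  have c_mult: "?c (q * r) = ?c q * ?c r" for q r
    by (rule poly_eqI) (simp add: coeff_map_poly coeff_mult)
  have "degree (?c p) = degree p" by (rule degree_map_poly) simp
  then obtain z where z: "poly (?c p) z = 0"
    using assms fundamental_theorem_of_algebra[of "?c p"] constant_degree[of "?c p"] by auto
  show ?thesis
  proof (cases "Im z = 0")
    case True
    then have "z = of_real (Re z)" by (simp add: complex_eq_iff)
    moreover have "poly (?c q) (of_real x) = of_real (poly q x)" for q x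
      by (induction q) (simp_all add: map_poly_pCons)
    ultimately have "complex_of_real (poly p (Re z)) = 0" using z by metis
    then show ?thesis by (metis dvdE of_real_eq_0_iff poly_eq_0_iff_dvd)
  next
    case False
    let ?m = "[:(Re z)\<^sup>2 + (Im z)\<^sup>2, -2 * Re z, 1:]"
    have m0: "poly (?c ?m) z = 0"
      by (simp add: map_poly_pCons complex_eq_iff power2_eq_square algebra_simps)
    have "p = ?m * (p div ?m) + p mod ?m" by (rule mult_div_mod_eq[symmetric])
    then have "?c p = ?c ?m * ?c (p div ?m) + ?c (p mod ?m)" using c_add c_mult by metis
    then have r0: "poly (?c (p mod ?m)) z = 0" using z m0 by simp
    have "degree (p mod ?m) < 2" using degree_mod_less[of ?m p] by auto
    moreover obtain a r' where r': "p mod ?m = pCons a r'" by (cases "p mod ?m") auto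
    ultimately have "degree r' = 0" by (auto split: if_splits)
    then obtain b where "r' = [:b:]" by (rule degree_eq_zeroE)
    with r' have r: "p mod ?m = [:a, b:]" by simp
    have "complex_of_real a + z * complex_of_real b = 0" using r0[unfolded r] by (simp add: map_poly_pCons)
    then have "a = 0 \<and> b = 0" using False by (auto simp: complex_eq_iff)
    then have "p = ?m * (p div ?m)" using r \<open>p = ?m * (p div ?m) + p mod ?m\<close> by simp
    then show ?thesis by blast
  qed
qed

text \<open>Continuity recovers the sign at one exceptional point, which in the application is a
  root that has just been divided out.\<close>

lemma poly_nonneg_closure:
  fixes q :: "real poly"
  assumes "0 < R" "x \<in> {0..R}" "\<And>t. t \<in> {0..R} \<Longrightarrow> t \<noteq> x \<Longrightarrow> 0 \<le> poly q t"
  shows "0 \<le> poly q x"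
proof (rule ccontr)
  assume neg: "\<not> 0 \<le> poly q x"
  have "isCont (poly q) x" by simp
  then obtain d where d: "0 < d" "\<And>t. \<bar>t - x\<bar> < d \<Longrightarrow> \<bar>poly q t - poly q x\<bar> < - poly q x"
    using iffD1[OF continuous_at_eps_delta, rule_format, of x "poly q" "- poly q x"] neg by (auto simp: dist_real_def)
  \<comment> \<open>A nearby point of the interval other than \<open>x\<close>: to the right, unless
    \<open>x\<close> is the right endpoint.\<close>
  define t where "t = (if x < R then x + min (d/2) (R - x) else x - min (d/2) x)"
  have "t \<in> {0..R}" "t \<noteq> x" "\<bar>t - x\<bar> < d" using assms(1,2) d(1) by (auto simp: t_def)
  then show False using assms(3) d(2) neg by fastforce
qed

text \<open>The theorem of Lukacs, by splitting off the roots.\<close>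

lemma nonneg_poly_induct:
  fixes Pos :: "real poly \<Rightarrow> bool"
  assumes R: "0 < R"
    and add: "\<And>p q. Pos p \<Longrightarrow> Pos q \<Longrightarrow> Pos (p + q)"
    and sq: "\<And>p q. Pos p \<Longrightarrow> Pos (q * q * p)"
    and one: "Pos 1" and X: "Pos [:0, 1:]" and RX: "Pos [:R, -1:]"
    and p: "\<And>t. t \<in> {0..R} \<Longrightarrow> 0 \<le> poly p t"
  shows "Pos p"
proof -
  let ?X = "[:0, 1:] :: real poly" and ?Y = "[:R, -1:] :: real poly"
  \<comment> \<open>The multipliers 1, X, R - X and X(R - X) are closed under products up to square
    factors, so \<open>P\<close> is stable under multiplication by X and by R - X, which
    \<open>Pos\<close> alone is not assumed to be.\<close>
  define P where "P p \<longleftrightarrow> Pos p \<and> Pos (?X * p) \<and> Pos (?Y * p) \<and> Pos (?X * ?Y * p)" for p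
  have P_add: "P (p + q)" if "P p" "P q" for p q using that add unfolding P_def distrib_left by blast
  have P_sq: "P (q * q * p)" if "P p" for p q
    using that sq[of _ q] unfolding P_def by (metis mult.left_commute)
  have P_const: "P ([:c:] * p)" if "P p" "0 \<le> c" for c p
    using P_sq[OF that(1), of "[:sqrt c:]"] that(2) by simp
  have P_X: "P (?X * p)" if "P p" for p
    using that sq[of p ?X] sq[of "?Y * p" ?X] unfolding P_def by (simp only: mult_ac)
  have P_Y: "P (?Y * p)" if "P p" for p
    using that sq[of p ?Y] sq[of "?X * p" ?Y] unfolding P_def by (simp only: mult_ac)
  have "Pos (?X * ?Y)"
  proof -
    have "Pos ([:sqrt (1/R):] * [:sqrt (1/R):] * (?X * ?X * ?Y + ?Y * ?Y * ?X))"
      by (intro sq add X RX)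
    \<comment> \<open>The sum is \<open>R\<close> times X(R - X), because X and R - X add up to
      \<open>R\<close>; so the product of the two generators already belongs to the cone.\<close>
    moreover have "[:sqrt (1/R):] * [:sqrt (1/R):] * (?X * ?X * ?Y + ?Y * ?Y * ?X) = ?X * ?Y"
      using R by (simp add: field_simps)
    ultimately show ?thesis by metis
  qed
  then have P1: "P 1" using one X RX unfolding P_def by simp
  have P0: "P [:c:]" if "0 \<le> c" for c using P_const[OF P1 that] by simp
  have "P p" using p
  proof (induction "degree p" arbitrary: p rule: less_induct)
    case less
    show ?case
    proof (cases "degree p = 0")
      case True
      then obtain c where c: "p = [:c:]" by (rule degree_eq_zeroE)
      then show ?thesis using less.prems[of 0] R P0 by simp
    next
      case False
      then consider (real) x q where "p = [:-x, 1:] * q" | (cpx) a b q where "p = [:a\<^sup>2 + b\<^sup>2, -2 * a, 1:] * q"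
        using real_poly_factor[of p] by blast
      then show ?thesis
      proof cases
        case (cpx a b q)
        show ?thesis
        \<comment> \<open>The factorisation leaves \<open>b = 0\<close> possible. The quadratic is
          then the square of a linear factor, and the sign of the cofactor at its root needs
          continuity.\<close>
        proof (cases "b = 0")
          case True
          then have pq: "p = [:-a, 1:] * [:-a, 1:] * q" using cpx by (simp add: power2_eq_square algebra_simps)
          have q0: "q \<noteq> 0" using False cpx by auto
          have "degree p = 2 + degree q" unfolding pq using q0 by (simp add: degree_mult_eq del: mult_pCons_left mult_pCons_right)
          have nn: "0 \<le> poly q t" if "t \<in> {0..R}" "t \<noteq> a" for t
          proof -
            have "0 \<le> (t - a)\<^sup>2 * poly q t" using less.prems[OF that(1)] by (simp add: pq power2_eq_square algebra_simps)
            then show ?thesis using that by (simp add: zero_le_mult_iff)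
          qed
          have "0 \<le> poly q t" if "t \<in> {0..R}" for t
            using nn that poly_nonneg_closure[OF R, of a q] by (cases "t = a") auto
          then have "P q" using less.hyps[of q] \<open>degree p = 2 + degree q\<close> by simp
          then show ?thesis unfolding pq by (rule P_sq)
        next
          case b: False
          have pq: "p = [:-a, 1:] * [:-a, 1:] * q + [:b\<^sup>2:] * q" using cpx by (simp add: power2_eq_square smult_add_left algebra_simps)
          have q0: "q \<noteq> 0" using False cpx by auto
          have "degree p = 2 + degree q" unfolding cpx using q0 by (subst degree_mult_eq) auto
          have "0 \<le> poly q t" if "t \<in> {0..R}" for t
          proof -
            have "0 \<le> ((t - a)\<^sup>2 + b\<^sup>2) * poly q t" using less.prems[OF that] by (simp add: cpx power2_eq_square algebra_simps)
            moreover have "0 < (t - a)\<^sup>2 + b\<^sup>2" using b by (simp add: add_nonneg_pos)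
            ultimately show ?thesis by (simp add: zero_le_mult_iff)
          qed
          then have "P q" using less.hyps[of q] \<open>degree p = 2 + degree q\<close> by simp
          then show ?thesis unfolding pq by (intro P_add P_sq P_const) auto
        qed
      next
        case (real x q)
        have q0: "q \<noteq> 0" using False real by auto
        have deg: "degree p = 1 + degree q" unfolding real using q0 by (subst degree_mult_eq) auto
        have pt: "0 \<le> (t - x) * poly q t" if "t \<in> {0..R}" for t using less.prems[OF that] by (simp add: real algebra_simps)
        consider "x \<le> 0" | "R \<le> x" | "0 < x" "x < R" by linarith
        then show ?thesis
        proof cases
          case 1
          have "0 \<le> poly q t" if "t \<in> {0..R}" "t \<noteq> 0" for t
            using pt[OF that(1)] that 1 by (auto simp: zero_le_mult_iff)
          then have "0 \<le> poly q t" if "t \<in> {0..R}" for t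
            using that poly_nonneg_closure[OF R, of 0 q] R by (cases "t = 0") auto
          then have "P q" using less.hyps[of q] deg by simp
          \<comment> \<open>For a root \<open>x \<le> 0\<close> the linear factor is the generator X
            plus the nonnegative constant \<open>-x\<close>.\<close>
          moreover have "p = ?X * q + [:-x:] * q" using real by (simp add: algebra_simps)
          ultimately show ?thesis using P_add[OF P_X P_const, of q q "-x"] 1 by simp
        next
          case 2
          have "0 \<le> poly (-q) t" if "t \<in> {0..R}" "t \<noteq> R" for t
            using pt[OF that(1)] that 2 by (auto simp: zero_le_mult_iff)
          then have "0 \<le> poly (-q) t" if "t \<in> {0..R}" for t
            using that poly_nonneg_closure[OF R, of R "-q"] R by (cases "t = R") auto
          then have "P (-q)" using less.hyps[of "-q"] deg by simp
          \<comment> \<open>For a root \<open>x\<close> at or beyond \<open>R\<close> the factor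
            \<open>t - x\<close> is the negative of \<open>(R - t) + (x - R)\<close>, so the sign
            goes to the cofactor.\<close>
          moreover have "p = ?Y * (-q) + [:x - R:] * (-q)" using real by (simp add: smult_diff_left algebra_simps)
          ultimately show ?thesis using P_add[OF P_Y P_const, of "-q" "-q" "x - R"] 2 by simp
        next
          case 3
          have "0 \<le> poly ([:-x, 1:] * q) t" "0 \<le> poly ([:x, -1:] * (-q)) t" if "t \<in> {0..R}" for t
            using pt[OF that] by (auto simp: algebra_simps)
          \<comment> \<open>To the right of an interior root \<open>q\<close> is nonnegative and to
            the left nonpositive, so \<open>q\<close> vanishes there too and the root of
            \<open>p\<close> is double.\<close>
          have "poly q x = 0"
          proof (rule ccontr)
            assume nz: "poly q x \<noteq> 0"
            have "isCont (poly q) x" by simp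
            then obtain d where d: "0 < d" "\<And>t. \<bar>t - x\<bar> < d \<Longrightarrow> \<bar>poly q t - poly q x\<bar> < \<bar>poly q x\<bar>"
              using iffD1[OF continuous_at_eps_delta, rule_format, of x "poly q" "\<bar>poly q x\<bar>"] nz by (auto simp: dist_real_def)
            define h where "h = min (d/2) (min x (R - x))"
            have h: "0 < h" "x + h \<in> {0..R}" "x - h \<in> {0..R}" "h < d" using 3 d(1) by (auto simp: h_def)
            have "0 \<le> poly q (x + h)" "poly q (x - h) \<le> 0"
              using pt[OF h(2)] pt[OF h(3)] h(1) by (auto simp: zero_le_mult_iff mult_le_0_iff)
            moreover have "\<bar>poly q (x + h) - poly q x\<bar> < \<bar>poly q x\<bar>" "\<bar>poly q (x - h) - poly q x\<bar> < \<bar>poly q x\<bar>"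
              using h d(2) by auto
            ultimately show False by linarith
          qed
          then obtain r where r: "q = [:-x, 1:] * r" by (metis dvdE poly_eq_0_iff_dvd)
          have pq: "p = [:-x, 1:] * [:-x, 1:] * r" using real r by (simp only: mult.assoc)
          have r0: "r \<noteq> 0" using q0 r by auto
          have "degree p = 2 + degree r" unfolding pq using r0 by (simp add: degree_mult_eq del: mult_pCons_left mult_pCons_right)
          have nn: "0 \<le> poly r t" if "t \<in> {0..R}" "t \<noteq> x" for t
          proof -
            have "0 \<le> (t - x)\<^sup>2 * poly r t" using less.prems[OF that(1)] by (simp add: pq power2_eq_square algebra_simps)
            then show ?thesis using that by (simp add: zero_le_mult_iff)
          qed
          have "0 \<le> poly r t" if "t \<in> {0..R}" for t
            using nn that poly_nonneg_closure[OF R, of x r] by (cases "t = x") auto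
          then have "P r" using less.hyps[of r] \<open>degree p = 2 + degree r\<close> by simp
          then show ?thesis unfolding pq by (rule P_sq)
        qed
      qed
    qed
  qed
  then show ?thesis by (simp add: P_def)
qed

lemma real_poly_approx:
  fixes g :: "real \<Rightarrow> real"
  assumes "continuous_on {0..R} g" "0 < e"
  shows "\<exists>p. \<forall>t \<in> {0..R}. \<bar>poly p t - g t\<bar> < e"
proof -
  obtain f where f: "real_polynomial_function f" "\<And>x. x \<in> {0..R} \<Longrightarrow> \<bar>g x - f x\<bar> < e"
    using Stone_Weierstrass_real_polynomial_function[OF compact_Icc assms] by blast
  then obtain a n where a: "f = (\<lambda>x. \<Sum>i\<le>n. a i * x^i)" by (auto simp: real_polynomial_function_iff_sum)
  have "poly (\<Sum>i\<le>n. monom (a i) i) t = f t" for t by (simp add: a poly_sum poly_monom)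
  then show ?thesis using f(2) by (metis abs_minus_commute)
qed

section \<open>Polynomials in a self-adjoint operator\<close>

text \<open>Horner evaluation of \<open>p\<close> at \<open>B\<close>. The constant coefficient
  multiplies the identity on all functions, so the result fits \<open>bounded_ops\<close> only after
  the cut-off made in \<open>bop_poly\<close>.\<close>

definition poly_op :: "'i operator \<Rightarrow> real poly \<Rightarrow> 'i operator" where
  "poly_op B p = fold_coeffs (\<lambda>a f \<xi> i. of_real a * \<xi> i + B (f \<xi>) i) p (\<lambda>\<xi> i. 0)"

locale positive_op =
  fixes S :: "'i set" and B :: "'i operator" and R :: real
  assumes B: "B \<in> bounded_ops S"
    and symm: "\<And>\<xi> \<eta>. \<xi> \<in> ell2 S \<Longrightarrow> \<eta> \<in> ell2 S \<Longrightarrow> ell2_inner S (B \<xi>) \<eta> = ell2_inner S \<xi> (B \<eta>)"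
    and pos: "\<And>\<xi>. \<xi> \<in> ell2 S \<Longrightarrow> 0 \<le> Re (ell2_inner S (B \<xi>) \<xi>)"
    and R: "0 < R" "\<And>\<xi>. \<xi> \<in> ell2 S \<Longrightarrow> Re (ell2_inner S (B \<xi>) \<xi>) \<le> R * (ell2_norm S \<xi>)\<^sup>2"
begin

lemma poly_op_0 [simp]: "poly_op B 0 = (\<lambda>\<xi> i. 0)"
  by (simp add: poly_op_def)

lemma poly_op_pCons [simp]: "poly_op B (pCons a p) = (\<lambda>\<xi> i. of_real a * \<xi> i + B (poly_op B p \<xi>) i)"
  by (cases "p = 0 \<and> a = 0") (auto simp: poly_op_def bop_zero[OF B])

lemma poly_op_ell2: "\<xi> \<in> ell2 S \<Longrightarrow> poly_op B p \<xi> \<in> ell2 S"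
  by (induction p) (auto intro!: ell2_add ell2_scale bop_ell2[OF B])

lemma poly_op_add: "\<xi> \<in> ell2 S \<Longrightarrow> poly_op B (p + q) \<xi> = (\<lambda>i. poly_op B p \<xi> i + poly_op B q \<xi> i)"
  by (induction p q rule: poly_induct2) (auto simp: bop_add[OF B] poly_op_ell2 algebra_simps)

lemma poly_op_smult: "\<xi> \<in> ell2 S \<Longrightarrow> poly_op B (smult c p) \<xi> = (\<lambda>i. of_real c * poly_op B p \<xi> i)"
  by (induction p) (auto simp: bop_scale[OF B] poly_op_ell2 algebra_simps)

lemma poly_op_linear:
  "\<xi> \<in> ell2 S \<Longrightarrow> \<eta> \<in> ell2 S \<Longrightarrow> poly_op B p (\<lambda>i. \<xi> i + \<eta> i) = (\<lambda>i. poly_op B p \<xi> i + poly_op B p \<eta> i)"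
  "\<xi> \<in> ell2 S \<Longrightarrow> poly_op B p (\<lambda>i. c * \<xi> i) = (\<lambda>i. c * poly_op B p \<xi> i)"
  by (induction p) (auto simp: bop_add[OF B] bop_scale[OF B] poly_op_ell2 algebra_simps)

lemma poly_op_commute: "\<xi> \<in> ell2 S \<Longrightarrow> poly_op B p (B \<xi>) = B (poly_op B p \<xi>)"
  by (induction p) (auto simp: bop_add[OF B] bop_scale[OF B] poly_op_ell2 bop_ell2[OF B] ell2_scale bop_zero[OF B])

lemma poly_op_mult: "\<xi> \<in> ell2 S \<Longrightarrow> poly_op B (p * q) \<xi> = poly_op B p (poly_op B q \<xi>)"
  by (induction p) (auto simp: poly_op_add poly_op_smult algebra_simps)

lemma poly_op_symm: "\<xi> \<in> ell2 S \<Longrightarrow> \<eta> \<in> ell2 S \<Longrightarrow>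
    ell2_inner S (poly_op B p \<xi>) \<eta> = ell2_inner S \<xi> (poly_op B p \<eta>)"
proof (induction p arbitrary: \<xi> \<eta>)
  case (pCons a p)
  then show ?case
    by (simp add: ell2_inner_add_left ell2_inner_add_right ell2_scale bop_ell2[OF B] poly_op_ell2
       ell2_inner_scale_left ell2_inner_scale_right symm poly_op_commute)
qed simp

text \<open>Takes the place of the spectral theorem. By \<open>nonneg_poly_induct\<close> only the
  generators have to be checked: sums are clear, and a factor \<open>q * q\<close> is distributed to
  the two sides of the inner product because \<open>poly_op B q\<close> is symmetric.\<close>

lemma poly_op_nonneg:
  assumes "\<And>t. t \<in> {0..R} \<Longrightarrow> 0 \<le> poly p t" "\<xi> \<in> ell2 S"
  shows "0 \<le> Re (ell2_inner S (poly_op B p \<xi>) \<xi>)"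
proof -
  have "\<forall>\<xi> \<in> ell2 S. 0 \<le> Re (ell2_inner S (poly_op B p \<xi>) \<xi>)"
  proof (rule nonneg_poly_induct[where Pos = "\<lambda>p. \<forall>\<xi> \<in> ell2 S. 0 \<le> Re (ell2_inner S (poly_op B p \<xi>) \<xi>)" and R = R])
    fix p q assume "\<forall>\<xi> \<in> ell2 S. 0 \<le> Re (ell2_inner S (poly_op B p \<xi>) \<xi>)"
    moreover have "ell2_inner S (poly_op B (q * q * p) \<xi>) \<xi> = ell2_inner S (poly_op B p (poly_op B q \<xi>)) (poly_op B q \<xi>)"
      if "\<xi> \<in> ell2 S" for \<xi>
    proof -
      have "q * q * p = q * (p * q)" by (simp add: mult_ac)
      show ?thesis unfolding \<open>q * q * p = q * (p * q)\<close>
        using that poly_op_symm[of "poly_op B p (poly_op B q \<xi>)" \<xi> q] by (simp add: poly_op_mult poly_op_ell2)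
    qed
    ultimately show "\<forall>\<xi> \<in> ell2 S. 0 \<le> Re (ell2_inner S (poly_op B (q * q * p) \<xi>) \<xi>)"
      by (simp add: poly_op_ell2)
  qed (use assms(1) R pos in \<open>auto simp: poly_op_add poly_op_ell2 ell2_inner_add_left one_pCons bop_zero[OF B]
        ell2_inner_self ell2_inner_diff_left bop_ell2[OF B] ell2_scale ell2_inner_scale_left bop_scale[OF B, where c = "-1", simplified]\<close>)
  then show ?thesis using assms(2) by blast
qed

text \<open>Positivity for the polynomial \<open>s\<^sup>2 - p * p\<close>, read as a comparison of
  squared norms.\<close>

lemma poly_op_bound:
  assumes "\<And>t. t \<in> {0..R} \<Longrightarrow> \<bar>poly p t\<bar> \<le> s" "\<xi> \<in> ell2 S"
  shows "ell2_norm S (poly_op B p \<xi>) \<le> s * ell2_norm S \<xi>"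
proof -
  have s: "0 \<le> s" using assms(1)[of 0] R(1) by auto
  have "0 \<le> Re (ell2_inner S (poly_op B ([:s\<^sup>2:] + smult (-1) (p * p)) \<xi>) \<xi>)"
  proof (rule poly_op_nonneg[OF _ assms(2)])
    fix t assume "t \<in> {0..R}"
    then have "(poly p t)\<^sup>2 \<le> s\<^sup>2" using assms(1)[of t] by (simp add: abs_le_square_iff[symmetric])
    then show "0 \<le> poly ([:s\<^sup>2:] + smult (-1) (p * p)) t" by (simp add: power2_eq_square)
  qed
  also have "ell2_inner S (poly_op B ([:s\<^sup>2:] + smult (-1) (p * p)) \<xi>) \<xi> =
     of_real (s\<^sup>2 * (ell2_norm S \<xi>)\<^sup>2 - (ell2_norm S (poly_op B p \<xi>))\<^sup>2)"
    using assms(2) by (subst poly_op_add) (simp_all add: poly_op_smult poly_op_mult poly_op_ell2 bop_zero[OF B] ell2_inner_diff_left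
       ell2_scale ell2_inner_scale_left poly_op_symm ell2_inner_self del: smult_minus_left)
  finally have "(ell2_norm S (poly_op B p \<xi>))\<^sup>2 \<le> (s * ell2_norm S \<xi>)\<^sup>2"
    by (simp add: power_mult_distrib)
  then show ?thesis by (rule power2_le_imp_le) (simp add: s)
qed

text \<open>The same argument for \<open>s - t * (p t)\<^sup>2\<close>. When \<open>B\<close> is the
  product of an adjoint of some operator with that operator, it bounds the operator followed after
  \<open>poly_op B p\<close> without a square root of \<open>B\<close>.\<close>

lemma poly_op_sqrt_bound:
  assumes "\<And>t. t \<in> {0..R} \<Longrightarrow> t * (poly p t)\<^sup>2 \<le> s" "\<xi> \<in> ell2 S"
  shows "Re (ell2_inner S (B (poly_op B p \<xi>)) (poly_op B p \<xi>)) \<le> s * (ell2_norm S \<xi>)\<^sup>2"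
proof -
  have "0 \<le> Re (ell2_inner S (poly_op B ([:s:] + smult (-1) (p * ([:0,1:] * p))) \<xi>) \<xi>)"
  proof (rule poly_op_nonneg[OF _ assms(2)])
    fix t assume "t \<in> {0..R}"
    then show "0 \<le> poly ([:s:] + smult (-1) (p * ([:0,1:] * p))) t" using assms(1)[of t]
      by (simp add: power2_eq_square mult_ac)
  qed
  also have "ell2_inner S (poly_op B ([:s:] + smult (-1) (p * ([:0,1:] * p))) \<xi>) \<xi> =
     of_real (s * (ell2_norm S \<xi>)\<^sup>2) - ell2_inner S (B (poly_op B p \<xi>)) (poly_op B p \<xi>)"
    using assms(2) by (subst poly_op_add) (simp_all add: poly_op_smult poly_op_mult poly_op_ell2 bop_zero[OF B] ell2_inner_diff_left
       ell2_scale ell2_inner_scale_left poly_op_symm ell2_inner_self bop_ell2[OF B] del: smult_minus_left mult_pCons_left mult_pCons_right)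
  finally show ?thesis by simp
qed

definition bop_poly :: "real poly \<Rightarrow> 'i operator" where
  "bop_poly p \<xi> = (if \<xi> \<in> ell2 S then poly_op B p \<xi> else (\<lambda>_. 0))"

lemma bop_poly_bounded: "bop_poly p \<in> bounded_ops S"
proof -
  have "compact (poly p ` {0..R})" by (intro compact_continuous_image continuous_intros compact_Icc)
  then obtain s where s: "\<And>t. t \<in> {0..R} \<Longrightarrow> \<bar>poly p t\<bar> \<le> s"
    by (meson bounded_real compact_imp_bounded image_eqI)
  show ?thesis
    by (rule bounded_opsI[where C = s])
      (auto simp: bop_poly_def poly_op_ell2 poly_op_linear ell2_add ell2_scale intro!: poly_op_bound s)
qed

lemma op_norm_bop_poly_le:
  assumes "\<And>t. t \<in> {0..R} \<Longrightarrow> \<bar>poly p t\<bar> \<le> s"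
  shows "op_norm S (bop_poly p) \<le> s"
  by (rule op_norm_leI) (use assms[of 0] R(1) in \<open>auto simp: bop_poly_def intro!: poly_op_bound assms\<close>)

lemma bop_poly_mult: "bop_poly (p * q) = bop_poly p \<circ> bop_poly q"
  by (auto simp: bop_poly_def fun_eq_iff poly_op_mult poly_op_ell2 bop_zero[OF bop_poly_bounded[unfolded bop_poly_def]])
   (metis bop_poly_bounded bop_zero bop_poly_def ell2_zero)

lemma bop_poly_diff: "bop_poly (p - q) = (bop_poly p \<ominus> bop_poly q)"
  using poly_op_add[of _ p "smult (-1) q"] poly_op_smult[of _ "-1" q]
  by (auto simp: bop_poly_def fun_eq_iff)

lemma bop_poly_X: "bop_poly [:0, 1:] = B"
  by (auto simp: bop_poly_def fun_eq_iff bop_zero[OF B] bop_off[OF B])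

lemma bop_poly_adjoint: "op_adjoint S (bop_poly p) = bop_poly p"
  by (rule op_adjoint_eqI[OF bop_poly_bounded]) (auto simp: bop_poly_def poly_op_symm)

text \<open>Polynomials that approximate the square root uniformly on \<open>{0..R}\<close> give
  operators that are Cauchy in norm. They have no constant term because the algebra in which the
  root is wanted may lack a unit.\<close>

lemma sqrt_exists:
  "\<exists>C p. C \<in> bounded_ops S \<and> op_adjoint S C = C \<and> C \<circ> C = B \<and>
     (\<forall>n. coeff (p n) 0 = 0) \<and> op_conv S (\<lambda>n. bop_poly (p n)) C"
proof -
  have "\<exists>p. coeff p 0 = 0 \<and> (\<forall>t \<in> {0..R}. \<bar>poly p t - sqrt t\<bar> < e)" if e: "0 < e" for e
  proof -
    have e2: "0 < e / 2" using e by simp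
    \<comment> \<open>Subtracting the value at 0 removes the constant term and costs a second
      \<open>e / 2\<close>, as the square root vanishes at 0.\<close>
    obtain q where q: "\<forall>t \<in> {0..R}. \<bar>poly q t - sqrt t\<bar> < e / 2"
      using real_poly_approx[OF continuous_on_real_sqrt[OF continuous_on_id] e2] by blast
    have 0: "\<bar>poly q 0\<bar> < e / 2" using bspec[OF q, of 0] R(1) by simp
    have "\<bar>poly (q - [:poly q 0:]) t - sqrt t\<bar> < e" if "t \<in> {0..R}" for t
    proof -
      have "poly (q - [:poly q 0:]) t = poly q t - poly q 0" by simp
      with bspec[OF q that] 0 show ?thesis by linarith
    qed
    then show ?thesis by (intro exI[of _ "q - [:poly q 0:]"]) (auto simp: poly_0_coeff_0)
  qed
  from this[of "inverse (real (Suc n))" for n]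
  have "\<exists>p. coeff p 0 = 0 \<and> (\<forall>t \<in> {0..R}. \<bar>poly p t - sqrt t\<bar> < inverse (Suc n))" for n by simp
  then obtain p where p: "\<And>n. coeff (p n) 0 = 0" "\<And>n t. t \<in> {0..R} \<Longrightarrow> \<bar>poly (p n) t - sqrt t\<bar> < inverse (Suc n)"
    by metis
  have pd: "op_norm S (bop_poly (p m) \<ominus> bop_poly (p n)) \<le> inverse (Suc m) + inverse (Suc n)" for m n
    unfolding bop_poly_diff[symmetric]
    by (rule op_norm_bop_poly_le) (use p(2)[of _ m] p(2)[of _ n] in fastforce)
  have "\<exists>N. \<forall>m\<ge>N. \<forall>n\<ge>N. op_norm S (bop_poly (p m) \<ominus> bop_poly (p n)) < e" if e: "0 < e" for e
  proof -
    obtain N where N: "inverse (real (Suc N)) < e/2" using reals_Archimedean[of "e/2"] e by auto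
    have h: "inverse (real (Suc m)) < e/2" if "m \<ge> N" for m
      using that by (intro le_less_trans[OF _ N]) (auto intro!: le_imp_inverse_le)
    have "op_norm S (bop_poly (p m) \<ominus> bop_poly (p n)) < e" if "m \<ge> N" "n \<ge> N" for m n
      using le_less_trans[OF pd[of m n] add_strict_mono[OF h[OF that(1)] h[OF that(2)]]]
      unfolding field_sum_of_halves .
    then show ?thesis by blast
  qed
  then obtain C where C: "C \<in> bounded_ops S" "op_conv S (\<lambda>n. bop_poly (p n)) C"
    using bounded_ops_complete[of "\<lambda>n. bop_poly (p n)" S] bop_poly_bounded unfolding op_conv_def by blast
  note pb = bop_poly_bounded
  have "op_adjoint S C = C"
    using op_conv_adjoint[OF pb C] op_conv_unique[OF pb op_adjoint_bounded[OF C(1)] _ C(1)] C(2)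
    by (simp add: bop_poly_adjoint)
  moreover have "C \<circ> C = B"
  proof (rule op_conv_unique[where T = "\<lambda>n. bop_poly (p n * p n)"])
    show "op_conv S (\<lambda>n. bop_poly (p n * p n)) (C \<circ> C)"
      unfolding bop_poly_mult by (intro op_conv_compose pb C)
    \<comment> \<open>With \<open>d\<close> the error at \<open>t\<close>, the square of
      \<open>p n\<close> differs from \<open>t\<close> by \<open>d * (d + 2 * sqrt t)\<close>, and
      \<open>d\<close> is at most 1 in absolute value; hence the constant.\<close>
    have est: "op_norm S (bop_poly (p n * p n) \<ominus> B) \<le> (1 + 2 * sqrt R) * inverse (Suc n)" for n
      unfolding bop_poly_diff[symmetric, where q = "[:0,1:]", unfolded bop_poly_X]
    proof (rule op_norm_bop_poly_le)
      fix t assume t: "t \<in> {0..R}"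
      let ?d = "poly (p n) t - sqrt t"
      have "poly (p n * p n - [:0, 1:]) t = ?d * (?d + 2 * sqrt t)"
        using t by (simp add: algebra_simps)
      also have "\<bar>\<dots>\<bar> \<le> inverse (Suc n) * (1 + 2 * sqrt R)"
      proof -
        have "\<bar>?d\<bar> \<le> inverse (Suc n)" "inverse (real (Suc n)) \<le> 1" using p(2)[OF t, of n] by (auto simp: inverse_le_1_iff)
        moreover have "sqrt t \<le> sqrt R" "0 \<le> sqrt t" using t by auto
        ultimately show ?thesis unfolding abs_mult by (intro mult_mono) linarith+
      qed
      finally show "\<bar>poly (p n * p n - [:0, 1:]) t\<bar> \<le> (1 + 2 * sqrt R) * inverse (Suc n)" by (simp add: mult.commute)
    qed
    show "op_conv S (\<lambda>n. bop_poly (p n * p n)) B"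
      unfolding op_conv_def
    proof (rule Lim_null_comparison[OF always_eventually])
      show "(\<lambda>n. (1 + 2 * sqrt R) * inverse (Suc n)) \<longlonglongrightarrow> 0"
        using tendsto_mult_right_zero[OF LIMSEQ_inverse_real_of_nat] by simp
      show "\<forall>n. norm (op_norm S (bop_poly (p n * p n) \<ominus> B)) \<le> (1 + 2 * sqrt R) * inverse (real (Suc n))"
        using est op_norm_nonneg[OF bounded_ops_diff[OF pb B]] by simp
    qed
  qed (use pb B C bounded_ops_compose in auto)
  ultimately show ?thesis using C p(1) by blast
qed

end

section \<open>Topology and algebra of etale groupoids\<close>

section \<open>Topological preliminaries\<close>

abbreviation fun_plus (infixl "\<^bold>+" 65) where "f \<^bold>+ g \<equiv> \<lambda>\<gamma>. f \<gamma> + (g \<gamma> :: complex)"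
abbreviation fun_minus (infixl "\<^bold>-" 65) where "f \<^bold>- g \<equiv> \<lambda>\<gamma>. f \<gamma> - (g \<gamma> :: complex)"
abbreviation cplx :: "('a \<Rightarrow> real) \<Rightarrow> 'a \<Rightarrow> complex" where "cplx f \<equiv> \<lambda>x. complex_of_real (f x)"

lemma continuous_map_locallyI:
  assumes "\<And>x. x \<in> topspace X \<Longrightarrow> \<exists>U. openin X U \<and> x \<in> U \<and> continuous_map (subtopology X U) Y f"
  shows "continuous_map X Y f"
  unfolding continuous_map_eq_topcontinuous_at
proof
  fix x assume x: "x \<in> topspace X"
  then obtain U where U: "openin X U" "x \<in> U" "continuous_map (subtopology X U) Y f" using assms by blast
  show "topcontinuous_at X Y f x"
    unfolding topcontinuous_at_def
  proof (intro conjI allI impI)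
    show "f \<in> topspace X \<rightarrow> topspace Y"
    proof
      fix y assume "y \<in> topspace X"
      then show "f y \<in> topspace Y" using assms[of y] by (auto simp: continuous_map_def)
    qed
    fix V assume V: "openin Y V \<and> f x \<in> V"
    have "openin (subtopology X U) {y \<in> topspace (subtopology X U). f y \<in> V}"
      using U(3) V by (auto simp: continuous_map_def)
    then have "openin X {y \<in> topspace (subtopology X U). f y \<in> V}"
      using U(1) by (simp add: openin_open_subtopology)
    then show "\<exists>W. openin X W \<and> x \<in> W \<and> (\<forall>y\<in>W. f y \<in> V)"
      using V x U(2) by (intro exI[of _ "{y \<in> topspace (subtopology X U). f y \<in> V}"]) auto
  qed (use x in auto)
qed

lemma continuous_map_compose_euclidean:
  assumes "continuous_map X euclidean f" "continuous_on UNIV h"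
  shows "continuous_map X euclidean (\<lambda>x. h (f x))"
  using continuous_map_compose[OF assms(1), of euclidean h] assms(2) by (simp add: o_def)

lemma continuous_map_complex_mult:
  fixes f g :: "'a \<Rightarrow> complex"
  assumes "continuous_map X euclidean f" "continuous_map X euclidean g"
  shows "continuous_map X euclidean (\<lambda>x. f x * g x)"
proof -
  have "continuous_map X euclidean (\<lambda>x. (f x, g x))"
    using continuous_map_pairedI[OF assms] by simp
  then have "continuous_map X euclidean (\<lambda>x. (\<lambda>p. fst p * snd p) (f x, g x))"
    by (rule continuous_map_compose_euclidean) (intro continuous_intros)
  then show ?thesis by simp
qed

locale lch_space =
  fixes T :: "'a topology"
  assumes lc: "locally_compact_space T" and haus: "Hausdorff_space T"
begin

text \<open>The set \<open>K\<close> is closed by the Hausdorff property, so \<open>U\<close> and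
  the complement of \<open>K\<close> form an open cover, and \<open>f\<close> is zero on the second
  set.\<close>

lemma continuous_extend_by_zero:
  fixes f :: "'a \<Rightarrow> 'b::real_normed_vector"
  assumes "openin T U" "compactin T K" "K \<subseteq> U" "continuous_map (subtopology T U) euclidean f"
    "\<And>x. x \<notin> K \<Longrightarrow> f x = 0"
  shows "continuous_map T euclidean f"
proof (rule continuous_map_locallyI)
  fix x assume x: "x \<in> topspace T"
  show "\<exists>U. openin T U \<and> x \<in> U \<and> continuous_map (subtopology T U) euclidean f"
  proof (cases "x \<in> U")
    case False
    let ?V = "topspace T - K"
    have "openin T ?V" using compactin_imp_closedin[OF haus assms(2)] by (simp add: openin_diff)
    moreover have "continuous_map (subtopology T ?V) euclidean f"
      by (rule continuous_map_eq[of _ _ "\<lambda>_. 0"]) (use assms(5) in auto)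
    ultimately show ?thesis using x False assms(3) by (intro exI[of _ ?V]) auto
  qed (use assms in blast)
qed

lemma bump_exists:
  assumes "openin T U" "x \<in> U"
  shows "\<exists>g K. continuous_map T euclideanreal g \<and> compactin T K \<and> K \<subseteq> U \<and> g x = 1 \<and>
     (\<forall>y. 0 \<le> g y \<and> g y \<le> 1) \<and> (\<forall>y. y \<notin> K \<longrightarrow> g y = 0)"
proof -
  have "neighbourhood_base_of (compactin T) T"
    using lc haus locally_compact_space_neighbourhood_base by blast
  then obtain V K where V: "openin T V" "compactin T K" "x \<in> V" "V \<subseteq> K" "K \<subseteq> U"
    using assms unfolding neighbourhood_base_of by meson
  have "completely_regular_space T"
    using locally_compact_regular_imp_completely_regular_space[OF lc] haus by blast
  moreover have "closedin T (topspace T - V)" using V by blast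
  moreover have "x \<in> topspace T - (topspace T - V)" using V(3) openin_subset[OF V(1)] by blast
  ultimately obtain f where f: "continuous_map T (top_of_set {0..1::real}) f" "f x = 0" "f ` (topspace T - V) \<subseteq> {1}"
    unfolding completely_regular_space_def by metis
  \<comment> \<open>Inside the space \<open>1 - f\<close> already vanishes off \<open>K\<close>; the
    case distinction fixes the value outside the space.\<close>
  define g where "g y = (if y \<in> K then 1 - f y else 0)" for y
  have f01: "f y \<in> {0..1}" if "y \<in> topspace T" for y
    using continuous_map_image_subset_topspace[OF f(1)] that by (auto simp: image_subset_iff Pi_iff)
  have Kt: "K \<subseteq> topspace T" using compactin_subset_topspace[OF V(2)] .
  have "continuous_map T euclideanreal f"
    using f(1) by (simp add: continuous_map_in_subtopology)
  then have "continuous_map T euclideanreal (\<lambda>y. 1 - f y)" by (intro continuous_intros) auto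
  then have "continuous_map T euclideanreal g"
    by (rule continuous_map_eq) (use f(3) V(4) in \<open>auto simp: g_def\<close>)
  then show ?thesis using V f(2) f01 Kt
    by (intro exI[of _ g] exI[of _ K]) (auto simp: g_def subset_iff)
qed

lemma partition_of_unity:
  assumes K: "compactin T K" and U: "\<And>x. x \<in> K \<Longrightarrow> openin T (U x) \<and> x \<in> U x"
  shows "\<exists>I \<psi> L. finite I \<and> I \<subseteq> K \<and>
    (\<forall>x \<in> I. continuous_map T euclideanreal (\<psi> x) \<and> compactin T (L x) \<and> L x \<subseteq> U x \<and>
        (\<forall>y. 0 \<le> \<psi> x y) \<and> (\<forall>y. y \<notin> L x \<longrightarrow> \<psi> x y = 0)) \<and>
    (\<forall>y. (\<Sum>x\<in>I. \<psi> x y) \<le> 1) \<and> (\<forall>y \<in> K. (\<Sum>x\<in>I. \<psi> x y) = 1)"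
proof -
  have "\<forall>x \<in> K. \<exists>g L. continuous_map T euclideanreal g \<and> compactin T L \<and> L \<subseteq> U x \<and> g x = 1 \<and>
     (\<forall>y. 0 \<le> g y \<and> g y \<le> 1) \<and> (\<forall>y. y \<notin> L \<longrightarrow> g y = 0)"
    using U bump_exists by blast
  then obtain g L where g: "\<And>x. x \<in> K \<Longrightarrow> continuous_map T euclideanreal (g x) \<and> compactin T (L x) \<and> L x \<subseteq> U x \<and> g x x = 1 \<and>
     (\<forall>y. 0 \<le> g x y \<and> g x y \<le> 1) \<and> (\<forall>y. y \<notin> L x \<longrightarrow> g x y = 0)"
    by metis
  define V where "V x = {y \<in> topspace T. g x y \<in> {1/2<..}}" for x
  have Vo: "openin T (V x)" if "x \<in> K" for x
    unfolding V_def by (rule openin_continuous_map_preimage[of _ euclideanreal]) (use g[OF that] in auto)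
  have Kt: "K \<subseteq> topspace T" using compactin_subset_topspace[OF K] .
  have Vx: "x \<in> V x" if "x \<in> K" for x using g[OF that] that Kt by (auto simp: V_def)
  have "\<exists>\<F>. finite \<F> \<and> \<F> \<subseteq> V ` K \<and> K \<subseteq> \<Union>\<F>"
    by (rule compactinD[OF K]) (use Vo Vx in blast)+
  then obtain \<F> where F: "finite \<F>" "\<F> \<subseteq> V ` K" "K \<subseteq> \<Union>\<F>" by blast
  then obtain I where I: "finite I" "I \<subseteq> K" "\<F> = V ` I" by (meson finite_subset_image)
  \<comment> \<open>A denominator of at least \<open>1/2\<close> keeps the quotients continuous
    everywhere. On \<open>K\<close> it equals the sum, because there some \<open>g x\<close> exceeds
    \<open>1/2\<close>.\<close>
  define h where "h y = max (\<Sum>x\<in>I. g x y) (1/2)" for y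
  have h: "1/2 \<le> h y" "(\<Sum>x\<in>I. g x y) \<le> h y" for y by (auto simp: h_def)
  have hK: "(\<Sum>x\<in>I. g x y) = h y" if y: "y \<in> K" for y
  proof -
    obtain x where x: "x \<in> I" "y \<in> V x" using F(3) I y by auto
    have "g x y \<le> (\<Sum>x\<in>I. g x y)" by (rule member_le_sum) (use x I g in auto)
    then show ?thesis using x by (auto simp: h_def V_def)
  qed
  have hc: "continuous_map T euclideanreal h" unfolding h_def
    by (intro continuous_intros) (use g I in auto)
  have "continuous_map T euclideanreal (\<lambda>y. g x y / h y)" if "x \<in> I" for x
  proof (rule continuous_map_real_divide[OF _ hc])
    show "h y \<noteq> 0" for y using h(1)[of y] by linarith
  qed (use that g I in blast)
  moreover have hp: "0 < h y" for y using h(1)[of y] by linarith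
  moreover have "(\<Sum>x\<in>I. g x y / h y) \<le> 1" for y
    using h(2)[of y] hp[of y] by (simp flip: sum_divide_distrib)
  moreover have "(\<Sum>x\<in>I. g x y / h y) = 1" if "y \<in> K" for y
    using hK[OF that] hp[of y] by (simp flip: sum_divide_distrib)
  ultimately show ?thesis
  proof (intro exI[of _ I] exI[of _ "\<lambda>x y. g x y / h y"] exI[of _ L] conjI ballI allI impI)
    fix x y assume "x \<in> I"
    then show "0 \<le> g x y / h y" using I g hp[of y] by (intro divide_nonneg_pos) auto
    show "L x \<subseteq> U x" using \<open>x \<in> I\<close> I g by blast
  qed (use I g in auto)
qed

end

section \<open>Algebra in groupoids\<close>

locale groupoid_alg =
  fixes G :: "'g groupoid"
  assumes alg: "algebraic_groupoid G"
begin

abbreviation "arr \<equiv> arrows G"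
abbreviation "s \<equiv> gsrc G"
abbreviation "r \<equiv> grng G"
abbreviation "iv \<equiv> ginv G"
abbreviation mult (infixl "\<odot>" 70) where "\<alpha> \<odot> \<beta> \<equiv> gmult G \<alpha> \<beta>"
abbreviation conv (infixl "\<star>" 70) where "f \<star> g \<equiv> convolution G f g"

lemma alg_unfold:
  assumes "\<alpha> \<in> arr"
  shows "s \<alpha> \<in> arr" "r \<alpha> \<in> arr" "s (s \<alpha>) = s \<alpha>" "r (s \<alpha>) = s \<alpha>" "s (r \<alpha>) = r \<alpha>" "r (r \<alpha>) = r \<alpha>"
    "r \<alpha> \<odot> \<alpha> = \<alpha>" "\<alpha> \<odot> s \<alpha> = \<alpha>" "iv \<alpha> \<in> arr" "s (iv \<alpha>) = r \<alpha>" "r (iv \<alpha>) = s \<alpha>"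
    "iv \<alpha> \<odot> \<alpha> = s \<alpha>" "\<alpha> \<odot> iv \<alpha> = r \<alpha>"
  using alg assms unfolding algebraic_groupoid_def by blast+

declare alg_unfold [simp]

lemma mult_closed [simp]:
  assumes "\<alpha> \<in> arr" "\<beta> \<in> arr" "s \<alpha> = r \<beta>"
  shows "\<alpha> \<odot> \<beta> \<in> arr" "s (\<alpha> \<odot> \<beta>) = s \<beta>" "r (\<alpha> \<odot> \<beta>) = r \<alpha>"
  using alg assms unfolding algebraic_groupoid_def composable_def by blast+

lemma mult_assoc:
  assumes "\<alpha> \<in> arr" "\<beta> \<in> arr" "\<gamma> \<in> arr" "s \<alpha> = r \<beta>" "s \<beta> = r \<gamma>"
  shows "(\<alpha> \<odot> \<beta>) \<odot> \<gamma> = \<alpha> \<odot> (\<beta> \<odot> \<gamma>)"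
  using alg assms unfolding algebraic_groupoid_def composable_def by blast

lemma cancel [simp]:
  assumes "\<alpha> \<in> arr" "\<beta> \<in> arr"
  shows "s \<alpha> = r \<beta> \<Longrightarrow> iv \<alpha> \<odot> (\<alpha> \<odot> \<beta>) = \<beta>"
    and "s \<alpha> = r \<beta> \<Longrightarrow> (\<alpha> \<odot> \<beta>) \<odot> iv \<beta> = \<alpha>"
    and "r \<alpha> = r \<beta> \<Longrightarrow> \<alpha> \<odot> (iv \<alpha> \<odot> \<beta>) = \<beta>"
    and "s \<alpha> = s \<beta> \<Longrightarrow> (\<alpha> \<odot> iv \<beta>) \<odot> \<beta> = \<alpha>"
proof -
  assume h: "s \<alpha> = r \<beta>"
  have "iv \<alpha> \<odot> (\<alpha> \<odot> \<beta>) = (iv \<alpha> \<odot> \<alpha>) \<odot> \<beta>"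
    by (rule mult_assoc[symmetric]) (simp_all add: assms h)
  then show "iv \<alpha> \<odot> (\<alpha> \<odot> \<beta>) = \<beta>" using h assms by simp
next
  assume h: "s \<alpha> = r \<beta>"
  have "(\<alpha> \<odot> \<beta>) \<odot> iv \<beta> = \<alpha> \<odot> (\<beta> \<odot> iv \<beta>)"
    by (rule mult_assoc) (simp_all add: assms h)
  then show "(\<alpha> \<odot> \<beta>) \<odot> iv \<beta> = \<alpha>" using assms alg_unfold(8)[of \<alpha>] by (simp flip: h)
next
  assume h: "r \<alpha> = r \<beta>"
  have "\<alpha> \<odot> (iv \<alpha> \<odot> \<beta>) = (\<alpha> \<odot> iv \<alpha>) \<odot> \<beta>"
    by (rule mult_assoc[symmetric]) (simp_all add: assms h)
  then show "\<alpha> \<odot> (iv \<alpha> \<odot> \<beta>) = \<beta>" using h assms by simp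
next
  assume h: "s \<alpha> = s \<beta>"
  have "(\<alpha> \<odot> iv \<beta>) \<odot> \<beta> = \<alpha> \<odot> (iv \<beta> \<odot> \<beta>)"
    by (rule mult_assoc) (simp_all add: assms h)
  then show "(\<alpha> \<odot> iv \<beta>) \<odot> \<beta> = \<alpha>" using assms alg_unfold(8)[of \<alpha>] by (simp flip: h)
qed

lemma inv_inv [simp]: "\<alpha> \<in> arr \<Longrightarrow> iv (iv \<alpha>) = \<alpha>"
  using cancel(3)[of \<alpha> "iv (iv \<alpha>)"] by simp

lemma inv_mult:
  assumes "\<alpha> \<in> arr" "\<beta> \<in> arr" "s \<alpha> = r \<beta>"
  shows "iv (\<alpha> \<odot> \<beta>) = iv \<beta> \<odot> iv \<alpha>"
proof -
  have "iv (\<alpha> \<odot> \<beta>) = (iv (\<alpha> \<odot> \<beta>) \<odot> \<alpha>) \<odot> iv \<alpha>" using assms by simp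
  also have "iv (\<alpha> \<odot> \<beta>) \<odot> \<alpha> = ((iv (\<alpha> \<odot> \<beta>) \<odot> \<alpha>) \<odot> \<beta>) \<odot> iv \<beta>" using assms by simp
  also have "(iv (\<alpha> \<odot> \<beta>) \<odot> \<alpha>) \<odot> \<beta> = s \<beta>" using assms by (subst mult_assoc) auto
  also have "s \<beta> \<odot> iv \<beta> = iv \<beta>" using assms alg_unfold(7)[of "iv \<beta>"] by simp
  finally show ?thesis .
qed

lemma units_iff: "u \<in> units G \<longleftrightarrow> u \<in> arr \<and> s u = u"
  unfolding units_def by (metis alg_unfold(1,3) imageE imageI)

lemma unit_simps:
  assumes "u \<in> units G" shows "u \<in> arr" "s u = u" "r u = u" "iv u = u"
proof -
  show 1: "u \<in> arr" "s u = u" using assms units_iff by auto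
  then show "r u = u" using alg_unfold(4)[of u] by simp
  then show "iv u = u" using alg_unfold(7)[of "iv u"] alg_unfold(13)[of u] 1 by simp
qed

lemma src_unit [simp]: "\<alpha> \<in> arr \<Longrightarrow> s \<alpha> \<in> units G" and rng_unit [simp]: "\<alpha> \<in> arr \<Longrightarrow> r \<alpha> \<in> units G"
  by (simp_all add: units_iff)

lemma factorizations_src:
  assumes "\<gamma> \<in> arr"
  shows "bij_betw (\<lambda>\<beta>. (\<gamma> \<odot> iv \<beta>, \<beta>)) (src_fibre G (s \<gamma>)) {(\<alpha>, \<beta>) \<in> composable G. \<alpha> \<odot> \<beta> = \<gamma>}"
  by (rule bij_betwI[where g = snd]) (use assms in \<open>auto simp: src_fibre_def composable_def\<close>)

lemma factorizations_rng:
  assumes "\<gamma> \<in> arr"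
  shows "bij_betw (\<lambda>\<alpha>. (\<alpha>, iv \<alpha> \<odot> \<gamma>)) (rng_fibre G (r \<gamma>)) {(\<alpha>, \<beta>) \<in> composable G. \<alpha> \<odot> \<beta> = \<gamma>}"
  by (rule bij_betwI[where g = fst]) (use assms in \<open>auto simp: rng_fibre_def composable_def\<close>)

lemma convolution_src:
  assumes "\<gamma> \<in> arr"
  shows "(f \<star> g) \<gamma> = (\<Sum>\<^sub>\<infinity>\<beta>\<in>src_fibre G (s \<gamma>). f (\<gamma> \<odot> iv \<beta>) * g \<beta>)"
  unfolding convolution_def by (subst infsum_reindex_bij_betw[OF factorizations_src[OF assms], symmetric]) simp

lemma convolution_rng:
  assumes "\<gamma> \<in> arr"
  shows "(f \<star> g) \<gamma> = (\<Sum>\<^sub>\<infinity>\<alpha>\<in>rng_fibre G (r \<gamma>). f \<alpha> * g (iv \<alpha> \<odot> \<gamma>))"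
  unfolding convolution_def by (subst infsum_reindex_bij_betw[OF factorizations_rng[OF assms], symmetric]) simp

lemma convolution_off: "\<gamma> \<notin> arr \<Longrightarrow> (f \<star> g) \<gamma> = 0"
proof -
  assume "\<gamma> \<notin> arr"
  then have "{(\<alpha>, \<beta>) \<in> composable G. \<alpha> \<odot> \<beta> = \<gamma>} = {}" by (auto simp: composable_def)
  then show ?thesis unfolding convolution_def by (simp only: infsum_empty)
qed

lemma bij_inv_fibre: "bij_betw iv (src_fibre G u) (rng_fibre G u)"
  by (rule bij_betwI[where g = iv]) (auto simp: src_fibre_def rng_fibre_def)

end

section \<open>Etale groupoids\<close>

locale lch_etale = lch_space "gtop G" for G :: "'g groupoid" +
  assumes etale: "etale_groupoid G"

sublocale lch_etale \<subseteq> groupoid_alg G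
  using etale by unfold_locales (simp add: etale_groupoid_def topological_groupoid_def)

context lch_etale
begin

abbreviation "T \<equiv> gtop G"

lemma arr_top: "arr = topspace T" by (simp add: arrows_def)

lemma src_cont: "continuous_map T T s" and rng_cont: "continuous_map T T r" and inv_cont: "continuous_map T T iv"
  and mult_cont: "continuous_map (subtopology (prod_topology T T) (composable G)) T (\<lambda>(\<alpha>, \<beta>). \<alpha> \<odot> \<beta>)"
  using etale by (simp_all add: etale_groupoid_def topological_groupoid_def)

lemma mult_cont':
  assumes "continuous_map X T a" "continuous_map X T b" "\<And>x. x \<in> topspace X \<Longrightarrow> s (a x) = r (b x)"
  shows "continuous_map X T (\<lambda>x. a x \<odot> b x)"
proof -
  have ab: "a x \<in> arr" "b x \<in> arr" if "x \<in> topspace X" for x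
    using assms(1,2) that by (auto simp: continuous_map_def arr_top)
  have "continuous_map X (subtopology (prod_topology T T) (composable G)) (\<lambda>x. (a x, b x))"
    by (rule continuous_map_into_subtopology[OF continuous_map_pairedI[OF assms(1,2)]])
      (use assms(3) ab in \<open>auto simp: composable_def\<close>)
  from continuous_map_compose[OF this mult_cont] show ?thesis by (simp add: o_def)
qed

text \<open>Close to a unit the source map is injective, while \<open>x\<close> and
  \<open>s x\<close> have the same source; when both are close to the unit they coincide.\<close>

lemma units_open: "openin T (units G)"
proof (subst openin_subopen, intro ballI)
  fix u assume u: "u \<in> units G"
  have "local_homeomorphism T (subtopology T (units G)) s" using etale by (simp add: etale_groupoid_def)
  then obtain V where V: "openin T V" "u \<in> V" "homeomorphic_map (subtopology T V) (subtopology (subtopology T (units G)) (s ` V)) s"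
    using unit_simps(1)[OF u] unfolding local_homeomorphism_def arr_top by blast
  have Vt: "V \<subseteq> arr" using openin_subset[OF V(1)] by (simp add: arr_top)
  have inj: "inj_on s V" using homeomorphic_imp_injective_map[OF V(3)] Vt by (simp add: arr_top Int_absorb1)
  let ?W = "V \<inter> {x \<in> topspace T. s x \<in> V}"
  have "openin T ?W" using V(1) openin_continuous_map_preimage[OF src_cont V(1)] by blast
  moreover have "?W \<subseteq> units G"
  proof
    fix x assume x: "x \<in> ?W"
    then have "s (s x) = s x" using Vt by (auto simp: subset_iff)
    then have "s x = x" using inj x by (auto dest: inj_onD)
    then show "x \<in> units G" using x Vt by (auto simp: units_iff)
  qed
  moreover have "u \<in> ?W" using V(2) u unit_simps[OF u] by (simp add: arr_top)
  ultimately show "\<exists>W. openin T W \<and> u \<in> W \<and> W \<subseteq> units G" by blast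
qed

lemma units_closed: "closedin T (units G)"
proof -
  have "closedin T {x \<in> topspace T. s x = id x}"
    by (rule closedin_continuous_maps_eq[OF haus src_cont]) auto
  moreover have "{x \<in> topspace T. s x = id x} = units G" by (auto simp: units_iff arr_top)
  ultimately show ?thesis by simp
qed

lemma local_homeo_open:
  assumes lh: "local_homeomorphism T (subtopology T (units G)) p" and U: "openin T U"
  shows "openin T (p ` U)"
proof (subst openin_subopen, intro ballI)
  fix y assume "y \<in> p ` U"
  then obtain x where x: "x \<in> U" "y = p x" by blast
  have Ut: "U \<subseteq> topspace T" using openin_subset[OF U] .
  obtain V where V: "openin T V" "x \<in> V" "openin (subtopology T (units G)) (p ` V)"
    "homeomorphic_map (subtopology T V) (subtopology (subtopology T (units G)) (p ` V)) p"
    using lh x Ut unfolding local_homeomorphism_def by blast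
  have "openin (subtopology T V) (U \<inter> V)" using U by (auto simp: openin_subtopology)
  then have "openin (subtopology (subtopology T (units G)) (p ` V)) (p ` (U \<inter> V))"
    using homeomorphic_imp_open_map[OF V(4)] by (simp add: open_map_def)
  then have "openin T (p ` (U \<inter> V))"
    using V(3) units_open by (meson openin_open_subtopology)
  moreover have "y \<in> p ` (U \<inter> V)" "p ` (U \<inter> V) \<subseteq> p ` U" using x V(2) by auto
  ultimately show "\<exists>W. openin T W \<and> y \<in> W \<and> W \<subseteq> p ` U" by blast
qed

lemma src_open: "openin T U \<Longrightarrow> openin T (s ` U)" and rng_open: "openin T U \<Longrightarrow> openin T (r ` U)"
  using local_homeo_open etale by (auto simp: etale_groupoid_def)

definition "bisection U \<longleftrightarrow> openin T U \<and> inj_on s U \<and> inj_on r U"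

lemma bisection_exists:
  assumes "\<gamma> \<in> arr" shows "\<exists>U. bisection U \<and> \<gamma> \<in> U"
proof -
  have *: "\<exists>V. openin T V \<and> \<gamma> \<in> V \<and> inj_on p V"
    if lh: "local_homeomorphism T (subtopology T (units G)) p" for p
  proof -
    obtain V where V: "openin T V" "\<gamma> \<in> V"
      "homeomorphic_map (subtopology T V) (subtopology (subtopology T (units G)) (p ` V)) p"
      using lh assms unfolding local_homeomorphism_def arr_top by blast
    have "V \<subseteq> topspace T" using openin_subset[OF V(1)] .
    then have "inj_on p V" using homeomorphic_imp_injective_map[OF V(3)] by (simp add: Int_absorb1)
    with V show ?thesis by blast
  qed
  obtain V W where "openin T V" "\<gamma> \<in> V" "inj_on s V" "openin T W" "\<gamma> \<in> W" "inj_on r W"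
    using *[of s] *[of r] etale unfolding etale_groupoid_def by metis
  then have "bisection (V \<inter> W) \<and> \<gamma> \<in> V \<inter> W" unfolding bisection_def by (auto intro: inj_on_subset)
  then show ?thesis by blast
qed

lemma bisection_subset: "bisection U \<Longrightarrow> openin T V \<Longrightarrow> V \<subseteq> U \<Longrightarrow> bisection V"
  unfolding bisection_def by (auto intro: inj_on_subset)

text \<open>The inverse of the range map on \<open>U\<close> is continuous because the range map is
  open. Such local sections reduce fibrewise sums over a bisection to single terms.\<close>

lemma bisection_section:
  assumes "bisection U"
  shows "\<exists>\<sigma>. continuous_map (subtopology T (r ` U)) T \<sigma> \<and> (\<forall>x \<in> r ` U. \<sigma> x \<in> U \<and> r (\<sigma> x) = x) \<and> (\<forall>\<alpha> \<in> U. \<sigma> (r \<alpha>) = \<alpha>)"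
proof -
  have U: "openin T U" "inj_on r U" using assms by (auto simp: bisection_def)
  define \<sigma> where "\<sigma> = the_inv_into U r"
  have 1: "\<sigma> x \<in> U \<and> r (\<sigma> x) = x" if "x \<in> r ` U" for x
    using that U(2) by (auto simp: \<sigma>_def the_inv_into_into f_the_inv_into_f)
  have 2: "\<sigma> (r \<alpha>) = \<alpha>" if "\<alpha> \<in> U" for \<alpha> using that U(2) by (simp add: \<sigma>_def the_inv_into_f_f)
  have "continuous_map (subtopology T (r ` U)) T \<sigma>"
    unfolding continuous_map_def
  proof (intro conjI allI impI)
    show "\<sigma> \<in> topspace (subtopology T (r ` U)) \<rightarrow> topspace T"
      using 1 openin_subset[OF U(1)] by auto
    fix V assume V: "openin T V"
    have "openin T (r ` (U \<inter> V))" using rng_open U(1) V by blast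
    moreover have "{x \<in> topspace (subtopology T (r ` U)). \<sigma> x \<in> V} = r ` (U \<inter> V)"
    proof
      show "{x \<in> topspace (subtopology T (r ` U)). \<sigma> x \<in> V} \<subseteq> r ` (U \<inter> V)" using 2 by auto
      show "r ` (U \<inter> V) \<subseteq> {x \<in> topspace (subtopology T (r ` U)). \<sigma> x \<in> V}"
        using 2 openin_subset[OF U(1)] alg_unfold(2) by (auto simp: arr_top)
    qed
    ultimately show "openin (subtopology T (r ` U)) {x \<in> topspace (subtopology T (r ` U)). \<sigma> x \<in> V}"
      using rng_open[OF U(1)] by (auto simp: openin_open_subtopology)
  qed
  with 1 2 show ?thesis by blast
qed

lemma preimage_open: "openin T U \<Longrightarrow> openin T {\<gamma> \<in> arr. r \<gamma> \<in> U}"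
  using openin_continuous_map_preimage[OF rng_cont] by (simp add: arr_top)

text \<open>Solve for the second factor: near \<open>\<alpha> \<odot> \<beta>\<close> the first
  factor can be prescribed as the local section at \<open>r \<gamma>\<close>, and the other factor
  then depends continuously on \<open>\<gamma>\<close>, so it remains in \<open>V\<close>. This is
  what makes the isotropy interior closed under products.\<close>

lemma mult_open:
  assumes "openin T U" "openin T V"
  shows "openin T {\<alpha> \<odot> \<beta> |\<alpha> \<beta>. \<alpha> \<in> U \<and> \<beta> \<in> V \<and> s \<alpha> = r \<beta>}"
proof (subst openin_subopen, intro ballI)
  fix \<gamma> assume "\<gamma> \<in> {\<alpha> \<odot> \<beta> |\<alpha> \<beta>. \<alpha> \<in> U \<and> \<beta> \<in> V \<and> s \<alpha> = r \<beta>}"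
  then obtain \<alpha> \<beta> where ab: "\<gamma> = \<alpha> \<odot> \<beta>" "\<alpha> \<in> U" "\<beta> \<in> V" "s \<alpha> = r \<beta>" by blast
  have arr: "\<alpha> \<in> arr" "\<beta> \<in> arr" using ab openin_subset[OF assms(1)] openin_subset[OF assms(2)] by (auto simp: arr_top)
  obtain B where B: "bisection B" "\<alpha> \<in> B" "B \<subseteq> U"
  proof -
    obtain B where "bisection B" "\<alpha> \<in> B" using bisection_exists[OF arr(1)] by blast
    then show ?thesis using that[of "B \<inter> U"] bisection_subset[of B "B \<inter> U"] assms(1) ab(2) by (auto simp: bisection_def)
  qed
  obtain \<sigma> where \<sigma>: "continuous_map (subtopology T (r ` B)) T \<sigma>" "\<And>x. x \<in> r ` B \<Longrightarrow> \<sigma> x \<in> B \<and> r (\<sigma> x) = x" "\<And>\<alpha>. \<alpha> \<in> B \<Longrightarrow> \<sigma> (r \<alpha>) = \<alpha>"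
    using bisection_section[OF B(1)] by blast
  have Bo: "openin T B" and Bt: "B \<subseteq> arr" using B openin_subset[of T B] by (auto simp: bisection_def arr_top)
  let ?W = "{\<gamma> \<in> arr. r \<gamma> \<in> r ` B}"
  have Wo: "openin T ?W" by (rule preimage_open[OF rng_open[OF Bo]])
  have rW: "continuous_map (subtopology T ?W) (subtopology T (r ` B)) r"
    by (rule continuous_map_into_subtopology) (auto intro: continuous_map_from_subtopology rng_cont)
  have \<sigma>W: "continuous_map (subtopology T ?W) T (\<lambda>\<gamma>. \<sigma> (r \<gamma>))"
    using continuous_map_compose[OF rW \<sigma>(1)] by (simp add: o_def)
  have c: "continuous_map (subtopology T ?W) T (\<lambda>\<gamma>. iv (\<sigma> (r \<gamma>)) \<odot> \<gamma>)"
  proof (rule mult_cont')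
    show "continuous_map (subtopology T ?W) T (\<lambda>\<gamma>. iv (\<sigma> (r \<gamma>)))"
      using continuous_map_compose[OF \<sigma>W inv_cont] by (simp add: o_def)
    show "continuous_map (subtopology T ?W) T (\<lambda>x. x)" by (rule continuous_map_from_subtopology) auto
    fix x assume "x \<in> topspace (subtopology T ?W)"
    then have "r x \<in> r ` B" by auto
    then show "s (iv (\<sigma> (r x))) = r x" using \<sigma>(2)[of "r x"] Bt by (auto simp: subset_iff)
  qed
  let ?P = "{\<gamma> \<in> topspace (subtopology T ?W). iv (\<sigma> (r \<gamma>)) \<odot> \<gamma> \<in> V}"
  have "openin (subtopology T ?W) ?P" by (rule openin_continuous_map_preimage[OF c assms(2)])
  then have "openin T ?P" using Wo by (meson openin_open_subtopology)
  moreover have "\<gamma> \<in> ?P" using ab arr B(2) \<sigma>(3)[OF B(2)] by (simp flip: arr_top)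
  moreover have "?P \<subseteq> {\<alpha> \<odot> \<beta> |\<alpha> \<beta>. \<alpha> \<in> U \<and> \<beta> \<in> V \<and> s \<alpha> = r \<beta>}"
  proof
    fix x assume x: "x \<in> ?P"
    then have xa: "x \<in> arr" "r x \<in> r ` B" by auto
    note sx = \<sigma>(2)[OF xa(2)]
    have "x = \<sigma> (r x) \<odot> (iv (\<sigma> (r x)) \<odot> x)" using xa sx Bt by (auto simp: subset_iff)
    moreover have "\<sigma> (r x) \<in> U" "iv (\<sigma> (r x)) \<odot> x \<in> V" "s (\<sigma> (r x)) = r (iv (\<sigma> (r x)) \<odot> x)"
      using x xa sx B(3) Bt by (auto simp: subset_iff)
    ultimately show "x \<in> {\<alpha> \<odot> \<beta> |\<alpha> \<beta>. \<alpha> \<in> U \<and> \<beta> \<in> V \<and> s \<alpha> = r \<beta>}" by blast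
  qed
  ultimately show "\<exists>W. openin T W \<and> \<gamma> \<in> W \<and> W \<subseteq> {\<alpha> \<odot> \<beta> |\<alpha> \<beta>. \<alpha> \<in> U \<and> \<beta> \<in> V \<and> s \<alpha> = r \<beta>}" by blast
qed

lemma inv_open:
  assumes "openin T U" shows "openin T (iv ` U)"
proof -
  have U: "U \<subseteq> arr" using openin_subset[OF assms] by (simp add: arr_top)
  have "iv ` U = {\<gamma> \<in> topspace T. iv \<gamma> \<in> U}"
    unfolding arr_top[symmetric]
  proof (intro equalityI subsetI)
    fix x assume "x \<in> {\<gamma> \<in> arr. iv \<gamma> \<in> U}"
    then show "x \<in> iv ` U" using inv_inv[of x] by (metis (mono_tags, lifting) image_eqI mem_Collect_eq)
  qed (use U in auto)
  then show ?thesis using openin_continuous_map_preimage[OF inv_cont assms] by simp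
qed

end

section \<open>Convolution algebra and regular representation\<close>

section \<open>Kernel operators\<close>

lemma kernel_op_aux:
  fixes k :: "'i \<Rightarrow> 'i \<Rightarrow> complex"
  assumes row: "\<And>i. i \<in> S \<Longrightarrow> finite {j \<in> S. k i j \<noteq> 0}" "\<And>i. i \<in> S \<Longrightarrow> (\<Sum>j | j \<in> S \<and> k i j \<noteq> 0. cmod (k i j)) \<le> C"
    and col: "\<And>j F. j \<in> S \<Longrightarrow> finite F \<Longrightarrow> F \<subseteq> S \<Longrightarrow> (\<Sum>i\<in>F. cmod (k i j)) \<le> C"
    and C: "0 \<le> C"
    and \<xi>: "\<xi> \<in> ell2 S"
  defines "z \<equiv> \<lambda>i. if i \<in> S then \<Sum>j | j \<in> S \<and> k i j \<noteq> 0. k i j * \<xi> j else 0"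
  shows "z \<in> ell2 S \<and> ell2_norm S z \<le> C * ell2_norm S \<xi>"
proof -
  let ?R = "\<lambda>i. {j \<in> S. k i j \<noteq> 0}"
  have "L2_set (\<lambda>i. cmod (z i)) F \<le> C * ell2_norm S \<xi>" if F: "finite F" "F \<subseteq> S" for F
  proof -
    \<comment> \<open>Schur test\<close>
    have pt: "(cmod (z i))\<^sup>2 \<le> C * (\<Sum>j\<in>?R i. cmod (k i j) * (cmod (\<xi> j))\<^sup>2)" if i: "i \<in> F" for i
    proof -
      have iS: "i \<in> S" using i F by auto
      have "cmod (z i) \<le> (\<Sum>j\<in>?R i. cmod (k i j) * cmod (\<xi> j))"
        using iS by (simp add: z_def norm_mult[symmetric] sum_norm_le)
      also have "\<dots> = (\<Sum>j\<in>?R i. \<bar>sqrt (cmod (k i j))\<bar> * \<bar>sqrt (cmod (k i j)) * cmod (\<xi> j)\<bar>)"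
        by (simp add: abs_mult mult.assoc[symmetric])
      also have "\<dots> \<le> L2_set (\<lambda>j. sqrt (cmod (k i j))) (?R i) * L2_set (\<lambda>j. sqrt (cmod (k i j)) * cmod (\<xi> j)) (?R i)"
        by (rule L2_set_mult_ineq)
      finally have "(cmod (z i))\<^sup>2 \<le> (L2_set (\<lambda>j. sqrt (cmod (k i j))) (?R i) * L2_set (\<lambda>j. sqrt (cmod (k i j)) * cmod (\<xi> j)) (?R i))\<^sup>2"
        by (intro power_mono) auto
      also have "\<dots> = (\<Sum>j\<in>?R i. cmod (k i j)) * (\<Sum>j\<in>?R i. cmod (k i j) * (cmod (\<xi> j))\<^sup>2)"
        by (simp add: power_mult_distrib L2_set_def sum_nonneg)
      also have "\<dots> \<le> C * (\<Sum>j\<in>?R i. cmod (k i j) * (cmod (\<xi> j))\<^sup>2)"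
        using row(2)[OF iS] by (intro mult_right_mono sum_nonneg) auto
      finally show ?thesis .
    qed
    define J where "J = (\<Union>i\<in>F. ?R i)"
    have J: "finite J" "J \<subseteq> S" using F row(1) by (auto simp: J_def)
    have "(\<Sum>i\<in>F. (cmod (z i))\<^sup>2) \<le> (\<Sum>i\<in>F. C * (\<Sum>j\<in>?R i. cmod (k i j) * (cmod (\<xi> j))\<^sup>2))"
      by (rule sum_mono) (rule pt)
    also have "\<dots> = (\<Sum>i\<in>F. C * (\<Sum>j\<in>J. cmod (k i j) * (cmod (\<xi> j))\<^sup>2))"
      by (intro sum.cong refl arg_cong2[where f = "(*)"] sum.mono_neutral_left) (use J F in \<open>auto simp: J_def\<close>)
    also have "\<dots> = C * (\<Sum>j\<in>J. (\<Sum>i\<in>F. cmod (k i j)) * (cmod (\<xi> j))\<^sup>2)"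
      by (simp add: sum_distrib_left[symmetric] sum_distrib_right sum.swap[of _ F J])
    also have "\<dots> \<le> C * (\<Sum>j\<in>J. C * (cmod (\<xi> j))\<^sup>2)"
      using col[OF _ F] J C by (intro mult_left_mono sum_mono mult_right_mono) auto
    also have "\<dots> = C\<^sup>2 * (L2_set (\<lambda>j. cmod (\<xi> j)) J)\<^sup>2"
      by (simp add: L2_set_def sum_nonneg power2_eq_square sum_distrib_left mult_ac)
    also have "\<dots> \<le> C\<^sup>2 * (ell2_norm S \<xi>)\<^sup>2"
      by (intro mult_left_mono power_mono L2_set_le_ell2_norm \<xi> J) auto
    finally have "(\<Sum>i\<in>F. (cmod (z i))\<^sup>2) \<le> (C * ell2_norm S \<xi>)\<^sup>2" by (simp add: power_mult_distrib)
    then show ?thesis unfolding L2_set_def using C by (intro real_le_lsqrt sum_nonneg) auto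
  qed
  then show ?thesis by (intro conjI ell2_boundedI) (auto simp: z_def)
qed

context lch_etale
begin

section \<open>Compactly supported functions\<close>

lemma CcI:
  assumes "continuous_map T euclidean f" "compactin T K" "\<And>\<gamma>. \<gamma> \<notin> K \<Longrightarrow> f \<gamma> = 0"
  shows "f \<in> Cc G"
proof -
  have K: "closedin T K" "K \<subseteq> arr" using compactin_imp_closedin[OF haus assms(2)] compactin_subset_topspace[OF assms(2)]
    by (auto simp: arr_top)
  have "{\<gamma> \<in> arrows G. f \<gamma> \<noteq> 0} \<subseteq> K" using assms(3) by auto
  then have "T closure_of {\<gamma> \<in> arrows G. f \<gamma> \<noteq> 0} \<subseteq> K" using closure_of_minimal K(1) by blast
  then have "compactin T (T closure_of {\<gamma> \<in> arrows G. f \<gamma> \<noteq> 0})"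
    using closed_compactin[OF assms(2) _ closedin_closure_of] by blast
  then show ?thesis using assms K by (auto simp: Cc_def)
qed

lemma Cc_vanish: "f \<in> Cc G \<Longrightarrow> \<gamma> \<notin> arr \<Longrightarrow> f \<gamma> = 0"
  and Cc_continuous: "f \<in> Cc G \<Longrightarrow> continuous_map T euclidean f"
  by (auto simp: Cc_def)

lemma Cc_support:
  assumes "f \<in> Cc G" shows "\<exists>K. compactin T K \<and> (\<forall>\<gamma>. \<gamma> \<notin> K \<longrightarrow> f \<gamma> = 0)"
proof (intro exI conjI allI impI)
  show "compactin T (T closure_of {\<gamma> \<in> arr. f \<gamma> \<noteq> 0})" using assms by (simp add: Cc_def)
  fix \<gamma> assume n: "\<gamma> \<notin> T closure_of {\<gamma> \<in> arr. f \<gamma> \<noteq> 0}"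
  have "{\<gamma> \<in> arr. f \<gamma> \<noteq> 0} \<subseteq> T closure_of {\<gamma> \<in> arr. f \<gamma> \<noteq> 0}"
    by (rule closure_of_subset) (auto simp: arr_top)
  then show "f \<gamma> = 0" using n Cc_vanish[OF assms, of \<gamma>] by blast
qed

lemma Cc_zero [simp]: "(\<lambda>_. 0) \<in> Cc G"
  by (rule CcI[of _ "{}"]) auto

lemma Cc_add: assumes "f \<in> Cc G" "g \<in> Cc G" shows "(f \<^bold>+ g) \<in> Cc G"
proof -
  obtain K where K: "compactin T K" "\<forall>\<gamma>. \<gamma> \<notin> K \<longrightarrow> f \<gamma> = 0" using Cc_support[OF assms(1)] by blast
  obtain L where L: "compactin T L" "\<forall>\<gamma>. \<gamma> \<notin> L \<longrightarrow> g \<gamma> = 0" using Cc_support[OF assms(2)] by blast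
  show ?thesis
    by (rule CcI[OF continuous_map_add[OF Cc_continuous[OF assms(1)] Cc_continuous[OF assms(2)]] compactin_Un[OF K(1) L(1)]])
      (use K L in auto)
qed

lemma Cc_mult: assumes "f \<in> Cc G" "continuous_map T euclidean g" shows "(\<lambda>\<gamma>. g \<gamma> * f \<gamma>) \<in> Cc G"
proof -
  obtain K where K: "compactin T K" "\<forall>\<gamma>. \<gamma> \<notin> K \<longrightarrow> f \<gamma> = 0" using Cc_support[OF assms(1)] by blast
  show ?thesis
    by (rule CcI[OF continuous_map_complex_mult[OF assms(2) Cc_continuous[OF assms(1)]] K(1)]) (use K in auto)
qed

lemma Cc_scale: "f \<in> Cc G \<Longrightarrow> (\<lambda>\<gamma>. c * f \<gamma>) \<in> Cc G"
  by (rule Cc_mult) auto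

lemma Cc_diff: "f \<in> Cc G \<Longrightarrow> g \<in> Cc G \<Longrightarrow> (f \<^bold>- g) \<in> Cc G"
  using Cc_add[of f "\<lambda>\<gamma>. (-1) * g \<gamma>"] Cc_scale[of g "-1"] by simp

lemma Cc_sum: "(\<And>x. x \<in> I \<Longrightarrow> f x \<in> Cc G) \<Longrightarrow> (\<lambda>\<gamma>. \<Sum>x\<in>I. f x \<gamma>) \<in> Cc G"
  by (induction I rule: infinite_finite_induct) (auto intro: Cc_add)

lemma Cc_restrict:
  assumes f: "f \<in> Cc G" and A: "openin T A" "closedin T A"
  shows "restrict_fun A f \<in> Cc G"
proof -
  have "continuous_map T euclidean (\<lambda>\<gamma>. if \<gamma> \<in> A then 1 else (0::complex))"
  proof (rule continuous_map_locallyI)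
    fix x assume x: "x \<in> topspace T"
    show "\<exists>U. openin T U \<and> x \<in> U \<and> continuous_map (subtopology T U) euclidean (\<lambda>\<gamma>. if \<gamma> \<in> A then 1 else (0::complex))"
    proof (cases "x \<in> A")
      case True
      have "continuous_map (subtopology T A) euclidean (\<lambda>\<gamma>. if \<gamma> \<in> A then 1 else (0::complex))"
        by (rule continuous_map_eq[of _ _ "\<lambda>_. 1"]) auto
      then show ?thesis using True A by blast
    next
      case False
      have "continuous_map (subtopology T (topspace T - A)) euclidean (\<lambda>\<gamma>. if \<gamma> \<in> A then 1 else (0::complex))"
        by (rule continuous_map_eq[of _ _ "\<lambda>_. 0"]) auto
      then show ?thesis using False A x by (intro exI[of _ "topspace T - A"]) auto
    qed
  qed
  moreover have "restrict_fun A f = (\<lambda>\<gamma>. (if \<gamma> \<in> A then 1 else 0) * f \<gamma>)" by (auto simp: restrict_fun_def)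
  ultimately show ?thesis using Cc_mult[OF f] by simp
qed

lemma Cc_bounded: assumes "f \<in> Cc G" shows "\<exists>M. \<forall>\<gamma>. cmod (f \<gamma>) \<le> M"
proof -
  obtain K where K: "compactin T K" "\<forall>\<gamma>. \<gamma> \<notin> K \<longrightarrow> f \<gamma> = 0" using Cc_support[OF assms] by blast
  have "compact (f ` K)" using image_compactin[OF K(1) Cc_continuous[OF assms]] by simp
  then obtain M where M: "\<forall>x \<in> f ` K. cmod x \<le> M" using compact_imp_bounded bounded_iff by blast
  have "cmod (f \<gamma>) \<le> max M 0" for \<gamma> using M K(2) by (cases "\<gamma> \<in> K") auto
  then show ?thesis by blast
qed

lemma bisection_partition:
  assumes "compactin T K"
  shows "\<exists>(I :: 'g set) \<psi> L U. finite I \<and>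
    (\<forall>x \<in> I. continuous_map T euclideanreal (\<psi> x) \<and> compactin T (L x) \<and> L x \<subseteq> U x \<and> bisection (U x) \<and>
        (\<forall>y. 0 \<le> \<psi> x y) \<and> (\<forall>y. y \<notin> L x \<longrightarrow> \<psi> x y = 0)) \<and>
    (\<forall>y. (\<Sum>x\<in>I. \<psi> x y) \<le> 1) \<and> (\<forall>y \<in> K. (\<Sum>x\<in>I. \<psi> x y) = 1)"
proof -
  have "\<forall>x \<in> K. \<exists>U. bisection U \<and> x \<in> U"
    using bisection_exists compactin_subset_topspace[OF assms] by (auto simp: arr_top)
  then obtain U where U: "\<And>x. x \<in> K \<Longrightarrow> bisection (U x) \<and> x \<in> U x" by metis
  have "\<exists>I \<psi> L. finite I \<and> I \<subseteq> K \<and>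
    (\<forall>x \<in> I. continuous_map T euclideanreal (\<psi> x) \<and> compactin T (L x) \<and> L x \<subseteq> U x \<and>
        (\<forall>y. 0 \<le> \<psi> x y) \<and> (\<forall>y. y \<notin> L x \<longrightarrow> \<psi> x y = 0)) \<and>
    (\<forall>y. (\<Sum>x\<in>I. \<psi> x y) \<le> 1) \<and> (\<forall>y \<in> K. (\<Sum>x\<in>I. \<psi> x y) = 1)"
    by (rule partition_of_unity[OF assms]) (use U in \<open>auto simp: bisection_def\<close>)
  then obtain I \<psi> L where a: "finite I" "I \<subseteq> K" "\<forall>x\<in>I. continuous_map T euclideanreal (\<psi> x) \<and>
           compactin T (L x) \<and> L x \<subseteq> U x \<and> (\<forall>y. 0 \<le> \<psi> x y) \<and> (\<forall>y. y \<notin> L x \<longrightarrow> \<psi> x y = 0)"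
      "\<forall>y. (\<Sum>x\<in>I. \<psi> x y) \<le> 1" "\<forall>y\<in>K. (\<Sum>x\<in>I. \<psi> x y) = 1"
    by (elim exE conjE) (rule that)
  have b: "\<forall>x \<in> I. bisection (U x)" using U a(2) by blast
  show ?thesis
    by (rule exI[of _ I], rule exI[of _ \<psi>], rule exI[of _ L], rule exI[of _ U]) (simp add: a b)
qed

lemma Cc_decompose:
  assumes "f \<in> Cc G"
  shows "\<exists>(I :: 'g set) \<phi>. finite I \<and> (\<forall>x \<in> I. \<phi> x \<in> Cc G \<and>
      (\<exists>U L. bisection U \<and> compactin T L \<and> L \<subseteq> U \<and> (\<forall>\<gamma>. \<gamma> \<notin> L \<longrightarrow> \<phi> x \<gamma> = 0))) \<and> f = (\<lambda>\<gamma>. \<Sum>x\<in>I. \<phi> x \<gamma>)"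
proof -
  obtain K where K: "compactin T K" "\<forall>\<gamma>. \<gamma> \<notin> K \<longrightarrow> f \<gamma> = 0" using Cc_support[OF assms] by blast
  obtain I :: "'g set" and \<psi> L U where P: "finite I" "\<forall>x \<in> I. continuous_map T euclideanreal (\<psi> x) \<and> compactin T (L x) \<and> L x \<subseteq> U x \<and> bisection (U x) \<and>
        (\<forall>y. 0 \<le> \<psi> x y) \<and> (\<forall>y. y \<notin> L x \<longrightarrow> \<psi> x y = (0::real))" "\<forall>y \<in> K. (\<Sum>x\<in>I. \<psi> x y) = 1"
    using bisection_partition[OF K(1)] by blast
  have "continuous_map T euclidean (cplx (\<psi> x))" if "x \<in> I" for x
    by (rule continuous_map_compose_euclidean) (use P that in \<open>auto intro!: continuous_intros\<close>)
  then have 1: "(\<lambda>\<gamma>. complex_of_real (\<psi> x \<gamma>) * f \<gamma>) \<in> Cc G" if "x \<in> I" for x using Cc_mult[OF assms] that by blast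
  have 2: "f \<gamma> = (\<Sum>x\<in>I. complex_of_real (\<psi> x \<gamma>) * f \<gamma>)" for \<gamma>
  proof -
    have "(\<Sum>x\<in>I. complex_of_real (\<psi> x \<gamma>) * f \<gamma>) = complex_of_real (\<Sum>x\<in>I. \<psi> x \<gamma>) * f \<gamma>"
      by (simp add: sum_distrib_right)
    then show ?thesis using P(3) K(2) by (cases "\<gamma> \<in> K") auto
  qed
  have 3: "\<exists>V M. bisection V \<and> compactin T M \<and> M \<subseteq> V \<and> (\<forall>\<gamma>. \<gamma> \<notin> M \<longrightarrow> complex_of_real (\<psi> x \<gamma>) * f \<gamma> = 0)" if "x \<in> I" for x
    using P(2) that by (intro exI[of _ "U x"] exI[of _ "L x"]) auto
  show ?thesis
    by (rule exI[of _ I], rule exI[of _ "\<lambda>x \<gamma>. complex_of_real (\<psi> x \<gamma>) * f \<gamma>"], intro conjI ballI)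
      (fact P(1), fact 1, fact 3, rule ext, fact 2)
qed

text \<open>A bisection meets each source fibre and each range fibre at most once, so the number of
  bisections in a decomposition bounds all fibres uniformly.\<close>

lemma Cc_fibres_finite:
  assumes "f \<in> Cc G"
  shows "\<exists>N. \<forall>u. finite {\<gamma> \<in> src_fibre G u. f \<gamma> \<noteq> 0} \<and> card {\<gamma> \<in> src_fibre G u. f \<gamma> \<noteq> 0} \<le> N \<and>
     finite {\<gamma> \<in> rng_fibre G u. f \<gamma> \<noteq> 0} \<and> card {\<gamma> \<in> rng_fibre G u. f \<gamma> \<noteq> 0} \<le> N"
proof -
  obtain I :: "'g set" and \<phi> where I: "finite I" "\<forall>x \<in> I. \<phi> x \<in> Cc G \<and>
      (\<exists>U L. bisection U \<and> compactin T L \<and> L \<subseteq> U \<and> (\<forall>\<gamma>. \<gamma> \<notin> L \<longrightarrow> \<phi> x \<gamma> = 0))" "f = (\<lambda>\<gamma>. \<Sum>x\<in>I. \<phi> x \<gamma>)"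
    using Cc_decompose[OF assms] by blast
  have "\<exists>U. bisection U \<and> (\<forall>\<gamma>. \<gamma> \<notin> U \<longrightarrow> \<phi> x \<gamma> = 0)" if "x \<in> I" for x
    using I(2) that by (meson subsetD)
  then obtain U where U: "\<And>x. x \<in> I \<Longrightarrow> bisection (U x) \<and> (\<forall>\<gamma>. \<gamma> \<notin> U x \<longrightarrow> \<phi> x \<gamma> = 0)" by metis
  have *: "finite {\<gamma>. p \<gamma> = u \<and> f \<gamma> \<noteq> 0} \<and> card {\<gamma>. p \<gamma> = u \<and> f \<gamma> \<noteq> 0} \<le> card I" if p: "\<And>x. x \<in> I \<Longrightarrow> inj_on p (U x)" for p u
  proof -
    let ?V = "\<lambda>x. {\<gamma> \<in> U x. p \<gamma> = u}"
    have sub: "{\<gamma>. p \<gamma> = u \<and> f \<gamma> \<noteq> 0} \<subseteq> (\<Union>x\<in>I. ?V x)"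
    proof
      fix \<gamma> assume g: "\<gamma> \<in> {\<gamma>. p \<gamma> = u \<and> f \<gamma> \<noteq> 0}"
      then obtain x where "x \<in> I" "\<phi> x \<gamma> \<noteq> 0" unfolding I(3) by (auto elim: sum.not_neutral_contains_not_neutral)
      then show "\<gamma> \<in> (\<Union>x\<in>I. ?V x)" using g U by auto
    qed
    have V: "finite (?V x) \<and> card (?V x) \<le> 1" if "x \<in> I" for x
    proof -
      have "\<gamma> = \<gamma>'" if "\<gamma> \<in> ?V x" "\<gamma>' \<in> ?V x" for \<gamma> \<gamma>'
        using p[OF \<open>x \<in> I\<close>] that by (auto dest: inj_onD)
      then have "?V x = {} \<or> (\<exists>\<gamma>. ?V x = {\<gamma>})" by blast
      then show ?thesis
      proof (elim disjE exE)
        assume e: "?V x = {}" show ?thesis unfolding e by simp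
      next
        fix \<gamma> assume e: "?V x = {\<gamma>}" show ?thesis unfolding e by simp
      qed
    qed
    have fin: "finite (\<Union>x\<in>I. ?V x)" using I(1) V by blast
    have "card (\<Union>x\<in>I. ?V x) \<le> (\<Sum>x\<in>I. card (?V x))" by (rule card_UN_le[OF I(1)])
    also have "\<dots> \<le> (\<Sum>x\<in>I. 1)" by (rule sum_mono) (use V in blast)
    finally have "card (\<Union>x\<in>I. ?V x) \<le> card I" by simp
    then show ?thesis using finite_subset[OF sub fin] card_mono[OF fin sub] by linarith
  qed
  have 1: "{\<gamma> \<in> src_fibre G u. f \<gamma> \<noteq> 0} = {\<gamma>. s \<gamma> = u \<and> f \<gamma> \<noteq> 0}" "{\<gamma> \<in> rng_fibre G u. f \<gamma> \<noteq> 0} = {\<gamma>. r \<gamma> = u \<and> f \<gamma> \<noteq> 0}" for u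
    using Cc_vanish[OF assms] by (auto simp: src_fibre_def rng_fibre_def)
  show ?thesis unfolding 1 using *[of s] *[of r] U by (intro exI[of _ "card I"]) (auto simp: bisection_def)
qed

lemma Cc_src_finite: "f \<in> Cc G \<Longrightarrow> finite {\<gamma> \<in> src_fibre G u. f \<gamma> \<noteq> 0}"
  and Cc_rng_finite: "f \<in> Cc G \<Longrightarrow> finite {\<gamma> \<in> rng_fibre G u. f \<gamma> \<noteq> 0}"
  using Cc_fibres_finite by blast+

lemma infsum_finite_support:
  assumes "finite {x \<in> A. f x \<noteq> 0}" shows "infsum f A = (\<Sum>x | x \<in> A \<and> f x \<noteq> 0. f x)"
proof -
  have "infsum f A = infsum f {x \<in> A. f x \<noteq> 0}" by (rule infsum_cong_neutral) auto
  then show ?thesis using assms by simp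
qed

text \<open>The bound of the \<open>I\<close>-norm, as a predicate that does not degenerate for the empty groupoid.\<close>

definition I_bounded_by :: "('g \<Rightarrow> complex) \<Rightarrow> real \<Rightarrow> bool" where
  "I_bounded_by f C \<longleftrightarrow> 0 \<le> C \<and> (\<forall>u F. finite F \<longrightarrow> F \<subseteq> src_fibre G u \<longrightarrow> (\<Sum>\<gamma>\<in>F. cmod (f \<gamma>)) \<le> C) \<and>
     (\<forall>u F. finite F \<longrightarrow> F \<subseteq> rng_fibre G u \<longrightarrow> (\<Sum>\<gamma>\<in>F. cmod (f \<gamma>)) \<le> C)"

lemma I_bounded_by_nonneg: "I_bounded_by f C \<Longrightarrow> 0 \<le> C"
  and I_bounded_by_src: "I_bounded_by f C \<Longrightarrow> finite F \<Longrightarrow> F \<subseteq> src_fibre G u \<Longrightarrow> (\<Sum>\<gamma>\<in>F. cmod (f \<gamma>)) \<le> C"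
  and I_bounded_by_rng: "I_bounded_by f C \<Longrightarrow> finite F \<Longrightarrow> F \<subseteq> rng_fibre G u \<Longrightarrow> (\<Sum>\<gamma>\<in>F. cmod (f \<gamma>)) \<le> C"
  unfolding I_bounded_by_def by blast+

lemma Cc_infsum_norm:
  assumes "f \<in> Cc G"
  shows "(\<Sum>\<^sub>\<infinity>\<gamma>\<in>src_fibre G u. cmod (f \<gamma>)) = (\<Sum>\<gamma> | \<gamma> \<in> src_fibre G u \<and> f \<gamma> \<noteq> 0. cmod (f \<gamma>))"
    "(\<Sum>\<^sub>\<infinity>\<gamma>\<in>rng_fibre G u. cmod (f \<gamma>)) = (\<Sum>\<gamma> | \<gamma> \<in> rng_fibre G u \<and> f \<gamma> \<noteq> 0. cmod (f \<gamma>))"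
  by (subst infsum_finite_support; simp add: Cc_src_finite[OF assms] Cc_rng_finite[OF assms])+

lemma Cc_sum_norm_le:
  assumes "f \<in> Cc G" "finite F"
  shows "F \<subseteq> src_fibre G u \<Longrightarrow> (\<Sum>\<gamma>\<in>F. cmod (f \<gamma>)) \<le> (\<Sum>\<^sub>\<infinity>\<gamma>\<in>src_fibre G u. cmod (f \<gamma>))"
    "F \<subseteq> rng_fibre G u \<Longrightarrow> (\<Sum>\<gamma>\<in>F. cmod (f \<gamma>)) \<le> (\<Sum>\<^sub>\<infinity>\<gamma>\<in>rng_fibre G u. cmod (f \<gamma>))"
proof -
  have *: "(\<Sum>\<gamma>\<in>F. cmod (f \<gamma>)) \<le> (\<Sum>\<gamma> | \<gamma> \<in> A \<and> f \<gamma> \<noteq> 0. cmod (f \<gamma>))" if "F \<subseteq> A" "finite {\<gamma> \<in> A. f \<gamma> \<noteq> 0}" for A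
  proof -
    have "(\<Sum>\<gamma>\<in>F. cmod (f \<gamma>)) = (\<Sum>\<gamma>\<in>{\<gamma>\<in>F. f \<gamma> \<noteq> 0}. cmod (f \<gamma>))"
      by (rule sum.mono_neutral_right) (use assms in auto)
    also have "\<dots> \<le> (\<Sum>\<gamma> | \<gamma> \<in> A \<and> f \<gamma> \<noteq> 0. cmod (f \<gamma>))"
      by (rule sum_mono2) (use that in auto)
    finally show ?thesis .
  qed
  show "F \<subseteq> src_fibre G u \<Longrightarrow> (\<Sum>\<gamma>\<in>F. cmod (f \<gamma>)) \<le> (\<Sum>\<^sub>\<infinity>\<gamma>\<in>src_fibre G u. cmod (f \<gamma>))"
    "F \<subseteq> rng_fibre G u \<Longrightarrow> (\<Sum>\<gamma>\<in>F. cmod (f \<gamma>)) \<le> (\<Sum>\<^sub>\<infinity>\<gamma>\<in>rng_fibre G u. cmod (f \<gamma>))"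
    using * Cc_src_finite[OF assms(1)] Cc_rng_finite[OF assms(1)] by (simp_all add: Cc_infsum_norm[OF assms(1)])
qed

lemma I_bounded_by_exists: assumes "f \<in> Cc G" shows "\<exists>C. I_bounded_by f C"
proof -
  obtain N where N: "\<And>u. finite {\<gamma> \<in> src_fibre G u. f \<gamma> \<noteq> 0} \<and> card {\<gamma> \<in> src_fibre G u. f \<gamma> \<noteq> 0} \<le> N \<and>
     finite {\<gamma> \<in> rng_fibre G u. f \<gamma> \<noteq> 0} \<and> card {\<gamma> \<in> rng_fibre G u. f \<gamma> \<noteq> 0} \<le> N"
    using Cc_fibres_finite[OF assms] by blast
  obtain M where M: "\<And>\<gamma>. cmod (f \<gamma>) \<le> M" using Cc_bounded[OF assms] by blast
  have M0: "0 \<le> M" using M norm_ge_zero order_trans by blast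
  have *: "(\<Sum>\<gamma>\<in>A. cmod (f \<gamma>)) \<le> N * M" if "card A \<le> N" for A
  proof -
    have "(\<Sum>\<gamma>\<in>A. cmod (f \<gamma>)) \<le> of_nat (card A) * M" by (rule sum_bounded_above) (rule M)
    also have "\<dots> \<le> N * M" using that M0 by (intro mult_right_mono) auto
    finally show ?thesis .
  qed
  show ?thesis
    unfolding I_bounded_by_def
  proof (intro exI[of _ "N * M"] conjI allI impI)
    fix u :: 'g and F :: "'g set" assume F: "finite F"
    show "F \<subseteq> src_fibre G u \<Longrightarrow> (\<Sum>\<gamma>\<in>F. cmod (f \<gamma>)) \<le> N * M"
      using Cc_sum_norm_le(1)[OF assms F, of u] *[of "{\<gamma> \<in> src_fibre G u. f \<gamma> \<noteq> 0}"] N[of u]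
      by (simp add: Cc_infsum_norm[OF assms])
    show "F \<subseteq> rng_fibre G u \<Longrightarrow> (\<Sum>\<gamma>\<in>F. cmod (f \<gamma>)) \<le> N * M"
      using Cc_sum_norm_le(2)[OF assms F, of u] *[of "{\<gamma> \<in> rng_fibre G u. f \<gamma> \<noteq> 0}"] N[of u]
      by (simp add: Cc_infsum_norm[OF assms])
  qed (use M0 in auto)
qed

lemma I_bounded_by_infsum:
  assumes "f \<in> Cc G" "I_bounded_by f C"
  shows "(\<Sum>\<^sub>\<infinity>\<gamma>\<in>src_fibre G u. cmod (f \<gamma>)) \<le> C" "(\<Sum>\<^sub>\<infinity>\<gamma>\<in>rng_fibre G u. cmod (f \<gamma>)) \<le> C"
  unfolding Cc_infsum_norm[OF assms(1)]
  using I_bounded_by_src[OF assms(2) Cc_src_finite[OF assms(1)]] I_bounded_by_rng[OF assms(2) Cc_rng_finite[OF assms(1)]] by auto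

lemma I_norm_le: "units G \<noteq> {} \<Longrightarrow> f \<in> Cc G \<Longrightarrow> I_bounded_by f C \<Longrightarrow> I_norm G f \<le> C"
  unfolding I_norm_def using I_bounded_by_infsum by (intro cSUP_least) auto

lemma I_bounded_by_I_norm:
  assumes "units G \<noteq> {}" "f \<in> Cc G" shows "I_bounded_by f (I_norm G f)"
proof -
  obtain C where C: "I_bounded_by f C" using I_bounded_by_exists[OF assms(2)] by blast
  let ?m = "\<lambda>u. max (\<Sum>\<^sub>\<infinity>\<gamma>\<in>src_fibre G u. cmod (f \<gamma>)) (\<Sum>\<^sub>\<infinity>\<gamma>\<in>rng_fibre G u. cmod (f \<gamma>))"
  have b: "bdd_above (?m ` units G)" using I_bounded_by_infsum[OF assms(2) C] by (intro bdd_aboveI2[of _ _ C]) auto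
  have m: "?m u \<le> I_norm G f" if "u \<in> units G" for u
    unfolding I_norm_def by (rule cSUP_upper[OF that b])
  have "0 \<le> ?m u" for u by (simp add: infsum_nonneg le_max_iff_disj)
  then have n: "0 \<le> I_norm G f" using m assms(1) order_trans by blast
  have *: "(\<Sum>\<gamma>\<in>F. cmod (f \<gamma>)) \<le> I_norm G f" if F: "finite F" "F \<subseteq> src_fibre G u \<or> F \<subseteq> rng_fibre G u" for F u
  proof (cases "u \<in> units G")
    case True
    then show ?thesis using Cc_sum_norm_le[OF assms(2) F(1), of u] F(2) m[OF True] by fastforce
  next
    case False
    then have "F = {}" using F(2) by (auto simp: src_fibre_def rng_fibre_def)
    then show ?thesis using n by simp
  qed
  show ?thesis unfolding I_bounded_by_def using n * by blast
qed

section \<open>Convolution and involution\<close>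

lemma convolution_Cc:
  assumes "g \<in> Cc G" "\<gamma> \<in> arr"
  shows "(f \<star> g) \<gamma> = (\<Sum>\<beta> | \<beta> \<in> src_fibre G (s \<gamma>) \<and> g \<beta> \<noteq> 0. f (\<gamma> \<odot> iv \<beta>) * g \<beta>)"
proof -
  have "(f \<star> g) \<gamma> = infsum (\<lambda>\<beta>. f (\<gamma> \<odot> iv \<beta>) * g \<beta>) {\<beta> \<in> src_fibre G (s \<gamma>). g \<beta> \<noteq> 0}"
    unfolding convolution_src[OF assms(2)] by (rule infsum_cong_neutral) auto
  then show ?thesis using Cc_src_finite[OF assms(1)] by simp
qed

lemma convolution_Cc_rng:
  assumes "f \<in> Cc G" "\<gamma> \<in> arr"
  shows "(f \<star> g) \<gamma> = (\<Sum>\<alpha> | \<alpha> \<in> rng_fibre G (r \<gamma>) \<and> f \<alpha> \<noteq> 0. f \<alpha> * g (iv \<alpha> \<odot> \<gamma>))"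
proof -
  have "(f \<star> g) \<gamma> = infsum (\<lambda>\<alpha>. f \<alpha> * g (iv \<alpha> \<odot> \<gamma>)) {\<alpha> \<in> rng_fibre G (r \<gamma>). f \<alpha> \<noteq> 0}"
    unfolding convolution_rng[OF assms(2)] by (rule infsum_cong_neutral) auto
  then show ?thesis using Cc_rng_finite[OF assms(1)] by simp
qed

lemma convolution_sum_left:
  assumes "g \<in> Cc G"
  shows "(\<lambda>\<gamma>. \<Sum>x\<in>I. \<phi> x \<gamma>) \<star> g = (\<lambda>\<gamma>. \<Sum>x\<in>I. (\<phi> x \<star> g) \<gamma>)"
proof
  fix \<gamma> show "((\<lambda>\<gamma>. \<Sum>x\<in>I. \<phi> x \<gamma>) \<star> g) \<gamma> = (\<Sum>x\<in>I. (\<phi> x \<star> g) \<gamma>)"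
  proof (cases "\<gamma> \<in> arr")
    case True then show ?thesis
      by (simp add: convolution_Cc[OF assms] sum_distrib_right sum.swap[of _ I])
  qed (simp add: convolution_off)
qed

text \<open>Composable pairs form a closed set by the Hausdorff property, so those in
  \<open>K \<times> L\<close> form a compact set, and multiplication is continuous on it.\<close>

lemma product_compact:
  assumes "compactin T K" "compactin T L"
  shows "compactin T {\<alpha> \<odot> \<beta> |\<alpha> \<beta>. \<alpha> \<in> K \<and> \<beta> \<in> L \<and> s \<alpha> = r \<beta>}"
proof -
  let ?P = "prod_topology T T"
  have "closedin ?P {p \<in> topspace ?P. (s \<circ> fst) p = (r \<circ> snd) p}"
    by (rule closedin_continuous_maps_eq[OF haus]) (intro continuous_map_compose[OF continuous_map_fst src_cont]
        continuous_map_compose[OF continuous_map_snd rng_cont])+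
  moreover have "{p \<in> topspace ?P. (s \<circ> fst) p = (r \<circ> snd) p} = composable G"
    by (auto simp: composable_def arr_top)
  ultimately have "compactin ?P ((K \<times> L) \<inter> composable G)"
    using assms by (intro compact_Int_closedin) (auto simp: compactin_Times)
  then have "compactin (subtopology ?P (composable G)) ((K \<times> L) \<inter> composable G)"
    by (simp add: compactin_subtopology)
  from image_compactin[OF this mult_cont]
  have "compactin T ((\<lambda>(\<alpha>, \<beta>). \<alpha> \<odot> \<beta>) ` ((K \<times> L) \<inter> composable G))" .
  moreover have "(\<lambda>(\<alpha>, \<beta>). \<alpha> \<odot> \<beta>) ` ((K \<times> L) \<inter> composable G) = {\<alpha> \<odot> \<beta> |\<alpha> \<beta>. \<alpha> \<in> K \<and> \<beta> \<in> L \<and> s \<alpha> = r \<beta>}"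
    using compactin_subset_topspace[OF assms(1)] compactin_subset_topspace[OF assms(2)]
    by (auto simp: composable_def arr_top image_iff)
  ultimately show ?thesis by simp
qed

lemma convolution_support:
  assumes "f \<in> Cc G" "\<And>\<gamma>. \<gamma> \<notin> K \<Longrightarrow> f \<gamma> = 0" "\<And>\<gamma>. \<gamma> \<notin> L \<Longrightarrow> g \<gamma> = 0"
    "\<gamma> \<notin> {\<alpha> \<odot> \<beta> |\<alpha> \<beta>. \<alpha> \<in> K \<and> \<beta> \<in> L \<and> s \<alpha> = r \<beta>}"
  shows "(f \<star> g) \<gamma> = 0"
proof (cases "\<gamma> \<in> arr")
  case True
  have "f \<alpha> * g (iv \<alpha> \<odot> \<gamma>) = 0" if "\<alpha> \<in> rng_fibre G (r \<gamma>)" for \<alpha>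
  proof (rule ccontr)
    assume "f \<alpha> * g (iv \<alpha> \<odot> \<gamma>) \<noteq> 0"
    then have "\<alpha> \<in> K" "iv \<alpha> \<odot> \<gamma> \<in> L" using assms(2,3) by force+
    moreover have "\<gamma> = \<alpha> \<odot> (iv \<alpha> \<odot> \<gamma>)" "s \<alpha> = r (iv \<alpha> \<odot> \<gamma>)" using that True by (auto simp: rng_fibre_def)
    ultimately show False using assms(4) by blast
  qed
  then show ?thesis unfolding convolution_Cc_rng[OF assms(1) True] by (intro sum.neutral) auto
qed (simp add: convolution_off)

text \<open>When \<open>f\<close> is supported in a bisection, the sum at \<open>\<gamma>\<close>
  reduces to the term whose first factor is the local section at \<open>r \<gamma>\<close>, a
  continuous expression. Where no section is available the convolution vanishes in a neighbourhood,
  because the range image of the compact set \<open>L\<close> is closed.\<close>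

lemma convolution_bisection_continuous:
  assumes f: "f \<in> Cc G" and g: "g \<in> Cc G" and U: "bisection U" and L: "compactin T L" "L \<subseteq> U" "\<And>\<gamma>. \<gamma> \<notin> L \<Longrightarrow> f \<gamma> = 0"
  shows "continuous_map T euclidean (f \<star> g)"
proof (rule continuous_map_locallyI)
  fix x assume x: "x \<in> topspace T"
  have Uo: "openin T U" using U by (simp add: bisection_def)
  have Ut: "U \<subseteq> arr" using openin_subset[OF Uo] by (simp add: arr_top)
  obtain \<sigma> where \<sigma>: "continuous_map (subtopology T (r ` U)) T \<sigma>" "\<And>x. x \<in> r ` U \<Longrightarrow> \<sigma> x \<in> U \<and> r (\<sigma> x) = x" "\<And>\<alpha>. \<alpha> \<in> U \<Longrightarrow> \<sigma> (r \<alpha>) = \<alpha>"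
    using bisection_section[OF U] by blast
  let ?W = "{\<gamma> \<in> arr. r \<gamma> \<in> r ` U}"
  show "\<exists>V. openin T V \<and> x \<in> V \<and> continuous_map (subtopology T V) euclidean (f \<star> g)"
  proof (cases "x \<in> ?W")
    case True
    have Wo: "openin T ?W" by (rule preimage_open[OF rng_open[OF Uo]])
    have rW: "continuous_map (subtopology T ?W) (subtopology T (r ` U)) r"
      by (rule continuous_map_into_subtopology) (auto intro: continuous_map_from_subtopology rng_cont)
    have \<sigma>W: "continuous_map (subtopology T ?W) T (\<lambda>\<gamma>. \<sigma> (r \<gamma>))"
      using continuous_map_compose[OF rW \<sigma>(1)] by (simp add: o_def)
    have c: "continuous_map (subtopology T ?W) T (\<lambda>\<gamma>. iv (\<sigma> (r \<gamma>)) \<odot> \<gamma>)"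
    proof (rule mult_cont')
      show "continuous_map (subtopology T ?W) T (\<lambda>\<gamma>. iv (\<sigma> (r \<gamma>)))"
        using continuous_map_compose[OF \<sigma>W inv_cont] by (simp add: o_def)
      show "continuous_map (subtopology T ?W) T (\<lambda>x. x)" by (rule continuous_map_from_subtopology) auto
      fix x assume "x \<in> topspace (subtopology T ?W)"
      then have "r x \<in> r ` U" by auto
      then show "s (iv (\<sigma> (r x))) = r x" using \<sigma>(2)[of "r x"] Ut by (auto simp: subset_iff)
    qed
    have "continuous_map (subtopology T ?W) euclidean (\<lambda>\<gamma>. f (\<sigma> (r \<gamma>)) * g (iv (\<sigma> (r \<gamma>)) \<odot> \<gamma>))"
      using continuous_map_compose[OF \<sigma>W Cc_continuous[OF f]] continuous_map_compose[OF c Cc_continuous[OF g]]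
      by (intro continuous_map_complex_mult) (simp_all add: o_def)
    moreover have "(f \<star> g) \<gamma> = f (\<sigma> (r \<gamma>)) * g (iv (\<sigma> (r \<gamma>)) \<odot> \<gamma>)" if "\<gamma> \<in> topspace (subtopology T ?W)" for \<gamma>
    proof -
      have \<gamma>: "\<gamma> \<in> arr" "r \<gamma> \<in> r ` U" using that by auto
      note sg = \<sigma>(2)[OF \<gamma>(2)]
      have sub: "{\<alpha> \<in> rng_fibre G (r \<gamma>). f \<alpha> \<noteq> 0} \<subseteq> {\<sigma> (r \<gamma>)}"
        using \<sigma>(3) L by (auto simp: rng_fibre_def) (metis subsetD)
      have "(f \<star> g) \<gamma> = (\<Sum>\<alpha>\<in>{\<sigma> (r \<gamma>)}. f \<alpha> * g (iv \<alpha> \<odot> \<gamma>))"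
        unfolding convolution_Cc_rng[OF f \<gamma>(1)]
        by (rule sum.mono_neutral_left) (use sub sg Ut in \<open>auto simp: rng_fibre_def subset_iff\<close>)
      then show ?thesis by simp
    qed
    ultimately have "continuous_map (subtopology T ?W) euclidean (f \<star> g)"
      by (metis (no_types, lifting) continuous_map_eq)
    with Wo True show ?thesis by blast
  next
    case False
    let ?V = "{\<gamma> \<in> arr. r \<gamma> \<in> topspace T - r ` L}"
    have "closedin T (r ` L)" by (rule compactin_imp_closedin[OF haus image_compactin[OF L(1) rng_cont]])
    then have "openin T ?V" by (intro preimage_open) (simp add: openin_diff)
    moreover have "x \<in> ?V" using False x L(2) by (auto simp flip: arr_top)
    moreover have "continuous_map (subtopology T ?V) euclidean (f \<star> g)"
    proof (rule continuous_map_eq)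
      show "continuous_map (subtopology T ?V) euclidean (\<lambda>_. 0 :: complex)" by simp
      fix \<gamma> assume "\<gamma> \<in> topspace (subtopology T ?V)"
      then have \<gamma>V: "\<gamma> \<in> ?V" by simp
      have "f \<alpha> = 0" if "r \<alpha> = r \<gamma>" for \<alpha>
      proof -
        have "\<alpha> \<notin> L" using \<gamma>V that by (auto simp: image_iff)
        then show ?thesis by (rule L(3))
      qed
      then have e: "{\<alpha> \<in> rng_fibre G (r \<gamma>). f \<alpha> \<noteq> 0} = {}" by (auto simp: rng_fibre_def)
      have "\<gamma> \<in> arr" using \<gamma>V by simp
      show "0 = (f \<star> g) \<gamma>" unfolding convolution_Cc_rng[OF f \<open>\<gamma> \<in> arr\<close>] e by simp
    qed
    ultimately show ?thesis by blast
  qed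
qed

lemma Cc_convolution:
  assumes f: "f \<in> Cc G" and g: "g \<in> Cc G" shows "f \<star> g \<in> Cc G"
proof -
  obtain I :: "'g set" and \<phi> where I: "finite I" "\<forall>x \<in> I. \<phi> x \<in> Cc G \<and> (\<exists>U L. bisection U \<and> compactin T L \<and> L \<subseteq> U \<and> (\<forall>\<gamma>. \<gamma> \<notin> L \<longrightarrow> \<phi> x \<gamma> = 0))"
    "f = (\<lambda>\<gamma>. \<Sum>x\<in>I. \<phi> x \<gamma>)"
    using Cc_decompose[OF f] by blast
  obtain M where M: "compactin T M" "\<forall>\<gamma>. \<gamma> \<notin> M \<longrightarrow> g \<gamma> = 0" using Cc_support[OF g] by blast
  have "\<phi> x \<star> g \<in> Cc G" if x: "x \<in> I" for x
  proof -
    obtain U L where UL: "bisection U" "compactin T L" "L \<subseteq> U" "\<forall>\<gamma>. \<gamma> \<notin> L \<longrightarrow> \<phi> x \<gamma> = 0" using I(2) x by blast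
    have \<phi>: "\<phi> x \<in> Cc G" using I(2) x by blast
    show ?thesis
      by (rule CcI[OF convolution_bisection_continuous[OF \<phi> g UL(1-3)] product_compact[OF UL(2) M(1)]])
        (use UL(4) M(2) convolution_support[OF \<phi>, of L M g] in auto)
  qed
  then show ?thesis unfolding I(3) convolution_sum_left[OF g] by (rule Cc_sum)
qed

lemma Cc_involution: assumes f: "f \<in> Cc G" shows "involution G f \<in> Cc G"
proof -
  obtain K where K: "compactin T K" "\<forall>\<gamma>. \<gamma> \<notin> K \<longrightarrow> f \<gamma> = 0" using Cc_support[OF f] by blast
  have "continuous_map T euclidean (\<lambda>\<gamma>. cnj (f (iv \<gamma>)))"
    using continuous_map_compose[OF inv_cont Cc_continuous[OF f]]
    by (intro continuous_map_compose_euclidean[where h = cnj]) (auto simp: o_def intro!: continuous_intros)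
  then have "continuous_map T euclidean (involution G f)"
    by (rule continuous_map_eq) (simp add: involution_def arr_top)
  moreover have "compactin T (iv ` K)" by (rule image_compactin[OF K(1) inv_cont])
  moreover have "involution G f \<gamma> = 0" if "\<gamma> \<notin> iv ` K" for \<gamma>
  proof (cases "\<gamma> \<in> arr")
    case True
    then have "iv \<gamma> \<notin> K" using that inv_inv[of \<gamma>] by (metis image_eqI)
    then show ?thesis using K(2) by (simp add: involution_def)
  qed (simp add: involution_def)
  ultimately show ?thesis by (rule CcI)
qed

text \<open>Exchange the two sums: right translation by \<open>iv \<beta>\<close> maps a source
  fibre injectively into another one, and left translation does the same for range fibres.\<close>

lemma I_bounded_by_convolution:
  assumes f: "f \<in> Cc G" "I_bounded_by f C" and g: "g \<in> Cc G" "I_bounded_by g D"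
  shows "I_bounded_by (f \<star> g) (C * D)"
  unfolding I_bounded_by_def
proof (intro conjI allI impI)
  show "0 \<le> C * D" using I_bounded_by_nonneg f(2) g(2) by simp
  note fb = I_bounded_by_src[OF f(2)] I_bounded_by_rng[OF f(2)]
    and gb = I_bounded_by_src[OF g(2)] I_bounded_by_rng[OF g(2)]
    and C = I_bounded_by_nonneg[OF f(2)] and D = I_bounded_by_nonneg[OF g(2)]
  fix u :: 'g and F :: "'g set" assume F: "finite F"
  {
    assume Fs: "F \<subseteq> src_fibre G u"
    let ?A = "{\<beta> \<in> src_fibre G u. g \<beta> \<noteq> 0}"
    have "(\<Sum>\<gamma>\<in>F. cmod ((f \<star> g) \<gamma>)) \<le> (\<Sum>\<gamma>\<in>F. \<Sum>\<beta>\<in>?A. cmod (f (\<gamma> \<odot> iv \<beta>)) * cmod (g \<beta>))"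
    proof (rule sum_mono)
      fix \<gamma> assume "\<gamma> \<in> F"
      then have \<gamma>: "\<gamma> \<in> arr" "s \<gamma> = u" using Fs by (auto simp: src_fibre_def)
      show "cmod ((f \<star> g) \<gamma>) \<le> (\<Sum>\<beta>\<in>?A. cmod (f (\<gamma> \<odot> iv \<beta>)) * cmod (g \<beta>))"
        unfolding convolution_Cc[OF g(1) \<gamma>(1)] norm_mult[symmetric] \<gamma>(2) by (rule norm_sum)
    qed
    also have "\<dots> = (\<Sum>\<beta>\<in>?A. (\<Sum>\<gamma>\<in>F. cmod (f (\<gamma> \<odot> iv \<beta>))) * cmod (g \<beta>))"
      by (simp add: sum_distrib_right sum.swap[of _ F])
    also have "\<dots> \<le> (\<Sum>\<beta>\<in>?A. C * cmod (g \<beta>))"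
    proof (intro sum_mono mult_right_mono)
      fix \<beta> assume "\<beta> \<in> ?A"
      then have \<beta>: "\<beta> \<in> arr" "s \<beta> = u" by (auto simp: src_fibre_def)
      have inj: "inj_on (\<lambda>\<gamma>. \<gamma> \<odot> iv \<beta>) F"
        by (rule inj_on_inverseI[where g = "\<lambda>\<gamma>. \<gamma> \<odot> \<beta>"]) (use Fs \<beta> in \<open>auto simp: src_fibre_def\<close>)
      have "(\<Sum>\<gamma>\<in>F. cmod (f (\<gamma> \<odot> iv \<beta>))) = (\<Sum>\<delta>\<in>(\<lambda>\<gamma>. \<gamma> \<odot> iv \<beta>) ` F. cmod (f \<delta>))"
        by (simp add: sum.reindex[OF inj])
      also have "\<dots> \<le> C" by (rule fb(1)[of _ "r \<beta>"]) (use F Fs \<beta> in \<open>auto simp: src_fibre_def\<close>)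
      finally show "(\<Sum>\<gamma>\<in>F. cmod (f (\<gamma> \<odot> iv \<beta>))) \<le> C" .
    qed auto
    also have "\<dots> = C * (\<Sum>\<beta>\<in>?A. cmod (g \<beta>))" by (simp add: sum_distrib_left)
    also have "\<dots> \<le> C * D" using Cc_src_finite[OF g(1)] by (intro mult_left_mono gb(1)[of _ u] C) auto
    finally show "(\<Sum>\<gamma>\<in>F. cmod ((f \<star> g) \<gamma>)) \<le> C * D" .
  }
  {
    assume Fs: "F \<subseteq> rng_fibre G u"
    let ?A = "{\<alpha> \<in> rng_fibre G u. f \<alpha> \<noteq> 0}"
    have "(\<Sum>\<gamma>\<in>F. cmod ((f \<star> g) \<gamma>)) \<le> (\<Sum>\<gamma>\<in>F. \<Sum>\<alpha>\<in>?A. cmod (f \<alpha>) * cmod (g (iv \<alpha> \<odot> \<gamma>)))"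
    proof (rule sum_mono)
      fix \<gamma> assume "\<gamma> \<in> F"
      then have \<gamma>: "\<gamma> \<in> arr" "r \<gamma> = u" using Fs by (auto simp: rng_fibre_def)
      show "cmod ((f \<star> g) \<gamma>) \<le> (\<Sum>\<alpha>\<in>?A. cmod (f \<alpha>) * cmod (g (iv \<alpha> \<odot> \<gamma>)))"
        unfolding convolution_Cc_rng[OF f(1) \<gamma>(1)] norm_mult[symmetric] \<gamma>(2) by (rule norm_sum)
    qed
    also have "\<dots> = (\<Sum>\<alpha>\<in>?A. cmod (f \<alpha>) * (\<Sum>\<gamma>\<in>F. cmod (g (iv \<alpha> \<odot> \<gamma>))))"
      by (simp add: sum_distrib_left sum.swap[of _ F])
    also have "\<dots> \<le> (\<Sum>\<alpha>\<in>?A. cmod (f \<alpha>) * D)"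
    proof (intro sum_mono mult_left_mono)
      fix \<alpha> assume "\<alpha> \<in> ?A"
      then have \<alpha>: "\<alpha> \<in> arr" "r \<alpha> = u" by (auto simp: rng_fibre_def)
      have inj: "inj_on (\<lambda>\<gamma>. iv \<alpha> \<odot> \<gamma>) F"
        by (rule inj_on_inverseI[where g = "\<lambda>\<gamma>. \<alpha> \<odot> \<gamma>"]) (use Fs \<alpha> in \<open>auto simp: rng_fibre_def\<close>)
      have "(\<Sum>\<gamma>\<in>F. cmod (g (iv \<alpha> \<odot> \<gamma>))) = (\<Sum>\<delta>\<in>(\<lambda>\<gamma>. iv \<alpha> \<odot> \<gamma>) ` F. cmod (g \<delta>))"
        by (simp add: sum.reindex[OF inj])
      also have "\<dots> \<le> D" by (rule gb(2)[of _ "s \<alpha>"]) (use F Fs \<alpha> in \<open>auto simp: rng_fibre_def\<close>)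
      finally show "(\<Sum>\<gamma>\<in>F. cmod (g (iv \<alpha> \<odot> \<gamma>))) \<le> D" .
    qed auto
    also have "\<dots> = (\<Sum>\<alpha>\<in>?A. cmod (f \<alpha>)) * D" by (simp add: sum_distrib_right)
    also have "\<dots> \<le> C * D" using Cc_rng_finite[OF f(1)] by (intro mult_right_mono fb(2)[of _ u] D) auto
    finally show "(\<Sum>\<gamma>\<in>F. cmod ((f \<star> g) \<gamma>)) \<le> C * D" .
  }
qed

lemma I_bounded_by_involution:
  assumes "I_bounded_by f C" shows "I_bounded_by (involution G f) C"
  unfolding I_bounded_by_def
proof (intro conjI allI impI)
  show "0 \<le> C" using assms by (simp add: I_bounded_by_def)
  fix u :: 'g and F :: "'g set" assume F: "finite F"
  have eq: "(\<Sum>\<gamma>\<in>F. cmod (involution G f \<gamma>)) = (\<Sum>\<gamma>\<in>iv ` F. cmod (f \<gamma>))" if "F \<subseteq> arr"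
  proof -
    have "inj_on iv F" by (rule inj_on_inverseI[where g = iv]) (use that in auto)
    then show ?thesis using that by (simp add: sum.reindex involution_def subset_iff)
  qed
  {
    assume Fs: "F \<subseteq> src_fibre G u"
    then have "F \<subseteq> arr" "iv ` F \<subseteq> rng_fibre G u" by (auto simp: src_fibre_def rng_fibre_def)
    then show "(\<Sum>\<gamma>\<in>F. cmod (involution G f \<gamma>)) \<le> C" using assms F unfolding I_bounded_by_def by (simp add: eq)
  }
  {
    assume Fs: "F \<subseteq> rng_fibre G u"
    then have "F \<subseteq> arr" "iv ` F \<subseteq> src_fibre G u" by (auto simp: src_fibre_def rng_fibre_def)
    then show "(\<Sum>\<gamma>\<in>F. cmod (involution G f \<gamma>)) \<le> C" using assms F unfolding I_bounded_by_def by (simp add: eq)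
  }
qed

section \<open>The regular representation\<close>

abbreviation "lam \<equiv> sum_regular_rep G"

definition lam_kernel :: "('g \<Rightarrow> complex) \<Rightarrow> 'g \<Rightarrow> 'g \<Rightarrow> complex" where
  "lam_kernel f \<eta> \<gamma> = (if s \<eta> = s \<gamma> then f (\<eta> \<odot> iv \<gamma>) else 0)"

text \<open>The inner sum of \<open>regular_rep\<close> collapses because
  \<open>\<alpha> \<odot> \<gamma> = \<eta>\<close> determines \<open>\<alpha>\<close>. What remains
  is the convolution of \<open>f\<close> with the vector.\<close>

lemma lam_infsum:
  assumes "\<eta> \<in> arr" "\<xi> \<in> ell2 arr"
  shows "lam f \<xi> \<eta> = (\<Sum>\<^sub>\<infinity>\<gamma>\<in>src_fibre G (s \<eta>). f (\<eta> \<odot> iv \<gamma>) * \<xi> \<gamma>)"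
proof -
  have "(\<Sum>\<^sub>\<infinity>\<alpha>\<in>src_fibre G (r \<gamma>). f \<alpha> * basis_vector (\<alpha> \<odot> \<gamma>) \<eta>) = f (\<eta> \<odot> iv \<gamma>)" if "\<gamma> \<in> src_fibre G (s \<eta>)" for \<gamma>
  proof -
    have \<gamma>: "\<gamma> \<in> arr" "s \<gamma> = s \<eta>" using that by (auto simp: src_fibre_def)
    have "\<alpha> = \<eta> \<odot> iv \<gamma>" if "\<alpha> \<in> src_fibre G (r \<gamma>)" "basis_vector (\<alpha> \<odot> \<gamma>) \<eta> \<noteq> 0" for \<alpha>
      using that \<gamma> by (auto simp: src_fibre_def basis_vector_def split: if_splits)
    then have "(\<Sum>\<^sub>\<infinity>\<alpha>\<in>src_fibre G (r \<gamma>). f \<alpha> * basis_vector (\<alpha> \<odot> \<gamma>) \<eta>) = infsum (\<lambda>\<alpha>. f \<alpha> * basis_vector (\<alpha> \<odot> \<gamma>) \<eta>) {\<eta> \<odot> iv \<gamma>}"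
      by (intro infsum_cong_neutral) (use assms(1) \<gamma> in \<open>auto simp: src_fibre_def\<close>)
    also have "\<dots> = f (\<eta> \<odot> iv \<gamma>)" using assms(1) \<gamma> by (simp add: basis_vector_def)
    finally show ?thesis .
  qed
  then show ?thesis using assms unfolding sum_regular_rep_def regular_rep_def
    by (auto intro!: infsum_cong simp: mult.commute)
qed

lemma lam_off: "\<xi> \<notin> ell2 arr \<Longrightarrow> lam f \<xi> = (\<lambda>_. 0)"
  by (auto simp: sum_regular_rep_def)

lemma lam_kernel_row: "\<eta> \<in> arr \<Longrightarrow> bij_betw (\<lambda>\<gamma>. \<eta> \<odot> iv \<gamma>) {\<gamma> \<in> arr. lam_kernel f \<eta> \<gamma> \<noteq> 0} {\<alpha> \<in> rng_fibre G (r \<eta>). f \<alpha> \<noteq> 0}"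
  by (rule bij_betwI[where g = "\<lambda>\<alpha>. iv \<alpha> \<odot> \<eta>"])
    (auto simp: lam_kernel_def rng_fibre_def inv_mult split: if_splits)

lemma lam_sum:
  assumes "f \<in> Cc G" "\<eta> \<in> arr" "\<xi> \<in> ell2 arr"
  shows "lam f \<xi> \<eta> = (\<Sum>\<gamma> | \<gamma> \<in> arr \<and> lam_kernel f \<eta> \<gamma> \<noteq> 0. lam_kernel f \<eta> \<gamma> * \<xi> \<gamma>)"
proof -
  have fin: "finite {\<gamma> \<in> arr. lam_kernel f \<eta> \<gamma> \<noteq> 0}"
    using bij_betw_finite[OF lam_kernel_row[OF assms(2)]] Cc_rng_finite[OF assms(1)] by blast
  have "lam f \<xi> \<eta> = infsum (\<lambda>\<gamma>. lam_kernel f \<eta> \<gamma> * \<xi> \<gamma>) {\<gamma> \<in> arr. lam_kernel f \<eta> \<gamma> \<noteq> 0}"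
    unfolding lam_infsum[OF assms(2,3)]
    by (rule infsum_cong_neutral) (auto simp: lam_kernel_def src_fibre_def split: if_splits)
  then show ?thesis using fin by simp
qed

text \<open>A Schur test: a row of the kernel runs through a range fibre and a column through a
  source fibre of \<open>f\<close>, so the two halves of the \<open>I\<close>-norm bound the row and
  column sums.\<close>

lemma lam_bounded_aux:
  assumes f: "f \<in> Cc G" and C: "I_bounded_by f C" and \<xi>: "\<xi> \<in> ell2 arr"
  shows "lam f \<xi> \<in> ell2 arr \<and> ell2_norm arr (lam f \<xi>) \<le> C * ell2_norm arr \<xi>"
proof -
  have "lam f \<xi> = (\<lambda>\<eta>. if \<eta> \<in> arr then \<Sum>\<gamma> | \<gamma> \<in> arr \<and> lam_kernel f \<eta> \<gamma> \<noteq> 0. lam_kernel f \<eta> \<gamma> * \<xi> \<gamma> else 0)"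
    using lam_sum[OF f _ \<xi>] by (auto simp: fun_eq_iff) (simp add: sum_regular_rep_def)
  moreover have "(\<lambda>\<eta>. if \<eta> \<in> arr then \<Sum>\<gamma> | \<gamma> \<in> arr \<and> lam_kernel f \<eta> \<gamma> \<noteq> 0. lam_kernel f \<eta> \<gamma> * \<xi> \<gamma> else 0) \<in> ell2 arr \<and>
     ell2_norm arr (\<lambda>\<eta>. if \<eta> \<in> arr then \<Sum>\<gamma> | \<gamma> \<in> arr \<and> lam_kernel f \<eta> \<gamma> \<noteq> 0. lam_kernel f \<eta> \<gamma> * \<xi> \<gamma> else 0) \<le> C * ell2_norm arr \<xi>"
  proof (rule kernel_op_aux)
    fix \<eta> assume \<eta>: "\<eta> \<in> arr"
    note bij = lam_kernel_row[OF \<eta>, of f]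
    show "finite {\<gamma> \<in> arr. lam_kernel f \<eta> \<gamma> \<noteq> 0}" using bij_betw_finite[OF bij] Cc_rng_finite[OF f] by blast
    have "(\<Sum>\<gamma> | \<gamma> \<in> arr \<and> lam_kernel f \<eta> \<gamma> \<noteq> 0. cmod (lam_kernel f \<eta> \<gamma>)) =
       (\<Sum>\<gamma> | \<gamma> \<in> arr \<and> lam_kernel f \<eta> \<gamma> \<noteq> 0. cmod (f (\<eta> \<odot> iv \<gamma>)))"
      by (rule sum.cong) (auto simp: lam_kernel_def split: if_splits)
    also have "\<dots> = (\<Sum>\<alpha> | \<alpha> \<in> rng_fibre G (r \<eta>) \<and> f \<alpha> \<noteq> 0. cmod (f \<alpha>))"
      using sum.reindex_bij_betw[OF bij, of "\<lambda>\<alpha>. cmod (f \<alpha>)"] by simp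
    also have "\<dots> \<le> C" by (rule I_bounded_by_rng[OF C Cc_rng_finite[OF f]]) auto
    finally show "(\<Sum>\<gamma> | \<gamma> \<in> arr \<and> lam_kernel f \<eta> \<gamma> \<noteq> 0. cmod (lam_kernel f \<eta> \<gamma>)) \<le> C" .
  next
    fix \<gamma> F assume \<gamma>: "\<gamma> \<in> arr" and F: "finite F" "F \<subseteq> arr"
    let ?F = "{\<eta> \<in> F. s \<eta> = s \<gamma>}"
    have "(\<Sum>\<eta>\<in>F. cmod (lam_kernel f \<eta> \<gamma>)) = (\<Sum>\<eta>\<in>?F. cmod (f (\<eta> \<odot> iv \<gamma>)))"
      by (rule sum.mono_neutral_cong_right) (use F in \<open>auto simp: lam_kernel_def\<close>)
    also have "\<dots> = (\<Sum>\<alpha>\<in>(\<lambda>\<eta>. \<eta> \<odot> iv \<gamma>) ` ?F. cmod (f \<alpha>))"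
    proof -
      have "inj_on (\<lambda>\<eta>. \<eta> \<odot> iv \<gamma>) ?F"
        by (rule inj_on_inverseI[where g = "\<lambda>\<alpha>. \<alpha> \<odot> \<gamma>"]) (use F \<gamma> in auto)
      then show ?thesis by (simp add: sum.reindex)
    qed
    also have "\<dots> \<le> C"
    proof -
      have "finite ((\<lambda>\<eta>. \<eta> \<odot> iv \<gamma>) ` ?F)" "(\<lambda>\<eta>. \<eta> \<odot> iv \<gamma>) ` ?F \<subseteq> src_fibre G (r \<gamma>)"
        using F \<gamma> by (auto simp: src_fibre_def)
      then show ?thesis by (rule I_bounded_by_src[OF C])
    qed
    finally show "(\<Sum>\<eta>\<in>F. cmod (lam_kernel f \<eta> \<gamma>)) \<le> C" .
  qed (use C \<xi> in \<open>auto simp: I_bounded_by_def\<close>)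
  ultimately show ?thesis by simp
qed

lemma lam_bounded_ops:
  assumes f: "f \<in> Cc G" shows "lam f \<in> bounded_ops arr"
proof -
  obtain C where C: "I_bounded_by f C" using I_bounded_by_exists[OF f] by blast
  show ?thesis
  proof (rule bounded_opsI[where C = C])
    fix \<xi> \<eta> assume x: "\<xi> \<in> ell2 arr" "\<eta> \<in> ell2 arr"
    show "lam f (\<lambda>i. \<xi> i + \<eta> i) = (\<lambda>i. lam f \<xi> i + lam f \<eta> i)"
    proof
      fix i show "lam f (\<lambda>i. \<xi> i + \<eta> i) i = lam f \<xi> i + lam f \<eta> i"
        by (cases "i \<in> arr") (simp_all add: lam_sum[OF f] x ell2_add sum.distrib distrib_left, simp add: sum_regular_rep_def)
    qed
  next
    fix c \<xi> assume x: "\<xi> \<in> ell2 arr"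
    show "lam f (\<lambda>i. c * \<xi> i) = (\<lambda>i. c * lam f \<xi> i)"
    proof
      fix i show "lam f (\<lambda>i. c * \<xi> i) i = c * lam f \<xi> i"
        by (cases "i \<in> arr") (simp_all add: lam_sum[OF f] x ell2_scale sum_distrib_left mult_ac, simp add: sum_regular_rep_def)
    qed
  qed (use lam_bounded_aux[OF f C] lam_off in auto)
qed

lemma op_norm_lam_le: "f \<in> Cc G \<Longrightarrow> I_bounded_by f C \<Longrightarrow> op_norm arr (lam f) \<le> C"
  by (rule op_norm_leI) (use lam_bounded_aux in \<open>auto simp: I_bounded_by_def\<close>)

lemma lam_entry:
  assumes "\<eta> \<in> arr" "\<gamma> \<in> arr" shows "lam f (basis_vector \<gamma>) \<eta> = lam_kernel f \<eta> \<gamma>"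
proof -
  have "lam f (basis_vector \<gamma>) \<eta> = infsum (\<lambda>\<gamma>'. f (\<eta> \<odot> iv \<gamma>') * basis_vector \<gamma> \<gamma>') {\<gamma>' \<in> {\<gamma>}. s \<gamma>' = s \<eta>}"
    unfolding lam_infsum[OF assms(1) basis_vector_ell2[OF assms(2)]]
    by (rule infsum_cong_neutral) (use assms in \<open>auto simp: basis_vector_def src_fibre_def\<close>)
  also have "\<dots> = lam_kernel f \<eta> \<gamma>"
    by (cases "s \<gamma> = s \<eta>") (auto simp: lam_kernel_def basis_vector_def Collect_conj_eq)
  finally show ?thesis .
qed

lemma lam_add: "f \<in> Cc G \<Longrightarrow> g \<in> Cc G \<Longrightarrow> lam (f \<^bold>+ g) = (lam f \<oplus> lam g)"
  by (rule bounded_ops_eqI[of _ arr]) (auto simp: lam_entry lam_kernel_def intro!: lam_bounded_ops Cc_add bounded_ops_add)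

lemma lam_scale: "f \<in> Cc G \<Longrightarrow> lam (\<lambda>\<gamma>. c * f \<gamma>) = (\<lambda>\<xi> i. c * lam f \<xi> i)"
  by (rule bounded_ops_eqI[of _ arr]) (auto simp: lam_entry lam_kernel_def intro!: lam_bounded_ops Cc_scale bounded_ops_scale)

lemma lam_diff: "f \<in> Cc G \<Longrightarrow> g \<in> Cc G \<Longrightarrow> lam (f \<^bold>- g) = (lam f \<ominus> lam g)"
  by (rule bounded_ops_eqI[of _ arr]) (auto simp: lam_entry lam_kernel_def intro!: lam_bounded_ops Cc_diff bounded_ops_diff)

lemma lam_involution:
  assumes "f \<in> Cc G" shows "lam (involution G f) = op_adjoint arr (lam f)"
  by (rule bounded_ops_eqI[of _ arr])
    (use assms in \<open>auto simp: lam_entry lam_kernel_def op_adjoint_entry lam_bounded_ops involution_def inv_mult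
      intro!: lam_bounded_ops Cc_involution op_adjoint_bounded\<close>)

text \<open>Compared entrywise. The substitution of \<open>\<beta> \<odot> \<gamma>\<close> for the
  summation index turns matrix multiplication into a convolution sum.\<close>

lemma lam_convolution:
  assumes f: "f \<in> Cc G" and g: "g \<in> Cc G" shows "lam (f \<star> g) = lam f \<circ> lam g"
proof (rule bounded_ops_eqI[of _ arr])
  fix \<eta> \<gamma> assume a: "\<eta> \<in> arr" "\<gamma> \<in> arr"
  have ge: "lam g (basis_vector \<gamma>) \<in> ell2 arr" by (rule bop_ell2'[OF lam_bounded_ops[OF g]])
  have "(lam f \<circ> lam g) (basis_vector \<gamma>) \<eta> = (\<Sum>\<^sub>\<infinity>\<zeta>\<in>src_fibre G (s \<eta>). f (\<eta> \<odot> iv \<zeta>) * lam_kernel g \<zeta> \<gamma>)"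
    unfolding o_def lam_infsum[OF a(1) ge] by (rule infsum_cong) (auto simp: lam_entry a src_fibre_def)
  also have "\<dots> = lam_kernel (f \<star> g) \<eta> \<gamma>"
  proof (cases "s \<eta> = s \<gamma>")
    case False
    then have "(\<Sum>\<^sub>\<infinity>\<zeta>\<in>src_fibre G (s \<eta>). f (\<eta> \<odot> iv \<zeta>) * lam_kernel g \<zeta> \<gamma>) = 0"
      by (intro infsum_0) (auto simp: lam_kernel_def src_fibre_def)
    with False show ?thesis by (simp add: lam_kernel_def)
  next
    case True
    have ea: "\<eta> \<odot> iv \<gamma> \<in> arr" "s (\<eta> \<odot> iv \<gamma>) = r \<gamma>" using a True by auto
    have "bij_betw (\<lambda>\<beta>. \<beta> \<odot> \<gamma>) (src_fibre G (r \<gamma>)) (src_fibre G (s \<gamma>))"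
      by (rule bij_betwI[where g = "\<lambda>\<zeta>. \<zeta> \<odot> iv \<gamma>"]) (use a in \<open>auto simp: src_fibre_def\<close>)
    from infsum_reindex_bij_betw[OF this, of "\<lambda>\<zeta>. f (\<eta> \<odot> iv \<zeta>) * lam_kernel g \<zeta> \<gamma>"]
    have "(\<Sum>\<^sub>\<infinity>\<zeta>\<in>src_fibre G (s \<eta>). f (\<eta> \<odot> iv \<zeta>) * lam_kernel g \<zeta> \<gamma>) =
       (\<Sum>\<^sub>\<infinity>\<beta>\<in>src_fibre G (r \<gamma>). f (\<eta> \<odot> iv (\<beta> \<odot> \<gamma>)) * lam_kernel g (\<beta> \<odot> \<gamma>) \<gamma>)" using True by simp
    also have "\<dots> = (\<Sum>\<^sub>\<infinity>\<beta>\<in>src_fibre G (r \<gamma>). f ((\<eta> \<odot> iv \<gamma>) \<odot> iv \<beta>) * g \<beta>)"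
    proof (rule infsum_cong)
      fix \<beta> assume "\<beta> \<in> src_fibre G (r \<gamma>)"
      then have \<beta>: "\<beta> \<in> arr" "s \<beta> = r \<gamma>" by (auto simp: src_fibre_def)
      have "\<eta> \<odot> iv (\<beta> \<odot> \<gamma>) = (\<eta> \<odot> iv \<gamma>) \<odot> iv \<beta>"
        using mult_assoc[of \<eta> "iv \<gamma>" "iv \<beta>"] a True \<beta> by (simp add: inv_mult)
      moreover have "lam_kernel g (\<beta> \<odot> \<gamma>) \<gamma> = g \<beta>" using a \<beta> by (simp add: lam_kernel_def)
      ultimately show "f (\<eta> \<odot> iv (\<beta> \<odot> \<gamma>)) * lam_kernel g (\<beta> \<odot> \<gamma>) \<gamma> = f ((\<eta> \<odot> iv \<gamma>) \<odot> iv \<beta>) * g \<beta>" by simp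
    qed
    also have "\<dots> = convolution G f g (\<eta> \<odot> iv \<gamma>)" by (simp add: convolution_src[OF ea(1)] ea(2))
    finally show ?thesis using True by (simp add: lam_kernel_def)
  qed
  finally show "lam (f \<star> g) (basis_vector \<gamma>) \<eta> = (lam f \<circ> lam g) (basis_vector \<gamma>) \<eta>"
    by (simp add: lam_entry a)
qed (auto intro!: lam_bounded_ops Cc_convolution f g bounded_ops_compose)

end

section \<open>Full norm, completions and reduced algebra\<close>

section \<open>Transport of operators along an injection\<close>

definition ell2_pull :: "('i \<Rightarrow> 'k) \<Rightarrow> 'i set \<Rightarrow> ('k \<Rightarrow> complex) \<Rightarrow> 'i \<Rightarrow> complex" where
  "ell2_pull j S \<xi> i = (if i \<in> S then \<xi> (j i) else 0)"

definition ell2_push :: "('i \<Rightarrow> 'k) \<Rightarrow> 'i set \<Rightarrow> ('i \<Rightarrow> complex) \<Rightarrow> 'k \<Rightarrow> complex" where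
  "ell2_push j S \<zeta> k = (if k \<in> j ` S then \<zeta> (the_inv_into S j k) else 0)"

text \<open>Extension by zero along the isometry \<open>ell2_push\<close>, whose adjoint is
  \<open>ell2_pull\<close>. The supremum in \<open>full_norm\<close> ranges over representations on
  one fixed index type, so the regular representation has to be moved there.\<close>

definition op_push :: "('i \<Rightarrow> 'k) \<Rightarrow> 'i set \<Rightarrow> 'i operator \<Rightarrow> 'k operator" where
  "op_push j S T \<xi> = (if \<xi> \<in> ell2 UNIV then ell2_push j S (T (ell2_pull j S \<xi>)) else (\<lambda>_. 0))"

context
  fixes j :: "'i \<Rightarrow> 'k" and S :: "'i set"
  assumes inj: "inj_on j S"
begin

lemma push_image: "i \<in> S \<Longrightarrow> ell2_push j S \<zeta> (j i) = \<zeta> i"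
  by (simp add: ell2_push_def the_inv_into_f_f[OF inj])

lemma pull_ell2:
  assumes "\<xi> \<in> ell2 UNIV" shows "ell2_pull j S \<xi> \<in> ell2 S" "ell2_norm S (ell2_pull j S \<xi>) \<le> ell2_norm UNIV \<xi>"
proof -
  have *: "L2_set (\<lambda>i. cmod (ell2_pull j S \<xi> i)) F \<le> ell2_norm UNIV \<xi>" if F: "finite F" "F \<subseteq> S" for F
  proof -
    have "L2_set (\<lambda>i. cmod (ell2_pull j S \<xi> i)) F = L2_set (\<lambda>k. cmod (\<xi> k)) (j ` F)"
      unfolding L2_set_def using F by (subst sum.reindex) (auto simp: inj_on_subset[OF inj] ell2_pull_def subset_iff intro!: sum.cong)
    also have "\<dots> \<le> ell2_norm UNIV \<xi>" by (rule L2_set_le_ell2_norm[OF assms]) (use F in auto)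
    finally show ?thesis .
  qed
  show "ell2_pull j S \<xi> \<in> ell2 S" by (rule ell2_boundedI(1)[OF _ *]) (simp_all add: ell2_pull_def)
  show "ell2_norm S (ell2_pull j S \<xi>) \<le> ell2_norm UNIV \<xi>"
    by (rule ell2_boundedI(2)[OF _ *]) (simp_all add: ell2_pull_def)
qed

lemma push_has_sum:
  "f (0::complex) = (0::'b::{comm_monoid_add,t2_space}) \<Longrightarrow>
   ((\<lambda>k. f (ell2_push j S \<zeta> k)) has_sum x) UNIV \<longleftrightarrow> ((\<lambda>i. f (\<zeta> i)) has_sum x) S"
proof -
  assume f0: "f 0 = 0"
  have "((\<lambda>k. f (ell2_push j S \<zeta> k)) has_sum x) UNIV \<longleftrightarrow> ((\<lambda>k. f (ell2_push j S \<zeta> k)) has_sum x) (j ` S)"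
    by (rule has_sum_cong_neutral) (auto simp: ell2_push_def f0)
  also have "\<dots> \<longleftrightarrow> ((\<lambda>i. f (ell2_push j S \<zeta> (j i))) has_sum x) S"
    using has_sum_reindex[OF inj, of "\<lambda>k. f (ell2_push j S \<zeta> k)" x] by (simp add: o_def)
  also have "\<dots> \<longleftrightarrow> ((\<lambda>i. f (\<zeta> i)) has_sum x) S"
    by (rule has_sum_cong) (simp add: push_image)
  finally show ?thesis .
qed

lemma push_ell2:
  assumes "\<zeta> \<in> ell2 S" shows "ell2_push j S \<zeta> \<in> ell2 UNIV" "ell2_norm UNIV (ell2_push j S \<zeta>) = ell2_norm S \<zeta>"
proof -
  have h: "((\<lambda>k. (cmod (ell2_push j S \<zeta> k))\<^sup>2) has_sum (\<Sum>\<^sub>\<infinity>i\<in>S. (cmod (\<zeta> i))\<^sup>2)) UNIV"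
    using push_has_sum[of "\<lambda>z. (cmod z)\<^sup>2"] has_sum_infsum[OF ell2_summable[OF assms]] by simp
  show "ell2_push j S \<zeta> \<in> ell2 UNIV" using h by (auto simp: ell2_def summable_on_def)
  show "ell2_norm UNIV (ell2_push j S \<zeta>) = ell2_norm S \<zeta>" using infsumI[OF h] by (simp add: ell2_norm_def)
qed

lemma pull_push: "\<zeta> \<in> ell2 S \<Longrightarrow> ell2_pull j S (ell2_push j S \<zeta>) = \<zeta>"
  by (auto simp: ell2_pull_def push_image ell2_vanish)

lemma inner_push: "\<zeta> \<in> ell2 S \<Longrightarrow> \<eta> \<in> ell2 UNIV \<Longrightarrow> ell2_inner UNIV (ell2_push j S \<zeta>) \<eta> = ell2_inner S \<zeta> (ell2_pull j S \<eta>)"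
proof -
  assume a: "\<zeta> \<in> ell2 S" "\<eta> \<in> ell2 UNIV"
  have "ell2_inner UNIV (ell2_push j S \<zeta>) \<eta> = infsum (\<lambda>k. ell2_push j S \<zeta> k * cnj (\<eta> k)) (j ` S)"
    unfolding ell2_inner_def by (rule infsum_cong_neutral) (auto simp: ell2_push_def)
  also have "\<dots> = infsum (\<lambda>i. ell2_push j S \<zeta> (j i) * cnj (\<eta> (j i))) S"
    by (subst infsum_reindex[OF inj]) (simp add: o_def)
  also have "\<dots> = ell2_inner S \<zeta> (ell2_pull j S \<eta>)"
    unfolding ell2_inner_def by (rule infsum_cong) (simp add: push_image ell2_pull_def)
  finally show ?thesis .
qed

lemma pull_linear:
  "ell2_pull j S (\<lambda>k. \<xi> k + \<eta> k) = (\<lambda>i. ell2_pull j S \<xi> i + ell2_pull j S \<eta> i)"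
  "ell2_pull j S (\<lambda>k. c * \<xi> k) = (\<lambda>i. c * ell2_pull j S \<xi> i)"
  by (auto simp: ell2_pull_def)

lemma push_linear:
  "ell2_push j S (\<lambda>k. \<xi> k + \<eta> k) = (\<lambda>i. ell2_push j S \<xi> i + ell2_push j S \<eta> i)"
  "ell2_push j S (\<lambda>k. c * \<xi> k) = (\<lambda>i. c * ell2_push j S \<xi> i)" "ell2_push j S (\<lambda>_. 0) = (\<lambda>_. 0)"
  by (auto simp: ell2_push_def)

lemma op_push_bounded:
  assumes T: "T \<in> bounded_ops S" shows "op_push j S T \<in> bounded_ops UNIV"
proof (rule bounded_opsI[where C = "op_norm S T"])
  fix \<xi> :: "'k \<Rightarrow> complex" assume \<xi>: "\<xi> \<in> ell2 UNIV"
  show "op_push j S T \<xi> \<in> ell2 UNIV" using \<xi> by (simp add: op_push_def push_ell2 bop_ell2'[OF T])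
  have "ell2_norm S (T (ell2_pull j S \<xi>)) \<le> op_norm S T * ell2_norm S (ell2_pull j S \<xi>)"
    by (rule op_norm_bound[OF T pull_ell2(1)[OF \<xi>]])
  also have "\<dots> \<le> op_norm S T * ell2_norm UNIV \<xi>" by (rule mult_left_mono[OF pull_ell2(2)[OF \<xi>] op_norm_nonneg[OF T]])
  finally show "ell2_norm UNIV (op_push j S T \<xi>) \<le> op_norm S T * ell2_norm UNIV \<xi>"
    using \<xi> by (simp add: op_push_def push_ell2 bop_ell2'[OF T])
qed (auto simp: op_push_def ell2_add ell2_scale pull_linear pull_ell2 bop_add[OF T] bop_scale[OF T] push_linear)

lemma op_norm_push_ge:
  assumes T: "T \<in> bounded_ops S" shows "op_norm S T \<le> op_norm UNIV (op_push j S T)"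
proof (rule op_norm_leI[OF op_norm_nonneg[OF op_push_bounded[OF T]]])
  fix \<zeta> assume \<zeta>: "\<zeta> \<in> ell2 S"
  have "ell2_norm UNIV (op_push j S T (ell2_push j S \<zeta>)) \<le> op_norm UNIV (op_push j S T) * ell2_norm UNIV (ell2_push j S \<zeta>)"
    by (rule op_norm_bound[OF op_push_bounded[OF T] push_ell2(1)[OF \<zeta>]])
  then show "ell2_norm S (T \<zeta>) \<le> op_norm UNIV (op_push j S T) * ell2_norm S \<zeta>"
    using \<zeta> by (simp add: op_push_def push_ell2 pull_push bop_ell2'[OF T])
qed

lemma op_norm_push_le:
  assumes T: "T \<in> bounded_ops S" shows "op_norm UNIV (op_push j S T) \<le> op_norm S T"
proof (rule op_norm_leI[OF op_norm_nonneg[OF T]])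
  fix \<xi> :: "'k \<Rightarrow> complex" assume \<xi>: "\<xi> \<in> ell2 UNIV"
  have "ell2_norm S (T (ell2_pull j S \<xi>)) \<le> op_norm S T * ell2_norm S (ell2_pull j S \<xi>)"
    by (rule op_norm_bound[OF T pull_ell2(1)[OF \<xi>]])
  also have "\<dots> \<le> op_norm S T * ell2_norm UNIV \<xi>" by (rule mult_left_mono[OF pull_ell2(2)[OF \<xi>] op_norm_nonneg[OF T]])
  finally show "ell2_norm UNIV (op_push j S T \<xi>) \<le> op_norm S T * ell2_norm UNIV \<xi>"
    using \<xi> by (simp add: op_push_def push_ell2 bop_ell2'[OF T])
qed

lemma op_push_add: "op_push j S (T \<oplus> U) = (op_push j S T \<oplus> op_push j S U)"
  and op_push_scale: "op_push j S (\<lambda>\<xi> i. c * T \<xi> i) = (\<lambda>\<xi> i. c * op_push j S T \<xi> i)"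
  by (auto simp: op_push_def fun_eq_iff push_linear)

lemma op_push_compose:
  assumes "T \<in> bounded_ops S" "U \<in> bounded_ops S"
  shows "op_push j S (T \<circ> U) = op_push j S T \<circ> op_push j S U"
proof
  fix \<xi> :: "'k \<Rightarrow> complex"
  show "op_push j S (T \<circ> U) \<xi> = (op_push j S T \<circ> op_push j S U) \<xi>"
  proof (cases "\<xi> \<in> ell2 UNIV")
    case True
    then show ?thesis using bop_ell2'[OF assms(2)] by (simp add: op_push_def push_ell2 pull_push)
  next
    case False
    have "ell2_pull j S (\<lambda>_. 0) = (\<lambda>_. 0)" by (auto simp: ell2_pull_def)
    then show ?thesis using False by (simp add: op_push_def bop_zero[OF assms(1)] push_linear)
  qed
qed

lemma op_push_adjoint:
  assumes T: "T \<in> bounded_ops S"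
  shows "op_push j S (op_adjoint S T) = op_adjoint UNIV (op_push j S T)"
proof (rule op_adjoint_eqI[symmetric])
  note A = op_adjoint_bounded[OF T]
  show "op_push j S (op_adjoint S T) \<in> bounded_ops UNIV" by (rule op_push_bounded[OF A])
  fix \<xi> \<eta> :: "'k \<Rightarrow> complex" assume a: "\<xi> \<in> ell2 UNIV" "\<eta> \<in> ell2 UNIV"
  have "ell2_inner UNIV \<xi> (ell2_push j S (op_adjoint S T (ell2_pull j S \<eta>))) =
    cnj (ell2_inner S (op_adjoint S T (ell2_pull j S \<eta>)) (ell2_pull j S \<xi>))"
    using inner_push[OF bop_ell2'[OF A] a(1)] ell2_inner_commute by metis
  also have "\<dots> = ell2_inner S (T (ell2_pull j S \<xi>)) (ell2_pull j S \<eta>)"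
    using op_adjoint_inner[OF T pull_ell2(1)[OF a(1)] pull_ell2(1)[OF a(2)]] ell2_inner_commute by metis
  finally show "ell2_inner UNIV (op_push j S T \<xi>) \<eta> = ell2_inner UNIV \<xi> (op_push j S (op_adjoint S T) \<eta>)"
    using a by (simp add: op_push_def inner_push bop_ell2'[OF T])
qed

end

section \<open>Completions\<close>

lemma UN_eq_const: "X \<noteq> {} \<Longrightarrow> (\<And>a. a \<in> X \<Longrightarrow> f a = C) \<Longrightarrow> (\<Union>a\<in>X. f a) = C"
  by auto

text \<open>Operations on classes of Cauchy sequences are well defined once those on representatives
  satisfy Lipschitz estimates, so the axioms speak of distances. In \<open>d_mult\<close> one factor
  is changed at a time.\<close>

locale seminormed_algebra =
  fixes A :: "'a star_algebra"
  assumes add_closed: "\<And>a b. a \<in> carr A \<Longrightarrow> b \<in> carr A \<Longrightarrow> aadd A a b \<in> carr A"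
    and scale_closed: "\<And>c a. a \<in> carr A \<Longrightarrow> ascale A c a \<in> carr A"
    and mult_closed: "\<And>a b. a \<in> carr A \<Longrightarrow> b \<in> carr A \<Longrightarrow> amult A a b \<in> carr A"
    and star_closed: "\<And>a. a \<in> carr A \<Longrightarrow> astar A a \<in> carr A"
    and d_refl: "\<And>a. a \<in> carr A \<Longrightarrow> adist A a a = 0"
    and d_sym: "\<And>a b. a \<in> carr A \<Longrightarrow> b \<in> carr A \<Longrightarrow> adist A a b = adist A b a"
    and d_tri: "\<And>a b c. a \<in> carr A \<Longrightarrow> b \<in> carr A \<Longrightarrow> c \<in> carr A \<Longrightarrow> adist A a c \<le> adist A a b + adist A b c"
    and d_add: "\<And>a b a' b'. a \<in> carr A \<Longrightarrow> b \<in> carr A \<Longrightarrow> a' \<in> carr A \<Longrightarrow> b' \<in> carr A \<Longrightarrow>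
       adist A (aadd A a b) (aadd A a' b') \<le> adist A a a' + adist A b b'"
    and d_scale: "\<And>c a b. a \<in> carr A \<Longrightarrow> b \<in> carr A \<Longrightarrow> adist A (ascale A c a) (ascale A c b) \<le> cmod c * adist A a b"
    and d_mult: "\<And>a b a' b'. a \<in> carr A \<Longrightarrow> b \<in> carr A \<Longrightarrow> a' \<in> carr A \<Longrightarrow> b' \<in> carr A \<Longrightarrow>
       adist A (amult A a b) (amult A a' b') \<le> anorm A a * adist A b b' + adist A a a' * anorm A b'"
    and d_star: "\<And>a b. a \<in> carr A \<Longrightarrow> b \<in> carr A \<Longrightarrow> adist A (astar A a) (astar A b) \<le> adist A a b"
    and n_lip: "\<And>a b. a \<in> carr A \<Longrightarrow> b \<in> carr A \<Longrightarrow> \<bar>anorm A a - anorm A b\<bar> \<le> adist A a b"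
begin

abbreviation "d \<equiv> adist A"
abbreviation "cls \<equiv> cauchy_class A"
abbreviation "CS \<equiv> cauchy_seqs A"

lemma d_nonneg: "a \<in> carr A \<Longrightarrow> b \<in> carr A \<Longrightarrow> 0 \<le> d a b"
  using n_lip by (meson abs_ge_zero order_trans)

lemma CS_carr: "x \<in> CS \<Longrightarrow> x n \<in> carr A" by (simp add: cauchy_seqs_def)

lemma CS_I:
  assumes "\<And>n. x n \<in> carr A" "\<And>e. 0 < e \<Longrightarrow> \<exists>N. \<forall>m \<ge> N. \<forall>n \<ge> N. d (x m) (x n) < e"
  shows "x \<in> CS" using assms by (simp add: cauchy_seqs_def)

lemma CS_D: "x \<in> CS \<Longrightarrow> 0 < e \<Longrightarrow> \<exists>N. \<forall>m \<ge> N. \<forall>n \<ge> N. d (x m) (x n) < e"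
  by (simp add: cauchy_seqs_def)

lemma CS_const: "a \<in> carr A \<Longrightarrow> (\<lambda>_. a) \<in> CS"
  by (rule CS_I) (auto simp: d_refl)

lemma CS_lipschitz:
  assumes x: "x \<in> CS" and y: "y \<in> CS" and z: "\<And>n. z n \<in> carr A"
    and est: "\<And>m n. d (z m) (z n) \<le> K * d (x m) (x n) + K * d (y m) (y n)"
  shows "z \<in> CS"
proof (rule CS_I[OF z])
  fix e :: real assume e: "0 < e"
  \<comment> \<open>The 2 accounts for the two sequences, and \<open>\<bar>K\<bar> + 1\<close> is
    positive whatever the sign of \<open>K\<close>.\<close>
  let ?e = "e / (2 * (\<bar>K\<bar> + 1))"
  have e': "0 < ?e" using e by simp
  obtain N M where N: "\<forall>m \<ge> N. \<forall>n \<ge> N. d (x m) (x n) < ?e" and M: "\<forall>m \<ge> M. \<forall>n \<ge> M. d (y m) (y n) < ?e"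
    using CS_D[OF x e'] CS_D[OF y e'] by blast
  have "d (z m) (z n) < e" if mn: "m \<ge> max N M" "n \<ge> max N M" for m n
  proof -
    have le: "K * t \<le> (\<bar>K\<bar> + 1) * t" if "0 \<le> t" for t using that by (intro mult_right_mono) auto
    have "d (z m) (z n) \<le> (\<bar>K\<bar> + 1) * d (x m) (x n) + (\<bar>K\<bar> + 1) * d (y m) (y n)"
      using est[of m n] le[OF d_nonneg[OF CS_carr[OF x] CS_carr[OF x]], of m n]
        le[OF d_nonneg[OF CS_carr[OF y] CS_carr[OF y]], of m n] by linarith
    also have "\<dots> < (\<bar>K\<bar> + 1) * ?e + (\<bar>K\<bar> + 1) * ?e"
      using N M mn by (intro add_strict_mono mult_strict_left_mono) auto
    also have "\<dots> = e"
    proof -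
      have "k * (e / (2 * k)) + k * (e / (2 * k)) = e" if "k \<noteq> 0" for k :: real using that by simp
      moreover have "\<bar>K\<bar> + 1 \<noteq> 0" by linarith
      ultimately show ?thesis .
    qed
    finally show ?thesis .
  qed
  then show "\<exists>N. \<forall>m \<ge> N. \<forall>n \<ge> N. d (z m) (z n) < e" by blast
qed

lemma CS_norm_convergent: assumes "x \<in> CS" shows "\<exists>l. (\<lambda>n. anorm A (x n)) \<longlonglongrightarrow> l"
proof -
  have "Cauchy (\<lambda>n. anorm A (x n))"
  proof (rule metric_CauchyI)
    fix e :: real assume "0 < e"
    then obtain N where "\<forall>m \<ge> N. \<forall>n \<ge> N. d (x m) (x n) < e" using CS_D[OF assms] by blast
    moreover have "dist (anorm A (x m)) (anorm A (x n)) \<le> d (x m) (x n)" for m n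
      using n_lip[OF CS_carr[OF assms] CS_carr[OF assms]] by (simp add: dist_real_def)
    ultimately show "\<exists>M. \<forall>m\<ge>M. \<forall>n\<ge>M. dist (anorm A (x m)) (anorm A (x n)) < e" by (meson le_less_trans)
  qed
  then show ?thesis using convergent_eq_Cauchy by blast
qed

lemma CS_norm_bounded: assumes "x \<in> CS" shows "\<exists>K. \<forall>n. \<bar>anorm A (x n)\<bar> \<le> K"
proof -
  have "Bseq (\<lambda>n. anorm A (x n))" using CS_norm_convergent[OF assms] convergent_imp_Bseq convergentI by blast
  then show ?thesis unfolding Bseq_def by auto
qed

lemma CS_add: assumes x: "x \<in> CS" and y: "y \<in> CS" shows "(\<lambda>n. aadd A (x n) (y n)) \<in> CS"
proof (rule CS_lipschitz[OF x y, where K = 1])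
  show "aadd A (x n) (y n) \<in> carr A" for n by (rule add_closed[OF CS_carr[OF x] CS_carr[OF y]])
  show "d (aadd A (x m) (y m)) (aadd A (x n) (y n)) \<le> 1 * d (x m) (x n) + 1 * d (y m) (y n)" for m n
    using d_add[OF CS_carr[OF x] CS_carr[OF y] CS_carr[OF x] CS_carr[OF y], of m m n n] by simp
qed

lemma CS_scale: assumes x: "x \<in> CS" shows "(\<lambda>n. ascale A c (x n)) \<in> CS"
proof (rule CS_lipschitz[OF x x, where K = "cmod c"])
  show "ascale A c (x n) \<in> carr A" for n by (rule scale_closed[OF CS_carr[OF x]])
  show "d (ascale A c (x m)) (ascale A c (x n)) \<le> cmod c * d (x m) (x n) + cmod c * d (x m) (x n)" for m n
    using d_scale[OF CS_carr[OF x] CS_carr[OF x], of c m n] mult_nonneg_nonneg[OF norm_ge_zero d_nonneg[OF CS_carr[OF x] CS_carr[OF x]], of c m n]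
    by linarith
qed

lemma CS_star: assumes x: "x \<in> CS" shows "(\<lambda>n. astar A (x n)) \<in> CS"
proof (rule CS_lipschitz[OF x x, where K = 1])
  show "astar A (x n) \<in> carr A" for n by (rule star_closed[OF CS_carr[OF x]])
  show "d (astar A (x m)) (astar A (x n)) \<le> 1 * d (x m) (x n) + 1 * d (x m) (x n)" for m n
    using d_star[OF CS_carr[OF x] CS_carr[OF x], of m n] d_nonneg[OF CS_carr[OF x] CS_carr[OF x], of m n] by linarith
qed

lemma CS_mult: assumes x: "x \<in> CS" and y: "y \<in> CS" shows "(\<lambda>n. amult A (x n) (y n)) \<in> CS"
proof -
  obtain K L where K: "\<forall>n. \<bar>anorm A (x n)\<bar> \<le> K" and L: "\<forall>n. \<bar>anorm A (y n)\<bar> \<le> L" using CS_norm_bounded x y by metis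
  show ?thesis
  proof (rule CS_lipschitz[OF x y, where K = "max K L"])
    show "amult A (x n) (y n) \<in> carr A" for n by (rule mult_closed[OF CS_carr[OF x] CS_carr[OF y]])
    fix m n
    have "d (amult A (x m) (y m)) (amult A (x n) (y n)) \<le> anorm A (x m) * d (y m) (y n) + d (x m) (x n) * anorm A (y n)"
      by (rule d_mult[OF CS_carr[OF x] CS_carr[OF y] CS_carr[OF x] CS_carr[OF y]])
    also have "\<dots> \<le> max K L * d (y m) (y n) + d (x m) (x n) * max K L"
      using K L d_nonneg[OF CS_carr[OF x] CS_carr[OF x], of m n] d_nonneg[OF CS_carr[OF y] CS_carr[OF y], of m n]
      by (intro add_mono mult_right_mono mult_left_mono) (auto intro: order_trans[OF abs_ge_self] max.coboundedI1 max.coboundedI2)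
    finally show "d (amult A (x m) (y m)) (amult A (x n) (y n)) \<le> max K L * d (x m) (x n) + max K L * d (y m) (y n)"
      by (simp add: algebra_simps)
  qed
qed

lemma cls_iff: "y \<in> cls x \<longleftrightarrow> y \<in> CS \<and> (\<lambda>n. d (x n) (y n)) \<longlonglongrightarrow> 0"
  by (simp add: cauchy_class_def)

lemma cls_self: "x \<in> CS \<Longrightarrow> x \<in> cls x"
  by (simp add: cls_iff d_refl CS_carr)

lemma cls_eqI:
  assumes x: "x \<in> CS" and y: "y \<in> CS" and xy: "(\<lambda>n. d (x n) (y n)) \<longlonglongrightarrow> 0"
  shows "cls x = cls y"
proof -
  have *: "cls y \<subseteq> cls x" if x: "x \<in> CS" and y: "y \<in> CS" and xy: "(\<lambda>n. d (x n) (y n)) \<longlonglongrightarrow> 0" for x y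
  proof
    fix z assume z: "z \<in> cls y"
    then have zC: "z \<in> CS" by (simp add: cls_iff)
    have "(\<lambda>n. d (x n) (y n) + d (y n) (z n)) \<longlonglongrightarrow> 0"
      using tendsto_add[OF xy, of "\<lambda>n. d (y n) (z n)" 0] z by (simp add: cls_iff)
    then have "(\<lambda>n. d (x n) (z n)) \<longlonglongrightarrow> 0"
      by (rule Lim_null_comparison[rotated])
        (simp add: d_nonneg[OF CS_carr[OF x] CS_carr[OF zC]] d_tri[OF CS_carr[OF x] CS_carr[OF y] CS_carr[OF zC]])
    with zC show "z \<in> cls x" by (simp add: cls_iff)
  qed
  have "(\<lambda>n. d (y n) (x n)) \<longlonglongrightarrow> 0" using xy by (simp add: d_sym[OF CS_carr[OF y] CS_carr[OF x]])
  with * x y xy show ?thesis by blast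
qed

lemma cls_eq_iff: "x \<in> CS \<Longrightarrow> y \<in> CS \<Longrightarrow> cls x = cls y \<longleftrightarrow> (\<lambda>n. d (x n) (y n)) \<longlonglongrightarrow> 0"
  using cls_eqI cls_self cls_iff by blast

lemma completion_carr: "carr (completion A) = cls ` CS"
  by (simp add: completion_def)

lemma null_comb:
  fixes a b :: "nat \<Rightarrow> real"
  assumes "a \<longlonglongrightarrow> 0" "b \<longlonglongrightarrow> 0" "\<And>n. 0 \<le> c n" "\<And>n. c n \<le> K * a n + L * b n"
  shows "c \<longlonglongrightarrow> 0"
proof (rule Lim_null_comparison[of _ "\<lambda>n. K * a n + L * b n"])
  show "(\<lambda>n. K * a n + L * b n) \<longlonglongrightarrow> 0"
    using tendsto_add[OF tendsto_mult_left[OF assms(1), of K] tendsto_mult_left[OF assms(2), of L]] by simp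
qed (simp add: assms(3,4))

lemma completion_add:
  assumes x: "x \<in> CS" and y: "y \<in> CS"
  shows "aadd (completion A) (cls x) (cls y) = cls (\<lambda>n. aadd A (x n) (y n))"
proof -
  have "cls (\<lambda>n. aadd A (x' n) (y' n)) = cls (\<lambda>n. aadd A (x n) (y n))" if "x' \<in> cls x" "y' \<in> cls y" for x' y'
  proof -
    have C: "x' \<in> CS" "y' \<in> CS" and l: "(\<lambda>n. d (x n) (x' n)) \<longlonglongrightarrow> 0" "(\<lambda>n. d (y n) (y' n)) \<longlonglongrightarrow> 0"
      using that by (simp_all add: cls_iff)
    have "(\<lambda>n. d (aadd A (x n) (y n)) (aadd A (x' n) (y' n))) \<longlonglongrightarrow> 0"
      by (rule null_comb[OF l, of _ 1 1])
        (simp_all add: d_nonneg add_closed CS_carr x y C d_add)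
    from cls_eqI[OF CS_add[OF x y] CS_add[OF C] this] show ?thesis by simp
  qed
  then have "(\<Union>x'\<in>cls x. \<Union>y'\<in>cls y. cls (\<lambda>n. aadd A (x' n) (y' n))) = cls (\<lambda>n. aadd A (x n) (y n))"
    using cls_self[OF x] cls_self[OF y] by (intro UN_eq_const) blast+
  then show ?thesis by (simp add: completion_def)
qed

lemma completion_scale:
  assumes x: "x \<in> CS"
  shows "ascale (completion A) c (cls x) = cls (\<lambda>n. ascale A c (x n))"
proof -
  have "cls (\<lambda>n. ascale A c (x' n)) = cls (\<lambda>n. ascale A c (x n))" if "x' \<in> cls x" for x'
  proof -
    have C: "x' \<in> CS" and l: "(\<lambda>n. d (x n) (x' n)) \<longlonglongrightarrow> 0" using that by (simp_all add: cls_iff)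
    have "(\<lambda>n. d (ascale A c (x n)) (ascale A c (x' n))) \<longlonglongrightarrow> 0"
      by (rule null_comb[OF l l, of _ "cmod c" 0])
        (simp_all add: d_nonneg scale_closed CS_carr x C d_scale)
    from cls_eqI[OF CS_scale[OF x] CS_scale[OF C] this] show ?thesis by simp
  qed
  then have "(\<Union>x'\<in>cls x. cls (\<lambda>n. ascale A c (x' n))) = cls (\<lambda>n. ascale A c (x n))"
    using cls_self[OF x] by (intro UN_eq_const) blast+
  then show ?thesis by (simp add: completion_def)
qed

lemma completion_star:
  assumes x: "x \<in> CS"
  shows "astar (completion A) (cls x) = cls (\<lambda>n. astar A (x n))"
proof -
  have "cls (\<lambda>n. astar A (x' n)) = cls (\<lambda>n. astar A (x n))" if "x' \<in> cls x" for x'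
  proof -
    have C: "x' \<in> CS" and l: "(\<lambda>n. d (x n) (x' n)) \<longlonglongrightarrow> 0" using that by (simp_all add: cls_iff)
    have "(\<lambda>n. d (astar A (x n)) (astar A (x' n))) \<longlonglongrightarrow> 0"
      by (rule null_comb[OF l l, of _ 1 0])
        (simp_all add: d_nonneg star_closed CS_carr x C d_star)
    from cls_eqI[OF CS_star[OF x] CS_star[OF C] this] show ?thesis by simp
  qed
  then have "(\<Union>x'\<in>cls x. cls (\<lambda>n. astar A (x' n))) = cls (\<lambda>n. astar A (x n))"
    using cls_self[OF x] by (intro UN_eq_const) blast+
  then show ?thesis by (simp add: completion_def)
qed

lemma completion_mult:
  assumes x: "x \<in> CS" and y: "y \<in> CS"
  shows "amult (completion A) (cls x) (cls y) = cls (\<lambda>n. amult A (x n) (y n))"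
proof -
  have "cls (\<lambda>n. amult A (x' n) (y' n)) = cls (\<lambda>n. amult A (x n) (y n))" if "x' \<in> cls x" "y' \<in> cls y" for x' y'
  proof -
    have C: "x' \<in> CS" "y' \<in> CS" and l: "(\<lambda>n. d (x n) (x' n)) \<longlonglongrightarrow> 0" "(\<lambda>n. d (y n) (y' n)) \<longlonglongrightarrow> 0"
      using that by (simp_all add: cls_iff)
    obtain K L where K: "\<forall>n. \<bar>anorm A (x n)\<bar> \<le> K" and L: "\<forall>n. \<bar>anorm A (y' n)\<bar> \<le> L" using CS_norm_bounded x C by metis
    have "(\<lambda>n. d (amult A (x n) (y n)) (amult A (x' n) (y' n))) \<longlonglongrightarrow> 0"
    proof (rule null_comb[OF l, of _ L K])
      fix n
      show "0 \<le> d (amult A (x n) (y n)) (amult A (x' n) (y' n))" by (simp add: d_nonneg mult_closed CS_carr x y C)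
      have "d (amult A (x n) (y n)) (amult A (x' n) (y' n)) \<le> anorm A (x n) * d (y n) (y' n) + d (x n) (x' n) * anorm A (y' n)"
        by (rule d_mult) (simp_all add: CS_carr x y C)
      also have "\<dots> \<le> K * d (y n) (y' n) + d (x n) (x' n) * L"
        using K L by (intro add_mono mult_right_mono mult_left_mono) (auto intro: order_trans[OF abs_ge_self] simp: d_nonneg CS_carr x y C)
      finally show "d (amult A (x n) (y n)) (amult A (x' n) (y' n)) \<le> L * d (x n) (x' n) + K * d (y n) (y' n)" by (simp add: mult.commute)
    qed
    from cls_eqI[OF CS_mult[OF x y] CS_mult[OF C] this] show ?thesis by simp
  qed
  then have "(\<Union>x'\<in>cls x. \<Union>y'\<in>cls y. cls (\<lambda>n. amult A (x' n) (y' n))) = cls (\<lambda>n. amult A (x n) (y n))"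
    using cls_self[OF x] cls_self[OF y] by (intro UN_eq_const) blast+
  then show ?thesis by (simp add: completion_def)
qed

lemma completion_norm:
  assumes x: "x \<in> CS" shows "(\<lambda>n. anorm A (x n)) \<longlonglongrightarrow> anorm (completion A) (cls x)"
proof -
  obtain l where l: "(\<lambda>n. anorm A (x n)) \<longlonglongrightarrow> l" using CS_norm_convergent[OF x] by blast
  have "(\<lambda>n. anorm A (y n)) \<longlonglongrightarrow> l" if "y \<in> cls x" for y
  proof -
    have y: "y \<in> CS" "(\<lambda>n. d (x n) (y n)) \<longlonglongrightarrow> 0" using that by (simp_all add: cls_iff)
    have "(\<lambda>n. anorm A (y n) - anorm A (x n)) \<longlonglongrightarrow> 0"
      by (rule Lim_null_comparison[OF _ y(2)])
        (use n_lip[OF CS_carr[OF x] CS_carr[OF y(1)]] in \<open>simp add: abs_minus_commute\<close>)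
    from tendsto_add[OF this l] show ?thesis by simp
  qed
  then have "(THE r. \<forall>y\<in>cls x. (\<lambda>n. anorm A (y n)) \<longlonglongrightarrow> r) = l"
    using cls_self[OF x] by (intro the_equality) (auto intro: LIMSEQ_unique)
  with l show ?thesis by (simp add: completion_def)
qed

lemma completion_dist:
  assumes x: "x \<in> CS" and y: "y \<in> CS"
  shows "(\<lambda>n. d (x n) (y n)) \<longlonglongrightarrow> adist (completion A) (cls x) (cls y)"
  using completion_norm[OF CS_add[OF x CS_scale[OF y]], of "-1"]
  by (simp add: adist_def completion_scale[OF y] completion_add[OF x CS_scale[OF y]])

text \<open>Turns the approximating sequences of \<open>continuous_extension\<close> into
  representatives of the class, so that its values can be computed. The proof is a triangle estimate
  through a term of \<open>x\<close> far out in the sequence.\<close>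

lemma converges_to_completion:
  assumes x: "x \<in> CS" and z: "\<And>n. z n \<in> carr A"
  shows "converges_to (completion A) (\<lambda>n. to_completion A (z n)) (cls x) \<longleftrightarrow> z \<in> CS \<and> cls z = cls x"
proof -
  have lim: "(\<lambda>m. d (z n) (x m)) \<longlonglongrightarrow> adist (completion A) (to_completion A (z n)) (cls x)" for n
    using completion_dist[OF CS_const[OF z] x] by (simp add: to_completion_def)
  note dn = d_nonneg[OF z CS_carr[OF x]]
  show ?thesis
  proof
    assume "converges_to (completion A) (\<lambda>n. to_completion A (z n)) (cls x)"
    then have c: "(\<lambda>n. adist (completion A) (to_completion A (z n)) (cls x)) \<longlonglongrightarrow> 0" by (simp add: converges_to_def)
    have ex: "\<exists>N. \<forall>n\<ge>N. d (z n) (x n) < e" if e: "0 < e" for e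
    proof -
      have e2: "0 < e / 3" using e by simp
      obtain N where N: "\<forall>m \<ge> N. \<forall>n \<ge> N. d (x m) (x n) < e / 3" using CS_D[OF x e2] by blast
      obtain M where M: "\<forall>n\<ge>M. norm (adist (completion A) (to_completion A (z n)) (cls x) - 0) < e / 3"
        using LIMSEQ_D[OF c e2] by blast
      have "d (z n) (x n) < e" if n: "n \<ge> max N M" for n
      proof -
        obtain m0 where m0: "\<forall>m\<ge>m0. norm (d (z n) (x m) - adist (completion A) (to_completion A (z n)) (cls x)) < e / 3"
          using LIMSEQ_D[OF lim e2] by blast
        \<comment> \<open>Large enough both for the limit that computes the distance and for the
          Cauchy property of \<open>x\<close>.\<close>
        define m where "m = max m0 N"
        have a1: "\<bar>d (z n) (x m) - adist (completion A) (to_completion A (z n)) (cls x)\<bar> < e / 3"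
          using m0 by (simp add: m_def)
        have a2: "\<bar>adist (completion A) (to_completion A (z n)) (cls x)\<bar> < e / 3" using M n by simp
        have a3: "d (x m) (x n) < e / 3" using N n by (simp add: m_def)
        have "d (z n) (x n) \<le> d (z n) (x m) + d (x m) (x n)" by (rule d_tri[OF z CS_carr[OF x] CS_carr[OF x]])
        with a1 a2 a3 show ?thesis by linarith
      qed
      then show ?thesis by blast
    qed
    then have l: "(\<lambda>n. d (z n) (x n)) \<longlonglongrightarrow> 0" by (intro LIMSEQ_I) (simp add: dn)
    have "z \<in> CS"
    proof (rule CS_I[OF z])
      fix e :: real assume e: "0 < e"
      then have e2: "0 < e / 3" by simp
      obtain N where N: "\<forall>m \<ge> N. \<forall>n \<ge> N. d (x m) (x n) < e / 3" using CS_D[OF x e2] by blast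
      obtain M where M: "\<forall>n\<ge>M. d (z n) (x n) < e / 3" using ex[OF e2] by blast
      have "d (z m) (z n) < e" if "m \<ge> max N M" "n \<ge> max N M" for m n
      proof -
        have "d (z m) (z n) \<le> d (z m) (x m) + d (x m) (z n)" by (rule d_tri[OF z CS_carr[OF x] z])
        moreover have "d (x m) (z n) \<le> d (x m) (x n) + d (x n) (z n)" by (rule d_tri[OF CS_carr[OF x] CS_carr[OF x] z])
        moreover have "d (z n) (x n) = d (x n) (z n)" by (rule d_sym[OF z CS_carr[OF x]])
        ultimately show ?thesis using N[rule_format, of m n] M[rule_format, of m] M[rule_format, of n] that by simp
      qed
      then show "\<exists>N. \<forall>m\<ge>N. \<forall>n\<ge>N. d (z m) (z n) < e" by blast
    qed
    with l x show "z \<in> CS \<and> cls z = cls x" by (simp add: cls_eq_iff)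
  next
    assume a: "z \<in> CS \<and> cls z = cls x"
    show "converges_to (completion A) (\<lambda>n. to_completion A (z n)) (cls x)"
      unfolding converges_to_def
    proof (rule LIMSEQ_I)
      fix e :: real assume e: "0 < e"
      then have e2: "0 < e / 2" by simp
      obtain N where N: "\<forall>m \<ge> N. \<forall>n \<ge> N. d (z m) (z n) < e / 2" using CS_D[OF conjunct1[OF a] e2] by blast
      have "norm (adist (completion A) (to_completion A (z n)) (cls x) - 0) < e" if n: "n \<ge> N" for n
      proof -
        have l: "(\<lambda>m. d (z n) (z m)) \<longlonglongrightarrow> adist (completion A) (to_completion A (z n)) (cls x)"
          using completion_dist[OF CS_const[OF z] conjunct1[OF a]] a by (simp add: to_completion_def)
        have "adist (completion A) (to_completion A (z n)) (cls x) \<le> e / 2"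
          by (rule LIMSEQ_le_const2[OF l]) (use N n in \<open>auto intro!: exI[of _ N] less_imp_le\<close>)
        moreover have "0 \<le> adist (completion A) (to_completion A (z n)) (cls x)"
          by (rule LIMSEQ_le_const[OF l]) (use d_nonneg[OF z z] in auto)
        ultimately show ?thesis using e by simp
      qed
      then show "\<exists>no. \<forall>n\<ge>no. norm (adist (completion A) (to_completion A (z n)) (cls x) - 0) < e" by blast
    qed
  qed
qed

end

lemma continuous_extension_eqI:
  assumes "b \<in> carr B" "\<And>n. z n \<in> D" "converges_to A (\<lambda>n. p (z n)) a" "converges_to B (\<lambda>n. q (z n)) b"
    and "\<And>b' z'. b' \<in> carr B \<Longrightarrow> (\<And>n. z' n \<in> D) \<Longrightarrow> converges_to A (\<lambda>n. p (z' n)) a \<Longrightarrow> converges_to B (\<lambda>n. q (z' n)) b' \<Longrightarrow> b' = b"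
  shows "continuous_extension D A p B q a = b"
  unfolding continuous_extension_def
  by (rule the_equality) (use assms in blast)+

section \<open>Representations and the full norm\<close>

context lch_etale
begin

lemma zero_rep: "(\<lambda>f \<xi> i. 0) \<in> I_bounded_reps G"
proof -
  have "op_adjoint UNIV (\<lambda>_ _. 0) = ((\<lambda>_ _. 0) :: ('g \<Rightarrow> complex) operator)" by (rule op_adjoint_eqI) (auto simp: bounded_ops_zero)
  then show ?thesis
    unfolding I_bounded_reps_def star_hom_def norm_bounded_def
    by (auto simp: Cc_algebra_def operator_algebra_def bounded_ops_zero o_def intro!: exI[of _ 0])
qed

context
  fixes \<pi> assumes \<pi>: "\<pi> \<in> I_bounded_reps G"
begin

lemma rep_bounded_ops: "f \<in> Cc G \<Longrightarrow> \<pi> f \<in> bounded_ops UNIV"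
  and rep_add: "f \<in> Cc G \<Longrightarrow> g \<in> Cc G \<Longrightarrow> \<pi> (f \<^bold>+ g) = (\<pi> f \<oplus> \<pi> g)"
  and rep_scale: "f \<in> Cc G \<Longrightarrow> \<pi> (\<lambda>\<gamma>. c * f \<gamma>) = (\<lambda>\<xi> i. c * \<pi> f \<xi> i)"
  and rep_convolution: "f \<in> Cc G \<Longrightarrow> g \<in> Cc G \<Longrightarrow> \<pi> (f \<star> g) = \<pi> f \<circ> \<pi> g"
  and rep_involution: "f \<in> Cc G \<Longrightarrow> \<pi> (involution G f) = op_adjoint UNIV (\<pi> f)"
  using \<pi> unfolding I_bounded_reps_def star_hom_def by (simp_all add: Cc_algebra_def operator_algebra_def)

lemma rep_diff: "f \<in> Cc G \<Longrightarrow> g \<in> Cc G \<Longrightarrow> \<pi> (f \<^bold>- g) = (\<pi> f \<ominus> \<pi> g)"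
  using rep_add[of f "\<lambda>\<gamma>. (-1) * g \<gamma>"] rep_scale[of g "-1"] Cc_scale[of g "-1"] by simp

lemma rep_zero: "\<pi> (\<lambda>_. 0) = (\<lambda>_ _. 0)"
  using rep_scale[OF Cc_zero, of 0] by simp

lemma rep_sum: "(\<And>k. k \<in> K \<Longrightarrow> f k \<in> Cc G) \<Longrightarrow> \<pi> (\<lambda>\<gamma>. \<Sum>k\<in>K. f k \<gamma>) = (\<lambda>\<xi> i. \<Sum>k\<in>K. \<pi> (f k) \<xi> i)"
  by (induction K rule: infinite_finite_induct) (simp_all add: rep_zero rep_add Cc_sum)

text \<open>The C*-identity removes the constant from the boundedness assumption: under repeated
  passage from \<open>h\<close> to \<open>h* h\<close> the operator norm and the
  \<open>I\<close>-bound both get squared while the constant stays the same, so it disappears after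
  roots of order \<open>2 ^ n\<close>. Hence the supremum defining the full norm is finite.\<close>

lemma op_norm_rep_le_I:
  assumes f: "f \<in> Cc G" and C: "I_bounded_by f C" shows "op_norm UNIV (\<pi> f) \<le> C"
proof (cases "units G = {}")
  \<comment> \<open>Without units the supremum in \<open>I_norm\<close> is taken over the empty set
    and carries no information.\<close>
  case True
  then have "arr = {}" by (auto simp: units_def)
  then have "f = (\<lambda>_. 0)" using Cc_vanish[OF f] by auto
  then show ?thesis using I_bounded_by_nonneg[OF C] by (simp add: rep_zero)
next
  case False
  obtain K where K: "\<And>g. g \<in> Cc G \<Longrightarrow> op_norm UNIV (\<pi> g) \<le> K * I_norm G g"
    using \<pi> unfolding I_bounded_reps_def norm_bounded_def by (auto simp: Cc_algebra_def operator_algebra_def)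
  define c where "c = rec_nat f (\<lambda>_ h. convolution G (involution G h) h)"
  have c0: "c 0 = f" and cS: "c (Suc n) = involution G (c n) \<star> c n" for n by (simp_all add: c_def)
  have cC: "c n \<in> Cc G" for n by (induction n) (simp_all add: c0 cS f Cc_convolution Cc_involution)
  have cI: "I_bounded_by (c n) (C ^ (2 ^ n))" for n
  proof (induction n)
    case (Suc n)
    then show ?case
      using I_bounded_by_convolution[OF Cc_involution[OF cC] I_bounded_by_involution cC, of n "C ^ (2 ^ n)" n "C ^ (2 ^ n)"]
      by (simp add: cS power_add[symmetric] mult_2)
  qed (simp add: c0 C)
  have cN: "op_norm UNIV (\<pi> (c n)) = op_norm UNIV (\<pi> f) ^ (2 ^ n)" for n
  proof (induction n)
    case (Suc n)
    have "op_norm UNIV (\<pi> (c (Suc n))) = (op_norm UNIV (\<pi> (c n)))\<^sup>2"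
      unfolding cS rep_convolution[OF Cc_involution[OF cC] cC] rep_involution[OF cC]
      by (rule op_norm_Cstar[OF rep_bounded_ops[OF cC]])
    then show ?case using Suc by (simp add: power_mult[symmetric] mult.commute)
  qed (simp add: c0)
  have K0: "op_norm UNIV (\<pi> f) ^ (2 ^ n) \<le> (\<bar>K\<bar> + 1) * C ^ (2 ^ n)" for n
  proof -
    have "op_norm UNIV (\<pi> f) ^ (2 ^ n) \<le> K * I_norm G (c n)" using K[OF cC, of n] by (simp add: cN)
    also have "\<dots> \<le> (\<bar>K\<bar> + 1) * C ^ (2 ^ n)"
      using I_norm_le[OF False cC cI, of n] I_bounded_by_nonneg[OF I_bounded_by_I_norm[OF False cC]]
      by (intro mult_mono) auto
    finally show ?thesis .
  qed
  show ?thesis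
  proof (rule ccontr)
    assume "\<not> ?thesis"
    then have lt: "C < op_norm UNIV (\<pi> f)" by simp
    have C0: "0 \<le> C" by (rule I_bounded_by_nonneg[OF C])
    show False
    proof (cases "C = 0")
      case True
      then show False using K0[of 0] lt by simp
    next
      case False
      \<comment> \<open>If the bound failed, the powers of \<open>q > 1\<close> would outgrow the
        fixed constant.\<close>
      define q where "q = op_norm UNIV (\<pi> f) / C"
      have q: "1 < q" using lt C0 False by (simp add: q_def)
      obtain n where n: "\<bar>K\<bar> + 1 < q ^ n" using real_arch_pow[OF q] by blast
      have "q ^ n \<le> q ^ (2 ^ n)" using q by (intro power_increasing) (auto intro: less_imp_le less_exp)
      then have "\<bar>K\<bar> + 1 < q ^ (2 ^ n)" using n by linarith
      then have "(\<bar>K\<bar> + 1) * C ^ (2 ^ n) < op_norm UNIV (\<pi> f) ^ (2 ^ n)"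
        using C0 False by (simp add: q_def power_divide field_simps)
      with K0[of n] show False by linarith
    qed
  qed
qed

end

abbreviation "FN \<equiv> full_norm G"

lemma full_norm_bdd: assumes "f \<in> Cc G" shows "bdd_above ((\<lambda>\<pi>. op_norm UNIV (\<pi> f)) ` I_bounded_reps G)"
proof -
  obtain C where "I_bounded_by f C" using I_bounded_by_exists[OF assms] by blast
  then show ?thesis by (intro bdd_aboveI2[of _ _ C]) (rule op_norm_rep_le_I[OF _ assms])
qed

lemma rep_le_full_norm: "\<pi> \<in> I_bounded_reps G \<Longrightarrow> f \<in> Cc G \<Longrightarrow> op_norm UNIV (\<pi> f) \<le> FN f"
  unfolding full_norm_def by (rule cSUP_upper[OF _ full_norm_bdd])

lemma full_norm_leI: "(\<And>\<pi>. \<pi> \<in> I_bounded_reps G \<Longrightarrow> op_norm UNIV (\<pi> f) \<le> C) \<Longrightarrow> FN f \<le> C"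
  unfolding full_norm_def by (rule cSUP_least) (use zero_rep in auto)

lemma full_norm_nonneg: "f \<in> Cc G \<Longrightarrow> 0 \<le> FN f"
  using rep_le_full_norm[OF zero_rep, of f] by simp

lemma full_norm_zero: "FN (\<lambda>_. 0) = 0"
  by (rule antisym[OF full_norm_leI full_norm_nonneg]) (simp_all add: rep_zero)

lemma full_norm_add: "f \<in> Cc G \<Longrightarrow> g \<in> Cc G \<Longrightarrow> FN (f \<^bold>+ g) \<le> FN f + FN g"
proof (rule full_norm_leI)
  fix \<pi> assume a: "f \<in> Cc G" "g \<in> Cc G" "\<pi> \<in> I_bounded_reps G"
  show "op_norm UNIV (\<pi> (f \<^bold>+ g)) \<le> FN f + FN g"
    unfolding rep_add[OF a(3,1,2)]
    by (rule order_trans[OF op_norm_triangle[OF rep_bounded_ops[OF a(3,1)] rep_bounded_ops[OF a(3,2)]]])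
      (rule add_mono[OF rep_le_full_norm[OF a(3,1)] rep_le_full_norm[OF a(3,2)]])
qed

lemma full_norm_scale_le: "f \<in> Cc G \<Longrightarrow> FN (\<lambda>\<gamma>. c * f \<gamma>) \<le> cmod c * FN f"
proof (rule full_norm_leI)
  fix \<pi> assume a: "f \<in> Cc G" "\<pi> \<in> I_bounded_reps G"
  show "op_norm UNIV (\<pi> (\<lambda>\<gamma>. c * f \<gamma>)) \<le> cmod c * FN f"
    unfolding rep_scale[OF a(2,1)] op_norm_scale[OF rep_bounded_ops[OF a(2,1)]]
    by (rule mult_left_mono[OF rep_le_full_norm[OF a(2,1)]]) simp
qed

lemma full_norm_convolution: "f \<in> Cc G \<Longrightarrow> g \<in> Cc G \<Longrightarrow> FN (f \<star> g) \<le> FN f * FN g"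
proof (rule full_norm_leI)
  fix \<pi> assume a: "f \<in> Cc G" "g \<in> Cc G" "\<pi> \<in> I_bounded_reps G"
  show "op_norm UNIV (\<pi> (f \<star> g)) \<le> FN f * FN g"
    unfolding rep_convolution[OF a(3,1,2)]
    by (rule order_trans[OF op_norm_compose[OF rep_bounded_ops[OF a(3,1)] rep_bounded_ops[OF a(3,2)]]])
      (rule mult_mono[OF rep_le_full_norm[OF a(3,1)] rep_le_full_norm[OF a(3,2)] full_norm_nonneg[OF a(1)] op_norm_nonneg[OF rep_bounded_ops[OF a(3,2)]]])
qed

lemma full_norm_involution: "f \<in> Cc G \<Longrightarrow> FN (involution G f) \<le> FN f"
proof (rule full_norm_leI)
  fix \<pi> assume a: "f \<in> Cc G" "\<pi> \<in> I_bounded_reps G"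
  show "op_norm UNIV (\<pi> (involution G f)) \<le> FN f"
    unfolding rep_involution[OF a(2,1)] op_norm_adjoint[OF rep_bounded_ops[OF a(2,1)]] by (rule rep_le_full_norm[OF a(2,1)])
qed

text \<open>Transported along the injection \<open>basis_vector\<close> into the index type of
  \<open>I_bounded_reps\<close>, the regular representation takes part in the supremum.\<close>

lemma lam_le_full_norm: assumes f: "f \<in> Cc G" shows "op_norm arr (lam f) \<le> FN f"
proof -
  have inj: "inj_on (basis_vector :: 'g \<Rightarrow> 'g \<Rightarrow> complex) arr"
    by (rule inj_onI) (metis basis_vector_def one_neq_zero)
  define \<pi> where "\<pi> f = op_push basis_vector arr (lam f)" for f
  have "\<pi> \<in> I_bounded_reps G"
    unfolding I_bounded_reps_def star_hom_def norm_bounded_def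
  proof (intro CollectI conjI ballI allI)
    show "\<exists>C. \<forall>a\<in>carr (Cc_algebra G). anorm (operator_algebra UNIV) (\<pi> a) \<le> C * anorm (Cc_algebra G) a"
    \<comment> \<open>For the empty groupoid \<open>I_norm\<close> is the supremum of the empty set,
      a value of unknown sign; the factor 0 removes it.\<close>
    proof (intro exI[of _ "if units G = {} then 0 else 1"] ballI)
      fix a assume "a \<in> carr (Cc_algebra G)"
      then have a: "a \<in> Cc G" by (simp add: Cc_algebra_def)
      have 1: "op_norm UNIV (\<pi> a) \<le> op_norm arr (lam a)" unfolding \<pi>_def by (rule op_norm_push_le[OF inj lam_bounded_ops[OF a]])
      have "op_norm arr (lam a) \<le> (if units G = {} then 0 else 1) * I_norm G a"
      proof (cases "units G = {}")
        case True
        then have "arr = {}" by (auto simp: units_def)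
        then have "I_bounded_by a 0" using Cc_vanish[OF a] by (simp add: I_bounded_by_def)
        then show ?thesis using op_norm_lam_le[OF a] True by simp
      next
        case False
        then show ?thesis using op_norm_lam_le[OF a I_bounded_by_I_norm[OF False a]] by simp
      qed
      with 1 show "anorm (operator_algebra UNIV) (\<pi> a) \<le> (if units G = {} then 0 else 1) * anorm (Cc_algebra G) a"
        by (simp add: operator_algebra_def Cc_algebra_def)
    qed
  qed (auto simp: Cc_algebra_def operator_algebra_def \<pi>_def lam_add lam_scale lam_convolution lam_involution
      op_push_add[OF inj] op_push_scale[OF inj] op_push_compose[OF inj] op_push_adjoint[OF inj] lam_bounded_ops op_push_bounded[OF inj])
  from rep_le_full_norm[OF this f] op_norm_push_ge[OF inj lam_bounded_ops[OF f]] show ?thesis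
    by (simp add: \<pi>_def)
qed

abbreviation "FA \<equiv> (Cc_algebra G)\<lparr>anorm := full_norm G\<rparr>"

lemma FA_simps [simp]: "carr FA = Cc G" "aadd FA = (\<lambda>f g \<gamma>. f \<gamma> + g \<gamma>)" "ascale FA = (\<lambda>c f \<gamma>. c * f \<gamma>)"
  "amult FA = convolution G" "astar FA = involution G" "anorm FA = full_norm G" "azero FA = (\<lambda>_. 0)"
  by (simp_all add: Cc_algebra_def)

lemma adist_FA: "adist FA f g = FN (f \<^bold>- g)"
  by (simp add: adist_def)

lemma convolution_sum_right: "f \<in> Cc G \<Longrightarrow> convolution G f (g \<^bold>- h) = (convolution G f g \<^bold>- convolution G f h)"
proof
  fix \<gamma> assume f: "f \<in> Cc G"
  show "(f \<star> (g \<^bold>- h)) \<gamma> = (f \<star> g) \<gamma> - (f \<star> h) \<gamma>"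
    by (cases "\<gamma> \<in> arr") (simp_all add: convolution_off convolution_Cc_rng[OF f] right_diff_distrib sum_subtractf)
qed

lemma convolution_diff_left: "g \<in> Cc G \<Longrightarrow> convolution G (f \<^bold>- h) g = (convolution G f g \<^bold>- convolution G h g)"
proof
  fix \<gamma> assume g: "g \<in> Cc G"
  show "((f \<^bold>- h) \<star> g) \<gamma> = (f \<star> g) \<gamma> - (h \<star> g) \<gamma>"
    by (cases "\<gamma> \<in> arr") (simp_all add: convolution_off convolution_Cc[OF g] left_diff_distrib sum_subtractf)
qed

lemma involution_diff: "involution G (f \<^bold>- g) = (involution G f \<^bold>- involution G g)"
  by (auto simp: involution_def)

lemma full_norm_minus_commute: "f \<in> Cc G \<Longrightarrow> g \<in> Cc G \<Longrightarrow> FN (f \<^bold>- g) = FN (g \<^bold>- f)"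
  using full_norm_scale_le[OF Cc_diff, of f g "-1"] full_norm_scale_le[OF Cc_diff, of g f "-1"] by simp

lemma full_norm_triangle_diff:
  "f \<in> Cc G \<Longrightarrow> g \<in> Cc G \<Longrightarrow> h \<in> Cc G \<Longrightarrow> FN (f \<^bold>- h) \<le> FN (f \<^bold>- g) + FN (g \<^bold>- h)"
  using full_norm_add[OF Cc_diff[of f g] Cc_diff[of g h]] by simp

lemma FA_seminormed: "seminormed_algebra FA"
proof
  fix a b a' b' assume c: "a \<in> carr FA" "b \<in> carr FA" "a' \<in> carr FA" "b' \<in> carr FA"
  then have C: "a \<in> Cc G" "b \<in> Cc G" "a' \<in> Cc G" "b' \<in> Cc G" by simp_all
  have "(\<lambda>\<gamma>. a \<gamma> + b \<gamma> - (a' \<gamma> + b' \<gamma>)) = (\<lambda>\<gamma>. (a \<gamma> - a' \<gamma>) + (b \<gamma> - b' \<gamma>))" by auto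
  then show "adist FA (aadd FA a b) (aadd FA a' b') \<le> adist FA a a' + adist FA b b'"
    using full_norm_add[OF Cc_diff[OF C(1,3)] Cc_diff[OF C(2,4)]] by (simp add: adist_FA)
  have "FN (convolution G a b \<^bold>- convolution G a' b') \<le>
    FN (convolution G a b \<^bold>- convolution G a b') + FN (convolution G a b' \<^bold>- convolution G a' b')"
    by (intro full_norm_triangle_diff Cc_convolution C)
  also have "\<dots> \<le> FN a * FN (b \<^bold>- b') + FN (a \<^bold>- a') * FN b'"
    unfolding convolution_sum_right[OF C(1), symmetric] convolution_diff_left[OF C(4), symmetric]
    by (intro add_mono full_norm_convolution Cc_diff C)
  finally show "adist FA (amult FA a b) (amult FA a' b') \<le> anorm FA a * adist FA b b' + adist FA a a' * anorm FA b'"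
    by (simp add: adist_FA)
next
  fix a b c assume "a \<in> carr FA" "b \<in> carr FA" "c \<in> carr FA"
  then show "adist FA a c \<le> adist FA a b + adist FA b c" by (simp add: adist_FA full_norm_triangle_diff)
next
  fix a b :: "'g \<Rightarrow> complex" and c :: complex assume "a \<in> carr FA" "b \<in> carr FA"
  then have C: "a \<in> Cc G" "b \<in> Cc G" by simp_all
  show "adist FA (ascale FA c a) (ascale FA c b) \<le> cmod c * adist FA a b"
    using full_norm_scale_le[OF Cc_diff[OF C], of c] by (simp add: adist_FA right_diff_distrib)
  show "adist FA (astar FA a) (astar FA b) \<le> adist FA a b"
    using full_norm_involution[OF Cc_diff[OF C]] by (simp add: adist_FA involution_diff)
  show "adist FA a b = adist FA b a" using full_norm_minus_commute C by (simp add: adist_FA)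
  show "\<bar>anorm FA a - anorm FA b\<bar> \<le> adist FA a b"
    using full_norm_add[OF Cc_diff[OF C] C(2)] full_norm_add[OF Cc_diff[OF C(2,1)] C(1)] full_norm_minus_commute[OF C]
    by (simp add: adist_FA)
qed (simp_all add: adist_FA full_norm_zero Cc_add Cc_scale Cc_convolution Cc_involution)

end

section \<open>Reduced algebras\<close>

sublocale lch_etale \<subseteq> C: seminormed_algebra FA
  by (rule FA_seminormed)

lemma converges_to_operator: "converges_to (operator_algebra S) T U \<longleftrightarrow> op_conv S T U"
  by (simp add: converges_to_def op_conv_def adist_def operator_algebra_def)

lemma op_conv_close:
  assumes T: "\<And>n. T n \<in> bounded_ops S" and U: "\<And>n. U n \<in> bounded_ops S" and b: "b \<in> bounded_ops S" "op_conv S T b"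
    and c: "c \<longlonglongrightarrow> 0" "\<And>n. op_norm S (T n \<ominus> U n) \<le> c n"
  shows "op_conv S U b"
  unfolding op_conv_def
proof (rule Lim_null_comparison[OF always_eventually], rule allI)
  fix n
  have "op_norm S (U n \<ominus> b) \<le> op_norm S (U n \<ominus> T n) + op_norm S (T n \<ominus> b)"
    by (rule op_norm_diff_triangle[OF U T b(1)])
  also have "\<dots> \<le> c n + op_norm S (T n \<ominus> b)"
    using c(2)[of n] unfolding op_norm_minus_commute[OF T U, of n] by (rule add_right_mono)
  finally show "norm (op_norm S (U n \<ominus> b)) \<le> c n + op_norm S (T n \<ominus> b)"
    using op_norm_nonneg[OF bounded_ops_diff[OF U b(1)], of n] by simp
next
  show "(\<lambda>n. c n + op_norm S (T n \<ominus> b)) \<longlonglongrightarrow> 0"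
    using tendsto_add[OF c(1) b(2)[unfolded op_conv_def]] by simp
qed

context lch_etale
begin

lemma converges_to_reduced: "converges_to (reduced_algebra G) V W \<longleftrightarrow> op_conv arr V W"
  by (simp add: converges_to_def op_conv_def adist_def reduced_algebra_def operator_algebra_def)

lemma CS_Cc: "x \<in> C.CS \<Longrightarrow> x n \<in> Cc G"
  using C.CS_carr[of x n] by simp

lemma lam_diff_le: "f \<in> Cc G \<Longrightarrow> g \<in> Cc G \<Longrightarrow> op_norm arr (lam f \<ominus> lam g) \<le> FN (f \<^bold>- g)"
  using lam_le_full_norm[OF Cc_diff, of f g] by (simp add: lam_diff)

lemma lam_limit_exists:
  assumes x: "x \<in> C.CS" shows "\<exists>b \<in> bounded_ops arr. op_conv arr (\<lambda>n. lam (x n)) b"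
  unfolding op_conv_def
proof (rule bounded_ops_complete[OF lam_bounded_ops[OF CS_Cc[OF x]]])
  fix e :: real assume "0 < e"
  then obtain N where N: "\<forall>m \<ge> N. \<forall>n \<ge> N. adist FA (x m) (x n) < e" using C.CS_D[OF x] by blast
  have "op_norm arr (lam (x m) \<ominus> lam (x n)) < e" if "m \<ge> N" "n \<ge> N" for m n
    using le_less_trans[OF lam_diff_le[OF CS_Cc[OF x] CS_Cc[OF x]] N[rule_format, OF that, unfolded adist_FA]] .
  then show "\<exists>N. \<forall>m\<ge>N. \<forall>n\<ge>N. op_norm arr (lam (x m) \<ominus> lam (x n)) < e" by blast
qed

lemma lam_limit_cls:
  assumes x: "x \<in> C.CS" and y: "y \<in> C.CS" and e: "C.cls x = C.cls y"
    and b: "b \<in> bounded_ops arr" "op_conv arr (\<lambda>n. lam (x n)) b"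
  shows "op_conv arr (\<lambda>n. lam (y n)) b"
proof (rule op_conv_close[OF lam_bounded_ops[OF CS_Cc[OF x]] lam_bounded_ops[OF CS_Cc[OF y]] b])
  show "(\<lambda>n. adist FA (x n) (y n)) \<longlonglongrightarrow> 0" using C.cls_eq_iff[OF x y] e by simp
  show "op_norm arr (lam (x n) \<ominus> lam (y n)) \<le> adist FA (x n) (y n)" for n
    unfolding adist_FA by (rule lam_diff_le[OF CS_Cc[OF x] CS_Cc[OF y]])
qed

lemma full_algebra_carr: "carr (full_algebra G) = C.cls ` C.CS"
  by (simp add: full_algebra_def C.completion_carr)

lemma full_embed_converges:
  assumes "x \<in> C.CS" "\<And>n. z n \<in> Cc G"
  shows "converges_to (full_algebra G) (\<lambda>n. full_embed G (z n)) (C.cls x) \<longleftrightarrow> z \<in> C.CS \<and> C.cls z = C.cls x"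
  unfolding full_algebra_def full_embed_def by (rule C.converges_to_completion) (use assms in auto)

lemma reduced_quotient_eq:
  assumes x: "x \<in> C.CS" and b: "b \<in> bounded_ops arr" "op_conv arr (\<lambda>n. lam (x n)) b"
  shows "reduced_quotient G (C.cls x) = b"
  unfolding reduced_quotient_def
proof (rule continuous_extension_eqI)
  show "b \<in> carr (operator_algebra arr)" using b by (simp add: operator_algebra_def)
  show "x n \<in> Cc G" for n by (rule CS_Cc[OF x])
  show "converges_to (full_algebra G) (\<lambda>n. full_embed G (x n)) (C.cls x)"
    using full_embed_converges[OF x CS_Cc[OF x]] x by simp
  show "converges_to (operator_algebra arr) (\<lambda>n. lam (x n)) b" using b by (simp add: converges_to_operator)
next
  fix b' z assume h: "b' \<in> carr (operator_algebra arr)" "\<And>n. z n \<in> Cc G"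
    "converges_to (full_algebra G) (\<lambda>n. full_embed G (z n)) (C.cls x)" "converges_to (operator_algebra arr) (\<lambda>n. lam (z n)) b'"
  have z: "z \<in> C.CS" "C.cls z = C.cls x" using full_embed_converges[OF x h(2)] h(3) by auto
  have "op_conv arr (\<lambda>n. lam (x n)) b'"
    by (rule lam_limit_cls[OF z(1) x z(2)]) (use h(1) h(4)[unfolded converges_to_operator] in \<open>simp_all add: operator_algebra_def\<close>)
  then show "b' = b"
    using op_conv_unique[OF lam_bounded_ops[OF CS_Cc[OF x]] _ _ b] h(1) by (simp add: operator_algebra_def)
qed

text \<open>The sequences allowed here are Cauchy for the full norm. That limits in operator norm
  alone also belong to the algebra is the content of \<open>reduced_closed\<close>.\<close>

lemma reduced_carr: "carr (reduced_algebra G) = {b \<in> bounded_ops arr. \<exists>x \<in> C.CS. op_conv arr (\<lambda>n. lam (x n)) b}"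
proof (intro equalityI subsetI)
  fix b assume "b \<in> carr (reduced_algebra G)"
  then obtain x where x: "x \<in> C.CS" "b = reduced_quotient G (C.cls x)"
    by (auto simp: reduced_algebra_def full_algebra_carr)
  obtain b' where b': "b' \<in> bounded_ops arr" "op_conv arr (\<lambda>n. lam (x n)) b'" using lam_limit_exists[OF x(1)] by blast
  show "b \<in> {b \<in> bounded_ops arr. \<exists>x \<in> C.CS. op_conv arr (\<lambda>n. lam (x n)) b}"
    using reduced_quotient_eq[OF x(1) b'] b' x by auto
next
  fix b assume "b \<in> {b \<in> bounded_ops arr. \<exists>x \<in> C.CS. op_conv arr (\<lambda>n. lam (x n)) b}"
  then obtain x where x: "x \<in> C.CS" and b: "b \<in> bounded_ops arr" "op_conv arr (\<lambda>n. lam (x n)) b" by auto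
  show "b \<in> carr (reduced_algebra G)" using reduced_quotient_eq[OF x b] x
    by (auto simp: reduced_algebra_def full_algebra_carr)
qed

lemma reduced_bounded: "b \<in> carr (reduced_algebra G) \<Longrightarrow> b \<in> bounded_ops arr"
  by (simp add: reduced_carr)

lemma lam_reduced: assumes f: "f \<in> Cc G" shows "lam f \<in> carr (reduced_algebra G)"
  using C.CS_const[of f] f by (auto simp: reduced_carr lam_bounded_ops op_conv_const intro!: bexI[of _ "\<lambda>_. f"])

lemma reduced_simps [simp]: "azero (reduced_algebra G) = (\<lambda>_ _. 0)" "aadd (reduced_algebra G) = (\<lambda>T U \<xi> i. T \<xi> i + U \<xi> i)"
  "ascale (reduced_algebra G) = (\<lambda>c T \<xi> i. c * T \<xi> i)" "amult (reduced_algebra G) = (\<lambda>T U. T \<circ> U)"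
  "astar (reduced_algebra G) = op_adjoint arr" "anorm (reduced_algebra G) = op_norm arr"
  by (simp_all add: reduced_algebra_def operator_algebra_def)

section \<open>Isotropy subgroupoid, its algebras and their inclusions\<close>

section \<open>The interior of the isotropy\<close>

abbreviation "Iso \<equiv> isotropy_interior G"
abbreviation "IG \<equiv> iso_groupoid G"

lemma IG_simps [simp]: "gsrc IG = s" "grng IG = r" "gmult IG = gmult G" "ginv IG = iv" "gtop IG = subtopology T Iso"
  by (simp_all add: iso_groupoid_def)

lemma Iso_open: "openin T Iso"
  by (simp add: isotropy_interior_def openin_interior_of)

lemma Iso_isotropy: "Iso \<subseteq> isotropy G"
  by (simp add: isotropy_interior_def interior_of_subset)

lemma Iso_D: "\<gamma> \<in> Iso \<Longrightarrow> \<gamma> \<in> arr" "\<gamma> \<in> Iso \<Longrightarrow> r \<gamma> = s \<gamma>"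
  using Iso_isotropy by (auto simp: isotropy_def)

lemma Iso_maximal: "openin T U \<Longrightarrow> U \<subseteq> isotropy G \<Longrightarrow> U \<subseteq> Iso"
  by (simp add: isotropy_interior_def interior_of_maximal)

lemma arrows_IG [simp]: "arrows IG = Iso"
  using openin_subset[OF Iso_open] by (auto simp: arrows_def)

lemma units_Iso: "units G \<subseteq> Iso"
  by (rule Iso_maximal[OF units_open]) (auto simp: isotropy_def unit_simps)

text \<open>Products of open sets are open and products of isotropy arrows are isotropy arrows; the
  interior is the largest open set of isotropy arrows.\<close>

lemma Iso_mult:
  assumes "\<alpha> \<in> Iso" "\<beta> \<in> Iso" "s \<alpha> = r \<beta>" shows "\<alpha> \<odot> \<beta> \<in> Iso"
proof -
  have "{\<alpha> \<odot> \<beta> |\<alpha> \<beta>. \<alpha> \<in> Iso \<and> \<beta> \<in> Iso \<and> s \<alpha> = r \<beta>} \<subseteq> isotropy G"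
    by (auto simp: isotropy_def Iso_D)
  then show ?thesis using Iso_maximal[OF mult_open[OF Iso_open Iso_open]] assms by blast
qed

lemma Iso_iv: assumes "\<alpha> \<in> Iso" shows "iv \<alpha> \<in> Iso"
proof -
  have "iv ` Iso \<subseteq> isotropy G" by (auto simp: isotropy_def Iso_D)
  then show ?thesis using Iso_maximal[OF inv_open[OF Iso_open]] assms by blast
qed

lemma Iso_iv_iff: "\<alpha> \<in> arr \<Longrightarrow> iv \<alpha> \<in> Iso \<longleftrightarrow> \<alpha> \<in> Iso"
  using Iso_iv inv_inv by metis

lemma Iso_src: "\<alpha> \<in> Iso \<Longrightarrow> s \<alpha> \<in> Iso"
  using units_Iso Iso_D(1) src_unit by blast

lemma Iso_rng: "\<alpha> \<in> Iso \<Longrightarrow> r \<alpha> \<in> Iso"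
  using units_Iso Iso_D(1) rng_unit by blast

lemma Iso_mult_left:
  assumes "\<alpha> \<in> arr" "\<beta> \<in> Iso" "s \<alpha> = r \<beta>" shows "\<alpha> \<odot> \<beta> \<in> Iso \<longleftrightarrow> \<alpha> \<in> Iso"
proof
  assume "\<alpha> \<odot> \<beta> \<in> Iso"
  then have "(\<alpha> \<odot> \<beta>) \<odot> iv \<beta> \<in> Iso"
    by (rule Iso_mult[OF _ Iso_iv[OF assms(2)]]) (use assms Iso_D(1) in auto)
  then show "\<alpha> \<in> Iso" unfolding cancel(2)[OF assms(1) Iso_D(1)[OF assms(2)] assms(3)] .
qed (use assms Iso_mult in auto)

lemma Iso_mult_right:
  assumes "\<alpha> \<in> Iso" "\<beta> \<in> arr" "s \<alpha> = r \<beta>" shows "\<alpha> \<odot> \<beta> \<in> Iso \<longleftrightarrow> \<beta> \<in> Iso"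
proof
  assume "\<alpha> \<odot> \<beta> \<in> Iso"
  then have "iv \<alpha> \<odot> (\<alpha> \<odot> \<beta>) \<in> Iso"
    by (rule Iso_mult[OF Iso_iv[OF assms(1)]]) (use assms Iso_D(1) in auto)
  then show "\<beta> \<in> Iso" unfolding cancel(1)[OF Iso_D(1)[OF assms(1)] assms(2,3)] .
qed (use assms Iso_mult in auto)

lemma units_IG [simp]: "units IG = units G"
proof -
  have "s ` Iso = units G"
  proof
    show "s ` Iso \<subseteq> units G" using Iso_D by auto
    show "units G \<subseteq> s ` Iso" using units_Iso unit_simps(2) by (metis image_eqI subsetD subsetI)
  qed
  then show ?thesis by (simp add: units_def)
qed

lemma src_fibre_IG: "src_fibre IG u = src_fibre G u \<inter> Iso" and rng_fibre_IG: "rng_fibre IG u = rng_fibre G u \<inter> Iso"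
  using Iso_D by (auto simp: src_fibre_def rng_fibre_def)

text \<open>Stated for a general \<open>p\<close> because it is applied to the source and to the
  range map. On a bisection cut down to \<open>Iso\<close> the map is continuous, open and
  injective.\<close>

lemma iso_local_homeo:
  assumes p: "continuous_map T T p" "\<And>U. openin T U \<Longrightarrow> openin T (p ` U)" "\<And>U. bisection U \<Longrightarrow> inj_on p U" "\<And>\<alpha>. \<alpha> \<in> arr \<Longrightarrow> p \<alpha> \<in> units G"
  shows "local_homeomorphism (subtopology T Iso) (subtopology (subtopology T Iso) (units G)) p"
  unfolding local_homeomorphism_def
proof
  fix x assume "x \<in> topspace (subtopology T Iso)"
  then have x: "x \<in> Iso" by simp
  obtain B where B: "bisection B" "x \<in> B" using bisection_exists Iso_D x by blast
  let ?U = "B \<inter> Iso"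
  have Bo: "openin T B" using B by (simp add: bisection_def)
  have Uo: "openin T ?U" using Bo Iso_open by blast
  have pU: "p ` ?U \<subseteq> units G" using p(4) Iso_D by auto
  have e1: "subtopology (subtopology T Iso) ?U = subtopology T ?U"
  proof -
    have "Iso \<inter> ?U = ?U" by blast
    then show ?thesis by (simp only: subtopology_subtopology)
  qed
  have e2: "subtopology (subtopology (subtopology T Iso) (units G)) (p ` ?U) = subtopology T (p ` ?U)"
  proof -
    have "Iso \<inter> units G \<inter> p ` ?U = p ` ?U" using pU units_Iso by blast
    then show ?thesis by (simp add: subtopology_subtopology)
  qed
  have tU: "topspace (subtopology T ?U) = ?U" using openin_subset[OF Uo] by auto
  have tpU: "topspace (subtopology T (p ` ?U)) = p ` ?U" using openin_subset[OF p(2)[OF Uo]] by auto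
  have "homeomorphic_map (subtopology T ?U) (subtopology T (p ` ?U)) p"
  proof (rule bijective_open_imp_homeomorphic_map)
    show "continuous_map (subtopology T ?U) (subtopology T (p ` ?U)) p"
      by (rule continuous_map_into_subtopology) (auto intro: continuous_map_from_subtopology p(1))
    show "open_map (subtopology T ?U) (subtopology T (p ` ?U)) p"
      unfolding open_map_def
    proof (intro allI impI)
      fix V assume "openin (subtopology T ?U) V"
      then have V: "openin T V" "V \<subseteq> ?U" using Uo by (simp_all add: openin_open_subtopology)
      then show "openin (subtopology T (p ` ?U)) (p ` V)" using p(2) Uo
        by (auto simp: openin_open_subtopology)
    qed
    show "p ` topspace (subtopology T ?U) = topspace (subtopology T (p ` ?U))" by (simp only: tU tpU)
    show "inj_on p (topspace (subtopology T ?U))" unfolding tU using p(3)[OF B(1)] by (rule inj_on_subset) auto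
  qed
  moreover have "openin (subtopology T Iso) ?U" using Uo Iso_open by (simp add: openin_open_subtopology)
  moreover have "openin (subtopology (subtopology T Iso) (units G)) (p ` ?U)"
    using p(2)[OF Uo] pU units_Iso units_open Iso_open
    by (metis (no_types, lifting) Int_absorb1 openin_open_subtopology order_trans subtopology_subtopology)
  ultimately show "\<exists>U. openin (subtopology T Iso) U \<and> x \<in> U \<and> openin (subtopology (subtopology T Iso) (units G)) (p ` U) \<and>
      homeomorphic_map (subtopology (subtopology T Iso) U) (subtopology (subtopology (subtopology T Iso) (units G)) (p ` U)) p"
    using x B e1 e2 by (intro exI[of _ ?U]) auto
qed

lemma iso_lch_etale: "lch_etale IG"
proof
  show "locally_compact_space (gtop IG)" using lc Iso_open haus by (simp add: locally_compact_space_open_subset)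
  show "Hausdorff_space (gtop IG)" using haus by (simp add: Hausdorff_space_subtopology)
  have alg': "algebraic_groupoid IG"
    unfolding algebraic_groupoid_def composable_def
    using Iso_D(1) Iso_mult Iso_iv Iso_src Iso_rng by (auto simp: mult_assoc)
  have cont: "continuous_map (subtopology T Iso) (subtopology T Iso) p" if "continuous_map T T p" "\<And>\<alpha>. \<alpha> \<in> Iso \<Longrightarrow> p \<alpha> \<in> Iso" for p
    by (rule continuous_map_into_subtopology) (use that in \<open>auto intro: continuous_map_from_subtopology\<close>)
  let ?P = "subtopology (prod_topology (subtopology T Iso) (subtopology T Iso)) (composable IG)"
  have mc: "continuous_map ?P (subtopology T Iso) (\<lambda>p. fst p \<odot> snd p)"
  proof (rule continuous_map_into_subtopology)
    show "continuous_map ?P T (\<lambda>p. fst p \<odot> snd p)"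
    proof (rule mult_cont')
      show "continuous_map ?P T fst"
        by (intro continuous_map_from_subtopology continuous_map_into_fulltopology[OF continuous_map_fst])
      show "continuous_map ?P T snd"
        by (intro continuous_map_from_subtopology continuous_map_into_fulltopology[OF continuous_map_snd])
    qed (auto simp: composable_def)
    show "(\<lambda>p. fst p \<odot> snd p) \<in> topspace ?P \<rightarrow> Iso" by (auto simp: composable_def Iso_mult)
  qed
  have "topological_groupoid IG"
    unfolding topological_groupoid_def IG_simps
  proof (intro conjI alg')
    show "continuous_map (subtopology T Iso) (subtopology T Iso) s" by (rule cont[OF src_cont Iso_src])
    show "continuous_map (subtopology T Iso) (subtopology T Iso) r" by (rule cont[OF rng_cont]) (simp add: Iso_D Iso_src)
    show "continuous_map (subtopology T Iso) (subtopology T Iso) iv" by (rule cont[OF inv_cont Iso_iv])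
    show "continuous_map ?P (subtopology T Iso) (\<lambda>(\<alpha>, \<beta>). \<alpha> \<odot> \<beta>)" using mc by (simp add: case_prod_beta')
  qed
  then show "etale_groupoid IG"
    unfolding etale_groupoid_def IG_simps units_IG
    using iso_local_homeo[OF src_cont src_open] iso_local_homeo[OF rng_cont rng_open] by (auto simp: bisection_def)
qed

end

section \<open>The inclusion of the isotropy algebras\<close>

lemma ell2_superset:
  assumes "\<xi> \<in> ell2 S" "S \<subseteq> S'"
  shows "\<xi> \<in> ell2 S'" "ell2_norm S' \<xi> = ell2_norm S \<xi>"
proof -
  have "(\<lambda>i. (cmod (\<xi> i))\<^sup>2) summable_on S' \<longleftrightarrow> (\<lambda>i. (cmod (\<xi> i))\<^sup>2) summable_on S"
    by (rule summable_on_cong_neutral) (use assms ell2_vanish[OF assms(1)] in auto)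
  then show "\<xi> \<in> ell2 S'" using assms by (auto simp: ell2_def)
  have "(\<Sum>\<^sub>\<infinity>i\<in>S'. (cmod (\<xi> i))\<^sup>2) = (\<Sum>\<^sub>\<infinity>i\<in>S. (cmod (\<xi> i))\<^sup>2)"
    by (rule infsum_cong_neutral) (use assms ell2_vanish[OF assms(1)] in auto)
  then show "ell2_norm S' \<xi> = ell2_norm S \<xi>" by (simp add: ell2_norm_def)
qed

lemma ell2_restrict_subset:
  assumes "\<xi> \<in> ell2 S" "X \<subseteq> S"
  shows "restrict_fun X \<xi> \<in> ell2 X" "ell2_norm X (restrict_fun X \<xi>) \<le> ell2_norm S \<xi>"
    "(ell2_norm S (restrict_fun X \<xi>))\<^sup>2 = (\<Sum>\<^sub>\<infinity>i\<in>X. (cmod (\<xi> i))\<^sup>2)"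
proof -
  have s: "(\<lambda>i. (cmod (\<xi> i))\<^sup>2) summable_on X" using summable_on_subset_banach[OF ell2_summable[OF assms(1)] assms(2)] .
  have "(\<lambda>i. (cmod (restrict_fun X \<xi> i))\<^sup>2) summable_on X \<longleftrightarrow> (\<lambda>i. (cmod (\<xi> i))\<^sup>2) summable_on X"
    by (rule summable_on_cong) (simp add: restrict_fun_def)
  then show X: "restrict_fun X \<xi> \<in> ell2 X" using s by (auto simp: ell2_def restrict_fun_def)
  show "ell2_norm X (restrict_fun X \<xi>) \<le> ell2_norm S \<xi>"
    using ell2_superset(2)[OF X assms(2)] restrict_fun_ell2(2)[OF assms(1)] by metis
  have "(\<Sum>\<^sub>\<infinity>i\<in>X. (cmod (restrict_fun X \<xi> i))\<^sup>2) = (\<Sum>\<^sub>\<infinity>i\<in>X. (cmod (\<xi> i))\<^sup>2)"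
    by (rule infsum_cong) (simp add: restrict_fun_def)
  then show "(ell2_norm S (restrict_fun X \<xi>))\<^sup>2 = (\<Sum>\<^sub>\<infinity>i\<in>X. (cmod (\<xi> i))\<^sup>2)"
    using ell2_superset(2)[OF X assms(2)] by (simp add: ell2_norm_square)
qed

text \<open>Pythagoras over the blocks \<open>cl i\<close>, which partition \<open>S\<close>: a
  finite set of coordinates meets only finitely many blocks, and on each of them \<open>z\<close> is
  controlled by the part of \<open>\<xi>\<close> in the same block.\<close>

lemma block_bound:
  fixes cl :: "'i \<Rightarrow> 'i set"
  assumes cl: "\<And>i. i \<in> S \<Longrightarrow> i \<in> cl i \<and> cl i \<subseteq> S" "\<And>i j. i \<in> S \<Longrightarrow> j \<in> cl i \<Longrightarrow> cl j = cl i"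
    and \<xi>: "\<xi> \<in> ell2 S" and C: "0 \<le> C" and z: "\<And>i. i \<notin> S \<Longrightarrow> z i = 0"
    and est: "\<And>i F. i \<in> S \<Longrightarrow> finite F \<Longrightarrow> F \<subseteq> cl i \<Longrightarrow> L2_set (\<lambda>i. cmod (z i)) F \<le> C * ell2_norm S (restrict_fun (cl i) \<xi>)"
  shows "z \<in> ell2 S" "ell2_norm S z \<le> C * ell2_norm S \<xi>"
proof -
  have *: "L2_set (\<lambda>i. cmod (z i)) F \<le> C * ell2_norm S \<xi>" if F: "finite F" "F \<subseteq> S" for F
  proof -
    let ?X = "cl ` F"
    have disj: "X \<inter> Y = {}" if XY: "X \<in> ?X" "Y \<in> ?X" "X \<noteq> Y" for X Y
    proof (rule ccontr)
      assume "X \<inter> Y \<noteq> {}"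
      then obtain k where k: "k \<in> X" "k \<in> Y" by blast
      obtain i j where ij: "i \<in> F" "X = cl i" "j \<in> F" "Y = cl j" using XY by blast
      have "cl k = X" using cl(2)[of i k] F ij k by auto
      moreover have "cl k = Y" using cl(2)[of j k] F ij k by auto
      ultimately show False using XY by simp
    qed
    have XS: "X \<subseteq> S" if "X \<in> ?X" for X using that cl(1) F by blast
    have FU: "F = (\<Union>X\<in>?X. F \<inter> X)" using cl(1) F by auto
    have "(\<Sum>i\<in>F. (cmod (z i))\<^sup>2) = (\<Sum>i\<in>(\<Union>X\<in>?X. F \<inter> X). (cmod (z i))\<^sup>2)" using FU by simp
    also have "\<dots> = (\<Sum>X\<in>?X. \<Sum>i\<in>F \<inter> X. (cmod (z i))\<^sup>2)"
      by (rule sum.UNION_disjoint) (use F disj in auto)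
    also have "\<dots> \<le> (\<Sum>X\<in>?X. C\<^sup>2 * (\<Sum>\<^sub>\<infinity>i\<in>X. (cmod (\<xi> i))\<^sup>2))"
    proof (rule sum_mono)
      fix X assume X: "X \<in> ?X"
      then obtain i where i: "i \<in> F" "X = cl i" by blast
      have "L2_set (\<lambda>i. cmod (z i)) (F \<inter> X) \<le> C * ell2_norm S (restrict_fun X \<xi>)"
        unfolding i(2) by (rule est) (use i F in auto)
      then have "(L2_set (\<lambda>i. cmod (z i)) (F \<inter> X))\<^sup>2 \<le> (C * ell2_norm S (restrict_fun X \<xi>))\<^sup>2"
        by (intro power_mono) auto
      then show "(\<Sum>i\<in>F \<inter> X. (cmod (z i))\<^sup>2) \<le> C\<^sup>2 * (\<Sum>\<^sub>\<infinity>i\<in>X. (cmod (\<xi> i))\<^sup>2)"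
        by (simp add: L2_set_def sum_nonneg power_mult_distrib ell2_restrict_subset(3)[OF \<xi> XS[OF X]])
    qed
    also have "\<dots> = C\<^sup>2 * (\<Sum>\<^sub>\<infinity>i\<in>\<Union>?X. (cmod (\<xi> i))\<^sup>2)"
    proof -
      have "(\<Sum>X\<in>?X. \<Sum>\<^sub>\<infinity>i\<in>X. (cmod (\<xi> i))\<^sup>2) = (\<Sum>\<^sub>\<infinity>i\<in>(\<Union>X\<in>?X. X). (cmod (\<xi> i))\<^sup>2)"
        by (rule sum_infsum) (use F disj summable_on_subset_banach[OF ell2_summable[OF \<xi>] XS] in auto)
      then show ?thesis by (simp flip: sum_distrib_left)
    qed
    also have "\<dots> \<le> C\<^sup>2 * (\<Sum>\<^sub>\<infinity>i\<in>S. (cmod (\<xi> i))\<^sup>2)"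
    proof (rule mult_left_mono)
      have US: "\<Union>?X \<subseteq> S" using XS by blast
      show "(\<Sum>\<^sub>\<infinity>i\<in>\<Union>?X. (cmod (\<xi> i))\<^sup>2) \<le> (\<Sum>\<^sub>\<infinity>i\<in>S. (cmod (\<xi> i))\<^sup>2)"
        by (rule infsum_mono2[OF summable_on_subset_banach[OF ell2_summable[OF \<xi>] US] ell2_summable[OF \<xi>] US]) simp
    qed simp
    also have "\<dots> = (C * ell2_norm S \<xi>)\<^sup>2" by (simp add: power_mult_distrib ell2_norm_square)
    finally show ?thesis unfolding L2_set_def using C by (intro real_le_lsqrt sum_nonneg) auto
  qed
  show "z \<in> ell2 S" by (rule ell2_boundedI(1)[OF z *])
  show "ell2_norm S z \<le> C * ell2_norm S \<xi>" by (rule ell2_boundedI(2)[OF z *])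
qed

locale iso_etale = lch_etale G + H: lch_etale "iso_groupoid G" for G :: "'g groupoid"
begin

lemma Cc_H_vanish: "f \<in> Cc IG \<Longrightarrow> \<gamma> \<notin> Iso \<Longrightarrow> f \<gamma> = 0"
  using H.Cc_vanish by simp

lemma Cc_H_G: assumes f: "f \<in> Cc IG" shows "f \<in> Cc G"
proof -
  obtain K where K: "compactin (subtopology T Iso) K" "\<forall>\<gamma>. \<gamma> \<notin> K \<longrightarrow> f \<gamma> = 0" using H.Cc_support[OF f] by auto
  then have K': "compactin T K" "K \<subseteq> Iso" by (auto simp: compactin_subtopology)
  show ?thesis
  proof (rule CcI[OF continuous_extend_by_zero[OF Iso_open K'] K'(1)])
    show "continuous_map (subtopology T Iso) euclidean f" using H.Cc_continuous[OF f] by simp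
  qed (use K in auto)
qed

lemma restrict_H: "f \<in> Cc IG \<Longrightarrow> restrict_fun Iso f = f"
  using Cc_H_vanish by (auto simp: restrict_fun_def)

lemma Cc_restrict_H:
  assumes f: "f \<in> Cc G" and cl: "closedin T Iso" shows "restrict_fun Iso f \<in> Cc IG"
proof -
  obtain K where K: "compactin T K" "\<forall>\<gamma>. \<gamma> \<notin> K \<longrightarrow> f \<gamma> = 0" using Cc_support[OF f] by blast
  have "continuous_map (subtopology T Iso) euclidean (restrict_fun Iso f)"
    using Cc_continuous[OF Cc_restrict[OF f Iso_open cl]] by (rule continuous_map_from_subtopology)
  moreover have "compactin (subtopology T Iso) (K \<inter> Iso)"
    using K cl by (simp add: compactin_subtopology compact_Int_closedin)
  ultimately show ?thesis by (intro H.CcI[of _ "K \<inter> Iso"]) (use K in \<open>auto simp: restrict_fun_def\<close>)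
qed

lemma convolution_H:
  assumes f: "f \<in> Cc IG" and g: "g \<in> Cc IG" shows "convolution IG f g = f \<star> g"
proof
  fix \<gamma>
  have S: "{\<beta> \<in> src_fibre IG u. g \<beta> \<noteq> 0} = {\<beta> \<in> src_fibre G u. g \<beta> \<noteq> 0}" for u
    using Cc_H_vanish[OF g] by (auto simp: src_fibre_IG)
  show "convolution IG f g \<gamma> = (f \<star> g) \<gamma>"
  proof (cases "\<gamma> \<in> Iso")
    case True
    then show ?thesis using H.convolution_Cc[OF g, of \<gamma> f] convolution_Cc[OF Cc_H_G[OF g], of \<gamma> f] Iso_D by (simp add: S)
  next
    case False
    have "(f \<star> g) \<gamma> = 0"
    proof (cases "\<gamma> \<in> arr")
      case True
      have "f (\<gamma> \<odot> iv \<beta>) * g \<beta> = 0" if "\<beta> \<in> src_fibre G (s \<gamma>)" for \<beta>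
      proof (cases "\<beta> \<in> Iso")
        case b: True
        then have "\<gamma> \<odot> iv \<beta> \<notin> Iso" using Iso_mult_left[of \<gamma> "iv \<beta>"] Iso_iv[OF b] that True False by (auto simp: src_fibre_def)
        then show ?thesis using Cc_H_vanish[OF f] by simp
      qed (simp add: Cc_H_vanish[OF g])
      then show ?thesis unfolding convolution_Cc[OF Cc_H_G[OF g] True] by (intro sum.neutral) auto
    qed (simp add: convolution_off)
    then show ?thesis using H.convolution_off[of \<gamma>] False by simp
  qed
qed

lemma involution_H: assumes f: "f \<in> Cc IG" shows "involution IG f = involution G f"
proof
  fix \<gamma> show "involution IG f \<gamma> = involution G f \<gamma>"
    using Cc_H_vanish[OF f, of "iv \<gamma>"] Iso_iv_iff[of \<gamma>] Iso_D(1)[of \<gamma>] by (auto simp: involution_def)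
qed

lemma I_bounded_by_H: assumes f: "f \<in> Cc IG" and C: "H.I_bounded_by f C" shows "I_bounded_by f C"
  unfolding I_bounded_by_def
proof (intro conjI allI impI)
  show "0 \<le> C" by (rule H.I_bounded_by_nonneg[OF C])
  fix u :: 'g and F :: "'g set" assume F: "finite F"
  have e: "(\<Sum>\<gamma>\<in>F. cmod (f \<gamma>)) = (\<Sum>\<gamma>\<in>F \<inter> Iso. cmod (f \<gamma>))"
    by (rule sum.mono_neutral_right) (use F Cc_H_vanish[OF f] in auto)
  show "F \<subseteq> src_fibre G u \<Longrightarrow> (\<Sum>\<gamma>\<in>F. cmod (f \<gamma>)) \<le> C"
    unfolding e by (rule H.I_bounded_by_src[OF C, of _ u]) (use F in \<open>auto simp: src_fibre_IG\<close>)
  show "F \<subseteq> rng_fibre G u \<Longrightarrow> (\<Sum>\<gamma>\<in>F. cmod (f \<gamma>)) \<le> C"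
    unfolding e by (rule H.I_bounded_by_rng[OF C, of _ u]) (use F in \<open>auto simp: rng_fibre_IG\<close>)
qed

text \<open>Functions on the isotropy form a subalgebra of \<open>Cc G\<close> with the same
  \<open>I\<close>-bounds. Consequently the full norm does not grow under extension by zero, which
  makes \<open>iso_inclusion\<close> well defined.\<close>

lemma reps_restrict: assumes \<pi>: "\<pi> \<in> I_bounded_reps G" shows "\<pi> \<in> I_bounded_reps IG"
  unfolding I_bounded_reps_def star_hom_def norm_bounded_def
proof (intro CollectI conjI ballI allI)
  show "\<exists>C. \<forall>a\<in>carr (Cc_algebra IG). anorm (operator_algebra UNIV) (\<pi> a) \<le> C * anorm (Cc_algebra IG) a"
  \<comment> \<open>The empty groupoid is treated as in \<open>lam_le_full_norm\<close>.\<close>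
  proof (intro exI[of _ "if units G = {} then 0 else 1"] ballI)
    fix a assume "a \<in> carr (Cc_algebra IG)"
    then have a: "a \<in> Cc IG" by (simp add: Cc_algebra_def)
    have "op_norm UNIV (\<pi> a) \<le> (if units G = {} then 0 else 1) * I_norm IG a"
    proof (cases "units G = {}")
      case True
      then have "arr = {}" by (auto simp: units_def)
      then have "I_bounded_by a 0" using Cc_vanish[OF Cc_H_G[OF a]] by (simp add: I_bounded_by_def)
      then show ?thesis using op_norm_rep_le_I[OF \<pi> Cc_H_G[OF a]] True by simp
    next
      case False
      then show ?thesis
        using op_norm_rep_le_I[OF \<pi> Cc_H_G[OF a] I_bounded_by_H[OF a H.I_bounded_by_I_norm[OF _ a]]] by simp
    qed
    then show "anorm (operator_algebra UNIV) (\<pi> a) \<le> (if units G = {} then 0 else 1) * anorm (Cc_algebra IG) a"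
      by (simp add: operator_algebra_def Cc_algebra_def)
  qed
qed (simp_all add: Cc_algebra_def operator_algebra_def rep_bounded_ops[OF \<pi>] rep_add[OF \<pi>] rep_scale[OF \<pi>]
   rep_convolution[OF \<pi>] rep_involution[OF \<pi>] Cc_H_G convolution_H involution_H)

lemma full_norm_H: "f \<in> Cc IG \<Longrightarrow> FN f \<le> H.FN f"
  by (rule full_norm_leI) (rule H.rep_le_full_norm[OF reps_restrict])

lemma CS_H_G: assumes x: "x \<in> H.C.CS" shows "x \<in> C.CS"
proof (rule C.CS_I)
  have xc: "x n \<in> Cc IG" for n by (rule H.CS_Cc[OF x])
  show "x n \<in> carr FA" for n using Cc_H_G[OF xc] by simp
  fix e :: real assume "0 < e"
  then obtain N where N: "\<forall>m \<ge> N. \<forall>n \<ge> N. adist H.FA (x m) (x n) < e" using H.C.CS_D[OF x] by blast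
  have "adist FA (x m) (x n) < e" if "m \<ge> N" "n \<ge> N" for m n
    using full_norm_H[OF H.Cc_diff[OF xc xc], of m n] N[rule_format, OF that] by (simp add: adist_FA H.adist_FA)
  then show "\<exists>N. \<forall>m \<ge> N. \<forall>n \<ge> N. adist FA (x m) (x n) < e" by blast
qed

lemma cls_H_G: assumes x: "x \<in> H.C.CS" and y: "y \<in> H.C.CS" and e: "H.C.cls x = H.C.cls y" shows "C.cls x = C.cls y"
proof (rule C.cls_eqI[OF CS_H_G[OF x] CS_H_G[OF y]])
  have l: "(\<lambda>n. adist H.FA (x n) (y n)) \<longlonglongrightarrow> 0" using H.C.cls_eq_iff[OF x y] e by simp
  show "(\<lambda>n. adist FA (x n) (y n)) \<longlonglongrightarrow> 0"
    by (rule Lim_null_comparison[OF always_eventually l])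
      (use full_norm_H[OF H.Cc_diff[OF H.CS_Cc[OF x] H.CS_Cc[OF y]]] full_norm_nonneg[OF Cc_diff[OF Cc_H_G[OF H.CS_Cc[OF x]] Cc_H_G[OF H.CS_Cc[OF y]]]]
        in \<open>simp add: adist_FA H.adist_FA\<close>)
qed

lemma iso_inclusion_eq: assumes x: "x \<in> H.C.CS" shows "iso_inclusion G (H.C.cls x) = C.cls x"
  unfolding iso_inclusion_def
proof (rule continuous_extension_eqI)
  show "C.cls x \<in> carr (full_algebra G)" using CS_H_G[OF x] by (simp add: full_algebra_carr)
  show "x n \<in> Cc IG" for n by (rule H.CS_Cc[OF x])
  show "converges_to (full_algebra IG) (\<lambda>n. full_embed IG (x n)) (H.C.cls x)"
    using H.full_embed_converges[OF x H.CS_Cc[OF x]] x by simp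
  show "converges_to (full_algebra G) (\<lambda>n. full_embed G (x n)) (C.cls x)"
    using full_embed_converges[OF CS_H_G[OF x] CS_Cc[OF CS_H_G[OF x]]] CS_H_G[OF x] by simp
next
  fix b' z assume h: "b' \<in> carr (full_algebra G)" "\<And>n. z n \<in> Cc IG"
    "converges_to (full_algebra IG) (\<lambda>n. full_embed IG (z n)) (H.C.cls x)" "converges_to (full_algebra G) (\<lambda>n. full_embed G (z n)) b'"
  have z: "z \<in> H.C.CS" "H.C.cls z = H.C.cls x" using H.full_embed_converges[OF x h(2)] h(3) by auto
  obtain y where y: "y \<in> C.CS" "b' = C.cls y" using h(1) by (auto simp: full_algebra_carr)
  have "C.cls z = C.cls y" using full_embed_converges[OF y(1) Cc_H_G[OF h(2)]] h(4) y(2) by auto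
  then show "b' = C.cls x" using cls_H_G[OF z(1) x z(2)] y by simp
qed

lemma iso_subalgebra_eq: "iso_subalgebra G = C.cls ` H.C.CS"
  unfolding iso_subalgebra_def H.full_algebra_carr image_image
  by (rule image_cong) (simp_all add: iso_inclusion_eq)

subsection \<open>Cosets\<close>

text \<open>The entry of \<open>lam f\<close> at \<open>\<eta>\<close> and \<open>\<gamma>\<close>
  is the value of \<open>f\<close> at \<open>\<eta> \<odot> iv \<gamma>\<close>, so these sets are
  the blocks of the operators that come from functions supported in \<open>Iso\<close>.\<close>

definition coset :: "'g \<Rightarrow> 'g set" where
  "coset \<gamma> = {\<eta> \<in> arr. s \<eta> = s \<gamma> \<and> \<eta> \<odot> iv \<gamma> \<in> Iso}"

lemma coset_self: "\<gamma> \<in> arr \<Longrightarrow> \<gamma> \<in> coset \<gamma>"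
  using units_Iso by (auto simp: coset_def)

lemma coset_sub: "coset \<gamma> \<subseteq> arr" by (auto simp: coset_def)

lemma coset_mem_iff: "\<gamma> \<in> arr \<Longrightarrow> \<eta> \<in> coset \<gamma> \<longleftrightarrow> (\<exists>h \<in> Iso. s h = r \<gamma> \<and> \<eta> = h \<odot> \<gamma>)"
proof
  assume g: "\<gamma> \<in> arr" and "\<eta> \<in> coset \<gamma>"
  then show "\<exists>h \<in> Iso. s h = r \<gamma> \<and> \<eta> = h \<odot> \<gamma>" by (intro bexI[of _ "\<eta> \<odot> iv \<gamma>"]) (auto simp: coset_def)
next
  assume g: "\<gamma> \<in> arr" and "\<exists>h \<in> Iso. s h = r \<gamma> \<and> \<eta> = h \<odot> \<gamma>"
  then show "\<eta> \<in> coset \<gamma>" using Iso_D by (auto simp: coset_def)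
qed

lemma coset_eq: assumes g: "\<gamma> \<in> arr" and e: "\<eta> \<in> coset \<gamma>" shows "coset \<eta> = coset \<gamma>"
proof -
  obtain h where h: "h \<in> Iso" "s h = r \<gamma>" "\<eta> = h \<odot> \<gamma>" using e coset_mem_iff[OF g] by blast
  have ha: "h \<in> arr" using Iso_D h by blast
  have ea: "\<eta> \<in> arr" using e coset_sub by blast
  have re: "r \<eta> = r \<gamma>" using h ha g Iso_D(2)[OF h(1)] by simp
  show ?thesis
  proof (intro equalityI subsetI)
    fix \<zeta> assume "\<zeta> \<in> coset \<eta>"
    then obtain k where k: "k \<in> Iso" "s k = r \<eta>" "\<zeta> = k \<odot> \<eta>" using coset_mem_iff[OF ea] by blast
    have "\<zeta> = (k \<odot> h) \<odot> \<gamma>" unfolding k h(3) using k(2) re h ha g Iso_D[OF k(1)] Iso_D(2)[OF h(1)] by (subst mult_assoc) auto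
    moreover have "k \<odot> h \<in> Iso" using Iso_mult[OF k(1) h(1)] k(2) re h(2) Iso_D(2)[OF h(1)] by simp
    moreover have "s (k \<odot> h) = r \<gamma>" using k(2) re h ha g Iso_D[OF k(1)] Iso_D(2)[OF h(1)] by simp
    ultimately show "\<zeta> \<in> coset \<gamma>" using coset_mem_iff[OF g] by blast
  next
    fix \<zeta> assume "\<zeta> \<in> coset \<gamma>"
    then obtain k where k: "k \<in> Iso" "s k = r \<gamma>" "\<zeta> = k \<odot> \<gamma>" using coset_mem_iff[OF g] by blast
    have ka: "k \<in> arr" using Iso_D k by blast
    have rh: "r h = s h" "r k = s k" using Iso_D(2) h(1) k(1) by auto
    have "(k \<odot> iv h) \<odot> \<eta> = k \<odot> (iv h \<odot> \<eta>)" by (rule mult_assoc) (use ka ha ea h k rh re in auto)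
    also have "iv h \<odot> \<eta> = \<gamma>" using h ha g by simp
    finally have "\<zeta> = (k \<odot> iv h) \<odot> \<eta>" using k by simp
    moreover have "k \<odot> iv h \<in> Iso" by (rule Iso_mult[OF k(1) Iso_iv[OF h(1)]]) (use ha h k in auto)
    moreover have "s (k \<odot> iv h) = r \<eta>" using ka ha h k rh re by simp
    ultimately show "\<zeta> \<in> coset \<eta>" using coset_mem_iff[OF ea] by blast
  qed
qed

lemma lam_H_restrict:
  assumes f: "f \<in> Cc G" and \<xi>: "\<xi> \<in> ell2 Iso"
  shows "H.lam (restrict_fun Iso f) \<xi> = restrict_fun Iso (lam f \<xi>)"
proof
  fix \<eta>
  have sub: "Iso \<subseteq> arr" using Iso_D by blast
  show "H.lam (restrict_fun Iso f) \<xi> \<eta> = restrict_fun Iso (lam f \<xi>) \<eta>"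
  proof (cases "\<eta> \<in> Iso")
    case True
    have "H.lam (restrict_fun Iso f) \<xi> \<eta> = (\<Sum>\<^sub>\<infinity>\<gamma>\<in>src_fibre IG (s \<eta>). restrict_fun Iso f (\<eta> \<odot> iv \<gamma>) * \<xi> \<gamma>)"
      using H.lam_infsum[of \<eta> \<xi>] True \<xi> by simp
    also have "\<dots> = (\<Sum>\<^sub>\<infinity>\<gamma>\<in>src_fibre G (s \<eta>). f (\<eta> \<odot> iv \<gamma>) * \<xi> \<gamma>)"
    proof (rule infsum_cong_neutral)
      fix \<gamma> assume "\<gamma> \<in> src_fibre IG (s \<eta>) \<inter> src_fibre G (s \<eta>)"
      then have "\<gamma> \<in> Iso" "s \<gamma> = s \<eta>" by (auto simp: src_fibre_def)
      then have "\<eta> \<odot> iv \<gamma> \<in> Iso" using True Iso_D by (intro Iso_mult Iso_iv) auto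
      then show "restrict_fun Iso f (\<eta> \<odot> iv \<gamma>) * \<xi> \<gamma> = f (\<eta> \<odot> iv \<gamma>) * \<xi> \<gamma>" by (simp add: restrict_fun_def)
    qed (use ell2_vanish[OF \<xi>] in \<open>auto simp: src_fibre_IG\<close>)
    also have "\<dots> = lam f \<xi> \<eta>" using lam_infsum[of \<eta> \<xi> f] True sub ell2_superset(1)[OF \<xi> sub] by auto
    finally show ?thesis using True by (simp add: restrict_fun_def)
  next
    case False
    then show ?thesis by (simp add: restrict_fun_def sum_regular_rep_def)
  qed
qed

text \<open>The space \<open>ell2 Iso\<close> sits inside \<open>ell2 arr\<close>, and the
  compression of \<open>lam f\<close> to it is the regular representation of the restricted
  function.\<close>

lemma op_norm_H_restrict_le: assumes f: "f \<in> Cc G" shows "op_norm Iso (H.lam (restrict_fun Iso f)) \<le> op_norm arr (lam f)"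
proof (rule op_norm_leI[OF op_norm_nonneg[OF lam_bounded_ops[OF f]]])
  fix \<xi> assume \<xi>: "\<xi> \<in> ell2 Iso"
  have sub: "Iso \<subseteq> arr" using Iso_D by blast
  note x = ell2_superset[OF \<xi> sub]
  show "ell2_norm Iso (H.lam (restrict_fun Iso f) \<xi>) \<le> op_norm arr (lam f) * ell2_norm Iso \<xi>"
    unfolding lam_H_restrict[OF f \<xi>]
    using order_trans[OF ell2_restrict_subset(2)[OF bop_ell2'[OF lam_bounded_ops[OF f]] sub] op_norm_bound[OF lam_bounded_ops[OF f] x(1)]]
    by (simp add: x(2))
qed

text \<open>Right translation by \<open>\<gamma>\<close> identifies the coset of \<open>\<gamma>\<close> with a fibre of the isotropy bundle.\<close>

lemma op_norm_lam_le_H: assumes f: "f \<in> Cc IG" shows "op_norm arr (lam f) \<le> op_norm Iso (H.lam f)"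
proof (rule op_norm_leI)
  have B: "H.lam f \<in> bounded_ops Iso" using H.lam_bounded_ops[OF f] by simp
  show C0: "0 \<le> op_norm Iso (H.lam f)" by (rule op_norm_nonneg[OF B])
  fix \<xi> assume \<xi>: "\<xi> \<in> ell2 arr"
  show "ell2_norm arr (lam f \<xi>) \<le> op_norm Iso (H.lam f) * ell2_norm arr \<xi>"
  proof (rule block_bound(2)[where cl = coset and S = arr])
    show "i \<in> coset i \<and> coset i \<subseteq> arr" if "i \<in> arr" for i using coset_self[OF that] coset_sub by blast
    show "coset j = coset i" if "i \<in> arr" "j \<in> coset i" for i j by (rule coset_eq[OF that])
    show "lam f \<xi> i = 0" if "i \<notin> arr" for i using that by (simp add: sum_regular_rep_def)
    fix \<gamma> F assume \<gamma>: "\<gamma> \<in> arr" and F: "finite F" "F \<subseteq> coset \<gamma>"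
    let ?D = "{h \<in> Iso. s h = r \<gamma>}"
    have D: "h \<in> arr" "r h = r \<gamma>" "s h = r \<gamma>" "h \<odot> \<gamma> \<in> arr" "s (h \<odot> \<gamma>) = s \<gamma>" if "h \<in> ?D" for h
      using that Iso_D[of h] \<gamma> by auto
    have bij: "bij_betw (\<lambda>h. h \<odot> \<gamma>) ?D (coset \<gamma>)"
      by (rule bij_betwI[where g = "\<lambda>\<eta>. \<eta> \<odot> iv \<gamma>"]) (use \<gamma> Iso_D in \<open>auto simp: coset_def\<close>)
    \<comment> \<open>The part of \<open>\<xi>\<close> in the coset, translated back to the fibre of
      \<open>Iso\<close> over \<open>r \<gamma>\<close> and extended by zero to all of
      \<open>Iso\<close>.\<close>
    define z where "z h = (if h \<in> ?D then \<xi> (h \<odot> \<gamma>) else 0)" for h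
    have z2: "L2_set (\<lambda>h. cmod (z h)) F' \<le> ell2_norm arr (restrict_fun (coset \<gamma>) \<xi>)" if F': "finite F'" "F' \<subseteq> Iso" for F'
    proof -
      have "(\<Sum>h\<in>F'. (cmod (z h))\<^sup>2) = (\<Sum>h\<in>F' \<inter> ?D. (cmod (\<xi> (h \<odot> \<gamma>)))\<^sup>2)"
        by (rule sum.mono_neutral_cong_right) (use F' in \<open>auto simp: z_def\<close>)
      also have "\<dots> = (\<Sum>h\<in>F' \<inter> ?D. (cmod (restrict_fun (coset \<gamma>) \<xi> (h \<odot> \<gamma>)))\<^sup>2)"
        by (rule sum.cong) (use bij in \<open>auto simp: restrict_fun_def bij_betw_def\<close>)
      also have "\<dots> = (\<Sum>\<eta>\<in>(\<lambda>h. h \<odot> \<gamma>) ` (F' \<inter> ?D). (cmod (restrict_fun (coset \<gamma>) \<xi> \<eta>))\<^sup>2)"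
      proof -
        have "inj_on (\<lambda>h. h \<odot> \<gamma>) (F' \<inter> ?D)" by (rule inj_on_subset[OF bij_betw_imp_inj_on[OF bij]]) auto
        then show ?thesis by (simp add: sum.reindex)
      qed
      finally have "L2_set (\<lambda>h. cmod (z h)) F' = L2_set (\<lambda>\<eta>. cmod (restrict_fun (coset \<gamma>) \<xi> \<eta>)) ((\<lambda>h. h \<odot> \<gamma>) ` (F' \<inter> ?D))"
        by (simp only: L2_set_def)
      also have "\<dots> \<le> ell2_norm arr (restrict_fun (coset \<gamma>) \<xi>)"
      proof (rule L2_set_le_ell2_norm[OF restrict_fun_ell2(1)[OF \<xi>]])
        show "(\<lambda>h. h \<odot> \<gamma>) ` (F' \<inter> ?D) \<subseteq> arr" using D(4) by blast
      qed (use F' in simp)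
      finally show ?thesis .
    qed
    have z: "z \<in> ell2 Iso" by (rule ell2_boundedI(1)[OF _ z2]) (auto simp: z_def)
    have zn: "ell2_norm Iso z \<le> ell2_norm arr (restrict_fun (coset \<gamma>) \<xi>)" by (rule ell2_boundedI(2)[OF _ z2]) (auto simp: z_def)
    \<comment> \<open>Only arrows of the same coset contribute, since \<open>f\<close> vanishes off
      \<open>Iso\<close>; once \<open>\<gamma>\<close> cancels, the sum is one over a fibre of the
      isotropy bundle.\<close>
    have key: "lam f \<xi> (h \<odot> \<gamma>) = H.lam f z h" if h: "h \<in> ?D" for h
    proof -
      note h' = D[OF h]
      have "lam f \<xi> (h \<odot> \<gamma>) = (\<Sum>\<^sub>\<infinity>\<zeta>\<in>src_fibre G (s \<gamma>). f ((h \<odot> \<gamma>) \<odot> iv \<zeta>) * \<xi> \<zeta>)"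
        using lam_infsum[OF h'(4) \<xi>, of f] h' by simp
      also have "\<dots> = (\<Sum>\<^sub>\<infinity>\<zeta>\<in>coset \<gamma>. f ((h \<odot> \<gamma>) \<odot> iv \<zeta>) * \<xi> \<zeta>)"
      proof (rule infsum_cong_neutral)
        fix \<zeta> assume "\<zeta> \<in> src_fibre G (s \<gamma>) - coset \<gamma>"
        then have \<zeta>: "\<zeta> \<in> arr" "s \<zeta> = s \<gamma>" "\<zeta> \<notin> coset \<gamma>" by (auto simp: src_fibre_def)
        have "(h \<odot> \<gamma>) \<odot> iv \<zeta> \<notin> Iso"
        proof
          assume "(h \<odot> \<gamma>) \<odot> iv \<zeta> \<in> Iso"
          then have "h \<odot> \<gamma> \<in> coset \<zeta>" using h' \<zeta> by (simp add: coset_def)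
          then have "coset (h \<odot> \<gamma>) = coset \<zeta>" by (rule coset_eq[OF \<zeta>(1)])
          moreover have "h \<odot> \<gamma> \<in> coset \<gamma>" using bij h by (auto simp: bij_betw_def)
          then have "coset (h \<odot> \<gamma>) = coset \<gamma>" by (rule coset_eq[OF \<gamma>])
          ultimately show False using coset_self[OF \<zeta>(1)] \<zeta>(3) by simp
        qed
        then show "f ((h \<odot> \<gamma>) \<odot> iv \<zeta>) * \<xi> \<zeta> = 0" using Cc_H_vanish[OF f] by simp
      qed (auto simp: coset_def src_fibre_def)
      also have "\<dots> = (\<Sum>\<^sub>\<infinity>k\<in>?D. f ((h \<odot> \<gamma>) \<odot> iv (k \<odot> \<gamma>)) * \<xi> (k \<odot> \<gamma>))"
        using infsum_reindex_bij_betw[OF bij, of "\<lambda>\<zeta>. f ((h \<odot> \<gamma>) \<odot> iv \<zeta>) * \<xi> \<zeta>"] by simp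
      also have "\<dots> = (\<Sum>\<^sub>\<infinity>k\<in>src_fibre IG (s h). f (h \<odot> iv k) * z k)"
      proof (rule infsum_cong_neutral)
        fix k assume "k \<in> ?D \<inter> src_fibre IG (s h)"
        then have k: "k \<in> ?D" by simp
        note k' = D[OF k]
        have "(h \<odot> \<gamma>) \<odot> iv (k \<odot> \<gamma>) = (h \<odot> \<gamma>) \<odot> (iv \<gamma> \<odot> iv k)" using k' \<gamma> by (simp add: inv_mult)
        also have "\<dots> = ((h \<odot> \<gamma>) \<odot> iv \<gamma>) \<odot> iv k" by (rule mult_assoc[symmetric]) (use h' k' \<gamma> in auto)
        also have "\<dots> = h \<odot> iv k" using h' \<gamma> by simp
        finally show "f ((h \<odot> \<gamma>) \<odot> iv (k \<odot> \<gamma>)) * \<xi> (k \<odot> \<gamma>) = f (h \<odot> iv k) * z k" using k by (simp add: z_def)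
      qed (use h' in \<open>auto simp: src_fibre_IG src_fibre_def z_def Iso_D\<close>)
      also have "\<dots> = H.lam f z h" using H.lam_infsum[of h z f] z h by simp
      finally show ?thesis .
    qed
    have "L2_set (\<lambda>\<eta>. cmod (lam f \<xi> \<eta>)) F = L2_set (\<lambda>h. cmod (H.lam f z h)) ((\<lambda>\<eta>. \<eta> \<odot> iv \<gamma>) ` F)"
    proof -
      have i: "inj_on (\<lambda>\<eta>. \<eta> \<odot> iv \<gamma>) F"
        by (rule inj_on_inverseI[where g = "\<lambda>h. h \<odot> \<gamma>"]) (use F \<gamma> in \<open>auto simp: coset_def\<close>)
      have "cmod (lam f \<xi> \<eta>) = cmod (H.lam f z (\<eta> \<odot> iv \<gamma>))" if "\<eta> \<in> F" for \<eta>
      proof -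
        have e: "\<eta> \<in> arr" "s \<eta> = s \<gamma>" "\<eta> \<odot> iv \<gamma> \<in> ?D" using that F \<gamma> by (auto simp: coset_def)
        then show ?thesis using key[OF e(3)] \<gamma> by simp
      qed
      then show ?thesis unfolding L2_set_def by (subst sum.reindex[OF i]) simp
    qed
    also have "\<dots> \<le> ell2_norm Iso (H.lam f z)"
      by (rule L2_set_le_ell2_norm[OF bop_ell2'[OF B]]) (use F in \<open>auto simp: coset_def\<close>)
    also have "\<dots> \<le> op_norm Iso (H.lam f) * ell2_norm Iso z" by (rule op_norm_bound[OF B z])
    also have "\<dots> \<le> op_norm Iso (H.lam f) * ell2_norm arr (restrict_fun (coset \<gamma>) \<xi>)" by (rule mult_left_mono[OF zn C0])
    finally show "L2_set (\<lambda>i. cmod (lam f \<xi> i)) F \<le> op_norm Iso (H.lam f) * ell2_norm arr (restrict_fun (coset \<gamma>) \<xi>)" .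
  qed (use C0 \<xi> in auto)
qed

text \<open>Makes the inclusion of reduced algebras isometric. One inequality is the block estimate,
  the other the compression to \<open>ell2 Iso\<close>, where restriction does not change
  \<open>f\<close>.\<close>

lemma op_norm_lam_H: assumes f: "f \<in> Cc IG" shows "op_norm Iso (H.lam f) = op_norm arr (lam f)"
  using op_norm_lam_le_H[OF f] op_norm_H_restrict_le[OF Cc_H_G[OF f]] by (simp add: restrict_H[OF f])

lemma op_norm_lam_H_diff:
  assumes f: "f \<in> Cc IG" and g: "g \<in> Cc IG"
  shows "op_norm Iso (H.lam f \<ominus> H.lam g) = op_norm arr (lam f \<ominus> lam g)"
  using op_norm_lam_H[OF H.Cc_diff[OF f g]] by (simp add: H.lam_diff[OF f g] lam_diff[OF Cc_H_G[OF f] Cc_H_G[OF g]])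

text \<open>The result does not depend on the approximating sequence because \<open>lam\<close> and
  \<open>H.lam\<close> give the same distances between functions on the isotropy.\<close>

lemma iso_inclusion_red_eq:
  assumes z: "\<And>n. z n \<in> Cc IG" and a: "a \<in> bounded_ops Iso" "op_conv Iso (\<lambda>n. H.lam (z n)) a"
    and b: "b \<in> carr (reduced_algebra G)" "op_conv arr (\<lambda>n. lam (z n)) b"
  shows "iso_inclusion_red G a = b"
  unfolding iso_inclusion_red_def
proof (rule continuous_extension_eqI[OF b(1) z])
  show "converges_to (reduced_algebra IG) (\<lambda>n. H.lam (z n)) a" using a H.converges_to_reduced by simp
  show "converges_to (reduced_algebra G) (\<lambda>n. lam (z n)) b" using b by (simp add: converges_to_reduced)
  fix b' z' assume h: "b' \<in> carr (reduced_algebra G)" "\<And>n. z' n \<in> Cc IG"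
    "converges_to (reduced_algebra IG) (\<lambda>n. H.lam (z' n)) a" "converges_to (reduced_algebra G) (\<lambda>n. lam (z' n)) b'"
  have a': "op_conv Iso (\<lambda>n. H.lam (z' n)) a" using h(3) H.converges_to_reduced by simp
  have B: "H.lam (z n) \<in> bounded_ops Iso" "H.lam (z' n) \<in> bounded_ops Iso" for n
    using H.lam_bounded_ops[OF z] H.lam_bounded_ops[OF h(2)] by auto
  note L = lam_bounded_ops[OF Cc_H_G[OF z]] lam_bounded_ops[OF Cc_H_G[OF h(2)]]
  have "(\<lambda>n. op_norm Iso (H.lam (z n) \<ominus> a) + op_norm Iso (H.lam (z' n) \<ominus> a)) \<longlonglongrightarrow> 0"
    using tendsto_add[OF a(2)[unfolded op_conv_def] a'[unfolded op_conv_def]] by simp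
  moreover have "op_norm arr (lam (z n) \<ominus> lam (z' n)) \<le>
      op_norm Iso (H.lam (z n) \<ominus> a) + op_norm Iso (H.lam (z' n) \<ominus> a)" for n
    unfolding op_norm_lam_H_diff[OF z h(2), symmetric]
    using op_norm_diff_triangle[OF B(1) a(1) B(2), of n n] unfolding op_norm_minus_commute[OF a(1) B(2), of n] .
  ultimately have "op_conv arr (\<lambda>n. lam (z' n)) b"
    by (rule op_conv_close[OF L(1) L(2) reduced_bounded[OF b(1)] b(2)])
  then show "b' = b"
    using op_conv_unique[OF L(2) reduced_bounded[OF h(1)] _ reduced_bounded[OF b(1)]] h(4) by (simp add: converges_to_reduced)
qed

lemma iso_subalgebra_red_eq:
  "iso_subalgebra_red G = {b \<in> bounded_ops arr. \<exists>x \<in> H.C.CS. op_conv arr (\<lambda>n. lam (x n)) b}"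
proof (intro equalityI subsetI)
  fix b assume "b \<in> iso_subalgebra_red G"
  then obtain a where a: "a \<in> carr (reduced_algebra IG)" "b = iso_inclusion_red G a" by (auto simp: iso_subalgebra_red_def)
  then obtain x where x: "x \<in> H.C.CS" "op_conv Iso (\<lambda>n. H.lam (x n)) a" and aB: "a \<in> bounded_ops Iso"
    using H.reduced_carr by auto
  obtain b' where b': "b' \<in> bounded_ops arr" "op_conv arr (\<lambda>n. lam (x n)) b'" using lam_limit_exists[OF CS_H_G[OF x(1)]] by blast
  have "b' \<in> carr (reduced_algebra G)" using b' CS_H_G[OF x(1)] by (auto simp: reduced_carr)
  then have "b = b'" using iso_inclusion_red_eq[OF H.CS_Cc[OF x(1)] aB x(2) _ b'(2)] a(2) by simp
  then show "b \<in> {b \<in> bounded_ops arr. \<exists>x \<in> H.C.CS. op_conv arr (\<lambda>n. lam (x n)) b}" using b' x by auto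
next
  fix b assume "b \<in> {b \<in> bounded_ops arr. \<exists>x \<in> H.C.CS. op_conv arr (\<lambda>n. lam (x n)) b}"
  then obtain x where x: "x \<in> H.C.CS" and b: "b \<in> bounded_ops arr" "op_conv arr (\<lambda>n. lam (x n)) b" by auto
  obtain a where a: "a \<in> bounded_ops Iso" "op_conv Iso (\<lambda>n. H.lam (x n)) a" using H.lam_limit_exists[OF x] by auto
  have "a \<in> carr (reduced_algebra IG)" using a x H.reduced_carr by auto
  moreover have "b \<in> carr (reduced_algebra G)" using b CS_H_G[OF x] by (auto simp: reduced_carr)
  then have "iso_inclusion_red G a = b" using iso_inclusion_red_eq[OF H.CS_Cc[OF x] a _ b(2)] by simp
  ultimately show "b \<in> iso_subalgebra_red G" by (auto simp: iso_subalgebra_red_def)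
qed

lemma iso_inclusion_red_lam: assumes f: "f \<in> Cc IG" shows "iso_inclusion_red G (H.lam f) = lam f"
proof (rule iso_inclusion_red_eq[where z = "\<lambda>_. f"])
  show "H.lam f \<in> bounded_ops Iso" using H.lam_bounded_ops[OF f] by simp
qed (simp_all add: f op_conv_const lam_reduced Cc_H_G)

end

section \<open>Norm-closedness of the reduced algebra\<close>

section \<open>Closed range of the regular representation\<close>

context lch_etale
begin

lemma convolution_unit_supported:
  assumes k: "\<And>y. y \<notin> units G \<Longrightarrow> k y = 0" and x: "x \<in> arr"
  shows "(f \<star> k) x = f x * k (s x)"
proof -
  have "(f \<star> k) x = (\<Sum>\<beta>\<in>{s x}. f (x \<odot> iv \<beta>) * k \<beta>)"
    unfolding convolution_src[OF x]
  proof (subst infsum_finite[symmetric])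
    show "(\<Sum>\<^sub>\<infinity>\<beta>\<in>src_fibre G (s x). f (x \<odot> iv \<beta>) * k \<beta>) = (\<Sum>\<^sub>\<infinity>\<beta>\<in>{s x}. f (x \<odot> iv \<beta>) * k \<beta>)"
      by (rule infsum_cong_neutral) (use k x in \<open>auto simp: src_fibre_def units_iff\<close>)
  qed simp
  then show ?thesis using x unit_simps(4)[of "s x"] by simp
qed

text \<open>The element \<open>f p(f* f)\<close>. The extra factor \<open>f\<close> stands in for
  the unit that the convolution algebra may lack.\<close>

definition conv_poly :: "('g \<Rightarrow> complex) \<Rightarrow> real poly \<Rightarrow> 'g \<Rightarrow> complex" where
  "conv_poly f p = fold_coeffs (\<lambda>a h \<gamma>. of_real a * f \<gamma> + (h \<star> (involution G f \<star> f)) \<gamma>) p (\<lambda>_. 0)"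

lemma conv_poly_0: "conv_poly f 0 = (\<lambda>_. 0)"
  by (simp add: conv_poly_def)

lemma convolution_zero_left: "(\<lambda>_. 0) \<star> g = (\<lambda>_. 0)"
  by (rule ext) (simp add: convolution_def case_prod_beta')

lemma conv_poly_pCons:
  "conv_poly f (pCons a p) = (\<lambda>\<gamma>. of_real a * f \<gamma> + (conv_poly f p \<star> (involution G f \<star> f)) \<gamma>)"
proof (cases "p = 0 \<and> a = 0")
  case True
  then show ?thesis by (simp add: conv_poly_def convolution_zero_left)
qed (auto simp: conv_poly_def)

lemma conv_poly_Cc: "f \<in> Cc G \<Longrightarrow> conv_poly f p \<in> Cc G"
  by (induction p) (auto simp: conv_poly_0 conv_poly_pCons intro!: Cc_add Cc_scale Cc_convolution Cc_involution)

context
  fixes S :: "'i set" and \<pi> :: "('g \<Rightarrow> complex) \<Rightarrow> 'i operator"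
  assumes bdd: "\<And>f. f \<in> Cc G \<Longrightarrow> \<pi> f \<in> bounded_ops S"
    and add: "\<And>f g. f \<in> Cc G \<Longrightarrow> g \<in> Cc G \<Longrightarrow> \<pi> (f \<^bold>+ g) = (\<pi> f \<oplus> \<pi> g)"
    and scale: "\<And>c f. f \<in> Cc G \<Longrightarrow> \<pi> (\<lambda>\<gamma>. c * f \<gamma>) = (\<lambda>\<xi> i. c * \<pi> f \<xi> i)"
    and conv: "\<And>f g. f \<in> Cc G \<Longrightarrow> g \<in> Cc G \<Longrightarrow> \<pi> (f \<star> g) = \<pi> f \<circ> \<pi> g"
    and inv: "\<And>f. f \<in> Cc G \<Longrightarrow> \<pi> (involution G f) = op_adjoint S (\<pi> f)"
begin

lemma rep_positive_op:
  assumes f: "f \<in> Cc G" and R: "0 < R" "(op_norm S (\<pi> f))\<^sup>2 \<le> R"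
  shows "positive_op S (op_adjoint S (\<pi> f) \<circ> \<pi> f) R"
proof
  note P = bdd[OF f] and A = op_adjoint_bounded[OF bdd[OF f]]
  show "op_adjoint S (\<pi> f) \<circ> \<pi> f \<in> bounded_ops S" by (rule bounded_ops_compose[OF A P])
  show "0 < R" by (rule R)
  fix \<xi> assume \<xi>: "\<xi> \<in> ell2 S"
  show "0 \<le> Re (ell2_inner S ((op_adjoint S (\<pi> f) \<circ> \<pi> f) \<xi>) \<xi>)" using ell2_norm_sq_op[OF P \<xi>] by simp
  have "(ell2_norm S (\<pi> f \<xi>))\<^sup>2 \<le> (op_norm S (\<pi> f) * ell2_norm S \<xi>)\<^sup>2" by (rule power_mono[OF op_norm_bound[OF P \<xi>]]) simp
  also have "\<dots> \<le> R * (ell2_norm S \<xi>)\<^sup>2" using R by (simp add: power_mult_distrib mult_right_mono)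
  finally show "Re (ell2_inner S ((op_adjoint S (\<pi> f) \<circ> \<pi> f) \<xi>) \<xi>) \<le> R * (ell2_norm S \<xi>)\<^sup>2"
    using ell2_norm_sq_op[OF P \<xi>] by simp
  fix \<eta> assume \<eta>: "\<eta> \<in> ell2 S"
  show "ell2_inner S ((op_adjoint S (\<pi> f) \<circ> \<pi> f) \<xi>) \<eta> = ell2_inner S \<xi> ((op_adjoint S (\<pi> f) \<circ> \<pi> f) \<eta>)"
    using op_adjoint_inner'[OF P bop_ell2[OF P \<xi>] \<eta>] op_adjoint_inner[OF P \<xi> bop_ell2[OF P \<eta>]] by simp
qed

lemma rep_conv_poly:
  assumes f: "f \<in> Cc G" and \<xi>: "\<xi> \<in> ell2 S"
  shows "\<pi> (conv_poly f p) \<xi> = \<pi> f (poly_op (op_adjoint S (\<pi> f) \<circ> \<pi> f) p \<xi>)"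
proof -
  define B where "B = op_adjoint S (\<pi> f) \<circ> \<pi> f"
  interpret B: positive_op S B "(op_norm S (\<pi> f))\<^sup>2 + 1"
    unfolding B_def by (rule rep_positive_op[OF f]) (simp_all add: add_nonneg_pos)
  have "\<forall>\<xi> \<in> ell2 S. \<pi> (conv_poly f p) \<xi> = \<pi> f (poly_op B p \<xi>)"
  proof (induction p)
    case 0
    have "\<pi> (\<lambda>_. 0) = (\<lambda>\<xi> i. 0)" using scale[OF Cc_zero, of 0] by simp
    then show ?case by (simp add: conv_poly_0 bop_zero[OF bdd[OF f]])
  next
    case (pCons a p)
    note c = conv_poly_Cc[OF f, of p] and b = Cc_convolution[OF Cc_involution[OF f] f]
    have "\<pi> (conv_poly f (pCons a p)) \<xi> = (\<lambda>i. of_real a * \<pi> f \<xi> i + \<pi> (conv_poly f p) (B \<xi>) i)" for \<xi>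
      unfolding conv_poly_pCons add[OF Cc_scale[OF f] Cc_convolution[OF c b]] scale[OF f] conv[OF c b]
        conv[OF Cc_involution[OF f] f] inv[OF f] B_def by simp
    then show ?case
      using pCons bop_ell2[OF B.B]
      by (auto simp: bop_add[OF bdd[OF f]] bop_scale[OF bdd[OF f]] ell2_scale B.poly_op_ell2 B.poly_op_commute)
  qed
  then show ?thesis using \<xi> by (simp only: B_def)
qed

text \<open>The squared norm of the operator at \<open>\<xi>\<close> is a coefficient of
  \<open>?B\<close> at the vector \<open>poly_op ?B p \<xi>\<close>, so the supremum of
  \<open>t * (poly p t)\<^sup>2\<close> decides. The representation is abstract because the estimate
  is needed for \<open>lam\<close> as well as for every representation in the full norm.\<close>

lemma rep_conv_poly_norm:
  assumes f: "f \<in> Cc G" and R: "0 < R" "(op_norm S (\<pi> f))\<^sup>2 \<le> R" and c: "0 \<le> c"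
    and p: "\<And>t. t \<in> {0..R} \<Longrightarrow> t * (poly p t)\<^sup>2 \<le> c\<^sup>2"
  shows "op_norm S (\<pi> (conv_poly f p)) \<le> c"
proof (rule op_norm_leI[OF c])
  let ?B = "op_adjoint S (\<pi> f) \<circ> \<pi> f"
  interpret B: positive_op S ?B R by (rule rep_positive_op[OF f R])
  fix \<xi> assume \<xi>: "\<xi> \<in> ell2 S"
  have "(ell2_norm S (\<pi> (conv_poly f p) \<xi>))\<^sup>2 = Re (ell2_inner S (?B (poly_op ?B p \<xi>)) (poly_op ?B p \<xi>))"
    unfolding rep_conv_poly[OF f \<xi>] using ell2_norm_sq_op[OF bdd[OF f] B.poly_op_ell2[OF \<xi>]] by simp
  also have "\<dots> \<le> c\<^sup>2 * (ell2_norm S \<xi>)\<^sup>2" by (rule B.poly_op_sqrt_bound[OF p \<xi>])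
  finally have "(ell2_norm S (\<pi> (conv_poly f p) \<xi>))\<^sup>2 \<le> (c * ell2_norm S \<xi>)\<^sup>2" by (simp add: power_mult_distrib)
  then show "ell2_norm S (\<pi> (conv_poly f p) \<xi>) \<le> c * ell2_norm S \<xi>" by (rule power2_le_imp_le) (simp add: c)
qed

end

lemma lam_conv_poly_norm:
  assumes f: "f \<in> Cc G" and R: "0 < R" "(op_norm arr (lam f))\<^sup>2 \<le> R" and c: "0 \<le> c"
    and p: "\<And>t. t \<in> {0..R} \<Longrightarrow> t * (poly p t)\<^sup>2 \<le> c\<^sup>2"
  shows "op_norm arr (lam (conv_poly f p)) \<le> c"
proof (rule rep_conv_poly_norm[where \<pi> = lam and R = R])
  show "t * (poly p t)\<^sup>2 \<le> c\<^sup>2" if "t \<in> {0..R}" for t by (rule p[OF that])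
qed (simp_all only: lam_bounded_ops lam_add lam_scale lam_convolution lam_involution f R c)

lemma full_norm_conv_poly:
  assumes f: "f \<in> Cc G" and R: "0 < R" "(FN f)\<^sup>2 \<le> R" and c: "0 \<le> c"
    and p: "\<And>t. t \<in> {0..R} \<Longrightarrow> t * (poly p t)\<^sup>2 \<le> c\<^sup>2"
  shows "FN (conv_poly f p) \<le> c"
proof (rule full_norm_leI)
  fix \<pi> assume \<pi>: "\<pi> \<in> I_bounded_reps G"
  have "(op_norm UNIV (\<pi> f))\<^sup>2 \<le> (FN f)\<^sup>2"
    by (rule power_mono[OF rep_le_full_norm[OF \<pi> f] op_norm_nonneg[OF rep_bounded_ops[OF \<pi> f]]])
  then have "(op_norm UNIV (\<pi> f))\<^sup>2 \<le> R" using R by linarith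
  note 1 = this
  show "op_norm UNIV (\<pi> (conv_poly f p)) \<le> c"
  proof (rule rep_conv_poly_norm[where \<pi> = \<pi> and R = R])
    show "t * (poly p t)\<^sup>2 \<le> c\<^sup>2" if "t \<in> {0..R}" for t by (rule p[OF that])
  qed (simp_all only: rep_bounded_ops[OF \<pi>] rep_add[OF \<pi>] rep_scale[OF \<pi>] rep_convolution[OF \<pi>] rep_involution[OF \<pi>] f R(1) c 1)
qed

lemma conv_poly_diff: "f \<in> Cc G \<Longrightarrow> conv_poly f (1 - p) = (f \<^bold>- conv_poly f p)"
proof -
  assume f: "f \<in> Cc G"
  note b = Cc_convolution[OF Cc_involution[OF f] f]
  have d: "conv_poly f (p - q) = (conv_poly f p \<^bold>- conv_poly f q)" for p q
    by (induction p q rule: poly_induct2) (auto simp: conv_poly_0 conv_poly_pCons convolution_diff_left[OF b] algebra_simps)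
  have "conv_poly f 1 = f" by (simp add: one_pCons conv_poly_pCons conv_poly_0 convolution_zero_left)
  then show ?thesis using d by simp
qed

text \<open>Functional calculus with a cut-off: the witness is \<open>f p(f* f)\<close> with
  \<open>p\<close> close to \<open>g\<close>. In every representation the cut-off holds the norm at
  \<open>2 * \<rho>\<close>. In the regular representation the square has its spectrum in
  \<open>{0..\<rho>\<^sup>2}\<close>, where \<open>g\<close> is 1, so little changes. This is the
  quantitative core of the closed range of *-homomorphisms.\<close>

lemma reduced_lift:
  assumes f: "f \<in> Cc G" and \<rho>: "0 < \<rho>" "op_norm arr (lam f) \<le> \<rho>" and e: "0 < e"
  shows "\<exists>f' \<in> Cc G. FN f' \<le> 2 * \<rho> \<and> op_norm arr (lam f \<ominus> lam f') \<le> e"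
proof -
  define R where "R = max ((FN f)\<^sup>2) (\<rho>\<^sup>2)"
  have R: "0 < R" "(FN f)\<^sup>2 \<le> R" "\<rho>\<^sup>2 \<le> R" using \<rho>(1) by (auto simp: R_def less_max_iff_disj)
  \<comment> \<open>the factor that cuts \<open>t \<mapsto> \<surd>t\<close> down to \<open>\<rho>\<close>\<close>
  define g where "g t = sqrt (\<rho>\<^sup>2 / max (\<rho>\<^sup>2) t)" for t
  have gc: "continuous_on {0..R} g" unfolding g_def
    by (intro continuous_intros) (use \<rho>(1) in \<open>auto simp: max_def not_le\<close>)
  \<comment> \<open>The first bound keeps \<open>sqrt t * \<bar>poly p t\<bar>\<close> at most
    \<open>2 * \<rho>\<close> on \<open>{0..R}\<close>, the second keeps the change on
    \<open>{0..\<rho>\<^sup>2}\<close> at most \<open>e\<close>.\<close>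
  define \<delta> where "\<delta> = min (\<rho> / sqrt R) (e / \<rho>)"
  have \<delta>: "0 < \<delta>" "\<delta> * sqrt R \<le> \<rho>" "\<rho> * \<delta> \<le> e" using \<rho>(1) R(1) e
    by (auto simp: \<delta>_def min_def field_simps)
  obtain p where p: "\<And>t. t \<in> {0..R} \<Longrightarrow> \<bar>poly p t - g t\<bar> < \<delta>" using real_poly_approx[OF gc \<delta>(1)] by blast
  have 1: "t * (poly p t)\<^sup>2 \<le> (2 * \<rho>)\<^sup>2" if t: "t \<in> {0..R}" for t
  proof -
    have g0: "0 \<le> g t" by (simp add: g_def le_max_iff_disj)
    have "sqrt t * g t \<le> \<rho>"
    proof (rule power2_le_imp_le)
      have "t * (\<rho>\<^sup>2 / max (\<rho>\<^sup>2) t) \<le> \<rho>\<^sup>2"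
        using t \<rho>(1) by (simp add: max_def field_simps)
      then show "(sqrt t * g t)\<^sup>2 \<le> \<rho>\<^sup>2" using t by (simp add: g_def power_mult_distrib max_def)
    qed (use \<rho> in simp)
    moreover have "\<bar>poly p t\<bar> \<le> g t + \<delta>" using p[OF t] g0 by linarith
    then have "sqrt t * \<bar>poly p t\<bar> \<le> sqrt t * (g t + \<delta>)" using t by (intro mult_left_mono) auto
    moreover have "sqrt t * \<delta> \<le> sqrt R * \<delta>" using t \<delta>(1) by (intro mult_right_mono) auto
    ultimately have "sqrt t * \<bar>poly p t\<bar> \<le> 2 * \<rho>" using \<delta>(2) by (simp add: algebra_simps)
    then have "(sqrt t * \<bar>poly p t\<bar>)\<^sup>2 \<le> (2 * \<rho>)\<^sup>2" using t by (intro power_mono) auto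
    then show ?thesis using t by (simp add: power_mult_distrib)
  qed
  have 2: "t * (poly (1 - p) t)\<^sup>2 \<le> e\<^sup>2" if t: "t \<in> {0..\<rho>\<^sup>2}" for t
  proof -
    have tR: "t \<in> {0..R}" using t R(3) by auto
    have "max (\<rho>\<^sup>2) t = \<rho>\<^sup>2" using t by simp
    then have "g t = 1" using \<rho>(1) by (simp add: g_def)
    then have "\<bar>poly (1 - p) t\<bar> \<le> \<delta>" using p[OF tR] by simp
    moreover have "sqrt t \<le> \<rho>" using t \<rho>(1) by (simp add: real_le_lsqrt)
    ultimately have "sqrt t * \<bar>poly (1 - p) t\<bar> \<le> \<rho> * \<delta>" using t \<rho>(1) by (intro mult_mono) auto
    then have "sqrt t * \<bar>poly (1 - p) t\<bar> \<le> e" using \<delta>(3) by linarith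
    then have "(sqrt t * \<bar>poly (1 - p) t\<bar>)\<^sup>2 \<le> e\<^sup>2" using t by (intro power_mono) auto
    then show ?thesis using t by (simp add: power_mult_distrib)
  qed
  have "FN (conv_poly f p) \<le> 2 * \<rho>" by (rule full_norm_conv_poly[OF f R(1,2) _ 1]) (use \<rho> in auto)
  moreover have "op_norm arr (lam (conv_poly f (1 - p))) \<le> e"
    by (rule lam_conv_poly_norm[OF f _ _ _ 2]) (use \<rho> e op_norm_nonneg[OF lam_bounded_ops[OF f]] in \<open>auto intro: power_mono\<close>)
  ultimately show ?thesis
    using conv_poly_Cc[OF f, of p] by (auto simp: conv_poly_diff[OF f] lam_diff[OF f conv_poly_Cc[OF f]])
qed

text \<open>The scheme of the open mapping theorem: corrections of small reduced norm are exchanged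
  for nearby ones of comparable full norm, so that the resulting sequence is Cauchy for the full
  norm and still tends to \<open>b\<close>.\<close>

lemma reduced_closed:
  assumes z: "\<And>n. z n \<in> Cc G" and b: "b \<in> bounded_ops arr" "op_conv arr (\<lambda>n. lam (z n)) b"
  shows "\<exists>x \<in> C.CS. op_conv arr (\<lambda>n. lam (x n)) b"
proof -
  let ?D = "\<lambda>f. op_norm arr (lam f \<ominus> b)"
  have dense: "\<exists>f \<in> Cc G. ?D f < e" if e: "0 < e" for e
  proof -
    obtain N where "norm (?D (z N) - 0) < e" using LIMSEQ_D[OF b(2)[unfolded op_conv_def] e] by blast
    then have "?D (z N) < e" by (simp only: real_norm_def diff_zero abs_less_iff)
    then show ?thesis using z by blast
  qed
  have step: "\<exists>h'. (h' \<in> Cc G \<and> ?D h' < (1/2) ^ Suc n) \<and> FN (h' \<^bold>- h) \<le> 4 * (1/2) ^ n"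
    if h: "h \<in> Cc G" "?D h < (1/2) ^ n" for h n
  proof -
    \<comment> \<open>Two errors of size \<open>?e / 8\<close>, one from \<open>d\<close> and one
      from the lift, together stay below the next threshold \<open>?e / 2\<close>.\<close>
    let ?e = "(1/2::real) ^ n"
    have e: "0 < ?e / 8" by simp
    obtain d where d: "d \<in> Cc G" "?D d < ?e / 8" using dense[OF e] by blast
    let ?f = "\<lambda>\<gamma>. d \<gamma> - h \<gamma>"
    have f: "?f \<in> Cc G" by (rule Cc_diff[OF d(1) h(1)])
    have "op_norm arr (lam ?f) \<le> ?D d + ?D h"
      unfolding lam_diff[OF d(1) h(1)]
      using op_norm_diff_triangle[OF lam_bounded_ops[OF d(1)] b(1) lam_bounded_ops[OF h(1)]]
      unfolding op_norm_minus_commute[OF b(1) lam_bounded_ops[OF h(1)]] .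
    also have "\<dots> \<le> 2 * ?e" using d(2) h(2) e by linarith
    finally obtain f' where f': "f' \<in> Cc G" "FN f' \<le> 2 * (2 * ?e)" "op_norm arr (lam ?f \<ominus> lam f') \<le> ?e / 8"
      using reduced_lift[OF f _ _ e, of "2 * ?e"] by auto
    let ?h = "\<lambda>\<gamma>. h \<gamma> + f' \<gamma>"
    have h': "?h \<in> Cc G" by (rule Cc_add[OF h(1) f'(1)])
    have "(lam d \<ominus> lam ?h) = (lam ?f \<ominus> lam f')"
      unfolding lam_add[OF h(1) f'(1)] lam_diff[OF d(1) h(1)] by (auto simp: algebra_simps)
    then have "op_norm arr (lam ?h \<ominus> lam d) \<le> ?e / 8"
      using f'(3) op_norm_minus_commute[OF lam_bounded_ops[OF h'] lam_bounded_ops[OF d(1)]] by simp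
    then have "?D ?h \<le> ?e / 8 + ?D d"
      using op_norm_diff_triangle[OF lam_bounded_ops[OF h'] lam_bounded_ops[OF d(1)] b(1)]
      by (rule order_trans[rotated, OF add_right_mono])
    also have "\<dots> < (1/2) ^ Suc n" using d(2) e power_Suc[of "1/2::real" n] by linarith
    finally show ?thesis using h' f'(2) by (intro exI[of _ ?h]) simp
  qed
  have "\<exists>x. \<forall>n. (x n \<in> Cc G \<and> ?D (x n) < (1/2) ^ n) \<and> FN (x (Suc n) \<^bold>- x n) \<le> 4 * (1/2) ^ n"
    by (rule dependent_nat_choice) (use dense[of 1] step in auto)
  then obtain x where x: "\<And>n. x n \<in> Cc G" "\<And>n. ?D (x n) < (1/2) ^ n" "\<And>n. FN (x (Suc n) \<^bold>- x n) \<le> 4 * (1/2) ^ n"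
    by blast
  \<comment> \<open>The increments \<open>4 * (1/2) ^ j\<close> sum to a geometric series, which
    explains the 8.\<close>
  have tele: "FN (x (n + k) \<^bold>- x n) \<le> 8 * ((1/2) ^ n - (1/2) ^ (n + k))" for n k
  proof (induction k)
    case (Suc k)
    have "FN (x (Suc (n + k)) \<^bold>- x n) \<le> FN (x (Suc (n + k)) \<^bold>- x (n + k)) + FN (x (n + k) \<^bold>- x n)"
      by (rule full_norm_triangle_diff) (rule x)+
    also have "\<dots> \<le> 4 * (1/2) ^ (n + k) + 8 * ((1/2) ^ n - (1/2) ^ (n + k))" by (rule add_mono[OF x(3) Suc])
    also have "\<dots> = 8 * ((1/2) ^ n - (1/2) ^ (n + Suc k))" by simp
    finally show ?case by simp
  qed (simp add: full_norm_zero)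
  have le: "FN (x m \<^bold>- x n) \<le> 8 * (1/2) ^ N" if "m \<ge> N" "n \<ge> N" for m n N
  proof -
    have *: "FN (x m \<^bold>- x n) \<le> 8 * (1/2) ^ N" if "n \<ge> N" "m \<ge> n" for m n
    proof -
      have "FN (x m \<^bold>- x n) \<le> 8 * ((1/2) ^ n - (1/2) ^ m)" using tele[of n "m - n"] that by simp
      also have "\<dots> \<le> 8 * (1/2) ^ n" by simp
      also have "\<dots> \<le> 8 * (1/2) ^ N" using that by (simp add: power_decreasing)
      finally show ?thesis .
    qed
    show ?thesis
      using *[of n m] *[of m n] full_norm_minus_commute[OF x(1) x(1), of m n] that by (cases "n \<le> m") auto
  qed
  have "x \<in> C.CS"
  proof (rule C.CS_I)
    fix e :: real assume "0 < e"
    then obtain N where N: "(1/2::real) ^ N < e / 8" using real_arch_pow_inv[of "e/8" "1/2"] by auto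
    have "adist FA (x m) (x n) < e" if "m \<ge> N" "n \<ge> N" for m n
      using le[OF that] N by (simp add: adist_FA)
    then show "\<exists>N. \<forall>m\<ge>N. \<forall>n\<ge>N. adist FA (x m) (x n) < e" by blast
  qed (simp add: x)
  moreover have "op_conv arr (\<lambda>n. lam (x n)) b"
    unfolding op_conv_def
  proof (rule Lim_null_comparison[OF always_eventually])
    show "\<forall>n. norm (?D (x n)) \<le> (1/2) ^ n"
      using x(2) op_norm_nonneg[OF bounded_ops_diff[OF lam_bounded_ops[OF x(1)] b(1)]] by (simp add: less_imp_le)
    show "(\<lambda>n. (1/2::real) ^ n) \<longlonglongrightarrow> 0" by (rule LIMSEQ_power_zero) simp
  qed
  ultimately show ?thesis by blast
qed

end

section \<open>The reduced isotropy algebra\<close>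

context iso_etale
begin

abbreviation "Mr \<equiv> iso_subalgebra_red G"

text \<open>Membership becomes approximability in operator norm, with no mention of the full norm. A
  convergent sequence is transported by the isometry \<open>op_norm_lam_H_diff\<close> to the
  isotropy bundle, where \<open>reduced_closed\<close> supplies one that is Cauchy for the full
  norm.\<close>

lemma Mr_iff: "b \<in> Mr \<longleftrightarrow> b \<in> bounded_ops arr \<and> (\<exists>z. (\<forall>n. z n \<in> Cc IG) \<and> op_conv arr (\<lambda>n. lam (z n)) b)"
proof
  assume "b \<in> Mr" then show "b \<in> bounded_ops arr \<and> (\<exists>z. (\<forall>n. z n \<in> Cc IG) \<and> op_conv arr (\<lambda>n. lam (z n)) b)"
    using H.CS_Cc by (auto simp: iso_subalgebra_red_eq)
next
  assume "b \<in> bounded_ops arr \<and> (\<exists>z. (\<forall>n. z n \<in> Cc IG) \<and> op_conv arr (\<lambda>n. lam (z n)) b)"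
  then obtain z where z: "\<And>n. z n \<in> Cc IG" and b: "b \<in> bounded_ops arr" "op_conv arr (\<lambda>n. lam (z n)) b" by blast
  have L: "lam (z n) \<in> bounded_ops arr" "H.lam (z n) \<in> bounded_ops Iso" for n
    using lam_bounded_ops[OF Cc_H_G[OF z]] H.lam_bounded_ops[OF z] by auto
  have "\<exists>N. \<forall>m\<ge>N. \<forall>n\<ge>N. op_norm Iso (H.lam (z m) \<ominus> H.lam (z n)) < e" if "0 < e" for e
    using op_conv_Cauchy[OF L(1) b that] by (simp add: op_norm_lam_H_diff[OF z z])
  then obtain a where a: "a \<in> bounded_ops Iso" "op_conv Iso (\<lambda>n. H.lam (z n)) a"
    using bounded_ops_complete[of "\<lambda>n. H.lam (z n)" Iso] L(2) unfolding op_conv_def by blast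
  obtain x where x: "x \<in> H.C.CS" "op_conv Iso (\<lambda>n. H.lam (x n)) a" using H.reduced_closed[where z = z, OF z, of a] a by auto
  note xc = H.CS_Cc[OF x(1)]
  have Lx: "lam (x n) \<in> bounded_ops arr" "H.lam (x n) \<in> bounded_ops Iso" for n
    using lam_bounded_ops[OF Cc_H_G[OF xc]] H.lam_bounded_ops[OF xc] by auto
  have "op_conv arr (\<lambda>n. lam (x n)) b"
  proof (rule op_conv_close[OF L(1) Lx(1) b])
    show "(\<lambda>n. op_norm Iso (H.lam (z n) \<ominus> a) + op_norm Iso (H.lam (x n) \<ominus> a)) \<longlonglongrightarrow> 0"
      using tendsto_add[OF a(2)[unfolded op_conv_def] x(2)[unfolded op_conv_def]] by simp
    show "op_norm arr (lam (z n) \<ominus> lam (x n)) \<le>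
        op_norm Iso (H.lam (z n) \<ominus> a) + op_norm Iso (H.lam (x n) \<ominus> a)" for n
      unfolding op_norm_lam_H_diff[OF z xc, symmetric]
      using op_norm_diff_triangle[OF L(2) a(1) Lx(2), of n n] unfolding op_norm_minus_commute[OF a(1) Lx(2), of n] .
  qed
  then show "b \<in> Mr" using b x by (auto simp: iso_subalgebra_red_eq)
qed

lemma Mr_bounded: "b \<in> Mr \<Longrightarrow> b \<in> bounded_ops arr"
  by (simp add: Mr_iff)

lemma Mr_reduced: "b \<in> Mr \<Longrightarrow> b \<in> carr (reduced_algebra G)"
  using CS_H_G by (auto simp: iso_subalgebra_red_eq reduced_carr)

lemma lam_Mr: "f \<in> Cc IG \<Longrightarrow> lam f \<in> Mr"
  by (auto simp: Mr_iff lam_bounded_ops Cc_H_G op_conv_const intro!: exI[of _ "\<lambda>_. f"])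

lemma Mr_approx: assumes b: "b \<in> Mr" and e: "0 < e" shows "\<exists>f \<in> Cc IG. op_norm arr (lam f \<ominus> b) < e"
proof -
  obtain z where z: "\<And>n. z n \<in> Cc IG" "op_conv arr (\<lambda>n. lam (z n)) b" using b by (auto simp: Mr_iff)
  obtain N where "norm (op_norm arr (lam (z N) \<ominus> b) - 0) < e" using LIMSEQ_D[OF z(2)[unfolded op_conv_def] e] by blast
  then have "op_norm arr (lam (z N) \<ominus> b) < e" by (simp only: real_norm_def diff_zero abs_less_iff)
  then show ?thesis using z by blast
qed

lemma Mr_closed:
  assumes t: "\<And>n. t n \<in> Mr" and b: "b \<in> bounded_ops arr" "op_conv arr t b" shows "b \<in> Mr"
proof -
  have "\<exists>f \<in> Cc IG. op_norm arr (lam f \<ominus> t n) < inverse (real (Suc n))" for n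
    by (rule Mr_approx[OF t]) simp
  then obtain z where z: "\<And>n. z n \<in> Cc IG" "\<And>n. op_norm arr (lam (z n) \<ominus> t n) < inverse (real (Suc n))" by metis
  note L = lam_bounded_ops[OF Cc_H_G[OF z(1)]]
  have "op_conv arr (\<lambda>n. lam (z n)) b"
  proof (rule op_conv_close[OF Mr_bounded[OF t] L b])
    show "(\<lambda>n. inverse (real (Suc n))) \<longlonglongrightarrow> 0" by (rule LIMSEQ_inverse_real_of_nat)
    show "op_norm arr (t n \<ominus> lam (z n)) \<le> inverse (real (Suc n))" for n
      using z(2)[of n] op_norm_minus_commute[OF L Mr_bounded[OF t], of n n] by simp
  qed
  then show ?thesis using b z by (auto simp: Mr_iff)
qed

lemma Mr_add: assumes "a \<in> Mr" "b \<in> Mr" shows "(a \<oplus> b) \<in> Mr"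
proof -
  obtain y z where y: "\<And>n. y n \<in> Cc IG" "op_conv arr (\<lambda>n. lam (y n)) a" and z: "\<And>n. z n \<in> Cc IG" "op_conv arr (\<lambda>n. lam (z n)) b"
    using assms by (auto simp: Mr_iff)
  have "op_conv arr (\<lambda>n. lam (y n \<^bold>+ z n)) (a \<oplus> b)"
    unfolding lam_add[OF Cc_H_G[OF y(1)] Cc_H_G[OF z(1)]]
    by (intro op_conv_add lam_bounded_ops Cc_H_G y z Mr_bounded assms)
  then show ?thesis using H.Cc_add[OF y(1) z(1)] bounded_ops_add[OF Mr_bounded[OF assms(1)] Mr_bounded[OF assms(2)]]
    by (auto simp: Mr_iff intro!: exI[of _ "\<lambda>n \<gamma>. y n \<gamma> + z n \<gamma>"])
qed

lemma Mr_scale: assumes "a \<in> Mr" shows "(\<lambda>\<xi> i. c * a \<xi> i) \<in> Mr"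
proof -
  obtain y where y: "\<And>n. y n \<in> Cc IG" "op_conv arr (\<lambda>n. lam (y n)) a" using assms by (auto simp: Mr_iff)
  have "op_conv arr (\<lambda>n. lam (\<lambda>\<gamma>. c * y n \<gamma>)) (\<lambda>\<xi> i. c * a \<xi> i)"
    unfolding lam_scale[OF Cc_H_G[OF y(1)]]
    by (intro op_conv_scale lam_bounded_ops Cc_H_G y Mr_bounded assms)
  then show ?thesis using H.Cc_scale[OF y(1)] bounded_ops_scale[OF Mr_bounded[OF assms(1)]]
    by (auto simp: Mr_iff intro!: exI[of _ "\<lambda>n \<gamma>. c * y n \<gamma>"])
qed

lemma Mr_compose: assumes "a \<in> Mr" "b \<in> Mr" shows "a \<circ> b \<in> Mr"
proof -
  obtain y z where y: "\<And>n. y n \<in> Cc IG" "op_conv arr (\<lambda>n. lam (y n)) a" and z: "\<And>n. z n \<in> Cc IG" "op_conv arr (\<lambda>n. lam (z n)) b"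
    using assms by (auto simp: Mr_iff)
  have c: "y n \<star> z n \<in> Cc IG" for n
    using H.Cc_convolution[OF y(1) z(1), of n n] convolution_H[OF y(1) z(1), of n n] by simp
  have "op_conv arr (\<lambda>n. lam (y n \<star> z n)) (a \<circ> b)"
    unfolding lam_convolution[OF Cc_H_G[OF y(1)] Cc_H_G[OF z(1)]]
    by (intro op_conv_compose lam_bounded_ops Cc_H_G y z Mr_bounded assms)
  then show ?thesis using c bounded_ops_compose[OF Mr_bounded[OF assms(1)] Mr_bounded[OF assms(2)]]
    by (auto simp: Mr_iff intro!: exI[of _ "\<lambda>n. convolution G (y n) (z n)"])
qed

section \<open>A conditional expectation forces the isotropy interior to be closed\<close>

lemma unit_supported_Cc:
  assumes "openin T W" "W \<subseteq> units G" "u \<in> W"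
  shows "\<exists>k L. k \<in> Cc IG \<and> compactin T L \<and> L \<subseteq> W \<and> k u = 1 \<and> (\<forall>y. y \<notin> L \<longrightarrow> k y = 0)"
proof -
  obtain g L where g: "continuous_map T euclideanreal g" "compactin T L" "L \<subseteq> W" "g u = 1" "\<forall>y. y \<notin> L \<longrightarrow> g y = 0"
    using bump_exists[OF assms(1,3)] by blast
  have "continuous_map T euclidean (cplx g)"
    by (rule continuous_map_compose_euclidean[OF g(1)]) (intro continuous_intros)
  then have "continuous_map (gtop IG) euclidean (cplx g)"
    by (simp add: continuous_map_from_subtopology)
  moreover have "compactin (gtop IG) L" using g(2,3) assms(2) units_Iso by (auto simp: compactin_subtopology)
  ultimately have "cplx g \<in> Cc IG" by (rule H.CcI) (use g in auto)
  then show ?thesis using g by (intro exI[of _ "cplx g"] exI[of _ L]) auto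
qed

lemma lam_unit_supported:
  assumes k: "k \<in> Cc G" "\<And>y. y \<notin> units G \<Longrightarrow> k y = 0" and u: "u \<in> units G" "k u = 1"
  shows "lam k (basis_vector u) = basis_vector u"
proof
  fix \<eta> show "lam k (basis_vector u) \<eta> = basis_vector u \<eta>"
  proof (cases "\<eta> \<in> arr")
    case True
    have eu: "\<eta> \<odot> iv u = \<eta>" if "s \<eta> = u" using that True unit_simps(4)[OF u(1)] by (metis alg_unfold(8))
    show ?thesis
    proof (cases "\<eta> = u")
      case True
      then show ?thesis using u(2) \<open>\<eta> \<in> arr\<close> eu unit_simps[OF u(1)] lam_entry[of u u k] by (simp add: lam_kernel_def) (simp add: basis_vector_def)
    next
      case False
      have "lam_kernel k \<eta> u = 0"
      proof (cases "s \<eta> = u")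
        case s: True
        then have "\<eta> \<notin> units G" using False unit_simps(2)[of \<eta>] by auto
        then show ?thesis using k(2) eu[OF s] unit_simps(2)[OF u(1)] s by (simp add: lam_kernel_def)
      qed (simp add: lam_kernel_def unit_simps(2)[OF u(1)])
      then have "lam k (basis_vector u) \<eta> = 0" using lam_entry[OF \<open>\<eta> \<in> arr\<close> unit_simps(1)[OF u(1)], of k] by simp
      moreover have "basis_vector u \<eta> = 0" using False by (simp add: basis_vector_def)
      ultimately show ?thesis by simp
    qed
  next
    case False
    then show ?thesis using u unit_simps(1)[OF u(1)] by (auto simp: sum_regular_rep_def basis_vector_def)
  qed
qed

lemma expectation_imp_closed:
  assumes E: "conditional_expectation (reduced_algebra G) Mr E"
  shows "closedin T Iso"
proof (rule ccontr)
  assume "\<not> closedin T Iso"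
  have Isub: "Iso \<subseteq> topspace T" using openin_subset[OF Iso_open] .
  then obtain \<gamma> where \<gamma>: "\<gamma> \<in> T closure_of Iso" "\<gamma> \<notin> Iso"
    using \<open>\<not> closedin T Iso\<close> closure_of_subset[OF Isub] by (metis closure_of_eq subsetI subset_antisym)
  have \<gamma>a: "\<gamma> \<in> arr" using \<gamma>(1) closure_of_subset_topspace by (fastforce simp: arr_top)
  obtain U where U: "bisection U" "\<gamma> \<in> U" using bisection_exists[OF \<gamma>a] by blast
  have Uo: "openin T U" and inj: "inj_on s U" using U by (auto simp: bisection_def)
  have Ua: "U \<subseteq> arr" using openin_subset[OF Uo] by (simp add: arr_top)
  obtain g K where g: "continuous_map T euclideanreal g" "compactin T K" "K \<subseteq> U" "g \<gamma> = 1" "\<forall>y. y \<notin> K \<longrightarrow> g y = 0"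
    using bump_exists[OF Uo U(2)] by blast
  define f where "f y = complex_of_real (g y)" for y
  have fc: "continuous_map T euclidean f" unfolding f_def
    by (rule continuous_map_compose_euclidean[OF g(1)]) (intro continuous_intros)
  have f: "f \<in> Cc G" by (rule CcI[OF fc g(2)]) (use g in \<open>auto simp: f_def\<close>)
  define b where "b = E (lam f)"
  have E': "\<And>a. a \<in> carr (reduced_algebra G) \<Longrightarrow> E a \<in> Mr" "\<And>b. b \<in> Mr \<Longrightarrow> E b = b"
    "\<And>a b. a \<in> carr (reduced_algebra G) \<Longrightarrow> b \<in> Mr \<Longrightarrow> E (a \<circ> b) = E a \<circ> b"
    using E unfolding conditional_expectation_def reduced_simps by blast+
  have bM: "b \<in> Mr" unfolding b_def by (rule E'(1)[OF lam_reduced[OF f]])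
  \<comment> \<open>Cut \<open>f\<close> down by a function \<open>k\<close> on the units supported
    in the source of \<open>U \<inter> Iso\<close>. Since the source map is injective on
    \<open>U\<close>, the product is supported in \<open>Iso\<close> and \<open>E\<close> fixes it,
    while bimodularity identifies it with \<open>b \<circ> lam k\<close>. Evaluation at the unit
    \<open>s \<alpha>\<close>, where \<open>k\<close> is 1, gives the entry.\<close>
  have val: "b (basis_vector (s \<alpha>)) \<alpha> = f \<alpha>" if \<alpha>: "\<alpha> \<in> Iso" "\<alpha> \<in> U" for \<alpha>
  proof -
    have \<alpha>a: "\<alpha> \<in> arr" using Iso_D \<alpha> by blast
    let ?W = "s ` (U \<inter> Iso)"
    have W: "openin T ?W" "?W \<subseteq> units G" "s \<alpha> \<in> ?W"
      using src_open[of "U \<inter> Iso"] Uo Iso_open Ua \<alpha> by auto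
    obtain k L where k: "k \<in> Cc IG" "compactin T L" "L \<subseteq> ?W" "k (s \<alpha>) = 1" "\<forall>y. y \<notin> L \<longrightarrow> k y = 0"
      using unit_supported_Cc[OF W] by blast
    have ku: "k y = 0" if "y \<notin> units G" for y using that k(3,5) W(2) by blast
    note kG = Cc_H_G[OF k(1)]
    let ?fk = "convolution G f k"
    have fk: "?fk x = f x * k (s x)" if "x \<in> arr" for x by (rule convolution_unit_supported[OF ku that])
    let ?K' = "K \<inter> {x \<in> topspace T. s x \<in> L}"
    have K': "compactin T ?K'"
      by (rule compact_Int_closedin[OF g(2) closedin_continuous_map_preimage[OF src_cont compactin_imp_closedin[OF haus k(2)]]])
    have "?K' \<subseteq> Iso"
    proof
      fix x assume x: "x \<in> ?K'"
      then obtain y where "y \<in> U \<inter> Iso" "s x = s y" using k(3) by blast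
      then have "x = y" using inj_onD[OF inj, of x y] x g(3) by blast
      then show "x \<in> Iso" using \<open>y \<in> U \<inter> Iso\<close> by blast
    qed
    then have K'': "compactin (gtop IG) ?K'" using K' by (simp add: compactin_subtopology)
    have "continuous_map (gtop IG) euclidean ?fk"
      using Cc_continuous[OF Cc_convolution[OF f kG]] by (simp add: continuous_map_from_subtopology)
    then have fkH: "?fk \<in> Cc IG"
    proof (rule H.CcI[OF _ K''])
      fix x assume x: "x \<notin> ?K'"
      show "?fk x = 0"
      proof (cases "x \<in> arr")
        case True
        then have "x \<notin> K \<or> s x \<notin> L" using x by (auto simp: arr_top)
        then show ?thesis using fk[OF True] g(5) k(5) by (auto simp: f_def)
      qed (simp add: convolution_off)
    qed
    have "lam ?fk = E (lam f \<circ> lam k)" using E'(2)[OF lam_Mr[OF fkH]] lam_convolution[OF f kG] by simp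
    also have "\<dots> = b \<circ> lam k" unfolding b_def by (rule E'(3)[OF lam_reduced[OF f] lam_Mr[OF k(1)]])
    finally have "lam ?fk (basis_vector (s \<alpha>)) \<alpha> = b (basis_vector (s \<alpha>)) \<alpha>"
      using lam_unit_supported[OF kG ku src_unit[OF \<alpha>a] k(4)] by simp
    moreover have "\<alpha> \<odot> iv (s \<alpha>) = \<alpha>" using \<alpha>a unit_simps(4)[OF src_unit[OF \<alpha>a]] by simp
    then have "lam ?fk (basis_vector (s \<alpha>)) \<alpha> = ?fk \<alpha>" using \<alpha>a by (simp add: lam_entry lam_kernel_def)
    ultimately show ?thesis using fk[OF \<alpha>a] k(4) by simp
  qed
  \<comment> \<open>The function \<open>h\<close> is 0 at \<open>\<gamma>\<close> and
    \<open>g\<close> is 1 there. Arrows of \<open>Iso\<close> close to \<open>\<gamma>\<close> would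
    then have \<open>cmod (h \<alpha>)\<close> below \<open>1/4\<close>, \<open>g \<alpha>\<close>
    above \<open>3/4\<close>, and a difference of less than \<open>1/4\<close>.\<close>
  obtain h where h: "h \<in> Cc IG" "op_norm arr (lam h \<ominus> b) < 1/4" using Mr_approx[OF bM, of "1/4"] by auto
  have close: "cmod (h x - b (basis_vector (s x)) x) < 1/4" if "x \<in> arr" for x
  proof -
    have "x \<odot> iv (s x) = x" using that unit_simps(4)[OF src_unit[OF that]] by simp
    then have "lam h (basis_vector (s x)) x = h x" using that by (simp add: lam_entry lam_kernel_def)
    then show ?thesis
      using op_norm_entry_le[OF bounded_ops_diff[OF lam_bounded_ops[OF Cc_H_G[OF h(1)]] Mr_bounded[OF bM]], of "s x" x] h(2) that by simp
  qed
  define V where "V = {x \<in> topspace T. h x \<in> ball 0 (1/4)} \<inter> {x \<in> topspace T. g x \<in> {3/4<..}} \<inter> U"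
  have "openin T V" unfolding V_def
    by (intro openin_Int Uo openin_continuous_map_preimage[OF Cc_continuous[OF Cc_H_G[OF h(1)]]] openin_continuous_map_preimage[OF g(1)]) auto
  moreover have "\<gamma> \<in> V" using \<gamma>a U(2) g(4) Cc_H_vanish[OF h(1) \<gamma>(2)] by (simp add: arr_top V_def)
  ultimately obtain \<alpha> where \<alpha>: "\<alpha> \<in> Iso" "\<alpha> \<in> V" using \<gamma>(1) unfolding in_closure_of by blast
  have "cmod (h \<alpha>) < 1/4" "3/4 < g \<alpha>" "\<alpha> \<in> U" using \<alpha>(2) by (auto simp: V_def)
  moreover have "cmod (h \<alpha> - f \<alpha>) < 1/4" using close[of \<alpha>] val[OF \<alpha>(1)] Iso_D(1)[OF \<alpha>(1)] \<open>\<alpha> \<in> U\<close> by simp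
  moreover have "cmod (f \<alpha>) = \<bar>g \<alpha>\<bar>" by (simp add: f_def)
  moreover have "cmod (f \<alpha>) \<le> cmod (h \<alpha>) + cmod (h \<alpha> - f \<alpha>)"
    using norm_triangle_ineq4[of "h \<alpha>" "h \<alpha> - f \<alpha>"] by simp
  ultimately show False by linarith
qed

end

section \<open>Conditional expectations onto the isotropy algebras\<close>

section \<open>Compression to the diagonal blocks\<close>

lemma restrict_fun_add: "restrict_fun X (\<lambda>i. \<xi> i + \<eta> i) = (\<lambda>i. restrict_fun X \<xi> i + restrict_fun X \<eta> i)"
  and restrict_fun_scale: "restrict_fun X (\<lambda>i. c * \<xi> i) = (\<lambda>i. c * restrict_fun X \<xi> i)"
  by (auto simp: restrict_fun_def)

context iso_etale
begin

text \<open>Defined on all bounded operators. Closedness of \<open>Iso\<close> enters when the image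
  of the reduced algebra is placed in \<open>Mr\<close>.\<close>

definition Psi :: "'g operator \<Rightarrow> 'g operator" where
  "Psi a \<xi> \<eta> = (if \<xi> \<in> ell2 arr \<and> \<eta> \<in> arr then a (restrict_fun (coset \<eta>) \<xi>) \<eta> else 0)"

lemma coset_sym: "\<gamma> \<in> arr \<Longrightarrow> \<eta> \<in> arr \<Longrightarrow> \<gamma> \<in> coset \<eta> \<longleftrightarrow> \<eta> \<in> coset \<gamma>"
  using coset_eq coset_self by metis

lemma Psi_bounded_aux:
  assumes a: "a \<in> bounded_ops arr" and \<xi>: "\<xi> \<in> ell2 arr"
  shows "Psi a \<xi> \<in> ell2 arr" "ell2_norm arr (Psi a \<xi>) \<le> op_norm arr a * ell2_norm arr \<xi>"
proof -
  have cl: "i \<in> coset i \<and> coset i \<subseteq> arr" if "i \<in> arr" for i using coset_self[OF that] coset_sub by blast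
  have z: "Psi a \<xi> i = 0" if "i \<notin> arr" for i using that by (simp add: Psi_def)
  have est: "L2_set (\<lambda>i. cmod (Psi a \<xi> i)) F \<le> op_norm arr a * ell2_norm arr (restrict_fun (coset i) \<xi>)"
    if i: "i \<in> arr" and F: "finite F" "F \<subseteq> coset i" for i F
  proof -
    have "L2_set (\<lambda>i. cmod (Psi a \<xi> i)) F = L2_set (\<lambda>j. cmod (a (restrict_fun (coset i) \<xi>) j)) F"
      unfolding L2_set_def
    proof (intro arg_cong[where f = sqrt] sum.cong refl)
      fix j assume "j \<in> F"
      then have j: "j \<in> coset i" using F by blast
      then show "(cmod (Psi a \<xi> j))\<^sup>2 = (cmod (a (restrict_fun (coset i) \<xi>) j))\<^sup>2"
        using coset_eq[OF i j] coset_sub \<xi> by (auto simp: Psi_def)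
    qed
    also have "\<dots> \<le> ell2_norm arr (a (restrict_fun (coset i) \<xi>))"
      by (rule L2_set_le_ell2_norm[OF bop_ell2'[OF a] F(1)]) (use F(2) coset_sub in blast)
    also have "\<dots> \<le> op_norm arr a * ell2_norm arr (restrict_fun (coset i) \<xi>)"
      by (rule op_norm_bound[OF a restrict_fun_ell2(1)[OF \<xi>]])
    finally show ?thesis .
  qed
  show "Psi a \<xi> \<in> ell2 arr" by (rule block_bound(1)[OF cl coset_eq \<xi> op_norm_nonneg[OF a] z est])
  show "ell2_norm arr (Psi a \<xi>) \<le> op_norm arr a * ell2_norm arr \<xi>"
    by (rule block_bound(2)[OF cl coset_eq \<xi> op_norm_nonneg[OF a] z est])
qed

lemma Psi_bounded: assumes a: "a \<in> bounded_ops arr" shows "Psi a \<in> bounded_ops arr"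
proof (rule bounded_opsI[where C = "op_norm arr a"])
  fix \<xi> \<eta> assume x: "\<xi> \<in> ell2 arr" "\<eta> \<in> ell2 arr"
  then show "Psi a (\<lambda>i. \<xi> i + \<eta> i) = (\<lambda>i. Psi a \<xi> i + Psi a \<eta> i)"
    by (auto simp: Psi_def ell2_add restrict_fun_add restrict_fun_ell2 bop_add[OF a])
next
  fix c \<xi> assume x: "\<xi> \<in> ell2 arr"
  then show "Psi a (\<lambda>i. c * \<xi> i) = (\<lambda>i. c * Psi a \<xi> i)"
    by (auto simp: Psi_def ell2_scale restrict_fun_scale restrict_fun_ell2 bop_scale[OF a])
qed (use Psi_bounded_aux[OF a] in \<open>auto simp: Psi_def\<close>)

lemma op_norm_Psi: assumes a: "a \<in> bounded_ops arr" shows "op_norm arr (Psi a) \<le> op_norm arr a"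
  by (rule op_norm_leI[OF op_norm_nonneg[OF a] Psi_bounded_aux(2)[OF a]])

lemma Psi_add: "Psi (a \<oplus> b) = (Psi a \<oplus> Psi b)"
  and Psi_diff: "Psi (a \<ominus> b) = (Psi a \<ominus> Psi b)"
  and Psi_scale: "Psi (\<lambda>\<xi> i. c * a \<xi> i) = (\<lambda>\<xi> i. c * Psi a \<xi> i)"
  by (auto simp: Psi_def fun_eq_iff)

lemma Psi_entry:
  assumes a: "a \<in> bounded_ops arr" and e: "\<eta> \<in> arr" "\<gamma> \<in> arr"
  shows "Psi a (basis_vector \<gamma>) \<eta> = (if \<eta> \<in> coset \<gamma> then a (basis_vector \<gamma>) \<eta> else 0)"
proof (cases "\<eta> \<in> coset \<gamma>")
  case True
  then have "restrict_fun (coset \<eta>) (basis_vector \<gamma>) = basis_vector \<gamma>"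
    using coset_sym[OF e(2,1)] by (auto simp: restrict_fun_def basis_vector_def)
  then show ?thesis using True e by (simp add: Psi_def basis_vector_ell2)
next
  case False
  then have "restrict_fun (coset \<eta>) (basis_vector \<gamma>) = (\<lambda>_. 0)"
    using coset_sym[OF e(2,1)] by (auto simp: restrict_fun_def basis_vector_def)
  then show ?thesis using False e by (simp add: Psi_def bop_zero[OF a])
qed

text \<open>The entry at \<open>\<eta>\<close> and \<open>\<gamma>\<close> is the value of
  \<open>f\<close> at \<open>\<eta> \<odot> iv \<gamma>\<close>, and for arrows with a common source
  being in the same block means that this arrow lies in \<open>Iso\<close>.\<close>

lemma Psi_lam:
  assumes f: "f \<in> Cc G" and fr: "restrict_fun Iso f \<in> Cc G"
  shows "Psi (lam f) = lam (restrict_fun Iso f)"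
proof (rule bounded_ops_eqI[OF Psi_bounded[OF lam_bounded_ops[OF f]] lam_bounded_ops[OF fr]])
  fix \<eta> \<gamma> assume e: "\<eta> \<in> arr" "\<gamma> \<in> arr"
  have "lam_kernel (restrict_fun Iso f) \<eta> \<gamma> = (if \<eta> \<in> coset \<gamma> then lam_kernel f \<eta> \<gamma> else 0)"
    using e by (simp add: lam_kernel_def restrict_fun_def coset_def)
  then show "Psi (lam f) (basis_vector \<gamma>) \<eta> = lam (restrict_fun Iso f) (basis_vector \<gamma>) \<eta>"
    using Psi_entry[OF lam_bounded_ops[OF f] e] lam_entry[OF e] by simp
qed

text \<open>Block diagonality passes to norm limits because entries are bounded by the operator
  norm.\<close>

lemma Mr_entry:
  assumes b: "b \<in> Mr" and e: "\<eta> \<in> arr" "\<gamma> \<in> arr" "\<eta> \<notin> coset \<gamma>"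
  shows "b (basis_vector \<gamma>) \<eta> = 0"
proof (rule ccontr)
  assume n: "b (basis_vector \<gamma>) \<eta> \<noteq> 0"
  then obtain f where f: "f \<in> Cc IG" "op_norm arr (lam f \<ominus> b) < cmod (b (basis_vector \<gamma>) \<eta>)"
    using Mr_approx[OF b, of "cmod (b (basis_vector \<gamma>) \<eta>)"] by auto
  have "lam_kernel f \<eta> \<gamma> = 0" using e Cc_H_vanish[OF f(1)] by (auto simp: lam_kernel_def coset_def)
  then have "lam f (basis_vector \<gamma>) \<eta> = 0" by (simp add: lam_entry[OF e(1,2)])
  then show False
    using op_norm_entry_le[OF bounded_ops_diff[OF lam_bounded_ops[OF Cc_H_G[OF f(1)]] Mr_bounded[OF b]] e(2), of \<eta>] f(2) by simp
qed

lemma Psi_Mr_eq: assumes b: "b \<in> Mr" shows "Psi b = b"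
  by (rule bounded_ops_eqI[OF Psi_bounded[OF Mr_bounded[OF b]] Mr_bounded[OF b]])
    (simp add: Psi_entry[OF Mr_bounded[OF b]] Mr_entry[OF b])

lemma Mr_local: "b \<in> Mr \<Longrightarrow> \<xi> \<in> ell2 arr \<Longrightarrow> \<eta> \<in> arr \<Longrightarrow> b \<xi> \<eta> = b (restrict_fun (coset \<eta>) \<xi>) \<eta>"
  using Psi_Mr_eq[of b] Psi_def[of b \<xi> \<eta>] by simp

text \<open>A block diagonal \<open>b\<close> reads, at \<open>\<eta>\<close>, only coordinates in
  the block of \<open>\<eta>\<close>, and on this block \<open>Psi a\<close> agrees with
  \<open>a\<close> applied to the restricted vector.\<close>

lemma Psi_mult_left:
  assumes a: "a \<in> bounded_ops arr" and b: "b \<in> Mr"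
  shows "Psi (b \<circ> a) = b \<circ> Psi a"
proof (intro ext)
  fix \<xi> \<eta>
  note bB = Mr_bounded[OF b] and P = Psi_bounded[OF a]
  show "Psi (b \<circ> a) \<xi> \<eta> = (b \<circ> Psi a) \<xi> \<eta>"
  proof (cases "\<xi> \<in> ell2 arr \<and> \<eta> \<in> arr")
    case True
    then have x: "\<xi> \<in> ell2 arr" and e: "\<eta> \<in> arr" by auto
    have eq: "restrict_fun (coset \<eta>) (a (restrict_fun (coset \<eta>) \<xi>)) = restrict_fun (coset \<eta>) (Psi a \<xi>)"
    proof
      fix \<zeta> show "restrict_fun (coset \<eta>) (a (restrict_fun (coset \<eta>) \<xi>)) \<zeta> = restrict_fun (coset \<eta>) (Psi a \<xi>) \<zeta>"
      proof (cases "\<zeta> \<in> coset \<eta>")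
        case z: True
        then have "\<zeta> \<in> arr" "coset \<zeta> = coset \<eta>" using coset_sub coset_eq[OF e z] by auto
        then show ?thesis using z x by (simp add: restrict_fun_def Psi_def)
      qed (simp add: restrict_fun_def)
    qed
    have "Psi (b \<circ> a) \<xi> \<eta> = b (a (restrict_fun (coset \<eta>) \<xi>)) \<eta>" using x e by (simp add: Psi_def)
    also have "\<dots> = b (restrict_fun (coset \<eta>) (Psi a \<xi>)) \<eta>"
      unfolding eq[symmetric] by (rule Mr_local[OF b bop_ell2'[OF a] e])
    also have "\<dots> = b (Psi a \<xi>) \<eta>" by (rule Mr_local[OF b bop_ell2'[OF P] e, symmetric])
    finally show ?thesis by simp
  next
    case False
    then have "\<xi> \<notin> ell2 arr \<or> \<eta> \<notin> arr" by blast
    then show ?thesis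
    proof
      assume n: "\<xi> \<notin> ell2 arr"
      have "Psi a \<xi> = (\<lambda>_. 0)" by (rule bop_off[OF P n])
      then show ?thesis using n by (simp add: bop_zero[OF bB]) (simp add: Psi_def)
    next
      assume n: "\<eta> \<notin> arr"
      then show ?thesis using ell2_vanish[OF bop_ell2'[OF bB] n] by (simp add: Psi_def)
    qed
  qed
qed

lemma Psi_mult_right:
  assumes a: "a \<in> bounded_ops arr" and b: "b \<in> Mr"
  shows "Psi (a \<circ> b) = Psi a \<circ> b"
proof (intro ext)
  fix \<xi> \<eta>
  note bB = Mr_bounded[OF b]
  show "Psi (a \<circ> b) \<xi> \<eta> = (Psi a \<circ> b) \<xi> \<eta>"
  proof (cases "\<xi> \<in> ell2 arr \<and> \<eta> \<in> arr")
    case True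
    then have x: "\<xi> \<in> ell2 arr" and e: "\<eta> \<in> arr" by auto
    have "b (restrict_fun (coset \<eta>) \<xi>) = restrict_fun (coset \<eta>) (b \<xi>)"
    proof
      fix \<zeta> show "b (restrict_fun (coset \<eta>) \<xi>) \<zeta> = restrict_fun (coset \<eta>) (b \<xi>) \<zeta>"
      proof (cases "\<zeta> \<in> arr")
        case za: True
        show ?thesis
        proof (cases "\<zeta> \<in> coset \<eta>")
          case z: True
          then show ?thesis using coset_eq[OF e z] Mr_local[OF b x za] by (simp add: restrict_fun_def)
        next
          case z: False
          have "restrict_fun (coset \<zeta>) (restrict_fun (coset \<eta>) \<xi>) = (\<lambda>_. 0)"
          proof
            fix k
            have "\<not> (k \<in> coset \<zeta> \<and> k \<in> coset \<eta>)" using z coset_eq[OF za, of k] coset_eq[OF e, of k] coset_self[OF za] by blast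
            then show "restrict_fun (coset \<zeta>) (restrict_fun (coset \<eta>) \<xi>) k = 0" by (auto simp: restrict_fun_def)
          qed
          then show ?thesis using z Mr_local[OF b restrict_fun_ell2(1)[OF x] za, of "coset \<eta>"] by (simp add: bop_zero[OF bB] restrict_fun_def)
        qed
      next
        case False
        then show ?thesis using ell2_vanish[OF bop_ell2'[OF bB]] by (simp add: restrict_fun_def)
      qed
    qed
    then show ?thesis using x e bop_ell2'[OF bB] by (simp add: Psi_def)
  next
    case False
    then show ?thesis using bop_ell2'[OF bB] bop_off[OF bB] bop_zero[OF Psi_bounded[OF a]] by (cases "\<eta> \<in> arr") (auto simp: Psi_def)
  qed
qed

lemma Psi_op_conv:
  assumes t: "\<And>n. t n \<in> bounded_ops arr" and a: "a \<in> bounded_ops arr" "op_conv arr t a"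
  shows "op_conv arr (\<lambda>n. Psi (t n)) (Psi a)"
  unfolding op_conv_def Psi_diff[symmetric]
  by (rule Lim_null_comparison[OF always_eventually a(2)[unfolded op_conv_def]])
    (use op_norm_Psi[OF bounded_ops_diff[OF t a(1)]] op_norm_nonneg[OF Psi_bounded[OF bounded_ops_diff[OF t a(1)]]] in simp)

lemma Psi_in_Mr:
  assumes cl: "closedin T Iso" and d: "\<And>n. d n \<in> Cc G" and a: "a \<in> bounded_ops arr" "op_conv arr (\<lambda>n. lam (d n)) a"
  shows "Psi a \<in> Mr"
proof (rule Mr_closed[OF _ Psi_bounded[OF a(1)] Psi_op_conv[OF lam_bounded_ops[OF d] a]])
  show "Psi (lam (d n)) \<in> Mr" for n
    using Psi_lam[OF d Cc_restrict[OF d Iso_open cl]] lam_Mr[OF Cc_restrict_H[OF d cl]] by simp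
qed

lemma Psi_adjoint:
  assumes a: "a \<in> bounded_ops arr" shows "op_adjoint arr (Psi a) = Psi (op_adjoint arr a)"
proof (rule bounded_ops_eqI[OF op_adjoint_bounded[OF Psi_bounded[OF a]] Psi_bounded[OF op_adjoint_bounded[OF a]]])
  fix \<eta> \<gamma> assume e: "\<eta> \<in> arr" "\<gamma> \<in> arr"
  show "op_adjoint arr (Psi a) (basis_vector \<gamma>) \<eta> = Psi (op_adjoint arr a) (basis_vector \<gamma>) \<eta>"
    unfolding op_adjoint_entry[OF Psi_bounded[OF a] e] Psi_entry[OF a e(2,1)] Psi_entry[OF op_adjoint_bounded[OF a] e]
      op_adjoint_entry[OF a e]
    using coset_sym[OF e] by simp
qed

lemma adjoint_square: "a \<in> bounded_ops S \<Longrightarrow> op_adjoint S (op_adjoint S a \<circ> a) = op_adjoint S a \<circ> a"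
  by (rule op_adjoint_eqI[OF bounded_ops_compose[OF op_adjoint_bounded]])
    (simp_all add: op_adjoint_inner' bop_ell2 op_adjoint_inner)

text \<open>The inner product splits over the cosets, and a coset \<open>X\<close> contributes the
  squared norm of \<open>a\<close> applied to the restriction of \<open>\<xi>\<close> to
  \<open>X\<close>.\<close>

lemma Psi_positive:
  assumes a: "a \<in> bounded_ops arr" and \<xi>: "\<xi> \<in> ell2 arr"
  shows "0 \<le> Re (ell2_inner arr (Psi (op_adjoint arr a \<circ> a) \<xi>) \<xi>)"
proof -
  let ?c = "op_adjoint arr a \<circ> a"
  note cB = bounded_ops_compose[OF op_adjoint_bounded[OF a] a]
  define h where "h \<eta> = Psi ?c \<xi> \<eta> * cnj (\<xi> \<eta>)" for \<eta>
  let ?X = "coset ` arr"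
  have hs: "h summable_on arr" unfolding h_def by (rule ell2_inner_summable[OF bop_ell2'[OF Psi_bounded[OF cB]] \<xi>])
  \<comment> \<open>Regroups the arrows by cosets, so that the sum can be carried out block by
    block.\<close>
  have bij: "bij_betw snd (SIGMA X:?X. X) arr"
  proof (rule bij_betwI[where g = "\<lambda>\<eta>. (coset \<eta>, \<eta>)"])
    show "snd \<in> (SIGMA X:?X. X) \<rightarrow> arr" using coset_sub by fastforce
    show "(\<lambda>\<eta>. (coset \<eta>, \<eta>)) \<in> arr \<rightarrow> (SIGMA X:?X. X)" using coset_self by auto
    show "(coset (snd p), snd p) = p" if "p \<in> (SIGMA X:?X. X)" for p
      using that coset_eq by (cases p) auto
  qed simp
  have "(\<lambda>p. h (snd p)) summable_on (SIGMA X:?X. X)" using hs summable_on_reindex_bij_betw[OF bij, of h] by simp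
  then have ss: "(\<lambda>(X, \<eta>). h \<eta>) summable_on (SIGMA X:?X. X)" by (simp add: case_prod_beta')
  have blk: "infsum h X = of_real ((ell2_norm arr (a (restrict_fun X \<xi>)))\<^sup>2)" if X: "X \<in> ?X" for X
  proof -
    obtain \<gamma> where \<gamma>: "\<gamma> \<in> arr" "X = coset \<gamma>" using X by blast
    let ?x = "restrict_fun X \<xi>"
    note x = restrict_fun_ell2(1)[OF \<xi>, of X]
    have "infsum h X = infsum (\<lambda>\<eta>. ?c ?x \<eta> * cnj (?x \<eta>)) arr"
    proof (rule infsum_cong_neutral)
      fix \<eta> assume "\<eta> \<in> X \<inter> arr"
      then show "h \<eta> = ?c ?x \<eta> * cnj (?x \<eta>)"
        using coset_eq[OF \<gamma>(1), of \<eta>] \<gamma>(2) \<xi> by (simp add: h_def Psi_def restrict_fun_def)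
    qed (use \<gamma> coset_sub in \<open>auto simp: restrict_fun_def\<close>)
    also have "\<dots> = ell2_inner arr (?c ?x) ?x" by (simp only: ell2_inner_def)
    also have "\<dots> = of_real ((ell2_norm arr (a ?x))\<^sup>2)" using ell2_norm_sq_op[OF a x] by simp
    finally show ?thesis .
  qed
  have "ell2_inner arr (Psi ?c \<xi>) \<xi> = infsum h arr" unfolding ell2_inner_def by (rule infsum_cong) (simp add: h_def)
  also have "\<dots> = infsum (\<lambda>p. h (snd p)) (SIGMA X:?X. X)" using infsum_reindex_bij_betw[OF bij, of h] by simp
  also have "\<dots> = infsum (\<lambda>(X, \<eta>). h \<eta>) (SIGMA X:?X. X)" by (simp add: case_prod_beta')
  also have "\<dots> = (\<Sum>\<^sub>\<infinity>X\<in>?X. infsum h X)" by (rule infsum_Sigma'_banach[OF ss, symmetric])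
  finally have eq: "ell2_inner arr (Psi ?c \<xi>) \<xi> = (\<Sum>\<^sub>\<infinity>X\<in>?X. infsum h X)" .
  \<comment> \<open>Were the block sums not summable, \<open>infsum\<close> would take the value 0,
    which also satisfies the inequality.\<close>
  have "0 \<le> Re (\<Sum>\<^sub>\<infinity>X\<in>?X. infsum h X)"
  proof (cases "(\<lambda>X. infsum h X) summable_on ?X")
    case True
    have "Re (\<Sum>\<^sub>\<infinity>X\<in>?X. infsum h X) = (\<Sum>\<^sub>\<infinity>X\<in>?X. Re (infsum h X))" by (rule infsum_Re[OF True, symmetric])
    also have "\<dots> \<ge> 0" by (rule infsum_nonneg) (simp only: blk Re_complex_of_real zero_le_power2)
    finally show ?thesis .
  qed (simp add: infsum_not_exists)
  then show ?thesis by (simp only: eq)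
qed

text \<open>The root is a norm limit of polynomials in \<open>b\<close> without constant term. These
  stay in \<open>Mr\<close>, which is closed under products and limits but need not contain the
  identity.\<close>

lemma Mr_sqrt:
  assumes b: "b \<in> Mr" "op_adjoint arr b = b" "\<And>\<xi>. \<xi> \<in> ell2 arr \<Longrightarrow> 0 \<le> Re (ell2_inner arr (b \<xi>) \<xi>)"
  shows "\<exists>c \<in> Mr. op_adjoint arr c = c \<and> c \<circ> c = b"
proof -
  note bB = Mr_bounded[OF b(1)]
  interpret B: positive_op arr b "op_norm arr b + 1"
  proof
    show "b \<in> bounded_ops arr" by (rule bB)
    show "0 < op_norm arr b + 1" using op_norm_nonneg[OF bB] by linarith
    fix \<xi> assume \<xi>: "\<xi> \<in> ell2 arr"
    show "0 \<le> Re (ell2_inner arr (b \<xi>) \<xi>)" by (rule b(3)[OF \<xi>])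
    have "Re (ell2_inner arr (b \<xi>) \<xi>) \<le> ell2_norm arr (b \<xi>) * ell2_norm arr \<xi>"
      using complex_Re_le_cmod ell2_Cauchy_Schwarz[OF bop_ell2[OF bB \<xi>] \<xi>] order_trans by blast
    also have "\<dots> \<le> (op_norm arr b * ell2_norm arr \<xi>) * ell2_norm arr \<xi>"
      by (rule mult_right_mono[OF op_norm_bound[OF bB \<xi>]]) simp
    also have "\<dots> \<le> (op_norm arr b + 1) * (ell2_norm arr \<xi>)\<^sup>2" by (simp add: power2_eq_square algebra_simps)
    finally show "Re (ell2_inner arr (b \<xi>) \<xi>) \<le> (op_norm arr b + 1) * (ell2_norm arr \<xi>)\<^sup>2" .
    fix \<eta> assume \<eta>: "\<eta> \<in> ell2 arr"
    show "ell2_inner arr (b \<xi>) \<eta> = ell2_inner arr \<xi> (b \<eta>)" using op_adjoint_inner[OF bB \<xi> \<eta>] b(2) by simp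
  qed
  \<comment> \<open>The leading coefficient 0 stands for one additional factor \<open>b\<close>, so
    no multiple of the identity ever occurs in the induction.\<close>
  have pM: "B.bop_poly (pCons 0 q) \<in> Mr" for q
  proof (induction q)
    case 0
    have "B.bop_poly 0 = (\<lambda>\<xi> i. 0 * b \<xi> i)" by (auto simp: B.bop_poly_def fun_eq_iff)
    then show ?case using Mr_scale[OF b(1), of 0] by simp
  next
    case (pCons a q)
    have "B.bop_poly (pCons 0 (pCons a q)) = (\<lambda>\<xi> i. of_real a * b \<xi> i + (b \<circ> B.bop_poly (pCons 0 q)) \<xi> i)"
      by (auto simp: B.bop_poly_def fun_eq_iff bop_add[OF bB] bop_scale[OF bB] ell2_scale B.poly_op_ell2 bop_ell2[OF bB] bop_off[OF bB] bop_zero[OF bB])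
    then show ?case using Mr_add[OF Mr_scale[OF b(1)] Mr_compose[OF b(1) pCons.IH]] by simp
  qed
  obtain c p where c: "c \<in> bounded_ops arr" "op_adjoint arr c = c" "c \<circ> c = b"
    and p: "\<And>n. coeff (p n) 0 = 0" "op_conv arr (\<lambda>n. B.bop_poly (p n)) c"
    using B.sqrt_exists by blast
  have "B.bop_poly (p n) \<in> Mr" for n
  proof -
    have "p n = pCons 0 (poly_shift 1 (p n))" using p(1)[of n]
      by (intro poly_eqI) (auto simp: coeff_pCons coeff_poly_shift split: nat.split)
    then show ?thesis using pM by metis
  qed
  then have "c \<in> Mr" by (rule Mr_closed[OF _ c(1) p(2)])
  with c show ?thesis by blast
qed

text \<open>Supplies the witness for the positivity clause of
  \<open>conditional_expectation\<close>; the full algebra draws on it as well.\<close>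

lemma Psi_square:
  assumes cl: "closedin T Iso" and d: "\<And>n. d n \<in> Cc G" and a: "a \<in> bounded_ops arr" "op_conv arr (\<lambda>n. lam (d n)) a"
  shows "\<exists>c \<in> Mr. op_adjoint arr c = c \<and> c \<circ> c = Psi (op_adjoint arr a \<circ> a)"
proof (rule Mr_sqrt)
  note L = lam_bounded_ops[OF d] and cB = bounded_ops_compose[OF op_adjoint_bounded[OF a(1)] a(1)]
  have "op_conv arr (\<lambda>n. lam (involution G (d n) \<star> d n)) (op_adjoint arr a \<circ> a)"
    unfolding lam_convolution[OF Cc_involution[OF d] d] lam_involution[OF d]
    by (intro op_conv_compose op_conv_adjoint op_adjoint_bounded L a)
  then show "Psi (op_adjoint arr a \<circ> a) \<in> Mr"
    by (intro Psi_in_Mr[OF cl _ cB]) (auto intro: Cc_convolution Cc_involution d)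
  show "op_adjoint arr (Psi (op_adjoint arr a \<circ> a)) = Psi (op_adjoint arr a \<circ> a)"
    unfolding Psi_adjoint[OF cB] adjoint_square[OF a(1)] ..
  show "0 \<le> Re (ell2_inner arr (Psi (op_adjoint arr a \<circ> a) \<xi>) \<xi>)" if "\<xi> \<in> ell2 arr" for \<xi>
    by (rule Psi_positive[OF a(1) that])
qed

lemma Psi_expectation:
  assumes cl: "closedin T Iso"
  shows "conditional_expectation (reduced_algebra G) Mr Psi"
proof -
  have approx: "\<exists>d. (\<forall>n. d n \<in> Cc G) \<and> op_conv arr (\<lambda>n. lam (d n)) a" if "a \<in> carr (reduced_algebra G)" for a
    using that CS_Cc by (auto simp: reduced_carr)
  show ?thesis
    unfolding conditional_expectation_def reduced_simps
  proof (intro conjI ballI allI)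
    fix a assume a: "a \<in> carr (reduced_algebra G)"
    note aB = reduced_bounded[OF a]
    obtain d where d: "\<And>n. d n \<in> Cc G" "op_conv arr (\<lambda>n. lam (d n)) a" using approx[OF a] by blast
    show "Psi a \<in> Mr" by (rule Psi_in_Mr[OF cl d(1) aB d(2)])
    show "op_norm arr (Psi a) \<le> op_norm arr a" by (rule op_norm_Psi[OF aB])
    show "\<exists>c\<in>carr (reduced_algebra G). Psi (op_adjoint arr a \<circ> a) = op_adjoint arr c \<circ> c"
      using Psi_square[OF cl d(1) aB d(2)] Mr_reduced by metis
    show "Psi (\<lambda>\<xi> i. c * a \<xi> i) = (\<lambda>\<xi> i. c * Psi a \<xi> i)" for c by (rule Psi_scale)
    show "Psi (a \<oplus> a') = (Psi a \<oplus> Psi a')" for a' by (rule Psi_add)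
    show "Psi (b \<circ> a) = b \<circ> Psi a" if "b \<in> Mr" for b by (rule Psi_mult_left[OF aB that])
    show "Psi (a \<circ> b) = Psi a \<circ> b" if "b \<in> Mr" for b by (rule Psi_mult_right[OF aB that])
  qed (rule Psi_Mr_eq)
qed

text \<open>The diagonal entries of \<open>a* a\<close> are the squared norms of the columns of
  \<open>a\<close>, and the diagonal lies inside the blocks kept by \<open>Psi\<close>.\<close>

lemma Psi_faithful: "faithful_map (reduced_algebra G) Psi"
  unfolding faithful_map_def reduced_simps
proof (intro ballI impI)
  fix a assume a: "a \<in> carr (reduced_algebra G)" and z: "Psi (op_adjoint arr a \<circ> a) = (\<lambda>_ _. 0)"
  note aB = reduced_bounded[OF a]
  show "a = (\<lambda>_ _. 0)"
  proof (rule bounded_ops_eqI[OF aB bounded_ops_zero])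
    fix \<eta> \<gamma> assume e: "\<eta> \<in> arr" "\<gamma> \<in> arr"
    note bv = basis_vector_ell2[OF e(2)]
    have "Psi (op_adjoint arr a \<circ> a) (basis_vector \<gamma>) \<gamma> = (op_adjoint arr a \<circ> a) (basis_vector \<gamma>) \<gamma>"
      using Psi_entry[OF bounded_ops_compose[OF op_adjoint_bounded[OF aB] aB] e(2,2)] coset_self[OF e(2)] by simp
    then have "op_adjoint arr a (a (basis_vector \<gamma>)) \<gamma> = 0" using z by simp
    then have "complex_of_real ((ell2_norm arr (a (basis_vector \<gamma>)))\<^sup>2) = 0"
      unfolding ell2_norm_sq_op[OF aB bv, symmetric] ell2_inner_basis_right[OF e(2)] .
    then have "ell2_norm arr (a (basis_vector \<gamma>)) = 0" by simp
    then show "a (basis_vector \<gamma>) \<eta> = 0" using ell2_norm_eq_0[OF bop_ell2'[OF aB]] by metis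
  qed
qed

lemma Psi_lam_inclusion:
  assumes cl: "closedin T Iso" and f: "f \<in> Cc G"
  shows "Psi (lam f) = iso_inclusion_red G (H.lam (restrict_fun Iso f))"
  using Psi_lam[OF f Cc_restrict[OF f Iso_open cl]] iso_inclusion_red_lam[OF Cc_restrict_H[OF f cl]] by simp

section \<open>The expectation on the full algebra\<close>

context
  assumes cl: "closedin T Iso" and amen: "\<And>f. f \<in> Cc IG \<Longrightarrow> H.FN f \<le> op_norm Iso (H.lam f)"
begin

abbreviation "res \<equiv> restrict_fun Iso"

lemma res_H: "f \<in> Cc G \<Longrightarrow> res f \<in> Cc IG"
  using Cc_restrict_H cl by blast

text \<open>The full norms are compared through the reduced ones: \<open>amen\<close> bounds the
  full norm on the isotropy by the reduced norm, compression does not enlarge the latter, and on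
  \<open>G\<close> the full norm dominates it.\<close>

lemma full_norm_res: assumes f: "f \<in> Cc G" shows "H.FN (res f) \<le> FN f"
  using amen[OF res_H[OF f]] op_norm_H_restrict_le[OF f] lam_le_full_norm[OF f] by linarith

lemma full_norm_lam_H: assumes f: "f \<in> Cc IG" shows "FN f \<le> op_norm arr (lam f)"
  using full_norm_H[OF f] amen[OF f] op_norm_lam_H[OF f] by linarith

lemma res_diff: "res (f \<^bold>- g) = (res f \<^bold>- res g)"
  by (auto simp: restrict_fun_def)

lemma CS_res: assumes x: "x \<in> C.CS" shows "(\<lambda>n. res (x n)) \<in> H.C.CS"
proof (rule H.C.CS_I)
  show "res (x n) \<in> carr H.FA" for n using res_H[OF CS_Cc[OF x]] by simp
  fix e :: real assume "0 < e"
  then obtain N where N: "\<forall>m \<ge> N. \<forall>n \<ge> N. adist FA (x m) (x n) < e" using C.CS_D[OF x] by blast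
  have "adist H.FA (res (x m)) (res (x n)) < e" if "m \<ge> N" "n \<ge> N" for m n
    using full_norm_res[OF Cc_diff[OF CS_Cc[OF x] CS_Cc[OF x]], of m n] N[rule_format, OF that]
    by (simp add: adist_FA H.adist_FA res_diff)
  then show "\<exists>N. \<forall>m \<ge> N. \<forall>n \<ge> N. adist H.FA (res (x m)) (res (x n)) < e" by blast
qed

text \<open>Restriction is applied to a chosen representative; independence of the choice is
  \<open>full_Psi_cls\<close>.\<close>

definition full_Psi :: "'g full_element \<Rightarrow> 'g full_element" where
  "full_Psi X = C.cls (\<lambda>n. res ((SOME x. x \<in> C.CS \<and> X = C.cls x) n))"

lemma full_Psi_cls: assumes x: "x \<in> C.CS" shows "full_Psi (C.cls x) = C.cls (\<lambda>n. res (x n))"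
proof -
  define y where "y = (SOME y. y \<in> C.CS \<and> C.cls x = C.cls y)"
  have y: "y \<in> C.CS" "C.cls x = C.cls y" using someI_ex[of "\<lambda>y. y \<in> C.CS \<and> C.cls x = C.cls y"] x by (auto simp: y_def)
  have l: "(\<lambda>n. adist FA (x n) (y n)) \<longlonglongrightarrow> 0" using C.cls_eq_iff[OF x y(1)] y(2) by simp
  have "H.C.cls (\<lambda>n. res (x n)) = H.C.cls (\<lambda>n. res (y n))"
  proof (rule H.C.cls_eqI[OF CS_res[OF x] CS_res[OF y(1)]])
    show "(\<lambda>n. adist H.FA (res (x n)) (res (y n))) \<longlonglongrightarrow> 0"
    proof (rule Lim_null_comparison[OF always_eventually l], rule allI)
      fix n
      note c = CS_Cc[OF x, of n] CS_Cc[OF y(1), of n]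
      show "norm (adist H.FA (res (x n)) (res (y n))) \<le> adist FA (x n) (y n)"
        using full_norm_res[OF Cc_diff[OF c]] H.full_norm_nonneg[OF res_H[OF Cc_diff[OF c]]]
        by (simp add: adist_FA H.adist_FA res_diff)
    qed
  qed
  then have "C.cls (\<lambda>n. res (x n)) = C.cls (\<lambda>n. res (y n))" by (rule cls_H_G[OF CS_res[OF x] CS_res[OF y(1)]])
  then show ?thesis by (simp add: full_Psi_def y_def)
qed

lemma full_simps:
  assumes x: "x \<in> C.CS" and y: "y \<in> C.CS"
  shows "aadd (full_algebra G) (C.cls x) (C.cls y) = C.cls (\<lambda>n \<gamma>. x n \<gamma> + y n \<gamma>)"
    "ascale (full_algebra G) c (C.cls x) = C.cls (\<lambda>n \<gamma>. c * x n \<gamma>)"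
    "amult (full_algebra G) (C.cls x) (C.cls y) = C.cls (\<lambda>n. convolution G (x n) (y n))"
    "astar (full_algebra G) (C.cls x) = C.cls (\<lambda>n. involution G (x n))"
  using C.completion_add[OF x y] C.completion_scale[OF x] C.completion_mult[OF x y] C.completion_star[OF x]
  by (simp_all add: full_algebra_def)

lemma full_CS:
  assumes x: "x \<in> C.CS" and y: "y \<in> C.CS"
  shows "(\<lambda>n \<gamma>. x n \<gamma> + y n \<gamma>) \<in> C.CS" "(\<lambda>n \<gamma>. c * x n \<gamma>) \<in> C.CS" "(\<lambda>n. convolution G (x n) (y n)) \<in> C.CS"
    "(\<lambda>n. involution G (x n)) \<in> C.CS"
  using C.CS_add[OF x y] C.CS_scale[OF x] C.CS_mult[OF x y] C.CS_star[OF x] by simp_all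

text \<open>A product with an arrow of \<open>Iso\<close> lies in \<open>Iso\<close> exactly when
  the other factor does, so it makes no difference whether one cuts off before or after the
  convolution.\<close>

lemma res_convolution:
  assumes b: "b \<in> Cc IG" and f: "f \<in> Cc G"
  shows "res (b \<star> f) = b \<star> res f" "res (f \<star> b) = res f \<star> b"
proof -
  note bG = Cc_H_G[OF b]
  show "res (b \<star> f) = b \<star> res f"
  proof
    fix \<gamma> show "res (b \<star> f) \<gamma> = (b \<star> res f) \<gamma>"
    proof (cases "\<gamma> \<in> arr")
      case True
      have "b \<alpha> * res f (iv \<alpha> \<odot> \<gamma>) = (if \<gamma> \<in> Iso then b \<alpha> * f (iv \<alpha> \<odot> \<gamma>) else 0)" if "\<alpha> \<in> rng_fibre G (r \<gamma>)" for \<alpha>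
      proof (cases "\<alpha> \<in> Iso")
        case a: True
        then have "iv \<alpha> \<odot> \<gamma> \<in> Iso \<longleftrightarrow> \<gamma> \<in> Iso"
          using that True Iso_mult_right[OF Iso_iv[OF a] True] by (auto simp: rng_fibre_def)
        then show ?thesis by (simp add: restrict_fun_def)
      qed (simp add: Cc_H_vanish[OF b])
      then have "(\<Sum>\<alpha> | \<alpha> \<in> rng_fibre G (r \<gamma>) \<and> b \<alpha> \<noteq> 0. b \<alpha> * res f (iv \<alpha> \<odot> \<gamma>)) =
          (\<Sum>\<alpha> | \<alpha> \<in> rng_fibre G (r \<gamma>) \<and> b \<alpha> \<noteq> 0. if \<gamma> \<in> Iso then b \<alpha> * f (iv \<alpha> \<odot> \<gamma>) else 0)"
        by (intro sum.cong) auto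
      then show ?thesis unfolding convolution_Cc_rng[OF bG True]
        by (cases "\<gamma> \<in> Iso") (simp_all add: restrict_fun_def convolution_Cc_rng[OF bG True])
    qed (simp add: convolution_off restrict_fun_def)
  qed
  show "res (f \<star> b) = res f \<star> b"
  proof
    fix \<gamma> show "res (f \<star> b) \<gamma> = (res f \<star> b) \<gamma>"
    proof (cases "\<gamma> \<in> arr")
      case True
      have "res f (\<gamma> \<odot> iv \<beta>) * b \<beta> = (if \<gamma> \<in> Iso then f (\<gamma> \<odot> iv \<beta>) * b \<beta> else 0)" if "\<beta> \<in> src_fibre G (s \<gamma>)" for \<beta>
      proof (cases "\<beta> \<in> Iso")
        case a: True
        then have "\<gamma> \<odot> iv \<beta> \<in> Iso \<longleftrightarrow> \<gamma> \<in> Iso"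
          using that True Iso_mult_left[OF True Iso_iv[OF a]] by (auto simp: src_fibre_def)
        then show ?thesis by (simp add: restrict_fun_def)
      qed (simp add: Cc_H_vanish[OF b])
      then have "(\<Sum>\<beta> | \<beta> \<in> src_fibre G (s \<gamma>) \<and> b \<beta> \<noteq> 0. res f (\<gamma> \<odot> iv \<beta>) * b \<beta>) =
          (\<Sum>\<beta> | \<beta> \<in> src_fibre G (s \<gamma>) \<and> b \<beta> \<noteq> 0. if \<gamma> \<in> Iso then f (\<gamma> \<odot> iv \<beta>) * b \<beta> else 0)"
        by (intro sum.cong) auto
      then show ?thesis unfolding convolution_Cc[OF bG True]
        by (cases "\<gamma> \<in> Iso") (simp_all add: restrict_fun_def convolution_Cc[OF bG True])
    qed (simp add: convolution_off restrict_fun_def)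
  qed
qed

text \<open>On the isotropy all norms agree, so the square root can be taken in the reduced algebra.\<close>

lemma full_Psi_square:
  assumes x: "x \<in> C.CS"
  shows "\<exists>c \<in> C.CS. C.cls (\<lambda>n. res (involution G (x n) \<star> x n)) = C.cls (\<lambda>n. convolution G (involution G (c n)) (c n))"
proof -
  obtain a where a: "a \<in> bounded_ops arr" "op_conv arr (\<lambda>n. lam (x n)) a" using lam_limit_exists[OF x] by blast
  note xc = CS_Cc[OF x] and cB = bounded_ops_compose[OF op_adjoint_bounded[OF a(1)] a(1)]
  obtain b where b: "b \<in> Mr" "op_adjoint arr b = b" "b \<circ> b = Psi (op_adjoint arr a \<circ> a)"
    using Psi_square[OF cl xc a] by blast
  obtain c where c: "c \<in> H.C.CS" "op_conv arr (\<lambda>n. lam (c n)) b" using b(1) by (auto simp: iso_subalgebra_red_eq)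
  note cc = H.CS_Cc[OF c(1)] and cG = Cc_H_G[OF H.CS_Cc[OF c(1)]] and bB = Mr_bounded[OF b(1)]
  let ?y = "\<lambda>n. res (involution G (x n) \<star> x n)" and ?w = "\<lambda>n. convolution G (involution G (c n)) (c n)"
  note xx = Cc_convolution[OF Cc_involution[OF xc] xc]
  have yH: "?y n \<in> Cc IG" for n by (rule res_H[OF xx])
  have wH: "?w n \<in> Cc IG" for n
    using H.Cc_convolution[OF H.Cc_involution[OF cc] cc, of n n] convolution_H[OF H.Cc_involution[OF cc] cc, of n n]
    by (simp add: involution_H[OF cc])
  have 1: "op_conv arr (\<lambda>n. lam (?y n)) (b \<circ> b)"
  proof -
    have "op_conv arr (\<lambda>n. lam (involution G (x n) \<star> x n)) (op_adjoint arr a \<circ> a)"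
      unfolding lam_convolution[OF Cc_involution[OF xc] xc] lam_involution[OF xc]
      by (intro op_conv_compose op_conv_adjoint op_adjoint_bounded lam_bounded_ops xc a)
    from Psi_op_conv[OF lam_bounded_ops[OF xx] cB this] show ?thesis
      unfolding Psi_lam[OF xx Cc_H_G[OF yH]] b(3) .
  qed
  have 2: "op_conv arr (\<lambda>n. lam (?w n)) (b \<circ> b)"
  proof -
    have "op_conv arr (\<lambda>n. op_adjoint arr (lam (c n)) \<circ> lam (c n)) (op_adjoint arr b \<circ> b)"
      by (intro op_conv_compose op_conv_adjoint op_adjoint_bounded lam_bounded_ops cG c bB)
    then show ?thesis unfolding lam_convolution[OF Cc_involution[OF cG] cG] lam_involution[OF cG] b(2) .
  qed
  \<comment> \<open>Both sequences consist of functions on \<open>Iso\<close> whose operators tend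
    to the same limit. For such functions the reduced norm bounds the full norm, so the difference
    is a null sequence in the full norm.\<close>
  have "C.cls ?y = C.cls ?w"
  proof (rule C.cls_eqI)
    show "?y \<in> C.CS" by (rule CS_H_G[OF CS_res[OF full_CS(3)[OF full_CS(4)[OF x x] x]]])
    show "?w \<in> C.CS" by (rule full_CS(3)[OF full_CS(4)[OF CS_H_G[OF c(1)] x] CS_H_G[OF c(1)]])
    have l: "(\<lambda>n. op_norm arr (lam (?y n) \<ominus> (b \<circ> b)) + op_norm arr (lam (?w n) \<ominus> (b \<circ> b))) \<longlonglongrightarrow> 0"
      using tendsto_add[OF 1[unfolded op_conv_def] 2[unfolded op_conv_def]] by simp
    show "(\<lambda>n. adist FA (?y n) (?w n)) \<longlonglongrightarrow> 0"
    proof (rule Lim_null_comparison[OF always_eventually l], rule allI)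
      fix n
      note L = lam_bounded_ops[OF Cc_H_G[OF yH], of n] lam_bounded_ops[OF Cc_H_G[OF wH], of n] bounded_ops_compose[OF bB bB]
      have "adist FA (?y n) (?w n) \<le> op_norm arr (lam (?y n) \<ominus> lam (?w n))"
        unfolding adist_FA lam_diff[OF Cc_H_G[OF yH] Cc_H_G[OF wH], symmetric] by (rule full_norm_lam_H[OF H.Cc_diff[OF yH wH]])
      also have "\<dots> \<le> op_norm arr (lam (?y n) \<ominus> (b \<circ> b)) + op_norm arr (lam (?w n) \<ominus> (b \<circ> b))"
        using op_norm_diff_triangle[OF L(1,3,2)] unfolding op_norm_minus_commute[OF L(3,2)] .
      finally show "norm (adist FA (?y n) (?w n)) \<le> \<dots>"
        using full_norm_nonneg[OF Cc_diff[OF Cc_H_G[OF yH] Cc_H_G[OF wH]], of n n] by (simp add: adist_FA)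
    qed
  qed
  then show ?thesis using CS_H_G[OF c(1)] by blast
qed

lemma res_simps: "res (f \<^bold>+ g) = (res f \<^bold>+ res g)" "res (\<lambda>\<gamma>. c * f \<gamma>) = (\<lambda>\<gamma>. c * res f \<gamma>)"
  by (auto simp: restrict_fun_def)

lemma full_Psi_expectation: "conditional_expectation (full_algebra G) (iso_subalgebra G) full_Psi"
  unfolding conditional_expectation_def full_algebra_carr iso_subalgebra_eq ball_simps(9) bex_simps(7)
proof (intro conjI ballI allI)
  fix x assume x: "x \<in> C.CS"
  note xr = CS_res[OF x] and xrG = CS_H_G[OF CS_res[OF x]]
  show "full_Psi (C.cls x) \<in> C.cls ` H.C.CS" unfolding full_Psi_cls[OF x] using xr by blast
  show "anorm (full_algebra G) (full_Psi (C.cls x)) \<le> anorm (full_algebra G) (C.cls x)"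
  proof (rule LIMSEQ_le)
    show "(\<lambda>n. FN (res (x n))) \<longlonglongrightarrow> anorm (full_algebra G) (full_Psi (C.cls x))"
      using C.completion_norm[OF xrG] by (simp add: full_algebra_def full_Psi_cls[OF x])
    show "(\<lambda>n. FN (x n)) \<longlonglongrightarrow> anorm (full_algebra G) (C.cls x)"
      using C.completion_norm[OF x] by (simp add: full_algebra_def)
    show "\<exists>N. \<forall>n\<ge>N. FN (res (x n)) \<le> FN (x n)"
      using order_trans[OF full_norm_H[OF res_H[OF CS_Cc[OF x]]] full_norm_res[OF CS_Cc[OF x]]] by blast
  qed
  show "full_Psi (ascale (full_algebra G) c (C.cls x)) = ascale (full_algebra G) c (full_Psi (C.cls x))" for c
    unfolding full_simps(2)[OF x x] full_Psi_cls[OF full_CS(2)[OF x x]] full_Psi_cls[OF x] full_simps(2)[OF xrG xrG] res_simps ..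
  show "full_Psi (aadd (full_algebra G) (C.cls x) (C.cls y)) = aadd (full_algebra G) (full_Psi (C.cls x)) (full_Psi (C.cls y))"
    if y: "y \<in> C.CS" for y
    unfolding full_simps(1)[OF x y] full_Psi_cls[OF full_CS(1)[OF x y]] full_Psi_cls[OF x] full_Psi_cls[OF y]
      full_simps(1)[OF xrG CS_H_G[OF CS_res[OF y]]] res_simps ..
  obtain c where c: "c \<in> C.CS"
    "C.cls (\<lambda>n. res (involution G (x n) \<star> x n)) = C.cls (\<lambda>n. convolution G (involution G (c n)) (c n))"
    using full_Psi_square[OF x] by blast
  have "full_Psi (amult (full_algebra G) (astar (full_algebra G) (C.cls x)) (C.cls x)) =
     amult (full_algebra G) (astar (full_algebra G) (C.cls c)) (C.cls c)"
    unfolding full_simps(4)[OF x x] full_simps(3)[OF full_CS(4)[OF x x] x] full_Psi_cls[OF full_CS(3)[OF full_CS(4)[OF x x] x]]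
      full_simps(4)[OF c(1) c(1)] full_simps(3)[OF full_CS(4)[OF c(1) c(1)] c(1)] by (rule c(2))
  then show "\<exists>c\<in>C.CS. full_Psi (amult (full_algebra G) (astar (full_algebra G) (C.cls x)) (C.cls x)) =
     amult (full_algebra G) (astar (full_algebra G) (C.cls c)) (C.cls c)" using c(1) by blast
  fix b assume b: "b \<in> H.C.CS"
  note bG = CS_H_G[OF b] and bc = H.CS_Cc[OF b]
  show "full_Psi (amult (full_algebra G) (C.cls b) (C.cls x)) = amult (full_algebra G) (C.cls b) (full_Psi (C.cls x))"
    unfolding full_simps(3)[OF bG x] full_Psi_cls[OF full_CS(3)[OF bG x]] full_Psi_cls[OF x] full_simps(3)[OF bG xrG]
      res_convolution(1)[OF bc CS_Cc[OF x]] ..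
  show "full_Psi (amult (full_algebra G) (C.cls x) (C.cls b)) = amult (full_algebra G) (full_Psi (C.cls x)) (C.cls b)"
    unfolding full_simps(3)[OF x bG] full_Psi_cls[OF full_CS(3)[OF x bG]] full_Psi_cls[OF x] full_simps(3)[OF xrG bG]
      res_convolution(2)[OF bc CS_Cc[OF x]] ..
next
  fix b assume b: "b \<in> H.C.CS"
  show "full_Psi (C.cls b) = C.cls b"
    unfolding full_Psi_cls[OF CS_H_G[OF b]] restrict_H[OF H.CS_Cc[OF b]] ..
qed

lemma full_Psi_embed:
  assumes f: "f \<in> Cc G"
  shows "full_Psi (full_embed G f) = iso_inclusion G (full_embed IG (res f))"
proof -
  have "(\<lambda>_. f) \<in> C.CS" by (rule C.CS_const) (simp add: f)
  moreover have "(\<lambda>_. res f) \<in> H.C.CS" by (rule H.C.CS_const) (simp add: res_H[OF f])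
  ultimately show ?thesis
    by (simp add: full_embed_def to_completion_def full_Psi_cls iso_inclusion_eq)
qed

end

end

section \<open>Full and reduced norms of amenable group bundles\<close>

section \<open>Weak containment for amenable group bundles\<close>

lemma has_sum_finite_sum:
  fixes f :: "'n \<Rightarrow> 'c \<Rightarrow> complex"
  shows "(\<And>i. i \<in> I \<Longrightarrow> (f i has_sum a i) C) \<Longrightarrow> ((\<lambda>c. \<Sum>i\<in>I. f i c) has_sum (\<Sum>i\<in>I. a i)) C"
  by (induction I rule: infinite_finite_induct) (simp_all add: has_sum_add)

lemma tensor_has_sum:
  fixes b :: "'n \<Rightarrow> 'n \<Rightarrow> complex"
  assumes w: "\<And>i. i \<in> I \<Longrightarrow> w i \<in> ell2 C" "\<And>i. i \<in> I \<Longrightarrow> w' i \<in> ell2 C"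
  shows "((\<lambda>c. \<Sum>i\<in>I. \<Sum>j\<in>I. b i j * (w i c * cnj (w' j c))) has_sum (\<Sum>i\<in>I. \<Sum>j\<in>I. b i j * ell2_inner C (w i) (w' j))) C"
  unfolding ell2_inner_def
  by (intro has_sum_finite_sum has_sum_cmult_right has_sum_infsum ell2_inner_summable w)

lemma tensor_inner:
  assumes x: "\<And>i. i \<in> I \<Longrightarrow> x i \<in> ell2 S" and y: "\<And>i. i \<in> I \<Longrightarrow> y i \<in> ell2 S"
  shows "ell2_inner S (\<lambda>k. \<Sum>i\<in>I. w i * x i k) (\<lambda>k. \<Sum>j\<in>I. w' j * y j k) =
    (\<Sum>i\<in>I. \<Sum>j\<in>I. ell2_inner S (x i) (y j) * (w i * cnj (w' j)))"
proof -
  have "ell2_inner S (\<lambda>k. \<Sum>i\<in>I. w i * x i k) (\<lambda>k. \<Sum>j\<in>I. w' j * y j k) =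
      (\<Sum>i\<in>I. ell2_inner S (\<lambda>k. w i * x i k) (\<lambda>k. \<Sum>j\<in>I. w' j * y j k))"
    by (rule ell2_inner_sum_left) (auto intro!: ell2_scale ell2_sum x y)
  also have "\<dots> = (\<Sum>i\<in>I. \<Sum>j\<in>I. ell2_inner S (\<lambda>k. w i * x i k) (\<lambda>k. w' j * y j k))"
    by (rule sum.cong[OF refl], rule ell2_inner_sum_right) (auto intro!: ell2_scale x y)
  finally show ?thesis by (simp add: ell2_inner_scale_left ell2_inner_scale_right mult_ac)
qed

text \<open>Here \<open>n c\<close> is the norm of the slice at \<open>c\<close> of the tensor
  \<open>\<Sum>i. x i \<otimes> w i\<close>. Summing its squares gives the squared norm of the
  tensor in terms of the Gram matrices of the two factors, without a construction of the tensor
  product.\<close>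

lemma tensor_norm:
  assumes w: "\<And>i. i \<in> I \<Longrightarrow> w i \<in> ell2 C" and x: "\<And>i. i \<in> I \<Longrightarrow> x i \<in> ell2 S"
  defines "n \<equiv> \<lambda>c. complex_of_real (ell2_norm S (\<lambda>k. \<Sum>i\<in>I. w i c * x i k))"
  shows "n \<in> ell2 C" "(ell2_norm C n)\<^sup>2 = Re (\<Sum>i\<in>I. \<Sum>j\<in>I. ell2_inner S (x i) (x j) * ell2_inner C (w i) (w j))"
proof -
  have n: "(cmod (n c))\<^sup>2 = Re (\<Sum>i\<in>I. \<Sum>j\<in>I. ell2_inner S (x i) (x j) * (w i c * cnj (w j c)))" for c
  proof -
    have "(\<lambda>k. \<Sum>i\<in>I. w i c * x i k) \<in> ell2 S" by (auto intro!: ell2_scale ell2_sum x)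
    then have "(cmod (n c))\<^sup>2 = Re (ell2_inner S (\<lambda>k. \<Sum>i\<in>I. w i c * x i k) (\<lambda>k. \<Sum>i\<in>I. w i c * x i k))"
      by (simp only: ell2_inner_self n_def norm_of_real power2_abs Re_complex_of_real)
    then show ?thesis by (simp only: tensor_inner[OF x x])
  qed
  have hs: "((\<lambda>c. (cmod (n c))\<^sup>2) has_sum Re (\<Sum>i\<in>I. \<Sum>j\<in>I. ell2_inner S (x i) (x j) * ell2_inner C (w i) (w j))) C"
    unfolding n by (rule has_sum_Re[OF tensor_has_sum[OF w w]])
  have "n c = 0" if "c \<notin> C" for c
  proof -
    have "(\<lambda>k. \<Sum>i\<in>I. w i c * x i k) = (\<lambda>_. 0)" using ell2_vanish[OF w that] by simp
    then show ?thesis by (simp add: n_def)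
  qed
  then show "n \<in> ell2 C" using hs by (auto simp: ell2_def summable_on_def)
  show "(ell2_norm C n)\<^sup>2 = Re (\<Sum>i\<in>I. \<Sum>j\<in>I. ell2_inner S (x i) (x j) * ell2_inner C (w i) (w j))"
    unfolding ell2_norm_square using infsumI[OF hs] .
qed

text \<open>The operator \<open>a \<otimes> 1\<close> on the Hilbert tensor product, whose elements are read off in the coordinates of the second factor.\<close>

lemma tensor_bound:
  fixes w w' :: "'n \<Rightarrow> 'c \<Rightarrow> complex"
  assumes a: "a \<in> bounded_ops S" and x: "\<And>i. i \<in> I \<Longrightarrow> x i \<in> ell2 S"
    and w: "\<And>i. i \<in> I \<Longrightarrow> w i \<in> ell2 C" "\<And>i. i \<in> I \<Longrightarrow> w' i \<in> ell2 C"
  defines "Q \<equiv> \<lambda>w. Re (\<Sum>i\<in>I. \<Sum>j\<in>I. ell2_inner S (x i) (x j) * ell2_inner C (w i) (w j))"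
  shows "cmod (\<Sum>i\<in>I. \<Sum>j\<in>I. ell2_inner S (a (x i)) (x j) * ell2_inner C (w i) (w' j)) \<le>
    op_norm S a * (sqrt (Q w) * sqrt (Q w'))" "0 \<le> Q w"
proof -
  let ?v = "\<lambda>w c k. \<Sum>i\<in>I. w i c * x i k"
  let ?n = "\<lambda>w c. complex_of_real (ell2_norm S (?v w c))"
  let ?t = "\<lambda>c. \<Sum>i\<in>I. \<Sum>j\<in>I. ell2_inner S (a (x i)) (x j) * (w i c * cnj (w' j c))"
  note n = tensor_norm[OF w(1) x, of I] and n' = tensor_norm[OF w(2) x, of I]
  have v: "?v w c \<in> ell2 S" for w :: "'n \<Rightarrow> 'c \<Rightarrow> complex" and c by (auto intro!: ell2_scale ell2_sum x)
  have t: "cmod (?t c) \<le> op_norm S a * cmod (?n w c * cnj (?n w' c))" for c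
  proof -
    have "?t c = ell2_inner S (\<lambda>k. \<Sum>i\<in>I. w i c * a (x i) k) (?v w' c)"
      by (rule tensor_inner[symmetric]) (auto intro!: bop_ell2[OF a] x)
    also have "(\<lambda>k. \<Sum>i\<in>I. w i c * a (x i) k) = a (?v w c)"
      by (subst bop_sum[OF a]) (auto intro!: ell2_scale x simp: bop_scale[OF a] x cong: sum.cong)
    finally have "cmod (?t c) \<le> ell2_norm S (a (?v w c)) * ell2_norm S (?v w' c)"
      using ell2_Cauchy_Schwarz[OF bop_ell2[OF a v] v] by simp
    also have "\<dots> \<le> op_norm S a * ell2_norm S (?v w c) * ell2_norm S (?v w' c)"
      by (intro mult_right_mono op_norm_bound[OF a] v) simp
    finally show ?thesis by (simp add: norm_mult)
  qed
  have sn: "(\<lambda>c. op_norm S a * cmod (?n w c * cnj (?n w' c))) summable_on C"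
    by (intro summable_on_cmult_right ell2_inner_abs_summable n(1) n'(1))
  have hs: "(?t has_sum (\<Sum>i\<in>I. \<Sum>j\<in>I. ell2_inner S (a (x i)) (x j) * ell2_inner C (w i) (w' j))) C"
    by (rule tensor_has_sum[OF w])
  have "cmod (\<Sum>i\<in>I. \<Sum>j\<in>I. ell2_inner S (a (x i)) (x j) * ell2_inner C (w i) (w' j)) = cmod (infsum ?t C)"
    using infsumI[OF hs] by simp
  also have "\<dots> \<le> (\<Sum>\<^sub>\<infinity>c\<in>C. op_norm S a * cmod (?n w c * cnj (?n w' c)))"
    by (rule norm_infsum_le[OF has_sum_infsum[OF has_sum_imp_summable[OF hs]] has_sum_infsum[OF sn]]) (rule t)
  also have "\<dots> = op_norm S a * (\<Sum>\<^sub>\<infinity>c\<in>C. cmod (?n w c * cnj (?n w' c)))"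
    by (rule infsum_cmult_right')
  also have "\<dots> \<le> op_norm S a * (ell2_norm C (?n w) * ell2_norm C (?n w'))"
    by (intro mult_left_mono ell2_Cauchy_Schwarz_sum n(1) n'(1) op_norm_nonneg a)
  also have "ell2_norm C (?n w) = sqrt (Q w)" by (simp only: Q_def n(2)[symmetric] real_sqrt_abs abs_of_nonneg[OF ell2_norm_nonneg])
  also have "ell2_norm C (?n w') = sqrt (Q w')" by (simp only: Q_def n'(2)[symmetric] real_sqrt_abs abs_of_nonneg[OF ell2_norm_nonneg])
  finally show "cmod (\<Sum>i\<in>I. \<Sum>j\<in>I. ell2_inner S (a (x i)) (x j) * ell2_inner C (w i) (w' j)) \<le>
    op_norm S a * (sqrt (Q w) * sqrt (Q w'))" .
  show "0 \<le> Q w" by (simp only: Q_def n(2)[symmetric] zero_le_power2)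
qed

text \<open>Test with \<open>\<eta> = a \<xi>\<close> and cancel one factor.\<close>

lemma op_norm_le_inner:
  assumes a: "a \<in> bounded_ops S" and C: "0 \<le> C"
    and le: "\<And>\<xi> \<eta>. \<xi> \<in> ell2 S \<Longrightarrow> \<eta> \<in> ell2 S \<Longrightarrow> cmod (ell2_inner S (a \<xi>) \<eta>) \<le> C * (ell2_norm S \<xi> * ell2_norm S \<eta>)"
  shows "op_norm S a \<le> C"
proof (rule op_norm_leI[OF C])
  fix \<xi> assume x: "\<xi> \<in> ell2 S"
  note ax = bop_ell2[OF a x]
  have "(ell2_norm S (a \<xi>))\<^sup>2 \<le> C * ell2_norm S \<xi> * ell2_norm S (a \<xi>)"
    using le[OF x ax] by (simp only: ell2_inner_self[OF ax] norm_of_real abs_power2 mult.assoc)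
  then show "ell2_norm S (a \<xi>) \<le> C * ell2_norm S \<xi>"
    using C mult_right_le_imp_le[of "ell2_norm S (a \<xi>)" "ell2_norm S (a \<xi>)"] ell2_norm_nonneg[of S "a \<xi>"]
    by (cases "ell2_norm S (a \<xi>) = 0") (auto simp: power2_eq_square order.strict_iff_order)
qed

context lch_etale
begin

lemma convolution_unit_supported_left:
  assumes k: "\<And>y. y \<notin> units G \<Longrightarrow> k y = 0" and x: "x \<in> arr"
  shows "(k \<star> f) x = k (r x) * f x"
proof -
  have "(k \<star> f) x = (\<Sum>\<alpha>\<in>{r x}. k \<alpha> * f (iv \<alpha> \<odot> x))"
    unfolding convolution_rng[OF x]
  proof (subst infsum_finite[symmetric])
    show "(\<Sum>\<^sub>\<infinity>\<alpha>\<in>rng_fibre G (r x). k \<alpha> * f (iv \<alpha> \<odot> x)) = (\<Sum>\<^sub>\<infinity>\<alpha>\<in>{r x}. k \<alpha> * f (iv \<alpha> \<odot> x))"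
    proof (rule infsum_cong_neutral)
      fix a assume "a \<in> rng_fibre G (r x) - {r x}"
      then show "k a * f (iv a \<odot> x) = 0" using k[of a] unit_simps(3)[of a] by (auto simp: rng_fibre_def)
    qed (use x in \<open>auto simp: rng_fibre_def\<close>)
  qed simp
  then show ?thesis using x unit_simps(4)[of "r x"] by simp
qed

lemma unit_real_involution:
  assumes "\<And>y. y \<notin> units G \<Longrightarrow> \<phi> y = 0"
  shows "involution G (cplx \<phi>) = (cplx \<phi>)"
proof
  fix y show "involution G (cplx \<phi>) y = complex_of_real (\<phi> y)"
  proof (cases "y \<in> units G")
    case True then show ?thesis using unit_simps[OF True] by (simp add: involution_def)
  next
    case False
    then have "y \<in> arr \<Longrightarrow> iv y \<notin> units G" using unit_simps(4)[of "iv y"] by auto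
    then show ?thesis using assms False by (simp add: involution_def)
  qed
qed

lemma unit_real_square:
  assumes "\<And>y. y \<notin> units G \<Longrightarrow> \<phi> y = 0"
  shows "cplx \<phi> \<star> cplx \<phi> = (\<lambda>y. complex_of_real ((\<phi> y)\<^sup>2))"
proof
  fix y show "(cplx \<phi> \<star> cplx \<phi>) y = complex_of_real ((\<phi> y)\<^sup>2)"
  proof (cases "y \<in> arr")
    case True
    then show ?thesis using assms unit_simps(3)[of y]
      by (cases "y \<in> units G") (simp_all add: convolution_unit_supported_left power2_eq_square)
  next
    case False
    then show ?thesis using assms unit_simps(1)[of y] by (auto simp: convolution_off)
  qed
qed

text \<open>A fibre contains at most one unit, so for functions on the units the
  \<open>I\<close>-norm is controlled by the supremum norm.\<close>

lemma I_bounded_by_units: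
  assumes k: "\<And>y. y \<notin> units G \<Longrightarrow> k y = 0" and C: "0 \<le> C" "\<And>y. cmod (k y) \<le> C"
  shows "I_bounded_by k C"
proof -
  have *: "(\<Sum>\<gamma>\<in>F. cmod (k \<gamma>)) \<le> C" if F: "finite F" "F \<inter> units G \<subseteq> {u}" for F :: "'g set" and u
  proof -
    have "(\<Sum>\<gamma>\<in>F. cmod (k \<gamma>)) = (\<Sum>\<gamma>\<in>F \<inter> units G. cmod (k \<gamma>))"
      by (rule sum.mono_neutral_right) (use F k in auto)
    also have "\<dots> \<le> (\<Sum>\<gamma>\<in>{u}. cmod (k \<gamma>))" by (rule sum_mono2) (use F in auto)
    finally show ?thesis using C(2)[of u] by simp
  qed
  show ?thesis unfolding I_bounded_by_def
  proof (intro conjI allI impI C)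
    fix u and F :: "'g set" assume F: "finite F"
    show "(\<Sum>\<gamma>\<in>F. cmod (k \<gamma>)) \<le> C" if "F \<subseteq> src_fibre G u"
      by (rule *[OF F, of u]) (use that unit_simps(2) in \<open>auto simp: src_fibre_def\<close>)
    show "(\<Sum>\<gamma>\<in>F. cmod (k \<gamma>)) \<le> C" if "F \<subseteq> rng_fibre G u"
      by (rule *[OF F, of u]) (use that unit_simps(3) in \<open>auto simp: rng_fibre_def\<close>)
  qed
qed

lemma I_bounded_by_dominated:
  assumes f: "I_bounded_by f C" and B: "0 \<le> B" "\<And>\<gamma>. cmod (g \<gamma>) \<le> B * cmod (f \<gamma>)"
  shows "I_bounded_by g (B * C)"
proof -
  have "(\<Sum>\<gamma>\<in>F. cmod (g \<gamma>)) \<le> B * C" if "(\<Sum>\<gamma>\<in>F. cmod (f \<gamma>)) \<le> C" for F :: "'g set"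
  proof -
    have "(\<Sum>\<gamma>\<in>F. cmod (g \<gamma>)) \<le> (\<Sum>\<gamma>\<in>F. B * cmod (f \<gamma>))" by (rule sum_mono) (rule B)
    also have "\<dots> \<le> B * C" using that B(1) by (simp add: mult_left_mono flip: sum_distrib_left)
    finally show ?thesis .
  qed
  then show ?thesis using f B(1) unfolding I_bounded_by_def by (auto intro: mult_nonneg_nonneg)
qed

lemma cutoff_exists:
  assumes K: "compactin T K" "K \<subseteq> units G"
  shows "\<exists>\<kappa> L. continuous_map T euclideanreal \<kappa> \<and> cplx \<kappa> \<in> Cc G \<and> compactin T L \<and> L \<subseteq> units G \<and>
    (\<forall>y. 0 \<le> \<kappa> y \<and> \<kappa> y \<le> 1) \<and> (\<forall>y \<in> K. \<kappa> y = 1) \<and> (\<forall>y. y \<notin> L \<longrightarrow> \<kappa> y = 0)"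
proof -
  have "openin T (units G) \<and> x \<in> units G" if "x \<in> K" for x using that K(2) units_open by blast
  then obtain I :: "'g set" and \<psi> L where p: "finite I"
    "\<forall>x \<in> I. continuous_map T euclideanreal (\<psi> x) \<and> compactin T (L x) \<and> L x \<subseteq> units G \<and>
        (\<forall>y. 0 \<le> \<psi> x y) \<and> (\<forall>y. y \<notin> L x \<longrightarrow> \<psi> x y = 0)"
    "\<forall>y. (\<Sum>x\<in>I. \<psi> x y) \<le> 1" "\<forall>y \<in> K. (\<Sum>x\<in>I. \<psi> x y) = 1"
    using partition_of_unity[OF K(1), of "\<lambda>_. units G"] by blast
  let ?\<kappa> = "\<lambda>y. \<Sum>x\<in>I. \<psi> x y" and ?L = "\<Union>x\<in>I. L x"
  have c: "continuous_map T euclideanreal ?\<kappa>" by (rule continuous_map_sum) (use p in auto)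
  have L: "compactin T ?L" by (rule compactin_Union) (use p in auto)
  have v: "?\<kappa> y = 0" if "y \<notin> ?L" for y by (rule sum.neutral) (use that p in auto)
  have "cplx ?\<kappa> \<in> Cc G"
    by (rule CcI[OF continuous_map_compose_euclidean[OF c] L]) (use v in \<open>auto intro: continuous_intros\<close>)
  then show ?thesis using p c L v by (intro exI[of _ ?\<kappa>] exI[of _ ?L]) (auto intro: sum_nonneg)
qed

text \<open>The \<open>\<phi> p\<close> are square roots of a partition of unity subordinate to sets
  on which all functions of \<open>E\<close> are nearly constant. Squares are wanted because they
  can be shared between the two sides of an inner product.\<close>

lemma unit_partition:
  assumes E: "finite E" "\<And>g. g \<in> E \<Longrightarrow> g \<in> Cc G" "\<And>g y. g \<in> E \<Longrightarrow> y \<notin> units G \<Longrightarrow> g y = 0" and e: "0 < \<epsilon>"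
  obtains P \<phi> where "finite P" "P \<subseteq> units G" "\<And>p. p \<in> P \<Longrightarrow> cplx (\<phi> p) \<in> Cc G"
    "\<And>p y. p \<in> P \<Longrightarrow> y \<notin> units G \<Longrightarrow> \<phi> p y = 0"
    "\<And>g y. g \<in> E \<Longrightarrow> cmod (g y - (\<Sum>p\<in>P. g p * of_real ((\<phi> p y)\<^sup>2))) \<le> \<epsilon>"
proof -
  have "\<forall>g \<in> E. \<exists>K. compactin T K \<and> (\<forall>y. y \<notin> K \<longrightarrow> g y = 0)" using Cc_support E(2) by blast
  then obtain K where K: "\<And>g. g \<in> E \<Longrightarrow> compactin T (K g)" "\<And>g y. g \<in> E \<Longrightarrow> y \<notin> K g \<Longrightarrow> g y = 0" by metis
  let ?K = "(\<Union>g\<in>E. K g) \<inter> units G"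
  have cK: "compactin T ?K"
    by (rule compact_Int_closedin[OF compactin_Union units_closed]) (use E(1) K(1) in auto)
  define V where "V x = (\<Inter>g\<in>E. {y \<in> topspace T. g y \<in> ball (g x) \<epsilon>}) \<inter> units G" for x
  have V: "openin T (V x) \<and> x \<in> V x" if x: "x \<in> ?K" for x
  proof
    show "openin T (V x)"
    proof (cases "E = {}")
      case False
      have "openin T {y \<in> topspace T. g y \<in> ball (g x) \<epsilon>}" if "g \<in> E" for g
        by (rule openin_continuous_map_preimage[OF Cc_continuous[OF E(2)[OF that]]]) simp
      then show ?thesis unfolding V_def using False E(1) by (intro openin_Int openin_INT2 units_open) auto
    qed (simp add: V_def units_open)
    show "x \<in> V x" using x e unit_simps(1)[of x] by (auto simp: V_def arr_top)
  qed
  obtain P :: "'g set" and \<psi> L where p: "finite P" "P \<subseteq> ?K"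
    "\<forall>x \<in> P. continuous_map T euclideanreal (\<psi> x) \<and> compactin T (L x) \<and> L x \<subseteq> V x \<and>
        (\<forall>y. 0 \<le> \<psi> x y) \<and> (\<forall>y. y \<notin> L x \<longrightarrow> \<psi> x y = 0)"
    "\<forall>y. (\<Sum>x\<in>P. \<psi> x y) \<le> 1" "\<forall>y \<in> ?K. (\<Sum>x\<in>P. \<psi> x y) = 1"
    
  proof -
    have "\<exists>I \<psi> L. finite I \<and> I \<subseteq> ?K \<and> (\<forall>x \<in> I. continuous_map T euclideanreal (\<psi> x) \<and> compactin T (L x) \<and> L x \<subseteq> V x \<and>
        (\<forall>y. 0 \<le> \<psi> x y) \<and> (\<forall>y. y \<notin> L x \<longrightarrow> \<psi> x y = 0)) \<and>
        (\<forall>y. (\<Sum>x\<in>I. \<psi> x y) \<le> 1) \<and> (\<forall>y \<in> ?K. (\<Sum>x\<in>I. \<psi> x y) = 1)"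
      by (rule partition_of_unity[OF cK]) (rule V)
    then show thesis by (elim exE conjE) (rule that; assumption)
  qed
  let ?\<phi> = "\<lambda>x y. sqrt (\<psi> x y)"
  have C: "cplx (?\<phi> x) \<in> Cc G" if x: "x \<in> P" for x
  proof (rule CcI[of _ "L x"])
    show "continuous_map T euclidean (cplx (?\<phi> x))"
      by (rule continuous_map_compose_euclidean[of _ "\<psi> x"]) (use p x in \<open>auto intro!: continuous_intros\<close>)
  qed (use p x in auto)
  have B: "cmod (g y - (\<Sum>x\<in>P. g x * of_real ((?\<phi> x y)\<^sup>2))) \<le> \<epsilon>" if g: "g \<in> E" for g y
  proof -
    have s2: "(?\<phi> x y)\<^sup>2 = \<psi> x y" if "x \<in> P" for x using p that by simp
    \<comment> \<open>Outside \<open>?K\<close>, where the partition may fail to add up to 1,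
      \<open>g\<close> vanishes.\<close>
    have "g y = (\<Sum>x\<in>P. \<psi> x y) * g y"
    proof (cases "y \<in> ?K")
      case True then have "(\<Sum>x\<in>P. \<psi> x y) = 1" using p(5) by blast
      then show ?thesis by simp
    next
      case False then have "g y = 0" using g K(2)[OF g] E(3)[OF g] by blast
      then show ?thesis by simp
    qed
    also have "\<dots> = (\<Sum>x\<in>P. of_real (\<psi> x y) * g y)" by (simp add: sum_distrib_right)
    finally have "g y - (\<Sum>x\<in>P. g x * of_real ((?\<phi> x y)\<^sup>2)) = (\<Sum>x\<in>P. of_real (\<psi> x y) * (g y - g x))"
      using s2 by (simp add: sum_subtractf right_diff_distrib mult.commute cong: sum.cong)
    also have "cmod \<dots> \<le> (\<Sum>x\<in>P. \<psi> x y * \<epsilon>)"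
    proof (rule sum_norm_le)
      fix x assume x: "x \<in> P"
      show "cmod (of_real (\<psi> x y) * (g y - g x)) \<le> \<psi> x y * \<epsilon>"
      proof (cases "y \<in> L x")
        case True
        then have "cmod (g y - g x) \<le> \<epsilon>" using p x g by (force simp: V_def dist_norm norm_minus_commute)
        then show ?thesis using p x by (simp add: norm_mult mult_left_mono)
      next
        case False
        then have "\<psi> x y = 0" using p(3) x by blast
        then show ?thesis by simp
      qed
    qed
    also have "\<dots> \<le> 1 * \<epsilon>" unfolding sum_distrib_right[symmetric] using p(4) e by (intro mult_right_mono) auto
    finally show ?thesis by simp
  qed
  have Z: "?\<phi> x y = 0" if "x \<in> P" "y \<notin> units G" for x y
  proof -
    have "y \<notin> L x" using p(3) that by (auto simp: V_def)
    then show ?thesis using p(3) that by simp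
  qed
  show thesis by (rule that[of P ?\<phi>]) (use p(1,2) C B Z in auto)
qed

lemma Cc_fibre_ell2:
  assumes "f \<in> Cc G" shows "restrict_fun (src_fibre G u) f \<in> ell2 arr"
proof -
  let ?F = "{\<gamma> \<in> src_fibre G u. f \<gamma> \<noteq> 0}"
  have "restrict_fun (src_fibre G u) f = restrict_fun ?F f" by (auto simp: restrict_fun_def)
  also have "\<dots> = (\<lambda>i. \<Sum>j\<in>?F. f j * basis_vector j i)" by (rule restrict_fun_finite_eq_sum[OF Cc_src_finite[OF assms]])
  also have "\<dots> \<in> ell2 arr" by (intro ell2_sum ell2_scale basis_vector_ell2) (auto simp: src_fibre_def)
  finally show ?thesis .
qed


text \<open>Replaces \<open>\<pi> g\<close> by scalars at the sample points. A uniform error of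
  \<open>\<epsilon>\<close> on the units is an error of \<open>\<epsilon>\<close> in the
  \<open>I\<close>-norm, hence in every representation; and as \<open>\<phi> p\<close> is real,
  \<open>\<pi>\<close> of its square can be moved half to each side.\<close>

lemma rep_unit_approx:
  assumes \<pi>: "\<pi> \<in> I_bounded_reps G" and g: "g \<in> Cc G" "\<And>y. y \<notin> units G \<Longrightarrow> g y = 0"
    and P: "finite P" and \<phi>: "\<And>p. p \<in> P \<Longrightarrow> cplx (\<phi> p) \<in> Cc G" "\<And>p y. p \<in> P \<Longrightarrow> y \<notin> units G \<Longrightarrow> \<phi> p y = 0"
    and e: "0 \<le> \<epsilon>" "\<And>y. cmod (g y - (\<Sum>p\<in>P. g p * of_real ((\<phi> p y)\<^sup>2))) \<le> \<epsilon>"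
    and w: "w \<in> ell2 UNIV" "w' \<in> ell2 UNIV"
  shows "cmod (ell2_inner UNIV (\<pi> g w) w' - (\<Sum>p\<in>P. g p *
      ell2_inner UNIV (\<pi> (cplx (\<phi> p)) w) (\<pi> (cplx (\<phi> p)) w')))
    \<le> \<epsilon> * (ell2_norm UNIV w * ell2_norm UNIV w')"
proof -
  let ?F = "\<lambda>p y. complex_of_real (\<phi> p y)"
  let ?sq = "\<lambda>p y. complex_of_real ((\<phi> p y)\<^sup>2)"
  let ?k = "\<lambda>y. \<Sum>p\<in>P. g p * ?sq p y"
  note B = rep_bounded_ops[OF \<pi>]
  have sq: "?F p \<star> ?F p = ?sq p" "involution G (?F p) = ?F p" if "p \<in> P" for p
    using unit_real_square unit_real_involution \<phi>(2)[OF that] by blast+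
  have sqC: "?sq p \<in> Cc G" if "p \<in> P" for p
    using Cc_convolution[OF \<phi>(1)[OF that] \<phi>(1)[OF that]] unfolding sq(1)[OF that] .
  have kC: "?k \<in> Cc G" by (intro Cc_sum Cc_scale sqC)
  have \<pi>k: "\<pi> ?k = (\<lambda>\<xi> i. \<Sum>p\<in>P. g p * \<pi> (?sq p) \<xi> i)"
    by (subst rep_sum[OF \<pi>], rule Cc_scale[OF sqC], assumption) (intro ext sum.cong refl, simp only: rep_scale[OF \<pi> sqC])
  have in1: "ell2_inner UNIV (\<pi> (?sq p) w) w' = ell2_inner UNIV (\<pi> (?F p) w) (\<pi> (?F p) w')" if p: "p \<in> P" for p
  proof -
    have a: "op_adjoint UNIV (\<pi> (?F p)) = \<pi> (?F p)" using rep_involution[OF \<pi> \<phi>(1)[OF p]] unfolding sq(2)[OF p] by simp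
    have "\<pi> (?sq p) w = \<pi> (?F p) (\<pi> (?F p) w)" unfolding sq(1)[OF p, symmetric] rep_convolution[OF \<pi> \<phi>(1)[OF p] \<phi>(1)[OF p]] by simp
    then show ?thesis
      using op_adjoint_inner[OF B[OF \<phi>(1)[OF p]] bop_ell2[OF B[OF \<phi>(1)[OF p]] w(1)] w(2)] unfolding a by simp
  qed
  have "ell2_inner UNIV (\<pi> ?k w) w' = (\<Sum>p\<in>P. g p * ell2_inner UNIV (\<pi> (?sq p) w) w')"
    unfolding \<pi>k
    by (subst ell2_inner_sum_left, rule ell2_scale[OF bop_ell2[OF B[OF sqC] w(1)]], assumption, rule w(2)) (simp only: ell2_inner_scale_left)
  also have "\<dots> = (\<Sum>p\<in>P. g p * ell2_inner UNIV (\<pi> (?F p) w) (\<pi> (?F p) w'))" by (intro sum.cong refl) (simp only: in1)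
  finally have 0: "ell2_inner UNIV (\<pi> ?k w) w' = (\<Sum>p\<in>P. g p * ell2_inner UNIV (\<pi> (?F p) w) (\<pi> (?F p) w'))" .
  have 1: "ell2_inner UNIV (\<pi> g w) w' - (\<Sum>p\<in>P. g p * ell2_inner UNIV (\<pi> (?F p) w) (\<pi> (?F p) w')) =
      ell2_inner UNIV (\<pi> (\<lambda>y. g y - ?k y) w) w'"
    unfolding rep_diff[OF \<pi> g(1) kC]
    by (simp only: 0[symmetric] ell2_inner_diff_left[OF bop_ell2[OF B[OF g(1)] w(1)] bop_ell2[OF B[OF kC] w(1)] w(2)])
  have dC: "(\<lambda>y. g y - ?k y) \<in> Cc G" by (rule Cc_diff[OF g(1) kC])
  have "I_bounded_by (\<lambda>y. g y - ?k y) \<epsilon>"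
    by (rule I_bounded_by_units[OF _ e(1)]) (use g(2) \<phi>(2) e(2) in auto)
  then have n: "op_norm UNIV (\<pi> (\<lambda>y. g y - ?k y)) \<le> \<epsilon>" by (rule op_norm_rep_le_I[OF \<pi> dC])
  have "cmod (ell2_inner UNIV (\<pi> (\<lambda>y. g y - ?k y) w) w') \<le> ell2_norm UNIV (\<pi> (\<lambda>y. g y - ?k y) w) * ell2_norm UNIV w'"
    by (rule ell2_Cauchy_Schwarz[OF bop_ell2[OF B[OF dC] w(1)] w(2)])
  also have "\<dots> \<le> (\<epsilon> * ell2_norm UNIV w) * ell2_norm UNIV w'"
    by (intro mult_right_mono order_trans[OF op_norm_bound[OF B[OF dC] w(1)]] n) simp_all
  finally show ?thesis unfolding 1 by (simp add: mult.assoc)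
qed

end

text \<open>The situation of the isotropy interior: each fibre is a group, and left and right
  multiplication by functions on the units agree.\<close>

locale group_bundle = lch_etale G for G :: "'g groupoid" +
  assumes rng_eq_src: "\<And>\<gamma>. \<gamma> \<in> arr \<Longrightarrow> r \<gamma> = s \<gamma>"
begin

lemma rng_src_fibre: "rng_fibre G u = src_fibre G u"
  using rng_eq_src by (auto simp: rng_fibre_def src_fibre_def)

context
  fixes I :: "'g set" and a :: "'g \<Rightarrow> 'g \<Rightarrow> real"
  assumes fin: "finite I" and A: "\<And>i. i \<in> I \<Longrightarrow> cplx (a i) \<in> Cc G"
    and single: "\<And>i x y. i \<in> I \<Longrightarrow> a i x \<noteq> 0 \<Longrightarrow> a i y \<noteq> 0 \<Longrightarrow> s x = s y \<Longrightarrow> x = y"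
begin

abbreviation "AA i \<equiv> cplx (a i)"
abbreviation "RR u i \<equiv> restrict_fun (src_fibre G u) (AA i)"
abbreviation "sqsum x \<equiv> (\<Sum>i\<in>I. (a i x)\<^sup>2)"

text \<open>At a unit \<open>u\<close> this is the inner product of \<open>lam c (RR u i)\<close> and \<open>RR u j\<close>.\<close>

definition "EE c i j = restrict_fun (units G) (involution G (AA j) \<star> (c \<star> AA i))"
definition "hh \<gamma> = (\<Sum>\<^sub>\<infinity>y\<in>src_fibre G (s \<gamma>). sqsum (\<gamma> \<odot> y) * sqsum y)"

lemma EE_Cc: "c \<in> Cc G \<Longrightarrow> i \<in> I \<Longrightarrow> j \<in> I \<Longrightarrow> EE c i j \<in> Cc G"
  unfolding EE_def by (intro Cc_restrict units_open units_closed Cc_convolution Cc_involution A)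

lemma EE_off: "y \<notin> units G \<Longrightarrow> EE c i j y = 0"
  by (simp add: EE_def restrict_fun_def)

lemma EE_inner:
  assumes c: "c \<in> Cc G" and u: "u \<in> units G" and ij: "i \<in> I" "j \<in> I"
  shows "EE c i j u = ell2_inner arr (lam c (RR u i)) (RR u j)"
proof -
  have t: "involution G (AA j) (u \<odot> iv \<beta>) * (c \<star> AA i) \<beta> = lam c (RR u i) \<beta> * cnj (RR u j \<beta>)"
    if b: "\<beta> \<in> src_fibre G u" for \<beta>
  proof -
    have ba: "\<beta> \<in> arr" "s \<beta> = u" using b by (auto simp: src_fibre_def)
    have "u \<odot> iv \<beta> = iv \<beta>" using alg_unfold(7)[of "iv \<beta>"] ba by simp
    then have 1: "involution G (AA j) (u \<odot> iv \<beta>) = AA j \<beta>" using ba by (simp add: involution_def)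
    have "(c \<star> AA i) \<beta> = lam c (RR u i) \<beta>"
      unfolding convolution_src[OF ba(1)] lam_infsum[OF ba(1) Cc_fibre_ell2[OF A[OF ij(1)]]]
      by (rule infsum_cong) (simp add: restrict_fun_def ba(2))
    then show ?thesis using 1 b by (simp add: restrict_fun_def)
  qed
  have "EE c i j u = (\<Sum>\<^sub>\<infinity>\<beta>\<in>src_fibre G u. lam c (RR u i) \<beta> * cnj (RR u j \<beta>))"
    using infsum_cong[OF t] u unit_simps[OF u] by (simp add: EE_def restrict_fun_def[of "units G"] convolution_src)
  also have "\<dots> = ell2_inner arr (lam c (RR u i)) (RR u j)"
    unfolding ell2_inner_def by (rule infsum_cong_neutral) (auto simp: restrict_fun_def src_fibre_def)
  finally show ?thesis .
qed

text \<open>By \<open>single\<close> the vectors \<open>RR u i\<close> and \<open>RR u j\<close> are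
  multiples of basis vectors, so the coefficient reduces to one matrix entry of
  \<open>lam c\<close>.\<close>

lemma EE_point:
  assumes c: "c \<in> Cc G" and u: "u \<in> units G" and ij: "i \<in> I" "j \<in> I"
    and x: "x \<in> src_fibre G u" "a j x \<noteq> 0" and y: "y \<in> src_fibre G u" "a i y \<noteq> 0"
  shows "EE c i j u = c (x \<odot> iv y) * of_real (a i y * a j x)"
proof -
  have R: "RR u i = (\<lambda>k. AA i y * basis_vector y k)" if "i \<in> I" "y \<in> src_fibre G u" "a i y \<noteq> 0" for i y
  proof
    fix k show "RR u i k = AA i y * basis_vector y k"
      using single[OF that(1) _ that(3), of k] that(2) by (auto simp: restrict_fun_def basis_vector_def src_fibre_def)
  qed
  have xy: "x \<in> arr" "y \<in> arr" "s x = s y" using x y by (auto simp: src_fibre_def)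
  show ?thesis unfolding EE_inner[OF c u ij] R[OF ij(1) y] R[OF ij(2) x]
      bop_scale[OF lam_bounded_ops[OF c] basis_vector_ell2[OF xy(2)]]
    using xy by (simp add: ell2_inner_scale_left ell2_inner_scale_right ell2_inner_basis_right lam_entry lam_kernel_def)
qed

text \<open>At \<open>\<gamma>\<close> the triple convolution is a sum over \<open>y\<close> of
  \<open>a j (\<gamma> \<odot> y)\<close>, the value of \<open>EE c i j\<close> at the unit, and
  \<open>a i y\<close>. By \<open>EE_point\<close> with \<open>x = \<gamma> \<odot> y\<close> the
  middle value is \<open>c \<gamma>\<close> times the same two factors again, and the resulting
  squares add up to \<open>hh\<close>.\<close>

lemma hh_convolution:
  assumes c: "c \<in> Cc G"
  shows "(\<lambda>\<gamma>. complex_of_real (hh \<gamma>) * c \<gamma>) =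
    (\<lambda>\<gamma>. \<Sum>i\<in>I. \<Sum>j\<in>I. ((AA j \<star> EE c i j) \<star> involution G (AA i)) \<gamma>)"
proof
  fix \<gamma> show "complex_of_real (hh \<gamma>) * c \<gamma> =
    (\<Sum>i\<in>I. \<Sum>j\<in>I. ((AA j \<star> EE c i j) \<star> involution G (AA i)) \<gamma>)"
  proof (cases "\<gamma> \<in> arr")
    case g: True
    let ?u = "s \<gamma>" and ?Y = "{y \<in> src_fibre G (s \<gamma>). \<exists>i\<in>I. a i y \<noteq> 0}"
    have u: "?u \<in> units G" using g by simp
    have "?Y = (\<Union>i\<in>I. {y \<in> src_fibre G ?u. AA i y \<noteq> 0})" by auto
    then have fY: "finite ?Y" using fin Cc_src_finite[OF A] by simp
    have h: "hh \<gamma> = (\<Sum>y\<in>?Y. sqsum (\<gamma> \<odot> y) * sqsum y)"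
    proof -
      have "hh \<gamma> = infsum (\<lambda>y. sqsum (\<gamma> \<odot> y) * sqsum y) ?Y"
        unfolding hh_def by (rule infsum_cong_neutral) (auto intro: sum.neutral)
      then show ?thesis using fY by simp
    qed
    have t: "((AA j \<star> EE c i j) \<star> involution G (AA i)) \<gamma> =
        (\<Sum>y\<in>?Y. c \<gamma> * of_real ((a j (\<gamma> \<odot> y))\<^sup>2 * (a i y)\<^sup>2))" if ij: "i \<in> I" "j \<in> I" for i j
    proof -
      let ?F = "convolution G (AA j) (EE c i j)" and ?B = "involution G (AA i)"
      have pt: "?F (\<gamma> \<odot> iv (iv y)) * ?B (iv y) = c \<gamma> * of_real ((a j (\<gamma> \<odot> y))\<^sup>2 * (a i y)\<^sup>2)" if y: "y \<in> src_fibre G ?u" for y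
      proof -
        have ya: "y \<in> arr" "s y = ?u" "s \<gamma> = r y" using y rng_eq_src by (auto simp: src_fibre_def)
        have gy: "\<gamma> \<odot> y \<in> src_fibre G ?u" "\<gamma> \<odot> y \<in> arr" using g ya by (auto simp: src_fibre_def)
        have "?F (\<gamma> \<odot> y) = AA j (\<gamma> \<odot> y) * EE c i j ?u"
          using convolution_unit_supported[of "EE c i j" "\<gamma> \<odot> y" "AA j", OF EE_off gy(2)] g ya by simp
        moreover have "?B (iv y) = AA i y" using ya by (simp add: involution_def)
        moreover have "AA j (\<gamma> \<odot> y) * EE c i j ?u * AA i y = c \<gamma> * of_real ((a j (\<gamma> \<odot> y))\<^sup>2 * (a i y)\<^sup>2)"
        proof (cases "a j (\<gamma> \<odot> y) = 0 \<or> a i y = 0")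
          case False
          then show ?thesis using EE_point[OF c u ij gy(1) _ y] g ya by (simp add: power2_eq_square)
        qed auto
        ultimately show ?thesis using ya(1) by simp
      qed
      have "(?F \<star> ?B) \<gamma> = (\<Sum>\<^sub>\<infinity>\<beta>\<in>src_fibre G ?u. ?F (\<gamma> \<odot> iv \<beta>) * ?B \<beta>)" by (rule convolution_src[OF g])
      also have "\<dots> = (\<Sum>\<^sub>\<infinity>y\<in>src_fibre G ?u. ?F (\<gamma> \<odot> iv (iv y)) * ?B (iv y))"
        using infsum_reindex_bij_betw[OF bij_inv_fibre[of ?u, unfolded rng_src_fibre], of "\<lambda>\<beta>. ?F (\<gamma> \<odot> iv \<beta>) * ?B \<beta>"] by simp
      also have "\<dots> = infsum (\<lambda>y. c \<gamma> * of_real ((a j (\<gamma> \<odot> y))\<^sup>2 * (a i y)\<^sup>2)) ?Y"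
        by (rule infsum_cong_neutral) (use pt ij in auto)
      finally show ?thesis using fY by simp
    qed
    have "(\<Sum>i\<in>I. \<Sum>j\<in>I. ((AA j \<star> EE c i j) \<star> involution G (AA i)) \<gamma>) =
        (\<Sum>i\<in>I. \<Sum>j\<in>I. \<Sum>y\<in>?Y. c \<gamma> * of_real ((a j (\<gamma> \<odot> y))\<^sup>2 * (a i y)\<^sup>2))"
      by (intro sum.cong refl t)
    also have "\<dots> = c \<gamma> * of_real (\<Sum>i\<in>I. \<Sum>j\<in>I. \<Sum>y\<in>?Y. (a j (\<gamma> \<odot> y))\<^sup>2 * (a i y)\<^sup>2)"
      by (simp only: sum_distrib_left of_real_sum)
    also have "(\<Sum>i\<in>I. \<Sum>j\<in>I. \<Sum>y\<in>?Y. (a j (\<gamma> \<odot> y))\<^sup>2 * (a i y)\<^sup>2) = (\<Sum>y\<in>?Y. sqsum (\<gamma> \<odot> y) * sqsum y)"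
      unfolding sum_product sum.swap[of _ ?Y I] by (intro sum.cong refl sum.swap)
    finally show ?thesis unfolding h by simp
  qed (simp add: convolution_off Cc_vanish[OF c])
qed

lemma hh_Cc:
  assumes c: "c \<in> Cc G" shows "(\<lambda>\<gamma>. complex_of_real (hh \<gamma>) * c \<gamma>) \<in> Cc G"
  unfolding hh_convolution[OF c] by (intro Cc_sum Cc_convolution EE_Cc Cc_involution A c)

text \<open>The outer factors are carried over to the two vectors as adjoints, which leaves a
  function on the units in the middle.\<close>

lemma hh_rep_inner:
  assumes \<pi>: "\<pi> \<in> I_bounded_reps G" and c: "c \<in> Cc G" and k: "k \<in> ell2 UNIV" "k' \<in> ell2 UNIV"
  shows "ell2_inner UNIV (\<pi> (\<lambda>\<gamma>. complex_of_real (hh \<gamma>) * c \<gamma>) k) k' =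
    (\<Sum>i\<in>I. \<Sum>j\<in>I. ell2_inner UNIV (\<pi> (EE c i j) (op_adjoint UNIV (\<pi> (AA i)) k)) (op_adjoint UNIV (\<pi> (AA j)) k'))"
proof -
  note B = rep_bounded_ops[OF \<pi>]
  let ?C = "\<lambda>i j. convolution G (AA j \<star> EE c i j) (involution G (AA i))"
  have C: "?C i j \<in> Cc G" if "i \<in> I" "j \<in> I" for i j using that by (intro Cc_convolution EE_Cc Cc_involution A c)
  have 1: "\<pi> (?C i j) k = \<pi> (AA j) (\<pi> (EE c i j) (op_adjoint UNIV (\<pi> (AA i)) k))" if ij: "i \<in> I" "j \<in> I" for i j
    unfolding rep_convolution[OF \<pi> Cc_convolution[OF A[OF ij(2)] EE_Cc[OF c ij]] Cc_involution[OF A[OF ij(1)]]]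
      rep_convolution[OF \<pi> A[OF ij(2)] EE_Cc[OF c ij]] rep_involution[OF \<pi> A[OF ij(1)]] by simp
  have "\<pi> (\<lambda>\<gamma>. complex_of_real (hh \<gamma>) * c \<gamma>) k = (\<lambda>x. \<Sum>i\<in>I. \<Sum>j\<in>I. \<pi> (?C i j) k x)"
    unfolding hh_convolution[OF c]
    by (subst rep_sum[OF \<pi>], intro Cc_sum C) (auto simp: rep_sum[OF \<pi> C] cong: sum.cong)
  then have "ell2_inner UNIV (\<pi> (\<lambda>\<gamma>. complex_of_real (hh \<gamma>) * c \<gamma>) k) k' = (\<Sum>i\<in>I. \<Sum>j\<in>I. ell2_inner UNIV (\<pi> (?C i j) k) k')"
    using bop_ell2[OF B[OF C] k(1)] k(2) by (simp add: ell2_inner_sum_left ell2_sum cong: sum.cong)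
  also have "\<dots> = (\<Sum>i\<in>I. \<Sum>j\<in>I. ell2_inner UNIV (\<pi> (EE c i j) (op_adjoint UNIV (\<pi> (AA i)) k)) (op_adjoint UNIV (\<pi> (AA j)) k'))"
  proof (intro sum.cong refl)
    fix i j assume ij: "i \<in> I" "j \<in> I"
    show "ell2_inner UNIV (\<pi> (?C i j) k) k' =
        ell2_inner UNIV (\<pi> (EE c i j) (op_adjoint UNIV (\<pi> (AA i)) k)) (op_adjoint UNIV (\<pi> (AA j)) k')"
      unfolding 1[OF ij]
      by (rule op_adjoint_inner[OF B[OF A[OF ij(2)]] bop_ell2[OF B[OF EE_Cc[OF c ij]] bop_ell2[OF op_adjoint_bounded[OF B[OF A[OF ij(1)]]] k(1)]] k(2)])
  qed
  finally show ?thesis .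
qed

text \<open>A substitute for the constant 1 on the unit space, which is compactly supported only
  when that space is compact.\<close>

lemma cutoff_fibre:
  shows "\<exists>\<kappa>. cplx \<kappa> \<in> Cc G \<and> (\<forall>y. 0 \<le> \<kappa> y \<and> \<kappa> y \<le> 1) \<and> (\<forall>y. y \<notin> units G \<longrightarrow> \<kappa> y = 0) \<and>
    (\<forall>i \<in> I. \<forall>x. a i x \<noteq> 0 \<longrightarrow> \<kappa> (s x) = 1)"
proof -
  have "\<forall>i \<in> I. \<exists>K. compactin T K \<and> (\<forall>y. y \<notin> K \<longrightarrow> AA i y = 0)" using Cc_support A by blast
  then obtain K where K: "\<And>i. i \<in> I \<Longrightarrow> compactin T (K i)" "\<And>i y. i \<in> I \<Longrightarrow> y \<notin> K i \<Longrightarrow> AA i y = 0" by metis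
  have cK: "compactin T (\<Union>i\<in>I. K i)" by (rule compactin_Union) (use fin K in auto)
  then have "(\<Union>i\<in>I. K i) \<subseteq> arr" using compactin_subset_topspace arr_top by metis
  then have "s ` (\<Union>i\<in>I. K i) \<subseteq> units G" by auto
  from cutoff_exists[OF image_compactin[OF cK src_cont] this] obtain \<kappa> L where \<kappa>: "cplx \<kappa> \<in> Cc G"
      "L \<subseteq> units G" "\<forall>y. 0 \<le> \<kappa> y \<and> \<kappa> y \<le> 1" "\<forall>y \<in> s ` (\<Union>i\<in>I. K i). \<kappa> y = 1" "\<forall>y. y \<notin> L \<longrightarrow> \<kappa> y = 0" by auto
  have "\<kappa> (s x) = 1" if "i \<in> I" "a i x \<noteq> 0" for i x
  proof -
    have "x \<in> K i" using K(2)[OF that(1), of x] that(2) by auto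
    then show ?thesis using \<kappa>(4) that(1) by blast
  qed
  then show ?thesis using \<kappa> by blast
qed

text \<open>Convolution with \<open>\<kappa>\<close> fixes every \<open>a i\<close>, so the
  coefficients become those of a Gram matrix.\<close>

lemma EE_cutoff:
  assumes \<kappa>: "cplx \<kappa> \<in> Cc G" "\<And>y. y \<notin> units G \<Longrightarrow> \<kappa> y = 0" "\<And>i x. i \<in> I \<Longrightarrow> a i x \<noteq> 0 \<Longrightarrow> \<kappa> (s x) = 1"
    and u: "u \<in> units G" and ij: "i \<in> I" "j \<in> I"
  shows "EE (cplx \<kappa>) i j u = ell2_inner arr (RR u i) (RR u j)"
proof -
  have "lam (cplx \<kappa>) (RR u i) = RR u i"
  proof
    fix \<eta> show "lam (cplx \<kappa>) (RR u i) \<eta> = RR u i \<eta>"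
    proof (cases "\<eta> \<in> arr")
      case True
      have "lam (cplx \<kappa>) (RR u i) \<eta> = (cplx \<kappa> \<star> RR u i) \<eta>"
        unfolding lam_infsum[OF True Cc_fibre_ell2[OF A[OF ij(1)]]] convolution_src[OF True] ..
      also have "\<dots> = \<kappa> (r \<eta>) * RR u i \<eta>" by (rule convolution_unit_supported_left[OF _ True]) (use \<kappa>(2) in simp)
      also have "\<dots> = RR u i \<eta>" using \<kappa>(3)[OF ij(1), of \<eta>] rng_eq_src[OF True] by (cases "a i \<eta> = 0") (simp_all add: restrict_fun_def)
      finally show ?thesis .
    next
      case False
      then show ?thesis
        using ell2_vanish[OF Cc_fibre_ell2[OF A[OF ij(1)]] False] ell2_vanish[OF bop_ell2'[OF lam_bounded_ops[OF \<kappa>(1)]] False] by simp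
    qed
  qed
  then show ?thesis unfolding EE_inner[OF \<kappa>(1) u ij] by simp
qed

text \<open>The product of \<open>hh\<close> and \<open>\<kappa>\<close> lives on the units, where
  \<open>hh\<close> is the fibrewise sum of the squares of \<open>sqsum\<close>, so its norm in any
  representation is at most \<open>S\<close>. Through \<open>hh_rep_inner\<close> this controls the
  Gram form of the vectors obtained from \<open>k\<close>.\<close>

lemma hh_cutoff_bound:
  assumes \<pi>: "\<pi> \<in> I_bounded_reps G" and \<kappa>: "cplx \<kappa> \<in> Cc G" "\<And>y. y \<notin> units G \<Longrightarrow> \<kappa> y = 0"
    "\<And>y. 0 \<le> \<kappa> y \<and> \<kappa> y \<le> 1"
    and S: "\<And>u. u \<in> units G \<Longrightarrow> (\<Sum>\<^sub>\<infinity>x\<in>src_fibre G u. (sqsum x)\<^sup>2) \<le> S" "0 \<le> S"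
    and k: "k \<in> ell2 UNIV"
  shows "Re (ell2_inner UNIV (\<pi> (\<lambda>\<gamma>. complex_of_real (hh \<gamma>) * complex_of_real (\<kappa> \<gamma>)) k) k) \<le> S * (ell2_norm UNIV k)\<^sup>2"
proof -
  let ?g = "\<lambda>\<gamma>. complex_of_real (hh \<gamma>) * complex_of_real (\<kappa> \<gamma>)"
  note gC = hh_Cc[OF \<kappa>(1)]
  have "cmod (?g y) \<le> S" for y
  proof (cases "y \<in> units G")
    case True
    have "hh y = (\<Sum>\<^sub>\<infinity>x\<in>src_fibre G y. (sqsum x)\<^sup>2)" unfolding hh_def unit_simps(2)[OF True]
    proof (rule infsum_cong)
      fix x assume "x \<in> src_fibre G y"
      then have "x \<in> arr" "r x = y" using rng_eq_src by (auto simp: src_fibre_def)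
      then have "y \<odot> x = x" using alg_unfold(7)[of x] by simp
      then show "sqsum (y \<odot> x) * sqsum x = (sqsum x)\<^sup>2" by (simp add: power2_eq_square)
    qed
    moreover have "0 \<le> (\<Sum>\<^sub>\<infinity>x\<in>src_fibre G y. (sqsum x)\<^sup>2)" by (rule infsum_nonneg) simp
    ultimately have "\<bar>hh y\<bar> * \<bar>\<kappa> y\<bar> \<le> S * 1" using S \<kappa>(3)[of y] True by (intro mult_mono) auto
    then show ?thesis by (simp add: norm_mult)
  qed (use \<kappa>(2) S(2) in simp)
  then have "I_bounded_by ?g S" by (intro I_bounded_by_units[OF _ S(2)]) (use \<kappa>(2) in auto)
  then have n: "op_norm UNIV (\<pi> ?g) \<le> S" by (rule op_norm_rep_le_I[OF \<pi> gC])
  note B = rep_bounded_ops[OF \<pi> gC]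
  have "Re (ell2_inner UNIV (\<pi> ?g k) k) \<le> ell2_norm UNIV (\<pi> ?g k) * ell2_norm UNIV k"
    using order_trans[OF complex_Re_le_cmod ell2_Cauchy_Schwarz[OF bop_ell2[OF B k] k]] .
  also have "\<dots> \<le> S * ell2_norm UNIV k * ell2_norm UNIV k"
    by (intro mult_right_mono order_trans[OF op_norm_bound[OF B k]] n) simp_all
  finally show ?thesis by (simp add: power2_eq_square mult.assoc)
qed

text \<open>
  Approximating the \<open>EE c i j\<close> by step functions subordinate to a partition of unity on the units writes the
  matrix coefficients of \<open>\<pi> (hh f)\<close> as those of \<open>lam f \<otimes> 1\<close>, so that \<open>tensor_bound\<close> applies.
\<close>

lemma hh_rep_bound:
  assumes \<pi>: "\<pi> \<in> I_bounded_reps G" and f: "f \<in> Cc G"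
    and S: "\<And>u. u \<in> units G \<Longrightarrow> (\<Sum>\<^sub>\<infinity>x\<in>src_fibre G u. (sqsum x)\<^sup>2) \<le> S" "0 \<le> S"
  shows "op_norm UNIV (\<pi> (\<lambda>\<gamma>. complex_of_real (hh \<gamma>) * f \<gamma>)) \<le> op_norm arr (lam f) * S"
proof (rule op_norm_le_inner[OF rep_bounded_ops[OF \<pi> hh_Cc[OF f]]])
  let ?N = "op_norm arr (lam f)"
  have N: "0 \<le> ?N" by (rule op_norm_nonneg[OF lam_bounded_ops[OF f]])
  show "0 \<le> ?N * S" using N S(2) by simp
  note B = rep_bounded_ops[OF \<pi>]
  obtain \<kappa> where \<kappa>: "cplx \<kappa> \<in> Cc G" "\<And>y. 0 \<le> \<kappa> y \<and> \<kappa> y \<le> 1" "\<And>y. y \<notin> units G \<Longrightarrow> \<kappa> y = 0"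
    "\<And>i x. i \<in> I \<Longrightarrow> a i x \<noteq> 0 \<Longrightarrow> \<kappa> (s x) = 1" using cutoff_fibre by metis
  let ?k = "cplx \<kappa>"
  \<comment> \<open>One form for two purposes: with \<open>c = f\<close> it is the coefficient to be
    estimated, with \<open>c = \<kappa>\<close> it plays the part of the squared norm of a
    tensor.\<close>
  define X where "X c w w' = (\<Sum>i\<in>I. \<Sum>j\<in>I. ell2_inner UNIV (\<pi> (EE c i j) (w i)) (w' j))" for c and w w' :: "'g \<Rightarrow> ('g \<Rightarrow> complex) \<Rightarrow> complex"
  define M where "M w w' = (\<Sum>i\<in>I. \<Sum>j\<in>I. ell2_norm UNIV (w i) * ell2_norm UNIV (w' j))" for w w' :: "'g \<Rightarrow> ('g \<Rightarrow> complex) \<Rightarrow> complex"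
  define Wv where "Wv k i = op_adjoint UNIV (\<pi> (AA i)) k" for k i
  have Wv: "Wv k i \<in> ell2 UNIV" if "k \<in> ell2 UNIV" "i \<in> I" for k i
    unfolding Wv_def by (rule bop_ell2[OF op_adjoint_bounded[OF B[OF A[OF that(2)]]] that(1)])
  \<comment> \<open>Exact coefficients are replaced by sampled ones at a cost of
    \<open>\<epsilon> * M\<close>, and the sampled ones obey the tensor estimate. The bounds
    \<open>D\<close> and \<open>D'\<close> are later provided by
    \<open>hh_cutoff_bound\<close>.\<close>
  have step: "cmod (X f w w') \<le> \<epsilon> * M w w' + ?N * (sqrt (D + \<epsilon> * M w w) * sqrt (D' + \<epsilon> * M w' w'))"
    if w: "\<And>i. i \<in> I \<Longrightarrow> w i \<in> ell2 UNIV" "\<And>i. i \<in> I \<Longrightarrow> w' i \<in> ell2 UNIV"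
      and D: "Re (X ?k w w) \<le> D" "Re (X ?k w' w') \<le> D'" and e: "0 < \<epsilon>" for w w' \<epsilon> D D'
  proof -
    \<comment> \<open>One partition has to serve the coefficient functions of \<open>f\<close> and
      of \<open>\<kappa>\<close> at the same time.\<close>
    let ?E = "(\<lambda>(c, i, j). EE c i j) ` ({f, ?k} \<times> I \<times> I)"
    have E: "finite ?E" "\<And>g. g \<in> ?E \<Longrightarrow> g \<in> Cc G" "\<And>g y. g \<in> ?E \<Longrightarrow> y \<notin> units G \<Longrightarrow> g y = 0"
      using fin EE_Cc f \<kappa>(1) EE_off by auto
    obtain P \<phi> where P: "finite P" "P \<subseteq> units G" "\<And>p. p \<in> P \<Longrightarrow> cplx (\<phi> p) \<in> Cc G"
        "\<And>p y. p \<in> P \<Longrightarrow> y \<notin> units G \<Longrightarrow> \<phi> p y = 0"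
        "\<And>g y. g \<in> ?E \<Longrightarrow> cmod (g y - (\<Sum>p\<in>P. g p * of_real ((\<phi> p y)\<^sup>2))) \<le> \<epsilon>"
    proof (rule unit_partition[OF E(1) _ _ e], goal_cases)
      case (1 g) then show ?case by (intro E(2))
    next
      case (2 g y) then show ?case by (intro E(3))
    next
      case (3 P \<phi>) show ?case by (rule 3(1)) (fact 3)+
    qed
    define b where "b p v = \<pi> (cplx (\<phi> p)) v" for p v
    have b: "b p v \<in> ell2 UNIV" if "p \<in> P" "v \<in> ell2 UNIV" for p v unfolding b_def by (rule bop_ell2[OF B[OF P(3)[OF that(1)]] that(2)])
    \<comment> \<open>The sampled coefficient at the unit \<open>p\<close>: scalars
      \<open>EE c i j p\<close> against vectors cut down by \<open>\<phi> p\<close>.\<close>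
    define Y where "Y c w w' p = (\<Sum>i\<in>I. \<Sum>j\<in>I. EE c i j p * ell2_inner UNIV (b p (w i)) (b p (w' j)))"
      for c p and w w' :: "'g \<Rightarrow> ('g \<Rightarrow> complex) \<Rightarrow> complex"
    have XY: "cmod (X c v v' - (\<Sum>p\<in>P. Y c v v' p)) \<le> \<epsilon> * M v v'"
      if c: "c \<in> {f, ?k}" and v: "\<And>i. i \<in> I \<Longrightarrow> v i \<in> ell2 UNIV" "\<And>i. i \<in> I \<Longrightarrow> v' i \<in> ell2 UNIV" for c v v'
    proof -
      have cC: "c \<in> Cc G" using c f \<kappa>(1) by blast
      have "(\<Sum>p\<in>P. Y c v v' p) = (\<Sum>i\<in>I. \<Sum>j\<in>I. \<Sum>p\<in>P. EE c i j p * ell2_inner UNIV (b p (v i)) (b p (v' j)))"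
        unfolding Y_def sum.swap[of _ I P] by (intro sum.cong refl sum.swap)
      then have "X c v v' - (\<Sum>p\<in>P. Y c v v' p) = (\<Sum>i\<in>I. \<Sum>j\<in>I. ell2_inner UNIV (\<pi> (EE c i j) (v i)) (v' j) -
          (\<Sum>p\<in>P. EE c i j p * ell2_inner UNIV (b p (v i)) (b p (v' j))))"
        by (simp only: X_def sum_subtractf)
      also have "cmod \<dots> \<le> (\<Sum>i\<in>I. \<Sum>j\<in>I. \<epsilon> * (ell2_norm UNIV (v i) * ell2_norm UNIV (v' j)))"
      proof (intro sum_norm_le)
        fix i j assume ij: "i \<in> I" "j \<in> I"
        show "cmod (ell2_inner UNIV (\<pi> (EE c i j) (v i)) (v' j) - (\<Sum>p\<in>P. EE c i j p * ell2_inner UNIV (b p (v i)) (b p (v' j))))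
          \<le> \<epsilon> * (ell2_norm UNIV (v i) * ell2_norm UNIV (v' j))"
          unfolding b_def
        proof (rule rep_unit_approx[OF \<pi> EE_Cc[OF cC ij] EE_off P(1) P(3) P(4)])
          have "EE c i j \<in> ?E" using c ij by (intro image_eqI[of _ _ "(c, i, j)"]) auto
          then show "cmod (EE c i j y - (\<Sum>p\<in>P. EE c i j p * of_real ((\<phi> p y)\<^sup>2))) \<le> \<epsilon>" for y by (rule P(5))
        qed (use e v ij in auto)
      qed
      finally show ?thesis by (simp add: M_def sum_distrib_left)
    qed
    have pu: "p \<in> units G" if "p \<in> P" for p using that P(2) by blast
    \<comment> \<open>At a fixed unit the scalars are coefficients of \<open>lam f\<close> for
      \<open>c = f\<close> and Gram coefficients for \<open>c = \<kappa>\<close>, which is the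
      setting of \<open>tensor_bound\<close>.\<close>
    have Q: "cmod (Y f v v' p) \<le> ?N * (sqrt (Re (Y ?k v v p)) * sqrt (Re (Y ?k v' v' p)))" "0 \<le> Re (Y ?k v v p)"
      if p: "p \<in> P" and v: "\<And>i. i \<in> I \<Longrightarrow> v i \<in> ell2 UNIV" "\<And>i. i \<in> I \<Longrightarrow> v' i \<in> ell2 UNIV" for v v' p
    proof -
      have k: "Y ?k v v' p = (\<Sum>i\<in>I. \<Sum>j\<in>I. ell2_inner arr (RR p i) (RR p j) * ell2_inner UNIV (b p (v i)) (b p (v' j)))" for v v'
        unfolding Y_def
      proof (intro sum.cong refl)
        fix i j assume ij: "i \<in> I" "j \<in> I"
        have "EE ?k i j p = ell2_inner arr (RR p i) (RR p j)"
          by (rule EE_cutoff[OF \<kappa>(1) _ _ pu[OF p] ij]) (erule \<kappa>(3), erule (1) \<kappa>(4))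
        then show "EE ?k i j p * ell2_inner UNIV (b p (v i)) (b p (v' j)) =
          ell2_inner arr (RR p i) (RR p j) * ell2_inner UNIV (b p (v i)) (b p (v' j))" by (simp only:)
      qed
      have f': "Y f v v' p = (\<Sum>i\<in>I. \<Sum>j\<in>I. ell2_inner arr (lam f (RR p i)) (RR p j) * ell2_inner UNIV (b p (v i)) (b p (v' j)))"
        unfolding Y_def by (intro sum.cong refl) (simp only: EE_inner[OF f pu[OF p]])
      note tb = tensor_bound[OF lam_bounded_ops[OF f], where I = I and x = "RR p" and C = UNIV and w = "\<lambda>i. b p (v i)" and w' = "\<lambda>i. b p (v' i)"]
      show "cmod (Y f v v' p) \<le> ?N * (sqrt (Re (Y ?k v v p)) * sqrt (Re (Y ?k v' v' p)))"
        unfolding f' k by (rule tb(1)) (use b[OF p] v Cc_fibre_ell2[OF A] in auto)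
      show "0 \<le> Re (Y ?k v v p)" unfolding k by (rule tb(2)) (use b[OF p] v Cc_fibre_ell2[OF A] in auto)
    qed
    have sQ: "(\<Sum>p\<in>P. Re (Y ?k v v p)) \<le> Re (X ?k v v) + \<epsilon> * M v v" if v: "\<And>i. i \<in> I \<Longrightarrow> v i \<in> ell2 UNIV" for v
    proof -
      have "(\<Sum>p\<in>P. Re (Y ?k v v p)) - Re (X ?k v v) = - Re (X ?k v v - (\<Sum>p\<in>P. Y ?k v v p))" by simp
      also have "\<dots> \<le> cmod (X ?k v v - (\<Sum>p\<in>P. Y ?k v v p))" using abs_Re_le_cmod[of "X ?k v v - (\<Sum>p\<in>P. Y ?k v v p)"] by linarith
      also have "\<dots> \<le> \<epsilon> * M v v" by (rule XY) (use v in auto)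
      finally show ?thesis by simp
    qed
    have Qw: "0 \<le> Re (Y ?k w w p)" "0 \<le> Re (Y ?k w' w' p)" if "p \<in> P" for p
      using Q(2)[OF that, of w w] Q(2)[OF that, of w' w'] w by blast+
    have sQw: "(\<Sum>p\<in>P. Re (Y ?k w w p)) \<le> Re (X ?k w w) + \<epsilon> * M w w"
        "(\<Sum>p\<in>P. Re (Y ?k w' w' p)) \<le> Re (X ?k w' w') + \<epsilon> * M w' w'"
      using sQ[of w] sQ[of w'] w by blast+
    have "cmod (\<Sum>p\<in>P. Y f w w' p) \<le> (\<Sum>p\<in>P. ?N * (sqrt (Re (Y ?k w w p)) * sqrt (Re (Y ?k w' w' p))))"
      by (rule sum_norm_le) (use Q(1) w in blast)
    also have "\<dots> = ?N * (\<Sum>p\<in>P. \<bar>sqrt (Re (Y ?k w w p))\<bar> * \<bar>sqrt (Re (Y ?k w' w' p))\<bar>)"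
      using Qw by (simp add: sum_distrib_left)
    \<comment> \<open>Cauchy-Schwarz over the sample points.\<close>
    also have "\<dots> \<le> ?N * (L2_set (\<lambda>p. sqrt (Re (Y ?k w w p))) P * L2_set (\<lambda>p. sqrt (Re (Y ?k w' w' p))) P)"
      by (intro mult_left_mono L2_set_mult_ineq N)
    also have "\<dots> = ?N * (sqrt (\<Sum>p\<in>P. Re (Y ?k w w p)) * sqrt (\<Sum>p\<in>P. Re (Y ?k w' w' p)))"
      using Qw by (simp add: L2_set_def)
    also have "\<dots> \<le> ?N * (sqrt (D + \<epsilon> * M w w) * sqrt (D' + \<epsilon> * M w' w'))"
    proof (intro mult_left_mono mult_mono real_sqrt_le_mono N)
      show *: "(\<Sum>p\<in>P. Re (Y ?k w w p)) \<le> D + \<epsilon> * M w w" using sQw(1) D by simp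
      show "(\<Sum>p\<in>P. Re (Y ?k w' w' p)) \<le> D' + \<epsilon> * M w' w'" using sQw(2) D by simp
      have nn: "0 \<le> (\<Sum>p\<in>P. Re (Y ?k w w p))" by (rule sum_nonneg) (rule Qw(1))
      then show "0 \<le> sqrt (D + \<epsilon> * M w w)" using * by simp
      show "0 \<le> sqrt (\<Sum>p\<in>P. Re (Y ?k w' w' p))" by (intro real_sqrt_ge_zero sum_nonneg) (rule Qw(2))
    qed
    finally have "cmod (\<Sum>p\<in>P. Y f w w' p) \<le> ?N * (sqrt (D + \<epsilon> * M w w) * sqrt (D' + \<epsilon> * M w' w'))" .
    moreover have "cmod (X f w w' - (\<Sum>p\<in>P. Y f w w' p)) \<le> \<epsilon> * M w w'" by (rule XY) (use w in auto)
    moreover have "cmod (X f w w') \<le> cmod (X f w w' - (\<Sum>p\<in>P. Y f w w' p)) + cmod (\<Sum>p\<in>P. Y f w w' p)"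
      using norm_triangle_ineq[of "X f w w' - (\<Sum>p\<in>P. Y f w w' p)" "\<Sum>p\<in>P. Y f w w' p"] by simp
    ultimately show ?thesis by linarith
  qed
  \<comment> \<open>The partition depended on \<open>\<epsilon>\<close>, but \<open>X\<close> and
    \<open>M\<close> do not, so \<open>\<epsilon>\<close> may tend to 0.\<close>
  have lim: "cmod (X f w w') \<le> ?N * (sqrt D * sqrt D')"
    if w: "\<And>i. i \<in> I \<Longrightarrow> w i \<in> ell2 UNIV" "\<And>i. i \<in> I \<Longrightarrow> w' i \<in> ell2 UNIV"
      and D: "Re (X ?k w w) \<le> D" "Re (X ?k w' w') \<le> D'" for w w' D D'
  proof (rule tendsto_lowerbound)
    show "((\<lambda>\<epsilon>. \<epsilon> * M w w' + ?N * (sqrt (D + \<epsilon> * M w w) * sqrt (D' + \<epsilon> * M w' w'))) \<longlongrightarrow> ?N * (sqrt D * sqrt D')) (at_right 0)"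
      by (auto intro!: tendsto_eq_intros)
    show "\<forall>\<^sub>F \<epsilon> in at_right 0. cmod (X f w w') \<le> \<epsilon> * M w w' + ?N * (sqrt (D + \<epsilon> * M w w) * sqrt (D' + \<epsilon> * M w' w'))"
      using eventually_at_right_less[of "0::real"] by eventually_elim (rule step[OF w D])
  qed simp
  fix k k' :: "('g \<Rightarrow> complex) \<Rightarrow> complex" assume k: "k \<in> ell2 UNIV" "k' \<in> ell2 UNIV"
  have Xk: "Re (X ?k (Wv k) (Wv k)) \<le> S * (ell2_norm UNIV k)\<^sup>2" if k: "k \<in> ell2 UNIV" for k
    using hh_cutoff_bound[OF \<pi> \<kappa>(1,3,2) S k] unfolding hh_rep_inner[OF \<pi> \<kappa>(1) k k] X_def Wv_def .
  have "cmod (ell2_inner UNIV (\<pi> (\<lambda>\<gamma>. complex_of_real (hh \<gamma>) * f \<gamma>) k) k') = cmod (X f (Wv k) (Wv k'))"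
    unfolding hh_rep_inner[OF \<pi> f k] X_def Wv_def ..
  also have "\<dots> \<le> ?N * (sqrt (S * (ell2_norm UNIV k)\<^sup>2) * sqrt (S * (ell2_norm UNIV k')\<^sup>2))"
    by (rule lim[OF _ _ Xk[OF k(1)] Xk[OF k(2)]]) (use Wv k in auto)
  also have "\<dots> = ?N * S * (ell2_norm UNIV k * ell2_norm UNIV k')" using S(2) by (simp add: real_sqrt_mult)
  finally show "cmod (ell2_inner UNIV (\<pi> (\<lambda>\<gamma>. complex_of_real (hh \<gamma>) * f \<gamma>) k) k') \<le> ?N * S * (ell2_norm UNIV k * ell2_norm UNIV k')" .
qed

end

end

section \<open>Almost invariant functions\<close>

text \<open>In terms of the roots, the left side is \<open>sqrt p\<close> times their distance and
  the right side is their sum times that distance. It converts the summable invariance in the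
  definition of amenability into an overlap of square roots, which is what \<open>hh\<close>
  measures.\<close>

lemma abs_sqrt_mult_diff_le:
  fixes p q :: real assumes "0 \<le> p" "0 \<le> q"
  shows "\<bar>sqrt q * sqrt p - p\<bar> \<le> \<bar>p - q\<bar>"
proof -
  let ?x = "sqrt p" and ?y = "sqrt q"
  have "\<bar>?y * ?x - ?x * ?x\<bar> = ?x * \<bar>?x - ?y\<bar>"
  proof -
    have "?y * ?x - ?x * ?x = ?x * (?y - ?x)" by (simp add: algebra_simps)
    then show ?thesis using assms by (simp only: abs_mult abs_minus_commute[of ?y]) simp
  qed
  also have "\<dots> \<le> (?x + ?y) * \<bar>?x - ?y\<bar>" using assms by (intro mult_right_mono) auto
  also have "\<dots> = \<bar>(?x + ?y) * (?x - ?y)\<bar>" using assms by (simp add: abs_mult)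
  also have "(?x + ?y) * (?x - ?y) = ?x * ?x - ?y * ?y" by (simp add: algebra_simps)
  finally show ?thesis using assms by simp
qed

context group_bundle
begin

lemma fibre_translate:
  assumes g: "\<gamma> \<in> arr" and \<mu>: "finite {y \<in> src_fibre G (s \<gamma>). \<mu> y \<noteq> (0::real)}"
  shows "finite {y \<in> src_fibre G (s \<gamma>). \<mu> (y \<odot> iv \<gamma>) \<noteq> 0}"
proof -
  have "inj_on (\<lambda>y. y \<odot> iv \<gamma>) (src_fibre G (s \<gamma>))"
  proof (rule inj_on_inverseI[where g = "\<lambda>y. y \<odot> \<gamma>"])
    fix y assume "y \<in> src_fibre G (s \<gamma>)"
    then show "(y \<odot> iv \<gamma>) \<odot> \<gamma> = y" using g by (simp add: src_fibre_def)
  qed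
  then have inj: "inj_on (\<lambda>y. y \<odot> iv \<gamma>) {y \<in> src_fibre G (s \<gamma>). \<mu> (y \<odot> iv \<gamma>) \<noteq> 0}" by (rule inj_on_subset) auto
  have "(\<lambda>y. y \<odot> iv \<gamma>) ` {y \<in> src_fibre G (s \<gamma>). \<mu> (y \<odot> iv \<gamma>) \<noteq> 0} \<subseteq> {y \<in> src_fibre G (s \<gamma>). \<mu> y \<noteq> 0}"
    using g rng_eq_src[OF g] by (auto simp: src_fibre_def)
  from finite_imageD[OF finite_subset[OF this \<mu>] inj] show ?thesis .
qed

text \<open>All three sums are finite, over the support of \<open>\<mu>\<close> and of its
  translate, so the pointwise estimate can be added up.\<close>

lemma translate_overlap:
  assumes g: "\<gamma> \<in> arr" and \<mu>: "\<And>y. 0 \<le> \<mu> y" "finite {y \<in> src_fibre G (s \<gamma>). \<mu> y \<noteq> (0::real)}"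
  shows "\<bar>(\<Sum>\<^sub>\<infinity>y\<in>src_fibre G (s \<gamma>). sqrt (\<mu> (y \<odot> iv \<gamma>)) * sqrt (\<mu> y)) - (\<Sum>\<^sub>\<infinity>y\<in>src_fibre G (s \<gamma>). \<mu> y)\<bar>
    \<le> (\<Sum>\<^sub>\<infinity>y\<in>src_fibre G (s \<gamma>). \<bar>\<mu> y - \<mu> (y \<odot> iv \<gamma>)\<bar>)"
proof -
  let ?A = "src_fibre G (s \<gamma>)"
  let ?Y = "{y \<in> ?A. \<mu> y \<noteq> 0} \<union> {y \<in> ?A. \<mu> (y \<odot> iv \<gamma>) \<noteq> 0}"
  have Y: "finite ?Y" using \<mu>(2) fibre_translate[OF g \<mu>(2)] by simp
  have fin: "infsum F ?A = sum F ?Y" if "\<And>y. \<mu> y = 0 \<Longrightarrow> \<mu> (y \<odot> iv \<gamma>) = 0 \<Longrightarrow> F y = 0" for F :: "'g \<Rightarrow> real"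
  proof -
    have "infsum F ?A = infsum F ?Y" by (rule infsum_cong_neutral) (use that in auto)
    then show ?thesis using Y by simp
  qed
  have "\<bar>(\<Sum>y\<in>?Y. sqrt (\<mu> (y \<odot> iv \<gamma>)) * sqrt (\<mu> y)) - (\<Sum>y\<in>?Y. \<mu> y)\<bar> = \<bar>\<Sum>y\<in>?Y. sqrt (\<mu> (y \<odot> iv \<gamma>)) * sqrt (\<mu> y) - \<mu> y\<bar>"
    by (simp only: sum_subtractf)
  also have "\<dots> \<le> (\<Sum>y\<in>?Y. \<bar>sqrt (\<mu> (y \<odot> iv \<gamma>)) * sqrt (\<mu> y) - \<mu> y\<bar>)" by (rule sum_abs)
  also have "\<dots> \<le> (\<Sum>y\<in>?Y. \<bar>\<mu> y - \<mu> (y \<odot> iv \<gamma>)\<bar>)" by (rule sum_mono) (rule abs_sqrt_mult_diff_le[OF \<mu>(1) \<mu>(1)])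
  finally show ?thesis by (simp add: fin)
qed

text \<open>Split \<open>f\<close> into \<open>f - h f\<close> and \<open>h f\<close>. The first is
  small in the \<open>I\<close>-norm because \<open>h\<close> is close to 1 on the support of
  \<open>f\<close>; the second is bounded by the regular representation, with
  \<open>1 + \<delta>\<close> bounding the mass of the almost invariant function over a
  fibre.\<close>

lemma amenable_approx:
  assumes am: "amenable_groupoid G" and f: "f \<in> Cc G" and \<pi>: "\<pi> \<in> I_bounded_reps G" and C: "I_bounded_by f C" and d: "0 < \<delta>"
  shows "op_norm UNIV (\<pi> f) \<le> op_norm arr (lam f) * (1 + \<delta>) + 2 * \<delta> * C"
proof -
  obtain K where K: "compactin T K" "\<And>\<gamma>. \<gamma> \<notin> K \<Longrightarrow> f \<gamma> = 0" using Cc_support[OF f] by blast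
  have Ka: "K \<subseteq> arr" using compactin_subset_topspace[OF K(1)] arr_top by simp
  have "s ` K \<subseteq> units G" using Ka by auto
  from cutoff_exists[OF image_compactin[OF K(1) src_cont] this]
  obtain \<kappa> L where \<kappa>: "continuous_map T euclideanreal \<kappa>" "cplx \<kappa> \<in> Cc G" "compactin T L" "L \<subseteq> units G"
      "\<forall>y. 0 \<le> \<kappa> y \<and> \<kappa> y \<le> 1" "\<forall>y \<in> s ` K. \<kappa> y = 1" "\<forall>y. y \<notin> L \<longrightarrow> \<kappa> y = 0"
    by (elim exE conjE) (rule that; assumption)
  obtain F :: "('g \<Rightarrow> real) filter" where F: "F \<noteq> bot"
      "\<forall>\<^sub>F \<mu> in F. (\<forall>\<gamma>. 0 \<le> \<mu> \<gamma>) \<and> cplx \<mu> \<in> Cc G"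
      "\<forall>K. compactin T K \<longrightarrow>
         uniform_limit K (\<lambda>\<mu> \<gamma>. \<Sum>\<^sub>\<infinity>\<beta>\<in>src_fibre G (r \<gamma>). \<mu> \<beta>) (\<lambda>_. 1) F \<and>
         uniform_limit K (\<lambda>\<mu> \<gamma>. \<Sum>\<^sub>\<infinity>\<beta>\<in>src_fibre G (r \<gamma>). \<bar>\<mu> \<beta> - \<mu> (\<beta> \<odot> \<gamma>)\<bar>) (\<lambda>_. 0) F"
    using am unfolding amenable_groupoid_def by (elim exE conjE) (rule that; assumption)
  note Fu = F(3)[rule_format, THEN conjunct1] F(3)[rule_format, THEN conjunct2]
  \<comment> \<open>A single \<open>\<mu>\<close> has to be admissible, have mass near 1 on the
    support set \<open>L\<close> of the cut-off, and be nearly invariant under the inverses of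
    \<open>K\<close>. Inverses occur because the overlap at \<open>\<gamma>\<close> translates
    \<open>\<mu>\<close> by \<open>iv \<gamma>\<close>.\<close>
  have "\<forall>\<^sub>F \<mu> in F. ((\<forall>\<gamma>. 0 \<le> \<mu> \<gamma>) \<and> cplx \<mu> \<in> Cc G) \<and>
      (\<forall>u\<in>L. dist (\<Sum>\<^sub>\<infinity>\<beta>\<in>src_fibre G (r u). \<mu> \<beta>) 1 < \<delta>) \<and>
      (\<forall>g\<in>iv ` K. dist (\<Sum>\<^sub>\<infinity>\<beta>\<in>src_fibre G (r g). \<bar>\<mu> \<beta> - \<mu> (\<beta> \<odot> g)\<bar>) 0 < \<delta>)"
    by (intro eventually_conj F(2) uniform_limitD[OF Fu(1)[OF \<kappa>(3)] d] uniform_limitD[OF Fu(2)[OF image_compactin[OF K(1) inv_cont]] d])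
  from eventually_happens'[OF F(1) this] obtain \<mu> where \<mu>0: "((\<forall>\<gamma>. 0 \<le> \<mu> \<gamma>) \<and> cplx \<mu> \<in> Cc G) \<and>
      (\<forall>u\<in>L. dist (\<Sum>\<^sub>\<infinity>\<beta>\<in>src_fibre G (r u). \<mu> \<beta>) 1 < \<delta>) \<and>
      (\<forall>g\<in>iv ` K. dist (\<Sum>\<^sub>\<infinity>\<beta>\<in>src_fibre G (r g). \<bar>\<mu> \<beta> - \<mu> (\<beta> \<odot> g)\<bar>) 0 < \<delta>)"
    by (elim exE) (rule that; assumption)
  then have \<mu>: "\<And>\<gamma>. 0 \<le> \<mu> \<gamma>" "cplx \<mu> \<in> Cc G"
      "\<And>u. u \<in> L \<Longrightarrow> \<bar>(\<Sum>\<^sub>\<infinity>\<beta>\<in>src_fibre G (r u). \<mu> \<beta>) - 1\<bar> < \<delta>"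
      "\<And>g. g \<in> iv ` K \<Longrightarrow> \<bar>\<Sum>\<^sub>\<infinity>\<beta>\<in>src_fibre G (r g). \<bar>\<mu> \<beta> - \<mu> (\<beta> \<odot> g)\<bar>\<bar> < \<delta>"
    unfolding dist_real_def diff_0_right by blast+
  let ?\<mu>' = "involution G (cplx \<mu>)"
  \<comment> \<open>Left translates occur in \<open>hh\<close> and right translates in the
    definition of amenability, so \<open>\<mu>\<close> is composed with inversion. The factor
    \<open>\<kappa> (s x)\<close> removes the fibres over which the mass of \<open>\<mu>\<close> is
    not controlled.\<close>
  define \<xi> where "\<xi> x = sqrt (\<kappa> (s x) * Re (?\<mu>' x))" for x
  have \<xi>a: "\<xi> x = sqrt (\<kappa> (s x) * \<mu> (iv x))" if "x \<in> arr" for x using that by (simp add: \<xi>_def involution_def)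
  have \<xi>0: "0 \<le> \<xi> x" for x using \<kappa>(5) \<mu>(1) by (simp add: \<xi>_def involution_def)
  note \<mu>'C = Cc_involution[OF \<mu>(2)]
  have \<xi>c: "continuous_map T euclideanreal \<xi>" unfolding \<xi>_def
  proof (rule continuous_map_compose_euclidean[where h = sqrt])
    have "continuous_map T euclideanreal (\<lambda>x. Re (?\<mu>' x))"
      by (rule continuous_map_compose_euclidean[OF Cc_continuous[OF \<mu>'C]]) (intro continuous_intros)
    moreover have "continuous_map T euclideanreal (\<lambda>x. \<kappa> (s x))" using continuous_map_compose[OF src_cont \<kappa>(1)] by (simp add: o_def)
    ultimately show "continuous_map T euclideanreal (\<lambda>x. \<kappa> (s x) * Re (?\<mu>' x))" by (intro continuous_map_real_mult)
  qed (intro continuous_intros)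
  obtain K' where K': "compactin T K'" "\<And>\<gamma>. \<gamma> \<notin> K' \<Longrightarrow> ?\<mu>' \<gamma> = 0" using Cc_support[OF \<mu>'C] by blast
  have \<xi>K: "\<xi> x = 0" if "x \<notin> K'" for x using K'(2)[OF that] by (simp add: \<xi>_def)
  obtain I :: "'g set" and \<psi> L' U where p: "finite I"
    "\<forall>x \<in> I. continuous_map T euclideanreal (\<psi> x) \<and> compactin T (L' x) \<and> L' x \<subseteq> U x \<and> bisection (U x) \<and>
        (\<forall>y. 0 \<le> \<psi> x y) \<and> (\<forall>y. y \<notin> L' x \<longrightarrow> \<psi> x y = 0)"
    "\<forall>y \<in> K'. (\<Sum>x\<in>I. \<psi> x y) = 1"
    using bisection_partition[OF K'(1)] by (elim exE conjE) (rule that; assumption)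
  \<comment> \<open>Distributing \<open>\<xi>\<close> by the partition and taking roots puts each
    \<open>a i\<close> into a bisection, while the squares add up to \<open>\<xi>\<close>.\<close>
  define a where "a i x = sqrt (\<psi> i x * \<xi> x)" for i x
  have a2: "(a i x)\<^sup>2 = \<psi> i x * \<xi> x" if "i \<in> I" for i x using p(2) that \<xi>0 by (simp add: a_def)
  have sq: "(\<Sum>i\<in>I. (a i x)\<^sup>2) = \<xi> x" for x
  proof (cases "x \<in> K'")
    case True then show ?thesis using p(3) by (simp add: a2 flip: sum_distrib_right)
  next
    case False then show ?thesis by (simp add: a2 \<xi>K)
  qed
  have A: "cplx (a i) \<in> Cc G" if i: "i \<in> I" for i
  proof (rule CcI[OF _ K'(1)])
    have c: "continuous_map T euclideanreal (\<lambda>x. \<psi> i x * \<xi> x)" using p(2) i \<xi>c by (intro continuous_map_real_mult) auto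
    show "continuous_map T euclidean (cplx (a i))" unfolding a_def
      by (rule continuous_map_compose_euclidean[OF c]) (intro continuous_intros)
  qed (simp add: a_def \<xi>K)
  have single: "x = y" if i: "i \<in> I" and xy: "a i x \<noteq> 0" "a i y \<noteq> 0" "s x = s y" for i x y
  proof -
    have "x \<in> U i" "y \<in> U i" using p(2) i xy(1,2) unfolding a_def by auto
    then show ?thesis using p(2) i xy(3) by (auto simp: bisection_def dest: inj_onD)
  qed
  have fm: "finite {y \<in> src_fibre G u. \<mu> y \<noteq> 0}" for u using Cc_src_finite[OF \<mu>(2), of u] by simp
  let ?h = "hh I a"
  let ?hf = "\<lambda>\<gamma>. complex_of_real (?h \<gamma>) * f \<gamma>"
  have reindex: "(\<Sum>\<^sub>\<infinity>y\<in>src_fibre G u. g (iv y)) = (\<Sum>\<^sub>\<infinity>y\<in>src_fibre G u. g y)" for u and g :: "'g \<Rightarrow> real"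
    using infsum_reindex_bij_betw[OF bij_inv_fibre[of u, unfolded rng_src_fibre], of g] .
  \<comment> \<open>Over \<open>L\<close> the mass is below \<open>1 + \<delta>\<close> and
    \<open>\<kappa>\<close> is at most 1; elsewhere \<open>\<kappa>\<close> is 0.\<close>
  have S: "(\<Sum>\<^sub>\<infinity>x\<in>src_fibre G u. (\<Sum>i\<in>I. (a i x)\<^sup>2)\<^sup>2) \<le> 1 + \<delta>" if u: "u \<in> units G" for u
  proof -
    have "(\<Sum>\<^sub>\<infinity>x\<in>src_fibre G u. (\<Sum>i\<in>I. (a i x)\<^sup>2)\<^sup>2) = (\<Sum>\<^sub>\<infinity>x\<in>src_fibre G u. \<kappa> u * \<mu> (iv x))"
      by (rule infsum_cong) (use \<kappa>(5) \<mu>(1) in \<open>auto simp: sq \<xi>a src_fibre_def\<close>)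
    also have "\<dots> = \<kappa> u * (\<Sum>\<^sub>\<infinity>x\<in>src_fibre G u. \<mu> x)" unfolding reindex[of "\<lambda>x. \<kappa> u * \<mu> x"] by (rule infsum_cmult_right')
    also have "\<dots> \<le> 1 + \<delta>"
    proof (cases "u \<in> L")
      case True
      then have "(\<Sum>\<^sub>\<infinity>x\<in>src_fibre G u. \<mu> x) \<le> 1 + \<delta>" using \<mu>(3)[OF True] unit_simps(3)[OF u] by simp
      moreover have "0 \<le> (\<Sum>\<^sub>\<infinity>x\<in>src_fibre G u. \<mu> x)" by (rule infsum_nonneg) (rule \<mu>)
      ultimately have "\<kappa> u * (\<Sum>\<^sub>\<infinity>x\<in>src_fibre G u. \<mu> x) \<le> 1 * (1 + \<delta>)" using \<kappa>(5) by (intro mult_mono) auto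
      then show ?thesis by simp
    qed (use \<kappa>(7) d in simp)
    finally show ?thesis .
  qed
  \<comment> \<open>One \<open>\<delta>\<close> is the defect of invariance, the other the deviation
    of the mass from 1.\<close>
  have h: "\<bar>1 - ?h \<gamma>\<bar> \<le> 2 * \<delta>" if g: "\<gamma> \<in> K" for \<gamma>
  proof -
    have ga: "\<gamma> \<in> arr" "\<kappa> (s \<gamma>) = 1" "s \<gamma> \<in> L" using g Ka \<kappa>(6,7) by auto
    let ?A = "src_fibre G (s \<gamma>)"
    have hdef: "?h \<gamma> = (\<Sum>\<^sub>\<infinity>y\<in>?A. (\<Sum>i\<in>I. (a i (\<gamma> \<odot> y))\<^sup>2) * (\<Sum>i\<in>I. (a i y)\<^sup>2))"
      by (rule hh_def[OF p(1)]; (rule A | rule single); assumption)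
    have "?h \<gamma> = (\<Sum>\<^sub>\<infinity>y\<in>?A. sqrt (\<mu> (iv y \<odot> iv \<gamma>)) * sqrt (\<mu> (iv y)))"
      unfolding hdef sq
    proof (rule infsum_cong)
      fix y assume "y \<in> ?A"
      then have y: "y \<in> arr" "s y = s \<gamma>" "s \<gamma> = r y" using rng_eq_src by (auto simp: src_fibre_def)
      then show "\<xi> (\<gamma> \<odot> y) * \<xi> y = sqrt (\<mu> (iv y \<odot> iv \<gamma>)) * sqrt (\<mu> (iv y))"
        using ga by (simp add: \<xi>a inv_mult)
    qed
    also have "\<dots> = (\<Sum>\<^sub>\<infinity>y\<in>?A. sqrt (\<mu> (y \<odot> iv \<gamma>)) * sqrt (\<mu> y))"
      by (rule reindex[of "\<lambda>y. sqrt (\<mu> (y \<odot> iv \<gamma>)) * sqrt (\<mu> y)"])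
    finally have "\<bar>?h \<gamma> - (\<Sum>\<^sub>\<infinity>y\<in>?A. \<mu> y)\<bar> \<le> (\<Sum>\<^sub>\<infinity>y\<in>?A. \<bar>\<mu> y - \<mu> (y \<odot> iv \<gamma>)\<bar>)"
      using translate_overlap[OF ga(1) \<mu>(1) fm] by simp
    also have "\<dots> < \<delta>" using \<mu>(4)[of "iv \<gamma>"] g ga(1) by auto
    finally show ?thesis using \<mu>(3)[OF ga(3)] ga(1) by (simp add: abs_less_iff abs_le_iff)
  qed
  have hfC: "?hf \<in> Cc G" by (rule hh_Cc[OF p(1) A single f])
  have dC: "(f \<^bold>- ?hf) \<in> Cc G" by (rule Cc_diff[OF f hfC])
  have "I_bounded_by (f \<^bold>- ?hf) (2 * \<delta> * C)"
  proof (rule I_bounded_by_dominated[OF C])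
    fix \<gamma>
    have "f \<gamma> - ?hf \<gamma> = complex_of_real (1 - ?h \<gamma>) * f \<gamma>" by (simp add: algebra_simps)
    then have "cmod (f \<gamma> - ?hf \<gamma>) = \<bar>1 - ?h \<gamma>\<bar> * cmod (f \<gamma>)" by (simp only: norm_mult norm_of_real)
    also have "\<dots> \<le> 2 * \<delta> * cmod (f \<gamma>)" using h[of \<gamma>] K(2)[of \<gamma>] by (cases "\<gamma> \<in> K") (auto intro: mult_right_mono)
    finally show "cmod (f \<gamma> - ?hf \<gamma>) \<le> 2 * \<delta> * cmod (f \<gamma>)" .
  qed (use d in simp)
  then have 1: "op_norm UNIV (\<pi> (f \<^bold>- ?hf)) \<le> 2 * \<delta> * C" by (rule op_norm_rep_le_I[OF \<pi> dC])
  have 2: "op_norm UNIV (\<pi> ?hf) \<le> op_norm arr (lam f) * (1 + \<delta>)"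
    by (rule hh_rep_bound[OF p(1) A single \<pi> f S]) (use d in simp_all)
  have "\<pi> f = \<pi> (\<lambda>\<gamma>. (f \<gamma> - ?hf \<gamma>) + ?hf \<gamma>)" by simp
  also have "\<dots> = (\<pi> (f \<^bold>- ?hf) \<oplus> \<pi> ?hf)" by (rule rep_add[OF \<pi> dC hfC])
  finally have "op_norm UNIV (\<pi> f) \<le> op_norm UNIV (\<pi> (f \<^bold>- ?hf)) + op_norm UNIV (\<pi> ?hf)"
    using op_norm_triangle[OF rep_bounded_ops[OF \<pi> dC] rep_bounded_ops[OF \<pi> hfC]] by simp
  then show ?thesis using 1 2 by simp
qed

text \<open>Let \<open>\<delta>\<close> tend to 0 in \<open>amenable_approx\<close>; the bound
  \<open>C\<close> depends only on \<open>f\<close>.\<close>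

lemma amenable_full_norm_le:
  assumes am: "amenable_groupoid G" and f: "f \<in> Cc G"
  shows "FN f \<le> op_norm arr (lam f)"
proof (rule full_norm_leI)
  fix \<pi> assume \<pi>: "\<pi> \<in> I_bounded_reps G"
  obtain C where C: "I_bounded_by f C" using I_bounded_by_exists[OF f] by blast
  have "op_norm UNIV (\<pi> f) \<le> op_norm arr (lam f)"
  proof (rule tendsto_lowerbound)
    show "((\<lambda>\<delta>. op_norm arr (lam f) * (1 + \<delta>) + 2 * \<delta> * C) \<longlongrightarrow> op_norm arr (lam f)) (at_right 0)"
      by (auto intro!: tendsto_eq_intros)
    show "\<forall>\<^sub>F \<delta> in at_right 0. op_norm UNIV (\<pi> f) \<le> op_norm arr (lam f) * (1 + \<delta>) + 2 * \<delta> * C"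
      using eventually_at_right_less[of "0::real"] by eventually_elim (rule amenable_approx[OF am f \<pi> C])
  qed simp
  then show "op_norm UNIV (\<pi> f) \<le> op_norm arr (lam f)" .
qed

end

theorem proposition4p1:
  fixes G :: "'g groupoid"
  assumes "etale_groupoid G"
    and "second_countable (gtop G)"
    and "locally_compact_space (gtop G)"
    and "Hausdorff_space (gtop G)"
  shows
    "((\<exists>\<Phi>. conditional_expectation (reduced_algebra G) (iso_subalgebra_red G) \<Phi>) \<longleftrightarrow>
        closedin (gtop G) (isotropy_interior G)) \<and>
     (closedin (gtop G) (isotropy_interior G) \<longrightarrow>
        (\<exists>\<Psi>\<^sub>r. conditional_expectation (reduced_algebra G) (iso_subalgebra_red G) \<Psi>\<^sub>r \<and>
              faithful_map (reduced_algebra G) \<Psi>\<^sub>r \<and>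
              (\<forall>f \<in> Cc G. \<Psi>\<^sub>r (sum_regular_rep G f) =
                 iso_inclusion_red G (sum_regular_rep (iso_groupoid G)
                   (restrict_fun (isotropy_interior G) f))))) \<and>
     (closedin (gtop G) (isotropy_interior G) \<and> amenable_groupoid (iso_groupoid G) \<longrightarrow>
        (\<exists>\<Psi>. conditional_expectation (full_algebra G) (iso_subalgebra G) \<Psi> \<and>
             (\<forall>f \<in> Cc G. \<Psi> (full_embed G f) =
                iso_inclusion G (full_embed (iso_groupoid G)
                  (restrict_fun (isotropy_interior G) f)))))"
proof -
  interpret lch_etale G by unfold_locales (use assms in auto)
  interpret iso_etale G by (rule iso_etale.intro[OF lch_etale_axioms iso_lch_etale])
  \<comment> \<open>Source and range agree on the isotropy, so the comparison of norms for group
    bundles applies to it.\<close>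
  interpret HB: group_bundle "iso_groupoid G"
    by (intro group_bundle.intro group_bundle_axioms.intro iso_lch_etale) (simp add: IG_simps Iso_D(2))
  have amen: "H.FN f \<le> op_norm (isotropy_interior G) (H.lam f)" if "amenable_groupoid (iso_groupoid G)" "f \<in> Cc (iso_groupoid G)" for f
    using HB.amenable_full_norm_le[OF that] by simp
  show ?thesis
  proof (intro conjI impI iffI)
    assume "\<exists>\<Phi>. conditional_expectation (reduced_algebra G) (iso_subalgebra_red G) \<Phi>"
    then show "closedin (gtop G) (isotropy_interior G)" using expectation_imp_closed by blast
  next
    assume cl: "closedin (gtop G) (isotropy_interior G)"
    show "\<exists>\<Phi>. conditional_expectation (reduced_algebra G) (iso_subalgebra_red G) \<Phi>"
      using Psi_expectation[OF cl] by blast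
    show "\<exists>\<Psi>\<^sub>r. conditional_expectation (reduced_algebra G) (iso_subalgebra_red G) \<Psi>\<^sub>r \<and>
        faithful_map (reduced_algebra G) \<Psi>\<^sub>r \<and>
        (\<forall>f \<in> Cc G. \<Psi>\<^sub>r (sum_regular_rep G f) =
           iso_inclusion_red G (sum_regular_rep (iso_groupoid G) (restrict_fun (isotropy_interior G) f)))"
      using Psi_expectation[OF cl] Psi_faithful Psi_lam_inclusion[OF cl] by blast
  next
    assume "closedin (gtop G) (isotropy_interior G) \<and> amenable_groupoid (iso_groupoid G)"
    then have cl: "closedin (gtop G) (isotropy_interior G)" and am: "amenable_groupoid (iso_groupoid G)" by auto
    show "\<exists>\<Psi>. conditional_expectation (full_algebra G) (iso_subalgebra G) \<Psi> \<and>
        (\<forall>f \<in> Cc G. \<Psi> (full_embed G f) =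
           iso_inclusion G (full_embed (iso_groupoid G) (restrict_fun (isotropy_interior G) f)))"
      using full_Psi_expectation[OF cl amen[OF am]] full_Psi_embed[OF cl amen[OF am]] by blast
  qed
qed

end
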